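(* Let $d\ge2$ and let $|\psi_\theta\rangle=U_\theta|\psi\rangle$ be an efficiently phase-dressed state on $d$ modes, where $|\psi\rangle$ is a pure fermionic Gaussian state of definite parity. Let $0<\epsilon<1$ and $0<\delta<1$. Then the certification protocol with target $|\psi_\theta\rangle$ (with the adaptive measurement basis computed from $|\psi_\theta\rangle$) certifies $|\psi_\theta\rangle$ to infidelity $\epsilon$ with confidence $1-\delta$ using $$N(\epsilon,\delta,d)\ \le\ \left\lceil\frac{d(d-1)}{\epsilon}\ln\frac1\delta\right\rceil$$ copies, single-qubit measurements only, and $\mathrm{poly}(d)$ classical processing per copy.
   Context: **Gaussian states.** On $(\mathbb C^2)^{\otimes d}$ with computational basis $|\mathbf x\rangle$, $\mathbf x\in\{0,1\}^d$, let $a_j=Z^{\otimes (j-1)}\otimes|0\rangle\langle1|\otimes \mathbb 1^{\otimes(d-j)}$ and define Majorana operators $c_j=a_j+a_j^\dagger$, $c_{d+j}=(a_j-a_j^\dagger)/i$, $j=1,\dots,d$. A pure fermionic Gaussian state is any state $e^{-iH}|\mathbf x\rangle$ (up to global phase) with $H=\frac i4\sum_{j,k=1}^{2d}h_{jk}c_jc_k$, $h$ real antisymmetric. It is specified classically by its covariance matrix $\Gamma_{jk}=-\frac i2\langle\psi|[c_j,c_k]|\psi\rangle$. Definite parity $\sigma\in\{\pm1\}$ means being a $\sigma$-eigenvector of $Z^{\otimes d}$; $\Pi_\sigma$ is the projector onto that eigenspace. **Phase-dressed state.** For $\theta:\{0,1\}^d\to\mathbb R$, $U_\theta=\sum_{\mathbf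 x}e^{i\theta(\mathbf x)}|\mathbf x\rangle\langle\mathbf x|$ and $|\psi_\theta\rangle=U_\theta|\psi\rangle$ (up to global phase). It is *efficiently phase-dressed* if there is a classical algorithm that on input $\mathbf x\in\{0,1\}^d$ computes $\theta(\mathbf x)$ in time $\mathrm{poly}(d)$. **Protocol for a target $|\phi\rangle$ of definite parity $\sigma$** (here $|\phi\rangle=|\psi_\theta\rangle$). On each copy of the lab state, flip a fair coin. *Heads (parity test):* measure all qubits in the computational basis; pass iff the outcome parity equals $\sigma$. *Tails (correlation test):* sample $k=\{k_1<k_2\}\subset\{1,\dots,d\}$ uniformly; measure the qubits outside $k$ in the computational basis, obtaining $\mathbf z^{(k)}$; measure qubit $k_1$ in the $X$ basis, obtaining $x\in\{+,-\}$; if $(\mathbf z^{(k)},x)$ has zero probability under $|\phi\rangle$ fail; otherwise measure qubit $k_2$ in a basis containing the conditional state $|\phi'\rangle$ of $|\phi\rangle$ on qubit $k_2$ given $(\mathbf z^{(k)},x)$, and pass iff the outcome is $|\phi'\rangle$. The protocol on $N$ copies outputs ACCEPT iff all $N$ copies pass. **Certification.** The protocol with $N$ copies certifies $|\phi\rangle$ to infidelity $\epsilon$ with confidence $1-\delta$ if (i) it accepts with probability $1$ when all copies are $|\phi\rangle\langle\phi|$, and (ii) whenever the lab state is a product $\rho_1\otimes\cdots\otimes\rho_N$ with $\frac1N\sum_j(1-\langle\phi|\rho_j|\phi\rangle)\ge\epsilon$, the probability of ACCEPT is at most $\delta$. $N(\epsilon,\delta,d)$ denotes the number of copies required, $\lceil\ln\delta/\ln(1-\gamma(\Omega)\epsilon)\rceil$,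 where $\Omega$ is the single-copy accept operator of the protocol and $\gamma(\Omega)=1-\lambda_2(\Omega)$ its spectral gap (eigenvalues ordered decreasingly, $\lambda_1(\Omega)=1$). Classical processing refers to computing the final measurement basis from the covariance matrix $\Gamma$ of $|\psi\rangle$, the algorithm for $\theta$, and the measurement outcomes. *)

theory Defs
  imports
    "HOL-Computational_Algebra.Polynomial"
    "Jordan_Normal_Form.Schur_Decomposition"
begin

section \<open>Registers of qubits\<close>

text \<open>
  The space of \<open>d\<close> qubits is \<open>carrier_vec (2 ^ d)\<close> over the complex numbers.  Qubits, modes and
  Majorana operators are numbered from 0.  A bit string of length \<open>d\<close> is a number \<open>x < 2 ^ d\<close>; its
  entry for qubit \<open>j\<close> is \<open>bit x j\<close>, and the basis state \<open>|x>\<close> is \<open>unit_vec (2 ^ d) x\<close>.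
\<close>

definition bitn :: "nat \<Rightarrow> nat \<Rightarrow> nat" where
  "bitn x j = of_bool (bit x j)"

definition outer :: "complex vec \<Rightarrow> complex vec \<Rightarrow> complex mat" where
  "outer u v = mat (dim_vec u) (dim_vec v) (\<lambda>(i, j). u $ i * cnj (v $ j))"

definition mtrace :: "complex mat \<Rightarrow> complex" where
  "mtrace A = (\<Sum>i<dim_row A. A $$ (i, i))"

definition msum :: "nat \<Rightarrow> ('i \<Rightarrow> complex mat) \<Rightarrow> 'i set \<Rightarrow> complex mat" where
  "msum n A I = mat n n (\<lambda>(r, s). \<Sum>i\<in>I. A i $$ (r, s))"

definition exp_mat :: "complex mat \<Rightarrow> complex mat" where
  "exp_mat A = mat (dim_row A) (dim_row A) (\<lambda>(r, s). \<Sum>n. (A ^\<^sub>m n) $$ (r, s) / fact n)"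

text \<open>The tensor product of 2 by 2 matrices, with factor \<open>A j\<close> acting on qubit \<open>j\<close>.\<close>

definition tensor :: "nat \<Rightarrow> (nat \<Rightarrow> complex mat) \<Rightarrow> complex mat" where
  "tensor d A = mat (2 ^ d) (2 ^ d) (\<lambda>(r, s). \<Prod>j<d. A j $$ (bitn r j, bitn s j))"

definition on_qubit :: "nat \<Rightarrow> nat \<Rightarrow> complex mat \<Rightarrow> complex mat" where
  "on_qubit d q A = tensor d (\<lambda>j. if j = q then A else 1\<^sub>m 2)"

definition ket0 :: "complex vec" where "ket0 = unit_vec 2 0"
definition ket1 :: "complex vec" where "ket1 = unit_vec 2 1"
definition ket_plus :: "complex vec" where
  "ket_plus = complex_of_real (1 / sqrt 2) \<cdot>\<^sub>v (ket0 + ket1)"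
definition ket_minus :: "complex vec" where
  "ket_minus = complex_of_real (1 / sqrt 2) \<cdot>\<^sub>v (ket0 - ket1)"

definition Zgate :: "complex mat" where
  "Zgate = outer ket0 ket0 - outer ket1 ket1"

definition parity_op :: "nat \<Rightarrow> complex mat" where
  "parity_op d = tensor d (\<lambda>_. Zgate)"

definition has_parity :: "nat \<Rightarrow> int \<Rightarrow> complex vec \<Rightarrow> bool" where
  "has_parity d \<sigma> \<psi> \<longleftrightarrow> \<sigma> \<in> {1, - 1} \<and> parity_op d *\<^sub>v \<psi> = of_int \<sigma> \<cdot>\<^sub>v \<psi>"

definition density_op :: "nat \<Rightarrow> complex mat \<Rightarrow> bool" where
  "density_op n \<rho> \<longleftrightarrow> \<rho> \<in> carrier_mat n n \<and> mat_adjoint \<rho> = \<rho> \<and>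
     (\<forall>v \<in> carrier_vec n. 0 \<le> Re ((\<rho> *\<^sub>v v) \<bullet>c v)) \<and> mtrace \<rho> = 1"


section \<open>Pure fermionic Gaussian states\<close>

definition annihilator :: "nat \<Rightarrow> nat \<Rightarrow> complex mat" where
  "annihilator d j =
     tensor d (\<lambda>i. if i < j then Zgate else if i = j then outer ket0 ket1 else 1\<^sub>m 2)"

definition majorana :: "nat \<Rightarrow> nat \<Rightarrow> complex mat" where
  "majorana d j =
     (if j < d then annihilator d j + mat_adjoint (annihilator d j)
      else (1 / \<i>) \<cdot>\<^sub>m (annihilator d (j - d) - mat_adjoint (annihilator d (j - d))))"

definition quadratic_hamiltonian :: "nat \<Rightarrow> (nat \<Rightarrow> nat \<Rightarrow> real) \<Rightarrow> complex mat" where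
  "quadratic_hamiltonian d h =
     (\<i> / 4) \<cdot>\<^sub>m msum (2 ^ d)
       (\<lambda>(j, k). complex_of_real (h j k) \<cdot>\<^sub>m (majorana d j * majorana d k))
       ({..<2 * d} \<times> {..<2 * d})"

definition gaussian_state :: "nat \<Rightarrow> complex vec \<Rightarrow> bool" where
  "gaussian_state d \<psi> \<longleftrightarrow>
     (\<exists>h x c. (\<forall>j<2 * d. \<forall>k<2 * d. h j k = - h k j) \<and> x < 2 ^ d \<and> cmod c = 1 \<and>
        \<psi> = c \<cdot>\<^sub>v (exp_mat (- \<i> \<cdot>\<^sub>m quadratic_hamiltonian d h) *\<^sub>v unit_vec (2 ^ d) x))"

text \<open>\<open>Re\<close> only changes the type: the expression is real because the commutator is anti-Hermitian.\<close>

definition covariance :: "nat \<Rightarrow> complex vec \<Rightarrow> nat \<Rightarrow> nat \<Rightarrow> real" where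
  "covariance d \<psi> j k =
     Re (- (\<i> / 2) *
       (((majorana d j * majorana d k - majorana d k * majorana d j) *\<^sub>v \<psi>) \<bullet>c \<psi>))"

definition phase_unitary :: "nat \<Rightarrow> (nat \<Rightarrow> real) \<Rightarrow> complex mat" where
  "phase_unitary d \<theta> = mat (2 ^ d) (2 ^ d) (\<lambda>(x, y). if x = y then exp (\<i> * \<theta> x) else 0)"

definition phase_dressed :: "nat \<Rightarrow> (nat \<Rightarrow> real) \<Rightarrow> complex vec \<Rightarrow> complex vec" where
  "phase_dressed d \<theta> \<psi> = phase_unitary d \<theta> *\<^sub>v \<psi>"


section \<open>Adaptive single-qubit measurement protocols\<close>

text \<open>
  \<open>Pick Ps\<close> continues with a uniformly random entry of \<open>Ps\<close>.  \<open>Measure q u v P Q\<close> measures qubit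
  \<open>q\<close> in the basis \<open>u, v\<close> of the qubit and continues with \<open>P\<close> on outcome \<open>u\<close>, with \<open>Q\<close> on \<open>v\<close>.
\<close>

datatype protocol =
    Accept
  | Reject
  | Pick "protocol list"
  | Measure nat "complex vec" "complex vec" protocol protocol

definition qubit_basis :: "complex vec \<Rightarrow> complex vec \<Rightarrow> bool" where
  "qubit_basis u v \<longleftrightarrow> u \<in> carrier_vec 2 \<and> v \<in> carrier_vec 2 \<and>
     u \<bullet>c u = 1 \<and> v \<bullet>c v = 1 \<and> u \<bullet>c v = 0"

text \<open>
  Every step is a projective measurement of one qubit of \<open>S\<close> in an orthonormal basis, and no qubit
  is measured twice.
\<close>

fun single_qubit_protocol :: "nat set \<Rightarrow> protocol \<Rightarrow> bool" where
  "single_qubit_protocol S Accept \<longleftrightarrow> True"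
| "single_qubit_protocol S Reject \<longleftrightarrow> True"
| "single_qubit_protocol S (Pick Ps) \<longleftrightarrow>
     Ps \<noteq> [] \<and> (\<forall>P \<in> set Ps. single_qubit_protocol S P)"
| "single_qubit_protocol S (Measure q u v P Q) \<longleftrightarrow>
     q \<in> S \<and> qubit_basis u v \<and>
     single_qubit_protocol (S - {q}) P \<and> single_qubit_protocol (S - {q}) Q"

text \<open>
  Born rule: \<open>accept_prob d P \<rho>\<close> is the probability of acceptance on the state \<open>\<rho>\<close>.  States after a
  measurement are not renormalised, so their trace is the probability of the outcomes so far.
\<close>

fun accept_prob :: "nat \<Rightarrow> protocol \<Rightarrow> complex mat \<Rightarrow> real" where
  "accept_prob d Accept \<rho> = Re (mtrace \<rho>)"
| "accept_prob d Reject \<rho> = 0"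
| "accept_prob d (Pick Ps) \<rho> = (\<Sum>P\<leftarrow>Ps. accept_prob d P \<rho>) / length Ps"
| "accept_prob d (Measure q u v P Q) \<rho> =
     (let E = on_qubit d q (outer u u); F = on_qubit d q (outer v v)
      in accept_prob d P (E * \<rho> * E) + accept_prob d Q (F * \<rho> * F))"

text \<open>
  The accept operator of a protocol: the same recursion in the Heisenberg picture, so that the
  acceptance probability is the trace of its product with \<open>\<rho>\<close> (see \<open>accept_prob_accept_op\<close>).
\<close>

fun accept_op :: "nat \<Rightarrow> protocol \<Rightarrow> complex mat" where
  "accept_op d Accept = 1\<^sub>m (2 ^ d)"
| "accept_op d Reject = 0\<^sub>m (2 ^ d) (2 ^ d)"
| "accept_op d (Pick Ps) =
     mat (2 ^ d) (2 ^ d) (\<lambda>(r, s). (\<Sum>P\<leftarrow>Ps. accept_op d P $$ (r, s)) / length Ps)"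
| "accept_op d (Measure q u v P Q) =
     (let E = on_qubit d q (outer u u); F = on_qubit d q (outer v v)
      in E * accept_op d P * E + F * accept_op d Q * F)"

lemma on_qubit_carrier [simp]:
  "on_qubit d q A \<in> carrier_mat (2 ^ d) (2 ^ d)"
  "dim_row (on_qubit d q A) = 2 ^ d" "dim_col (on_qubit d q A) = 2 ^ d"
  by (simp_all add: on_qubit_def tensor_def)

lemma accept_op_carrier [simp]: "accept_op d P \<in> carrier_mat (2 ^ d) (2 ^ d)"
  by (cases P) (auto simp: Let_def intro!: carrier_matI)

lemma mtrace_comm:
  assumes "A \<in> carrier_mat n n" "B \<in> carrier_mat n n"
  shows "mtrace (A * B) = mtrace (B * A)"
proof -
  have "mtrace (A * B) = (\<Sum>i<n. \<Sum>k<n. A $$ (i, k) * B $$ (k, i))"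
    using assms by (auto simp: mtrace_def scalar_prod_def lessThan_atLeast0 intro!: sum.cong)
  also have "\<dots> = (\<Sum>k<n. \<Sum>i<n. B $$ (k, i) * A $$ (i, k))"
    by (subst sum.swap) (simp add: mult.commute)
  also have "\<dots> = mtrace (B * A)"
    using assms by (auto simp: mtrace_def scalar_prod_def lessThan_atLeast0 intro!: sum.cong)
  finally show ?thesis .
qed

lemma mtrace_add:
  assumes "A \<in> carrier_mat n n" "B \<in> carrier_mat n n"
  shows "mtrace (A + B) = mtrace A + mtrace B"
  using assms by (auto simp: mtrace_def sum.distrib)

lemma mtrace_sandwich:
  assumes "E \<in> carrier_mat n n" "W \<in> carrier_mat n n" "\<rho> \<in> carrier_mat n n"
  shows "mtrace (W * (E * \<rho> * E)) = mtrace (E * W * E * \<rho>)"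
proof -
  have "W * (E * \<rho> * E) = (W * (E * \<rho>)) * E"
    using assms by (simp add: assoc_mult_mat[of _ n n _ n _ n])
  also have "mtrace \<dots> = mtrace (E * (W * (E * \<rho>)))"
    using assms by (intro mtrace_comm[of _ n]) auto
  also have "E * (W * (E * \<rho>)) = E * W * E * \<rho>"
    using assms by (simp add: assoc_mult_mat[of _ n n _ n _ n])
  finally show ?thesis .
qed

lemma accept_prob_accept_op:
  assumes "\<rho> \<in> carrier_mat (2 ^ d) (2 ^ d)"
  shows "accept_prob d P \<rho> = Re (mtrace (accept_op d P * \<rho>))"
  using assms
proof (induction d P \<rho> rule: accept_prob.induct)
  case (1 d \<rho>)
  then show ?case by simp
next
  case (2 d \<rho>)
  then show ?case by (simp add: mtrace_def)
next
  case (3 d Ps \<rho>)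
  define n :: nat where "n = 2 ^ d"
  have tr: "mtrace (A * \<rho>) = (\<Sum>i<n. \<Sum>k<n. A $$ (i, k) * \<rho> $$ (k, i))"
    if "A \<in> carrier_mat n n" for A
    using that 3(2)
    by (auto simp: n_def mtrace_def scalar_prod_def lessThan_atLeast0 intro!: sum.cong)
  have sw: "(\<Sum>P\<leftarrow>Qs. \<Sum>i<n. \<Sum>k<n. f P i k * \<rho> $$ (k, i)) =
      (\<Sum>i<n. \<Sum>k<n. (\<Sum>P\<leftarrow>Qs. f P i k) * \<rho> $$ (k, i))"
    for Qs :: "protocol list" and f
    by (induction Qs) (simp_all add: sum.distrib distrib_right)
  have Re_list: "Re (\<Sum>P\<leftarrow>Qs. g P) = (\<Sum>P\<leftarrow>Qs. Re (g P))" for Qs :: "protocol list" and g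
    by (induction Qs) simp_all
  have "mtrace (accept_op d (Pick Ps) * \<rho>) =
      (\<Sum>i<n. \<Sum>k<n. (\<Sum>P\<leftarrow>Ps. accept_op d P $$ (i, k)) * \<rho> $$ (k, i)) / length Ps"
    by (subst tr) (auto simp: n_def sum_divide_distrib intro!: sum.cong)
  also have "\<dots> = (\<Sum>P\<leftarrow>Ps. mtrace (accept_op d P * \<rho>)) / length Ps"
    by (subst sw[symmetric]) (simp add: tr n_def)
  finally have "Re (mtrace (accept_op d (Pick Ps) * \<rho>)) =
      (\<Sum>P\<leftarrow>Ps. Re (mtrace (accept_op d P * \<rho>))) / length Ps"
    by (simp add: Re_list Re_divide_of_nat)
  also have "(\<Sum>P\<leftarrow>Ps. Re (mtrace (accept_op d P * \<rho>))) = (\<Sum>P\<leftarrow>Ps. accept_prob d P \<rho>)"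
    using 3 by (intro arg_cong[of _ _ sum_list] map_cong) auto
  finally show ?case by simp
next
  case (4 d q u v P Q \<rho>)
  define E where "E = on_qubit d q (outer u u)"
  define F where "F = on_qubit d q (outer v v)"
  define A where "A = accept_op d P"
  define B where "B = accept_op d Q"
  have [simp]: "E \<in> carrier_mat (2 ^ d) (2 ^ d)" "F \<in> carrier_mat (2 ^ d) (2 ^ d)"
    "A \<in> carrier_mat (2 ^ d) (2 ^ d)" "B \<in> carrier_mat (2 ^ d) (2 ^ d)"
    by (simp_all add: E_def F_def A_def B_def)
  have c: "E * \<rho> * E \<in> carrier_mat (2 ^ d) (2 ^ d)" "F * \<rho> * F \<in> carrier_mat (2 ^ d) (2 ^ d)"
    "E * A * E \<in> carrier_mat (2 ^ d) (2 ^ d)" "F * B * F \<in> carrier_mat (2 ^ d) (2 ^ d)"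
    using 4(3) by (auto intro!: mult_carrier_mat[of _ "2 ^ d" "2 ^ d"])
  have "accept_prob d (Measure q u v P Q) \<rho> =
      Re (mtrace (A * (E * \<rho> * E))) + Re (mtrace (B * (F * \<rho> * F)))"
    using 4(1)[OF E_def F_def c(1)] 4(2)[OF E_def F_def c(2)]
    by (simp add: Let_def E_def F_def A_def B_def)
  also have "\<dots> = Re (mtrace (E * A * E * \<rho>)) + Re (mtrace (F * B * F * \<rho>))"
    using 4(3) by (simp add: mtrace_sandwich[of _ "2 ^ d"])
  also have "\<dots> = Re (mtrace ((E * A * E + F * B * F) * \<rho>))"
    using c 4(3)
    by (subst add_mult_distrib_mat[of _ "2 ^ d" "2 ^ d"])
       (auto simp: mtrace_add[of _ "2 ^ d"] intro!: mult_carrier_mat[of _ "2 ^ d" "2 ^ d"])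
  finally show ?case by (simp add: Let_def E_def F_def A_def B_def)
qed

text \<open>
  Measures the listed qubits in the computational basis and passes the outcomes to \<open>K\<close> as a bit
  string, in which the entries of all other qubits are those of the initial \<open>z\<close>.
\<close>

fun measure_comp :: "nat list \<Rightarrow> nat \<Rightarrow> (nat \<Rightarrow> protocol) \<Rightarrow> protocol" where
  "measure_comp [] z K = K z"
| "measure_comp (q # qs) z K =
     Measure q ket0 ket1 (measure_comp qs z K) (measure_comp qs (set_bit q z) K)"


section \<open>The certification protocol\<close>

definition outcome_parity :: "nat \<Rightarrow> nat \<Rightarrow> int" where
  "outcome_parity d x = (\<Prod>j<d. if bit x j then - 1 else 1)"

definition parity_test :: "nat \<Rightarrow> int \<Rightarrow> protocol" where
  "parity_test d \<sigma> =
     measure_comp [0..<d] 0 (\<lambda>x. if outcome_parity d x = \<sigma> then Accept else Reject)"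

definition x_ket :: "bool \<Rightarrow> complex vec" where
  "x_ket m = (if m then ket_minus else ket_plus)"

text \<open>
  The unnormalised state of qubit \<open>k2\<close> of \<open>\<phi>\<close> after outcome \<open>z\<close> on the qubits other than \<open>k1\<close> and
  \<open>k2\<close> and outcome \<open>x_ket m\<close> on qubit \<open>k1\<close>, that is, \<open>\<phi>\<close> contracted with \<open><z|\<close> and \<open><x_ket m|\<close>.
  The entries of \<open>z\<close> at \<open>k1\<close> and \<open>k2\<close> are zero.  Its squared norm is the probability of \<open>(z, m)\<close>.
\<close>

definition cond_vec :: "complex vec \<Rightarrow> nat \<Rightarrow> nat \<Rightarrow> nat \<Rightarrow> bool \<Rightarrow> complex vec" where
  "cond_vec \<phi> k1 k2 z m =
     vec 2 (\<lambda>b. \<Sum>a<2. cnj (x_ket m $ a) * \<phi> $ (z + a * 2 ^ k1 + b * 2 ^ k2))"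

definition outcome_prob :: "complex vec \<Rightarrow> nat \<Rightarrow> nat \<Rightarrow> nat \<Rightarrow> bool \<Rightarrow> real" where
  "outcome_prob \<phi> k1 k2 z m = Re (cond_vec \<phi> k1 k2 z m \<bullet>c cond_vec \<phi> k1 k2 z m)"

definition cond_state :: "complex vec \<Rightarrow> nat \<Rightarrow> nat \<Rightarrow> nat \<Rightarrow> bool \<Rightarrow> complex vec" where
  "cond_state \<phi> k1 k2 z m =
     complex_of_real (1 / sqrt (outcome_prob \<phi> k1 k2 z m)) \<cdot>\<^sub>v cond_vec \<phi> k1 k2 z m"

definition orth_state :: "complex vec \<Rightarrow> complex vec" where
  "orth_state u = vec 2 (\<lambda>b. if b = 0 then - cnj (u $ 1) else cnj (u $ 0))"

text \<open>
  The basis for the last measurement; \<open>None\<close> if the outcomes have probability zero.  The vector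
  completing the conditional state to an orthonormal basis is unique up to a phase.
\<close>

definition final_basis ::
  "complex vec \<Rightarrow> nat \<Rightarrow> nat \<Rightarrow> nat \<Rightarrow> bool \<Rightarrow> (complex vec \<times> complex vec) option" where
  "final_basis \<phi> k1 k2 z m =
     (if outcome_prob \<phi> k1 k2 z m = 0 then None
      else Some (cond_state \<phi> k1 k2 z m, orth_state (cond_state \<phi> k1 k2 z m)))"

definition final_step :: "complex vec \<Rightarrow> nat \<Rightarrow> nat \<Rightarrow> nat \<Rightarrow> bool \<Rightarrow> protocol" where
  "final_step \<phi> k1 k2 z m =
     (case final_basis \<phi> k1 k2 z m of
        None \<Rightarrow> Reject
      | Some (u, v) \<Rightarrow> Measure k2 u v Accept Reject)"

definition correlation_test_at :: "nat \<Rightarrow> complex vec \<Rightarrow> nat \<Rightarrow> nat \<Rightarrow> protocol" where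
  "correlation_test_at d \<phi> k1 k2 =
     measure_comp (filter (\<lambda>q. q \<noteq> k1 \<and> q \<noteq> k2) [0..<d]) 0
       (\<lambda>z. Measure k1 ket_plus ket_minus
              (final_step \<phi> k1 k2 z False) (final_step \<phi> k1 k2 z True))"

definition correlation_test :: "nat \<Rightarrow> complex vec \<Rightarrow> protocol" where
  "correlation_test d \<phi> =
     Pick [correlation_test_at d \<phi> k1 k2. k2 \<leftarrow> [0..<d], k1 \<leftarrow> [0..<k2]]"

definition copy_test :: "nat \<Rightarrow> int \<Rightarrow> complex vec \<Rightarrow> protocol" where
  "copy_test d \<sigma> \<phi> = Pick [parity_test d \<sigma>, correlation_test d \<phi>]"

text \<open>
  Acceptance of the product state with factors \<open>\<rho> 0, ..., \<rho> (N - 1)\<close>: the copies are tested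
  independently and all of them must pass.
\<close>

definition all_accept_prob :: "nat \<Rightarrow> protocol \<Rightarrow> nat \<Rightarrow> (nat \<Rightarrow> complex mat) \<Rightarrow> real" where
  "all_accept_prob d P N \<rho> = (\<Prod>j<N. accept_prob d P (\<rho> j))"

definition certifies :: "nat \<Rightarrow> protocol \<Rightarrow> complex vec \<Rightarrow> nat \<Rightarrow> real \<Rightarrow> real \<Rightarrow> bool" where
  "certifies d P \<phi> N \<epsilon> \<delta> \<longleftrightarrow> 0 < N \<and>
     all_accept_prob d P N (\<lambda>_. outer \<phi> \<phi>) = 1 \<and>
     (\<forall>\<rho>. (\<forall>j<N. density_op (2 ^ d) (\<rho> j)) \<longrightarrow>
        (1 / N) * (\<Sum>j<N. 1 - Re ((\<rho> j *\<^sub>v \<phi>) \<bullet>c \<phi>)) \<ge> \<epsilon> \<longrightarrow>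
        all_accept_prob d P N \<rho> \<le> \<delta>)"

text \<open>For matrices with real spectrum: the eigenvalues with multiplicity, in decreasing order.\<close>

definition eigenvalues_desc :: "complex mat \<Rightarrow> real list" where
  "eigenvalues_desc A =
     (THE es. sorted_wrt (\<ge>) es \<and> char_poly A = (\<Prod>e\<leftarrow>es. [:- complex_of_real e, 1:]))"

definition spectral_gap :: "complex mat \<Rightarrow> real" where
  "spectral_gap A = 1 - eigenvalues_desc A ! 1"

definition num_copies :: "nat \<Rightarrow> protocol \<Rightarrow> real \<Rightarrow> real \<Rightarrow> nat" where
  "num_copies d P \<epsilon> \<delta> = nat \<lceil>ln \<delta> / ln (1 - spectral_gap (accept_op d P) * \<epsilon>)\<rceil>"


section \<open>Classical algorithms\<close>

text \<open>
  Real RAM (Preparata and Shamos) as a structured language: arrays of natural numbers and of real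
  numbers with indirect addressing; exact real arithmetic, comparison and elementary functions at
  unit cost; no rounding and no conversion from reals to indices.  The operations on natural numbers
  are those of the uniform-cost RAM (addition and truncated subtraction, no multiplication), which
  is polynomially equivalent to Turing machines.  Programs are finite objects with integer constants
  only, so one program serves all input sizes.  Real arrays are indexed by two numbers.
\<close>

datatype nexp =
    NConst nat
  | NCell nat nexp
  | NAdd nexp nexp
  | NSub nexp nexp

datatype elementary = Sqrt | Sin | Cos | Arctan | Exp | Ln

datatype rexp =
    RConst int
  | RCell nat nexp nexp
  | RAdd rexp rexp
  | RSub rexp rexp
  | RMul rexp rexp
  | RDiv rexp rexp
  | RFun elementary rexp

datatype bexp =
    NLess nexp nexp
  | RLess rexp rexp
  | BNot bexp
  | BAnd bexp bexp

datatype com =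
    Skip
  | NAssign nat nexp nexp
  | RAssign nat nexp nexp rexp
  | Seq com com
  | Cond bexp com com
  | While bexp com

record store =
  nmem :: "nat \<Rightarrow> nat \<Rightarrow> nat"
  rmem :: "nat \<Rightarrow> nat \<Rightarrow> nat \<Rightarrow> real"

primrec elementary_fun :: "elementary \<Rightarrow> real \<Rightarrow> real" where
  "elementary_fun Sqrt = sqrt"
| "elementary_fun Sin = sin"
| "elementary_fun Cos = cos"
| "elementary_fun Arctan = arctan"
| "elementary_fun Exp = exp"
| "elementary_fun Ln = ln"

primrec nval :: "nexp \<Rightarrow> store \<Rightarrow> nat" where
  "nval (NConst n) s = n"
| "nval (NCell a i) s = nmem s a (nval i s)"
| "nval (NAdd e f) s = nval e s + nval f s"
| "nval (NSub e f) s = nval e s - nval f s"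

primrec rval :: "rexp \<Rightarrow> store \<Rightarrow> real" where
  "rval (RConst n) s = of_int n"
| "rval (RCell a i j) s = rmem s a (nval i s) (nval j s)"
| "rval (RAdd e f) s = rval e s + rval f s"
| "rval (RSub e f) s = rval e s - rval f s"
| "rval (RMul e f) s = rval e s * rval f s"
| "rval (RDiv e f) s = rval e s / rval f s"
| "rval (RFun g e) s = elementary_fun g (rval e s)"

primrec bval :: "bexp \<Rightarrow> store \<Rightarrow> bool" where
  "bval (NLess e f) s \<longleftrightarrow> nval e s < nval f s"
| "bval (RLess e f) s \<longleftrightarrow> rval e s < rval f s"
| "bval (BNot b) s \<longleftrightarrow> \<not> bval b s"
| "bval (BAnd b c) s \<longleftrightarrow> bval b s \<and> bval c s"

text \<open>The cost of an expression is the number of its operations, constants and memory accesses.\<close>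

primrec ncost :: "nexp \<Rightarrow> nat" where
  "ncost (NConst n) = 1"
| "ncost (NCell a i) = 1 + ncost i"
| "ncost (NAdd e f) = 1 + ncost e + ncost f"
| "ncost (NSub e f) = 1 + ncost e + ncost f"

primrec rcost :: "rexp \<Rightarrow> nat" where
  "rcost (RConst n) = 1"
| "rcost (RCell a i j) = 1 + ncost i + ncost j"
| "rcost (RAdd e f) = 1 + rcost e + rcost f"
| "rcost (RSub e f) = 1 + rcost e + rcost f"
| "rcost (RMul e f) = 1 + rcost e + rcost f"
| "rcost (RDiv e f) = 1 + rcost e + rcost f"
| "rcost (RFun g e) = 1 + rcost e"

primrec bcost :: "bexp \<Rightarrow> nat" where
  "bcost (NLess e f) = 1 + ncost e + ncost f"
| "bcost (RLess e f) = 1 + rcost e + rcost f"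
| "bcost (BNot b) = 1 + bcost b"
| "bcost (BAnd b c) = 1 + bcost b + bcost c"

definition nupd :: "store \<Rightarrow> nat \<Rightarrow> nat \<Rightarrow> nat \<Rightarrow> store" where
  "nupd s a i n = s\<lparr>nmem := (nmem s)(a := (nmem s a)(i := n))\<rparr>"

definition rupd :: "store \<Rightarrow> nat \<Rightarrow> nat \<Rightarrow> nat \<Rightarrow> real \<Rightarrow> store" where
  "rupd s a i j r =
     s\<lparr>rmem := (rmem s)(a := (rmem s a)(i := (rmem s a i)(j := r)))\<rparr>"

text \<open>\<open>exec c s t s'\<close>: program \<open>c\<close> started in \<open>s\<close> stops after \<open>t\<close> steps in \<open>s'\<close>.\<close>

inductive exec :: "com \<Rightarrow> store \<Rightarrow> nat \<Rightarrow> store \<Rightarrow> bool" where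
  Skip: "exec Skip s 1 s"
| NAssign: "exec (NAssign a i e) s (1 + ncost i + ncost e) (nupd s a (nval i s) (nval e s))"
| RAssign: "exec (RAssign a i j e) s (1 + ncost i + ncost j + rcost e)
              (rupd s a (nval i s) (nval j s) (rval e s))"
| Seq: "exec c1 s t1 s' \<Longrightarrow> exec c2 s' t2 s'' \<Longrightarrow> exec (Seq c1 c2) s (1 + t1 + t2) s''"
| CondTrue: "bval b s \<Longrightarrow> exec c1 s t s' \<Longrightarrow> exec (Cond b c1 c2) s (1 + bcost b + t) s'"
| CondFalse: "\<not> bval b s \<Longrightarrow> exec c2 s t s' \<Longrightarrow> exec (Cond b c1 c2) s (1 + bcost b + t) s'"
| WhileFalse: "\<not> bval b s \<Longrightarrow> exec (While b c) s (1 + bcost b) s"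
| WhileTrue: "bval b s \<Longrightarrow> exec c s t1 s' \<Longrightarrow> exec (While b c) s' t2 s'' \<Longrightarrow>
                exec (While b c) s (1 + bcost b + t1 + t2) s''"

text \<open>
  Input of a program for \<open>\<theta>\<close>: \<open>d\<close> in cell 0 of array 0, the bits of \<open>x\<close> in array 1, all else zero.
\<close>

definition phase_input :: "nat \<Rightarrow> nat \<Rightarrow> store" where
  "phase_input d x =
     \<lparr>nmem = (\<lambda>_ _. 0)(0 := (\<lambda>_. 0)(0 := d),
                       1 := (\<lambda>i. if i < d then bitn x i else 0)),
      rmem = (\<lambda>_ _ _. 0)\<rparr>"

text \<open>
  Polynomial time refers to the family of all \<open>\<theta> d\<close>, computed by one program.  The result is
  returned in real array 0.
\<close>

definition efficient_phase :: "(nat \<Rightarrow> nat \<Rightarrow> real) \<Rightarrow> bool" where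
  "efficient_phase \<theta> \<longleftrightarrow>
     (\<exists>(c :: com) (p :: nat poly). \<forall>d. \<forall>x<2 ^ d.
        \<exists>t s. exec c (phase_input d x) t s \<and> t \<le> poly p d \<and> rmem s 0 0 0 = \<theta> d x)"

text \<open>
  Input of a program for the final basis: \<open>d\<close>, the positions \<open>k1\<close> and \<open>k2\<close> and the outcome on
  qubit \<open>k1\<close> in array 0, the outcomes on the other qubits in array 1, the covariance matrix
  \<open>\<Gamma>\<close> in real array 0.
\<close>

definition basis_input ::
  "nat \<Rightarrow> (nat \<Rightarrow> nat \<Rightarrow> real) \<Rightarrow> nat \<Rightarrow> nat \<Rightarrow> nat \<Rightarrow> bool \<Rightarrow> store" where
  "basis_input d \<Gamma> k1 k2 z m =
     \<lparr>nmem = (\<lambda>_ _. 0)(0 := (\<lambda>_. 0)(0 := d, 1 := k1, 2 := k2, 3 := of_bool m),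
                       1 := (\<lambda>i. if i < d then bitn z i else 0)),
      rmem = (\<lambda>_ _ _. 0)(0 := (\<lambda>i j. if i < 2 * d \<and> j < 2 * d then \<Gamma> i j else 0))\<rparr>"

definition output_vec :: "store \<Rightarrow> nat \<Rightarrow> complex vec" where
  "output_vec s a = vec 2 (\<lambda>b. Complex (rmem s a b 0) (rmem s a b 1))"

text \<open>
  Output: cell 0 of array 2 tells whether the outcomes have positive probability; if so, real
  arrays 1 and 2 hold the two basis vectors.  Vectors only matter up to a phase, and \<open>\<Gamma>\<close> determines
  the state only up to a phase.
\<close>

definition outputs_basis :: "store \<Rightarrow> (complex vec \<times> complex vec) option \<Rightarrow> bool" where
  "outputs_basis s B \<longleftrightarrow>
     (case B of
        None \<Rightarrow> nmem s 2 0 = 0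
      | Some (u, v) \<Rightarrow> nmem s 2 0 = 1 \<and>
          (\<exists>\<alpha> \<beta>. cmod \<alpha> = 1 \<and> cmod \<beta> = 1 \<and>
             output_vec s 1 = \<alpha> \<cdot>\<^sub>v u \<and> output_vec s 2 = \<beta> \<cdot>\<^sub>v v))"

text \<open>
  \<open>c\<close> computes the final basis of the protocol with target \<open>phase_dressed d \<theta> \<psi>\<close> from the covariance
  matrix of \<open>\<psi>\<close> and the measurement outcomes within \<open>T\<close> steps.
\<close>

definition computes_final_basis ::
  "com \<Rightarrow> nat \<Rightarrow> nat \<Rightarrow> (nat \<Rightarrow> real) \<Rightarrow> complex vec \<Rightarrow> bool" where
  "computes_final_basis c T d \<theta> \<psi> \<longleftrightarrow>
     (\<forall>k1 k2 z m. k1 < k2 \<and> k2 < d \<and> z < 2 ^ d \<and> \<not> bit z k1 \<and> \<not> bit z k2 \<longrightarrow>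
        (\<exists>t s. exec c (basis_input d (covariance d \<psi>) k1 k2 z m) t s \<and> t \<le> T \<and>
           outputs_basis s (final_basis (phase_dressed d \<theta> \<psi>) k1 k2 z m)))"

end

theory Submission
  imports Defs "HOL-Analysis.L2_Norm"
begin

text \<open>
  Gaussian vectors \<open>f\<close> satisfy the relations \<open>(\<Sum> c\<^sub>m \<otimes> c\<^sub>m) (f \<otimes> f) = 0\<close>: basis states do, and
  quadratic Hamiltonians preserve them.  They are inherited by the projections of \<open>f\<close> on fixed
  occupation numbers of some modes, and they express the correlations of the occupation numbers in
  \<open>|f|\<^sup>2\<close> by squared entries of the covariance matrix, whose rows have bounded norm.  By Schur's test
  the normalised Gram matrix of the single occupation numbers has norm at most 2.  Measuring one mode
  after the other therefore gives a Poincare inequality for \<open>|f|\<^sup>2\<close>: the part of a vector orthogonal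
  to the target is bounded by the sum, over all pairs of modes, of its parts orthogonal to the target
  within the blocks where the other modes are fixed.  Phases do not affect it.  Within the right
  parity a pair test projects on the target in these blocks, which bounds the spectral
  gap of the protocol below by \<open>1 / (d (d - 1))\<close>.

  The final basis is computed by conditioning the covariance matrix on one outcome after the other,
  a rank-two update each.  The resulting covariance matrix of the two remaining modes contains the
  moduli and relative phases of the at most two nonzero amplitudes.
\<close>

section \<open>Majorana operators on amplitudes\<close>

text \<open>The constants fit together exactly. In a Gaussian vector with a set \<open>F\<close> of
  unmeasured modes, purity bounds the off-diagonal correlations in row \<open>i\<close> by the
  variance of bit \<open>i\<close>, which is the diagonal entry. The normalised Gram matrix is thus
  the identity plus a matrix of norm at most 1, whence the bound 2. Summed over
  \<open>i \<in> F\<close>, the defects left after measuring mode \<open>i\<close> therefore keep at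
  least \<open>card F - 2\<close> times the defect before. This factor is also the number of modes
  of \<open>F\<close> whose removal keeps a given pair, so both cancel along the descent, and the
  sum over pairs bounds the defect with constant 1, for every \<open>d\<close>. The descent has to
  stop at pairs, where the factor vanishes. Averaging over the \<open>d (d - 1) / 2\<close> pairs
  and over the coin gives the gap.

  The obstacle is that the intermediate vectors are projections, with arbitrary norm and possibly
  zero. The identities therefore carry the squared norm as an explicit factor, and quotients are
  arranged so that the convention for division by zero gives the right value on outcomes of
  probability zero.\<close>

lemma not_bit_above:
  fixes x :: nat
  assumes "x < 2 ^ d" "d \<le> i"
  shows "\<not> bit x i"
  using assms by (metis bit_take_bit_iff not_le take_bit_nat_eq_self)

lemma bit_flip_bit_nat [simp]: "bit (flip_bit j x) i \<longleftrightarrow> (bit x i \<noteq> (i = j))" for x :: nat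
  by (auto simp: bit_flip_bit_iff)

lemma flip_bit_less:
  fixes x :: nat
  assumes "x < 2 ^ d" "j < d"
  shows "flip_bit j x < 2 ^ d"
proof -
  have "take_bit d (flip_bit j x) = flip_bit j x"
    using assms not_bit_above[OF assms(1)]
    by (intro bit_eqI) (auto simp: bit_take_bit_iff not_less[symmetric])
  then show ?thesis by (metis take_bit_nat_less_exp)
qed

lemma flip_bit_involution [simp]: "flip_bit j (flip_bit j x) = x" for x :: nat
  by (auto intro!: bit_eqI)

lemma flip_bit_left_commute: "flip_bit j (flip_bit i x) = flip_bit i (flip_bit j x)" for x :: nat
  by (auto intro!: bit_eqI)

lemma eq_if_bits_eq:
  fixes x y :: nat
  assumes "x < 2 ^ d" "y < 2 ^ d" "\<And>i. i < d \<Longrightarrow> bit x i = bit y i"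
  shows "x = y"
  using assms by (intro bit_eqI) (metis not_bit_above not_le)

lemma sum_flip_bit:
  assumes "j < d"
  shows "(\<Sum>x<2 ^ d. f (flip_bit j x)) = (\<Sum>x<2 ^ d. f (x :: nat))"
  using assms by (intro sum.reindex_bij_witness[of _ "flip_bit j" "flip_bit j"])
    (auto simp: flip_bit_less)

definition bit_sign :: "nat \<Rightarrow> nat \<Rightarrow> complex" where
  "bit_sign x i = (if bit x i then - 1 else 1)"

text \<open>The Jordan--Wigner sign \<open>Z\<^sup>\<otimes>\<^sup>j\<close> in front of the \<open>j\<close>-th mode operators.\<close>

definition jw_sign :: "nat \<Rightarrow> nat \<Rightarrow> complex" where
  "jw_sign j x = (\<Prod>i<j. bit_sign x i)"

definition maj_mode :: "nat \<Rightarrow> nat \<Rightarrow> nat" where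
  "maj_mode d m = (if m < d then m else m - d)"

text \<open>A Majorana operator has one nonzero entry in each row, so on amplitudes it is a bit flip
  followed by a factor of modulus 1. Amplitudes are functions on all natural numbers, which keeps
  dimension conditions out of the algebra.\<close>

definition maj_coeff :: "nat \<Rightarrow> nat \<Rightarrow> nat \<Rightarrow> complex" where
  "maj_coeff d m x = (if m < d then 1 else - \<i> * bit_sign x (m - d)) * jw_sign (maj_mode d m) x"

definition maj :: "nat \<Rightarrow> nat \<Rightarrow> (nat \<Rightarrow> complex) \<Rightarrow> nat \<Rightarrow> complex" where
  "maj d m f x = maj_coeff d m x * f (flip_bit (maj_mode d m) x)"

lemma maj_mode_less: "m < 2 * d \<Longrightarrow> maj_mode d m < d"
  by (auto simp: maj_mode_def)

lemma index_mat_adjoint: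
  assumes "A \<in> carrier_mat n m" "i < m" "j < n"
  shows "mat_adjoint A $$ (i, j) = cnj (A $$ (j, i))"
  using assms by (auto simp: mat_adjoint_def mat_of_rows_def)

lemma mat_adjoint_carrier:
  "A \<in> carrier_mat n m \<Longrightarrow> mat_adjoint A \<in> carrier_mat m n"
  by (auto simp: mat_adjoint_def)

lemma annihilator_carrier [simp]: "annihilator d j \<in> carrier_mat (2 ^ d) (2 ^ d)"
  by (simp add: annihilator_def tensor_def)

lemma majorana_carrier [simp]: "majorana d m \<in> carrier_mat (2 ^ d) (2 ^ d)"
  using mat_adjoint_carrier[OF annihilator_carrier]
  by (auto simp: majorana_def intro!: add_carrier_mat minus_carrier_mat smult_carrier_mat)

lemma index_annihilator:
  assumes "j < d" "r < 2 ^ d" "s < 2 ^ d"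
  shows "annihilator d j $$ (r, s) =
    (if \<not> bit r j \<and> s = flip_bit j r then jw_sign j r else 0)"
proof -
  let ?g = "\<lambda>i. (if i < j then Zgate else if i = j then outer ket0 ket1 else 1\<^sub>m 2)
                $$ (bitn r i, bitn s i) :: complex"
  have entry: "annihilator d j $$ (r, s) = (\<Prod>i<d. ?g i)"
    using assms by (simp add: annihilator_def tensor_def)
  have g: "?g i = (if i < j then (if bit r i = bit s i then bit_sign r i else 0)
       else if i = j then (if \<not> bit r i \<and> bit s i then 1 else 0)
       else (if bit r i = bit s i then 1 else 0))" for i
    by (auto simp: Zgate_def outer_def ket0_def ket1_def bitn_def bit_sign_def)
  show ?thesis
  proof (cases "\<not> bit r j \<and> s = flip_bit j r")
    case True
    have "?g i = (if i \<in> {..<j} then bit_sign r i else 1)" for i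
      unfolding g using True by auto
    then have "(\<Prod>i<d. ?g i) = (\<Prod>i\<in>{..<d} \<inter> {..<j}. bit_sign r i)"
      by (simp only: prod.inter_restrict[OF finite_lessThan])
    also have "{..<d} \<inter> {..<j} = {..<j}" using assms(1) by auto
    finally have "(\<Prod>i<d. ?g i) = (\<Prod>i<j. bit_sign r i)" .
    then show ?thesis using True entry by (simp add: jw_sign_def)
  next
    case False
    have "\<exists>i<d. ?g i = 0"
    proof (rule ccontr)
      assume "\<not> (\<exists>i<d. ?g i = 0)"
      then have nz: "?g i \<noteq> 0" if "i < d" for i using that by blast
      have "bit s i = bit (flip_bit j r) i" if "i < d" for i
        using nz[OF that] unfolding g by (auto split: if_splits)
      then have "s = flip_bit j r"
        using assms by (intro eq_if_bits_eq[of _ d]) (auto simp: flip_bit_less)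
      moreover have "\<not> bit r j" using nz[OF assms(1)] unfolding g by (auto split: if_splits)
      ultimately show False using False by simp
    qed
    then obtain i where "i < d" "?g i = 0" by blast
    then have "(\<Prod>i<d. ?g i) = 0" by (intro prod_zero bexI[of _ i]) auto
    then show ?thesis unfolding entry using False by auto
  qed
qed

lemma jw_sign_flip_bit:
  "jw_sign j (flip_bit i x) = (if i < j then - 1 else 1) * jw_sign j x"
proof (cases "i < j")
  case True
  then have "jw_sign j (flip_bit i x) = bit_sign (flip_bit i x) i * (\<Prod>k\<in>{..<j} - {i}. bit_sign x k)"
    by (auto simp: jw_sign_def prod.remove[of "{..<j}" i] bit_sign_def intro!: prod.cong)
  also have "\<dots> = - jw_sign j x"
    using True by (auto simp: jw_sign_def prod.remove[of "{..<j}" i] bit_sign_def)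
  finally show ?thesis using True by simp
next
  case False
  then show ?thesis by (auto simp: jw_sign_def bit_sign_def intro!: prod.cong)
qed

lemma jw_sign_cases: "jw_sign j x = 1 \<or> jw_sign j x = - 1"
  by (induction j) (auto simp: jw_sign_def bit_sign_def)

lemma cnj_jw_sign [simp]: "cnj (jw_sign j x) = jw_sign j x"
  using jw_sign_cases[of j x] by auto

lemma jw_sign_sq [simp]: "jw_sign j x * jw_sign j x = 1"
  using jw_sign_cases[of j x] by auto

lemma cnj_bit_sign [simp]: "cnj (bit_sign x i) = bit_sign x i"
  by (auto simp: bit_sign_def)

lemma mult_mat_vec_index:
  assumes "A \<in> carrier_mat n m" "v \<in> carrier_vec m" "i < n"
  shows "(A *\<^sub>v v) $ i = (\<Sum>k<m. A $$ (i, k) * v $ k)"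
  using assms by (auto simp: scalar_prod_def lessThan_atLeast0 intro!: sum.cong)

lemma index_majorana:
  assumes "m < 2 * d" "r < 2 ^ d" "s < 2 ^ d"
  shows "majorana d m $$ (r, s) =
    (if s = flip_bit (maj_mode d m) r then maj_coeff d m r else 0)"
proof -
  define j where "j = maj_mode d m"
  have j: "j < d" using assms(1) by (simp add: j_def maj_mode_less)
  have flip: "r = flip_bit j s \<longleftrightarrow> s = flip_bit j r" by auto
  have entries: "annihilator d j $$ (r, s) = (if \<not> bit r j \<and> s = flip_bit j r then jw_sign j r else 0)"
    "mat_adjoint (annihilator d j) $$ (r, s) = (if bit r j \<and> s = flip_bit j r then jw_sign j r else 0)"
    using assms j
    by (auto simp: index_annihilator index_mat_adjoint[of _ "2 ^ d" "2 ^ d"] jw_sign_flip_bit)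
  have dims: "dim_row (mat_adjoint (annihilator d j)) = 2 ^ d"
    "dim_col (mat_adjoint (annihilator d j)) = 2 ^ d"
    using mat_adjoint_carrier[of "annihilator d j" "2 ^ d" "2 ^ d"] by auto
  show ?thesis
  proof (cases "m < d")
    case True
    then have "m = j" by (simp add: j_def maj_mode_def)
    then show ?thesis
      using assms True entries dims by (auto simp: majorana_def maj_coeff_def maj_mode_def)
  next
    case False
    then have "m - d = j" by (simp add: j_def maj_mode_def)
    then show ?thesis
      using assms False entries dims
      by (auto simp: majorana_def maj_coeff_def maj_mode_def bit_sign_def)
  qed
qed

lemma majorana_mult_vec:
  assumes "v \<in> carrier_vec (2 ^ d)" "m < 2 * d" "x < 2 ^ d"
  shows "(majorana d m *\<^sub>v v) $ x = maj d m (($) v) x"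
proof -
  have "(majorana d m *\<^sub>v v) $ x = (\<Sum>k<2 ^ d. majorana d m $$ (x, k) * v $ k)"
    using assms by (intro mult_mat_vec_index) auto
  also have "\<dots> = (\<Sum>k<2 ^ d. if k = flip_bit (maj_mode d m) x then maj_coeff d m x * v $ k else 0)"
    using assms by (intro sum.cong) (auto simp: index_majorana)
  also have "\<dots> = maj d m (($) v) x"
    using assms by (simp add: maj_def flip_bit_less maj_mode_less)
  finally show ?thesis .
qed

lemma bit_sign_flip_bit: "bit_sign (flip_bit j x) i = (if i = j then - 1 else 1) * bit_sign x i"
  by (auto simp: bit_sign_def)

lemma maj_coeff_flip_bit:
  "maj_coeff d m (flip_bit i x) =
     (if (\<not> m < d \<and> i = m - d) \<noteq> (i < maj_mode d m) then - 1 else 1) * maj_coeff d m x"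
  by (simp add: maj_coeff_def jw_sign_flip_bit bit_sign_flip_bit)

lemma maj_coeff_square:
  "maj_coeff d m x * maj_coeff d m x = (if m < d then 1 else - 1)"
  using jw_sign_cases[of "maj_mode d m" x] by (auto simp: maj_coeff_def bit_sign_def)

lemma maj_square: "maj d m (maj d m f) x = f x"
  using maj_coeff_square[of d m x]
  by (auto simp: maj_def maj_coeff_flip_bit maj_mode_def mult.assoc[symmetric])

lemma maj_anticommute:
  assumes "m < 2 * d" "n < 2 * d" "m \<noteq> n"
  shows "maj d m (maj d n f) x = - maj d n (maj d m f) x"
proof -
  define a where "a = ((\<not> n < d \<and> maj_mode d m = n - d) \<noteq> (maj_mode d m < maj_mode d n))"
  define b where "b = ((\<not> m < d \<and> maj_mode d n = m - d) \<noteq> (maj_mode d n < maj_mode d m))"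
  \<comment> \<open>Exactly one coefficient changes sign when the other operator flips its bit. For
    distinct modes the Jordan--Wigner string of the later one contains the earlier one; for the two
    operators of one mode only the second carries the bit sign.\<close>
  have ab: "a \<longleftrightarrow> \<not> b"
    using assms unfolding a_def b_def maj_mode_def
    by (cases "m < d"; cases "n < d") (simp_all, linarith+)
  have "maj_coeff d m x * maj_coeff d n (flip_bit (maj_mode d m) x) =
      - (maj_coeff d n x * maj_coeff d m (flip_bit (maj_mode d n) x))"
    unfolding maj_coeff_flip_bit a_def[symmetric] b_def[symmetric] ab by simp
  then show ?thesis
    by (simp add: maj_def mult.assoc[symmetric] flip_bit_left_commute[of "maj_mode d n"])
qed

text \<open>Antilinear in the first argument, so that \<open>v \<bullet>c u\<close> corresponds to
  \<open>ip d u v\<close>.\<close>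

definition ip :: "nat \<Rightarrow> (nat \<Rightarrow> complex) \<Rightarrow> (nat \<Rightarrow> complex) \<Rightarrow> complex" where
  "ip d f g = (\<Sum>x<2 ^ d. cnj (f x) * g x)"

lemma maj_coeff_adjoint:
  "cnj (maj_coeff d m (flip_bit (maj_mode d m) x)) = maj_coeff d m x"
  unfolding maj_coeff_flip_bit by (simp add: maj_coeff_def maj_mode_def)

lemma ip_maj:
  assumes "m < 2 * d"
  shows "ip d (maj d m f) g = ip d f (maj d m g)"
proof -
  let ?j = "maj_mode d m"
  have "ip d (maj d m f) g = (\<Sum>x<2 ^ d. cnj (maj d m f (flip_bit ?j x)) * g (flip_bit ?j x))"
    unfolding ip_def using assms by (intro sum_flip_bit[symmetric] maj_mode_less)
  also have "\<dots> = ip d f (maj d m g)"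
    by (simp add: ip_def maj_def maj_coeff_adjoint algebra_simps)
  finally show ?thesis .
qed

section \<open>The quadratic relations of Gaussian states\<close>

text \<open>Pascal's rule. For a bilinear form of two power sequences it is the Leibniz rule: it
  turns the derivative of order \<open>Suc n\<close> into a sum of first derivatives inside the one
  of order \<open>n\<close>.\<close>

lemma binomial_step:
  fixes g :: "nat \<Rightarrow> nat \<Rightarrow> 'a :: comm_semiring_1"
  shows "(\<Sum>i\<le>Suc n. of_nat (Suc n choose i) * g i (Suc n - i)) =
    (\<Sum>i\<le>n. of_nat (n choose i) * (g (Suc i) (n - i) + g i (Suc (n - i))))"
proof -
  have "(\<Sum>i\<le>Suc n. of_nat (Suc n choose i) * g i (Suc n - i)) =
      g 0 (Suc n) + (\<Sum>i\<le>n. of_nat ((n choose i) + (n choose Suc i)) * g (Suc i) (n - i))"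
    by (subst sum.atMost_Suc_shift) simp
  also have "\<dots> = (\<Sum>i\<le>n. of_nat (n choose i) * g (Suc i) (n - i)) +
      (g 0 (Suc n) + (\<Sum>i\<le>n. of_nat (n choose Suc i) * g (Suc i) (n - i)))"
    by (simp add: distrib_right sum.distrib add_ac)
  also have "g 0 (Suc n) + (\<Sum>i\<le>n. of_nat (n choose Suc i) * g (Suc i) (n - i)) =
      (\<Sum>i\<le>Suc n. of_nat (n choose i) * g i (Suc n - i))"
    by (subst sum.atMost_Suc_shift) simp
  also have "\<dots> = (\<Sum>i\<le>n. of_nat (n choose i) * g i (Suc (n - i)))"
    by (auto simp: Suc_diff_le binomial_eq_0 intro!: sum.cong)
  finally show ?thesis by (simp add: distrib_left sum.distrib)
qed

section \<open>Exponential series of matrices and bilinear forms of them\<close>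

lemma pow_mat_mult_vec_Suc:
  assumes "A \<in> carrier_mat n n" "u \<in> carrier_vec n"
  shows "A ^\<^sub>m Suc k *\<^sub>v u = A *\<^sub>v (A ^\<^sub>m k *\<^sub>v u)"
proof -
  have "A ^\<^sub>m k * A = A * A ^\<^sub>m k"
  proof (induction k)
    case (Suc k)
    have "A ^\<^sub>m Suc k * A = (A * A ^\<^sub>m k) * A" by (simp add: Suc)
    also have "\<dots> = A * A ^\<^sub>m Suc k"
      using assoc_mult_mat[OF assms(1) pow_carrier_mat[OF assms(1)] assms(1), of k] by simp
    finally show ?case .
  qed (use assms in simp)
  then show ?thesis
    using assms by (simp add: assoc_mult_mat_vec[of _ n n _ n])
qed

text \<open>The crude majorant, the sum of the moduli of all entries, is enough: it has to dominate
  the matrix exponential by the exponential series of one real number.\<close>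

lemma norm_pow_mat_le:
  fixes A :: "complex mat"
  assumes "A \<in> carrier_mat n n" "r < n" "k < n"
  shows "norm ((A ^\<^sub>m m) $$ (r, k)) \<le> (\<Sum>i<n. \<Sum>j<n. norm (A $$ (i, j))) ^ m"
  using assms(3)
proof (induction m arbitrary: k)
  case 0
  then show ?case using assms by simp
next
  case (Suc m)
  define M where "M = (\<Sum>i<n. \<Sum>j<n. norm (A $$ (i, j)))"
  have M: "0 \<le> M" by (simp add: M_def sum_nonneg)
  have "(A ^\<^sub>m Suc m) $$ (r, k) = (\<Sum>l<n. (A ^\<^sub>m m) $$ (r, l) * A $$ (l, k))"
    using assms Suc.prems pow_carrier_mat[OF assms(1), of m]
    by (auto simp: scalar_prod_def lessThan_atLeast0 intro!: sum.cong)
  also have "norm \<dots> \<le> (\<Sum>l<n. M ^ m * norm (A $$ (l, k)))"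
    using Suc.IH M by (intro sum_norm_le) (auto simp: norm_mult M_def intro!: mult_right_mono)
  also have "\<dots> \<le> M ^ m * (\<Sum>l<n. \<Sum>j<n. norm (A $$ (l, j)))"
  proof (unfold sum_distrib_left[symmetric], intro mult_left_mono sum_mono)
    fix l
    show "norm (A $$ (l, k)) \<le> (\<Sum>j<n. norm (A $$ (l, j)))"
      using Suc.prems by (intro member_le_sum) auto
  qed (use M in simp)
  finally show ?case by (simp add: M_def mult.commute)
qed

text \<open>The series in \<open>exp_mat\<close> is taken entry by entry. Absolute convergence is
  recorded as well, because the Cauchy product of two such series is formed later.\<close>

lemma exp_mat_mult_vec:
  assumes "A \<in> carrier_mat n n" "u \<in> carrier_vec n" "r < n"
  shows "summable (\<lambda>m. norm ((A ^\<^sub>m m *\<^sub>v u) $ r / fact m))"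
    and "(exp_mat A *\<^sub>v u) $ r = (\<Sum>m. (A ^\<^sub>m m *\<^sub>v u) $ r / fact m)"
proof -
  define M where "M = (\<Sum>i<n. \<Sum>j<n. norm (A $$ (i, j)))"
  have entry: "summable (\<lambda>m. norm ((A ^\<^sub>m m) $$ (r, k) / fact m))" if "k < n" for k
  proof (rule summable_comparison_test')
    show "summable (\<lambda>m. M ^ m / fact m)"
      using summable_exp_generic[of M] by (simp add: scaleR_conv_of_real field_simps)
    show "norm (norm ((A ^\<^sub>m m) $$ (r, k) / fact m)) \<le> M ^ m / fact m" if "0 \<le> m" for m
      using norm_pow_mat_le[OF assms(1,3) \<open>k < n\<close>, of m]
      by (simp add: norm_divide M_def divide_right_mono)
  qed
  have vec: "(A ^\<^sub>m m *\<^sub>v u) $ r / fact m = (\<Sum>k<n. (A ^\<^sub>m m) $$ (r, k) / fact m * u $ k)" for m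
    using mult_mat_vec_index[OF pow_carrier_mat[OF assms(1), of m] assms(2,3)]
    by (simp add: sum_divide_distrib)
  have terms: "summable (\<lambda>m. norm ((A ^\<^sub>m m) $$ (r, k) / fact m * u $ k))" if "k < n" for k
    using summable_mult2[OF entry[OF that], of "norm (u $ k)"] by (simp add: norm_mult norm_divide)
  show "summable (\<lambda>m. norm ((A ^\<^sub>m m *\<^sub>v u) $ r / fact m))"
  proof (rule summable_comparison_test')
    show "summable (\<lambda>m. \<Sum>k<n. norm ((A ^\<^sub>m m) $$ (r, k) / fact m * u $ k))"
      using terms by (intro summable_sum) auto
    show "norm (norm ((A ^\<^sub>m m *\<^sub>v u) $ r / fact m)) \<le>
        (\<Sum>k<n. norm ((A ^\<^sub>m m) $$ (r, k) / fact m * u $ k))" if "0 \<le> m" for m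
      unfolding vec real_norm_def abs_norm_cancel by (rule norm_sum)
  qed
  have "exp_mat A \<in> carrier_mat n n" using assms(1) by (auto simp: exp_mat_def)
  then have "(exp_mat A *\<^sub>v u) $ r = (\<Sum>k<n. (\<Sum>m. (A ^\<^sub>m m) $$ (r, k) / fact m) * u $ k)"
    using assms by (subst mult_mat_vec_index) (auto simp: exp_mat_def)
  also have "\<dots> = (\<Sum>k<n. \<Sum>m. (A ^\<^sub>m m) $$ (r, k) / fact m * u $ k)"
    by (intro sum.cong refl suminf_mult2 summable_norm_cancel[OF entry]) auto
  also have "\<dots> = (\<Sum>m. \<Sum>k<n. (A ^\<^sub>m m) $$ (r, k) / fact m * u $ k)"
    by (intro suminf_sum[symmetric] summable_norm_cancel[OF terms]) auto
  finally show "(exp_mat A *\<^sub>v u) $ r = (\<Sum>m. (A ^\<^sub>m m *\<^sub>v u) $ r / fact m)"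
    by (simp add: vec)
qed

text \<open>
  The Cauchy product expands a bilinear form of two exponentials; the hypothesis says that its
  derivatives of all orders at time zero vanish.
\<close>

lemma bilinear_exp:
  fixes b :: "nat \<Rightarrow> nat \<Rightarrow> complex" and u v :: "nat \<Rightarrow> nat \<Rightarrow> complex" and n :: nat
  defines "B \<equiv> \<lambda>f g. \<Sum>r<n. \<Sum>s<n. b r s * (f r * g s)"
  assumes u: "\<And>r. r < n \<Longrightarrow> summable (\<lambda>m. norm (u m r / fact m))"
    and v: "\<And>r. r < n \<Longrightarrow> summable (\<lambda>m. norm (v m r / fact m))"
    and step: "\<And>k. (\<Sum>i\<le>k. of_nat (k choose i) *
      (B (u (Suc i)) (v (k - i)) + B (u i) (v (Suc (k - i))))) = 0"
  shows "B (\<lambda>r. \<Sum>m. u m r / fact m) (\<lambda>r. \<Sum>m. v m r / fact m) = B (u 0) (v 0)"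
proof -
  \<comment> \<open>\<open>T k\<close> is the derivative of order \<open>k\<close> at time zero; the
    Cauchy product is the Taylor series \<open>T k / fact k\<close>, of which only the term for 0
    survives.\<close>
  define T where "T k = (\<Sum>i\<le>k. of_nat (k choose i) * B (u i) (v (k - i)))" for k
  have T_Suc: "T (Suc k) = 0" for k
    using step[of k] binomial_step[of k "\<lambda>i j. B (u i) (v j)"] by (simp add: T_def)
  have "(\<lambda>k. T k / fact k) sums B (\<lambda>r. \<Sum>m. u m r / fact m) (\<lambda>r. \<Sum>m. v m r / fact m)"
  proof -
    have "(\<lambda>k. \<Sum>r<n. \<Sum>s<n. b r s *
        (\<Sum>i\<le>k. u i r / fact i * (v (k - i) s / fact (k - i))))
      sums B (\<lambda>r. \<Sum>m. u m r / fact m) (\<lambda>r. \<Sum>m. v m r / fact m)"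
      unfolding B_def by (intro sums_sum sums_mult Cauchy_product_sums u v) auto
    moreover have "(\<Sum>r<n. \<Sum>s<n. b r s *
        (\<Sum>i\<le>k. u i r / fact i * (v (k - i) s / fact (k - i)))) = T k / fact k" for k
    proof -
      have "(\<Sum>r<n. \<Sum>s<n. b r s *
          (\<Sum>i\<le>k. u i r / fact i * (v (k - i) s / fact (k - i)))) =
          (\<Sum>r<n. \<Sum>i\<le>k. \<Sum>s<n. b r s *
          (u i r / fact i * (v (k - i) s / fact (k - i))))"
        unfolding sum_distrib_left by (intro sum.cong refl sum.swap)
      also have "\<dots> = (\<Sum>i\<le>k. \<Sum>r<n. \<Sum>s<n. b r s *
          (u i r / fact i * (v (k - i) s / fact (k - i))))"
        by (rule sum.swap)
      also have "\<dots> = (\<Sum>i\<le>k. of_nat (k choose i) / fact k * B (u i) (v (k - i)))"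
      proof (intro sum.cong refl)
        fix i assume "i \<in> {..k}"
        then have "of_nat (k choose i) / fact k = 1 / (fact i * fact (k - i) :: complex)"
          by (simp add: binomial_fact)
        then show "(\<Sum>r<n. \<Sum>s<n. b r s * (u i r / fact i * (v (k - i) s / fact (k - i)))) =
            of_nat (k choose i) / fact k * B (u i) (v (k - i))"
          by (simp add: B_def sum_distrib_left mult_ac)
      qed
      finally show ?thesis by (simp add: T_def sum_divide_distrib)
    qed
    ultimately show ?thesis by simp
  qed
  moreover have "(\<lambda>k. T k / fact k) sums (T 0 / fact 0)"
  proof -
    have "T k / fact k = 0" if "k \<notin> {0}" for k
      using that T_Suc by (cases k) auto
    from sums_finite[of "{0}" "\<lambda>k. T k / fact k", OF _ this] show ?thesis by simp
  qed
  ultimately have "B (\<lambda>r. \<Sum>m. u m r / fact m) (\<lambda>r. \<Sum>m. v m r / fact m) = T 0"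
    using sums_unique2 by fastforce
  then show ?thesis by (simp add: T_def)
qed

section \<open>Quadratic Hamiltonians acting on amplitudes\<close>

definition hop :: "nat \<Rightarrow> (nat \<Rightarrow> nat \<Rightarrow> real) \<Rightarrow> (nat \<Rightarrow> complex) \<Rightarrow> nat \<Rightarrow> complex" where
  "hop d h f x = (\<Sum>j<2 * d. \<Sum>k<2 * d. of_real (h j k) / 4 * maj d j (maj d k f) x)"

lemma quadratic_hamiltonian_carrier [simp]:
  "quadratic_hamiltonian d h \<in> carrier_mat (2 ^ d) (2 ^ d)"
  by (simp add: quadratic_hamiltonian_def msum_def)

lemma majorana_dim [simp]: "dim_row (majorana d m) = 2 ^ d" "dim_col (majorana d m) = 2 ^ d"
  using majorana_carrier[of d m] by (auto simp del: majorana_carrier)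

lemma index_majorana_mult:
  assumes "j < 2 * d" "k < 2 * d" "r < 2 ^ d" "v \<in> carrier_vec (2 ^ d)"
  shows "(\<Sum>s<2 ^ d. (majorana d j * majorana d k) $$ (r, s) * v $ s) = maj d j (maj d k (($) v)) r"
proof -
  have "(\<Sum>s<2 ^ d. (majorana d j * majorana d k) $$ (r, s) * v $ s) =
      ((majorana d j * majorana d k) *\<^sub>v v) $ r"
    using assms by (intro mult_mat_vec_index[symmetric])
      (auto intro!: mult_carrier_mat[of _ "2 ^ d" "2 ^ d"])
  also have "\<dots> = (majorana d j *\<^sub>v (majorana d k *\<^sub>v v)) $ r"
    using assms by (simp add: assoc_mult_mat_vec[of _ "2 ^ d" "2 ^ d" _ "2 ^ d"])
  also have "\<dots> = maj d j (($) (majorana d k *\<^sub>v v)) r"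
    using assms by (intro majorana_mult_vec) (auto intro!: mult_mat_vec_carrier[of _ "2 ^ d" "2 ^ d"])
  also have "\<dots> = maj d j (maj d k (($) v)) r"
    unfolding maj_def[of d j] using assms
    by (simp add: majorana_mult_vec flip_bit_less maj_mode_less del: index_mult_mat_vec)
  finally show ?thesis .
qed

text \<open>In \<open>- \<i> H\<close> the factor \<open>\<i> / 4\<close> of the Hamiltonian becomes
  \<open>1 / 4\<close>, so the generator is a real combination of products of two Majorana
  operators.\<close>

lemma quadratic_hamiltonian_mult_vec:
  assumes "v \<in> carrier_vec (2 ^ d)" "x < 2 ^ d"
  shows "((- \<i> \<cdot>\<^sub>m quadratic_hamiltonian d h) *\<^sub>v v) $ x = hop d h (($) v) x"
proof -
  have "((- \<i> \<cdot>\<^sub>m quadratic_hamiltonian d h) *\<^sub>v v) $ x =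
      (\<Sum>s<2 ^ d. (- \<i> \<cdot>\<^sub>m quadratic_hamiltonian d h) $$ (x, s) * v $ s)"
    using assms by (intro mult_mat_vec_index) auto
  also have "\<dots> = (\<Sum>s<2 ^ d. \<Sum>(j, k)\<in>{..<2 * d} \<times> {..<2 * d}.
      of_real (h j k) / 4 * ((majorana d j * majorana d k) $$ (x, s) * v $ s))"
  proof (intro sum.cong refl)
    fix s assume "s \<in> {..<2 ^ d :: nat}"
    then have "(- \<i> \<cdot>\<^sub>m quadratic_hamiltonian d h) $$ (x, s) =
        (1 / 4) * (\<Sum>(j, k)\<in>{..<2 * d} \<times> {..<2 * d}.
          of_real (h j k) * (majorana d j * majorana d k) $$ (x, s))"
      using assms majorana_carrier[of d]
      by (auto simp: quadratic_hamiltonian_def msum_def case_prod_unfold intro!: sum.cong)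
    then show "(- \<i> \<cdot>\<^sub>m quadratic_hamiltonian d h) $$ (x, s) * v $ s =
      (\<Sum>(j, k)\<in>{..<2 * d} \<times> {..<2 * d}.
        of_real (h j k) / 4 * ((majorana d j * majorana d k) $$ (x, s) * v $ s))"
      by (simp add: sum_distrib_left sum_distrib_right case_prod_unfold mult_ac)
  qed
  also have "\<dots> = (\<Sum>(j, k)\<in>{..<2 * d} \<times> {..<2 * d}.
      of_real (h j k) / 4 * (\<Sum>s<2 ^ d. (majorana d j * majorana d k) $$ (x, s) * v $ s))"
    by (subst sum.swap) (simp add: sum_distrib_left case_prod_unfold)
  also have "\<dots> = (\<Sum>(j, k)\<in>{..<2 * d} \<times> {..<2 * d}.
      of_real (h j k) / 4 * maj d j (maj d k (($) v)) x)"
    using assms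
    by (intro sum.cong refl)
      (simp add: index_majorana_mult case_prod_unfold mem_Times_iff del: index_mult_mat)
  finally show ?thesis by (simp add: hop_def sum.cartesian_product)
qed



text \<open>The amplitude at \<open>(x, y)\<close> of the sum of
  \<open>c\<^sub>m \<otimes> c\<^sub>m\<close> applied to \<open>f \<otimes> g\<close>. With one of
  \<open>x, y\<close> fixed it is an amplitude function of the other, on which \<open>hop\<close>
  can act.\<close>

definition wick_kernel ::
  "nat \<Rightarrow> (nat \<Rightarrow> complex) \<Rightarrow> (nat \<Rightarrow> complex) \<Rightarrow> nat \<Rightarrow> nat \<Rightarrow> complex" where
  "wick_kernel d f g x y = (\<Sum>m<2 * d. maj d m f x * maj d m g y)"

text \<open>
  The quadratic relations \<open>(\<Sum> c\<^sub>m \<otimes> c\<^sub>m) (f \<otimes> f) = 0\<close>, which characterise Gaussian vectors.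
\<close>

definition wick :: "nat \<Rightarrow> (nat \<Rightarrow> complex) \<Rightarrow> bool" where
  "wick d f \<longleftrightarrow> (\<forall>x<2 ^ d. \<forall>y<2 ^ d. wick_kernel d f f x y = 0)"

lemma maj_maj:
  assumes "l < 2 * d" "j < 2 * d"
  shows "maj d l (maj d j f) x = (if l = j then 2 * f x else 0) - maj d j (maj d l f) x"
  using assms by (cases "l = j") (simp_all add: maj_square, simp add: maj_anticommute[of l d j])

text \<open>The commutator of a Majorana operator with a quadratic expression is linear in the
  Majorana operators. Passing each of the two factors contributes half of it, and antisymmetry of
  \<open>h\<close> makes the two halves equal.\<close>

lemma maj_hop:
  assumes "l < 2 * d" and h: "\<And>j k. j < 2 * d \<Longrightarrow> k < 2 * d \<Longrightarrow> h j k = - h k j"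
  shows "maj d l (hop d h f) x = hop d h (maj d l f) x + (\<Sum>k<2 * d. of_real (h l k) * maj d k f x)"
proof -
  have mm: "maj d l (maj d j (maj d k f)) x = maj d j (maj d k (maj d l f)) x +
      (if l = j then 2 * maj d k f x else 0) - (if l = k then 2 * maj d j f x else 0)"
    if "j < 2 * d" "k < 2 * d" for j k
  proof -
    have "maj d l (maj d k f) = (\<lambda>x. (if l = k then 2 * f x else 0) - maj d k (maj d l f) x)"
      using maj_maj[OF assms(1) that(2)] by auto
    then have "maj d j (maj d l (maj d k f)) x =
        (if l = k then 2 * maj d j f x else 0) - maj d j (maj d k (maj d l f)) x"
      by (simp add: maj_def algebra_simps)
    then show ?thesis using maj_maj[OF assms(1) that(1), of "maj d k f" x] by simp
  qed
  have "maj d l (hop d h f) x =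
      (\<Sum>j<2 * d. \<Sum>k<2 * d. of_real (h j k) / 4 * maj d l (maj d j (maj d k f)) x)"
    unfolding hop_def maj_def[of d l] by (simp add: sum_distrib_left mult_ac)
  also have "\<dots> = (\<Sum>j<2 * d. \<Sum>k<2 * d. of_real (h j k) / 4 * maj d j (maj d k (maj d l f)) x +
      ((if l = j then of_real (h j k) / 2 * maj d k f x else 0) -
       (if l = k then of_real (h j k) / 2 * maj d j f x else 0)))"
  proof (intro sum.cong refl)
    fix j k assume "j \<in> {..<2 * d}" "k \<in> {..<2 * d}"
    then show "of_real (h j k) / 4 * maj d l (maj d j (maj d k f)) x =
      of_real (h j k) / 4 * maj d j (maj d k (maj d l f)) x +
      ((if l = j then of_real (h j k) / 2 * maj d k f x else 0) -
       (if l = k then of_real (h j k) / 2 * maj d j f x else 0))"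
      by (subst mm) (auto simp: field_simps)
  qed
  also have "\<dots> = hop d h (maj d l f) x +
      ((\<Sum>j<2 * d. \<Sum>k<2 * d. if l = j then of_real (h j k) / 2 * maj d k f x else 0) -
       (\<Sum>j<2 * d. \<Sum>k<2 * d. if l = k then of_real (h j k) / 2 * maj d j f x else 0))"
    by (simp add: hop_def sum.distrib sum_subtractf)
  also have "(\<Sum>j<2 * d. \<Sum>k<2 * d. if l = j then of_real (h j k) / 2 * maj d k f x else 0) =
      (\<Sum>k<2 * d. of_real (h l k) / 2 * maj d k f x)"
    using assms(1) by (subst sum.swap) simp
  also have "(\<Sum>j<2 * d. \<Sum>k<2 * d. if l = k then of_real (h j k) / 2 * maj d j f x else 0) =
      (\<Sum>k<2 * d. - (of_real (h l k) / 2 * maj d k f x))"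
    using assms(1) h[OF _ assms(1)] by (intro sum.cong) auto
  also have "(\<Sum>k<2 * d. of_real (h l k) / 2 * maj d k f x) -
      (\<Sum>k<2 * d. - (of_real (h l k) / 2 * maj d k f x)) = (\<Sum>k<2 * d. of_real (h l k) * maj d k f x)"
    unfolding sum_subtractf[symmetric] by (intro sum.cong) auto
  finally show ?thesis .
qed

lemma hop_cong:
  assumes "\<And>x. x < 2 ^ d \<Longrightarrow> f x = g x" "x < 2 ^ d"
  shows "hop d h f x = hop d h g x"
  unfolding hop_def using assms
  by (intro sum.cong refl arg_cong2[of _ _ _ _ "(*)"]) (auto simp: maj_def flip_bit_less maj_mode_less)

lemma maj_cong:
  assumes "\<And>x. x < 2 ^ d \<Longrightarrow> f x = g x" "x < 2 ^ d" "m < 2 * d"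
  shows "maj d m f x = maj d m g x"
  using assms by (simp add: maj_def flip_bit_less maj_mode_less)

lemma wick_kernel_cong:
  assumes "\<And>x. x < 2 ^ d \<Longrightarrow> f x = f' x" "\<And>x. x < 2 ^ d \<Longrightarrow> g x = g' x" "x < 2 ^ d" "y < 2 ^ d"
  shows "wick_kernel d f g x y = wick_kernel d f' g' x y"
  unfolding wick_kernel_def using assms
  by (intro sum.cong refl arg_cong2[of _ _ _ _ "(*)"] maj_cong) auto

lemma hop_sum: "hop d h (\<lambda>x. \<Sum>i\<in>I. c i * F i x) x = (\<Sum>i\<in>I. c i * hop d h (F i) x)"
proof -
  have "hop d h (\<lambda>x. \<Sum>i\<in>I. c i * F i x) x =
      (\<Sum>j<2 * d. \<Sum>k<2 * d. \<Sum>i\<in>I. of_real (h j k) / 4 * (c i * maj d j (maj d k (F i)) x))"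
    by (simp add: hop_def maj_def sum_distrib_left mult_ac)
  also have "\<dots> = (\<Sum>j<2 * d. \<Sum>i\<in>I. \<Sum>k<2 * d. of_real (h j k) / 4 * (c i * maj d j (maj d k (F i)) x))"
    by (intro sum.cong refl sum.swap)
  also have "\<dots> = (\<Sum>i\<in>I. \<Sum>j<2 * d. \<Sum>k<2 * d. of_real (h j k) / 4 * (c i * maj d j (maj d k (F i)) x))"
    by (rule sum.swap)
  finally show ?thesis by (simp add: hop_def sum_distrib_left mult_ac)
qed

text \<open>The sum of \<open>c\<^sub>m \<otimes> c\<^sub>m\<close> commutes with the generator
  acting on both tensor factors: the commutators from \<open>maj_hop\<close> add up to
  \<open>h l k\<close> times an expression symmetric in \<open>l\<close> and \<open>k\<close>, and
  \<open>h\<close> is antisymmetric.\<close>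

lemma wick_kernel_hop:
  assumes h: "\<And>j k. j < 2 * d \<Longrightarrow> k < 2 * d \<Longrightarrow> h j k = - h k j"
  shows "wick_kernel d (hop d h f) g x y + wick_kernel d f (hop d h g) x y =
    hop d h (\<lambda>x. wick_kernel d f g x y) x + hop d h (\<lambda>y. wick_kernel d f g x y) y"
proof -
  have cancel: "(\<Sum>l<2 * d. \<Sum>k<2 * d. of_real (h l k) * maj d k f x * maj d l g y) +
      (\<Sum>l<2 * d. \<Sum>k<2 * d. of_real (h l k) * maj d l f x * maj d k g y) = 0"
  proof -
    have "(\<Sum>l<2 * d. \<Sum>k<2 * d. of_real (h l k) * maj d l f x * maj d k g y) =
        (\<Sum>k<2 * d. \<Sum>l<2 * d. of_real (h l k) * maj d l f x * maj d k g y)"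
      by (rule sum.swap)
    also have "\<dots> = (\<Sum>l<2 * d. \<Sum>k<2 * d. - (of_real (h l k) * maj d k f x * maj d l g y))"
      by (intro sum.cong refl, subst h) auto
    finally show ?thesis by (simp add: sum_negf)
  qed
  have "wick_kernel d (hop d h f) g x y =
      (\<Sum>l<2 * d. maj d l g y * hop d h (maj d l f) x) +
      (\<Sum>l<2 * d. \<Sum>k<2 * d. of_real (h l k) * maj d k f x * maj d l g y)"
    unfolding wick_kernel_def sum.distrib[symmetric]
    by (intro sum.cong refl, subst maj_hop[OF _ h])
      (auto simp: distrib_left distrib_right sum_distrib_left sum_distrib_right mult_ac)
  moreover have "wick_kernel d f (hop d h g) x y =
      (\<Sum>l<2 * d. maj d l f x * hop d h (maj d l g) y) +
      (\<Sum>l<2 * d. \<Sum>k<2 * d. of_real (h l k) * maj d l f x * maj d k g y)"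
    unfolding wick_kernel_def sum.distrib[symmetric]
    by (intro sum.cong refl, subst maj_hop[OF _ h])
      (auto simp: distrib_left distrib_right sum_distrib_left sum_distrib_right mult_ac)
  moreover have "hop d h (\<lambda>x. wick_kernel d f g x y) x = (\<Sum>l<2 * d. maj d l g y * hop d h (maj d l f) x)"
    unfolding wick_kernel_def hop_sum[symmetric] by (simp add: mult.commute)
  moreover have "hop d h (\<lambda>y. wick_kernel d f g x y) y = (\<Sum>l<2 * d. maj d l f x * hop d h (maj d l g) y)"
    unfolding wick_kernel_def hop_sum[symmetric] by simp
  ultimately show ?thesis using cancel by (simp add: algebra_simps)
qed

section \<open>The quadratic relations mode by mode\<close>

lemma sum_two_times: "(\<Sum>m<2 * d. F m) = (\<Sum>j<d. F j + F (d + j))" for d :: nat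
proof -
  have "(\<Sum>m<2 * d. F m) = (\<Sum>m<d. F m) + (\<Sum>m\<in>{d..<2 * d}. F m)"
    by (subst sum.union_disjoint[symmetric]) (auto intro!: sum.cong)
  also have "(\<Sum>m\<in>{d..<2 * d}. F m) = (\<Sum>j<d. F (d + j))"
    by (rule sum.reindex_bij_witness[of _ "\<lambda>j. d + j" "\<lambda>m. m - d"]) auto
  finally show ?thesis by (simp add: sum.distrib)
qed

lemma maj_upper:
  assumes "j < d"
  shows "maj d j f x = jw_sign j x * f (flip_bit j x)"
    and "maj d (d + j) f x = - \<i> * bit_sign x j * jw_sign j x * f (flip_bit j x)"
  using assms by (simp_all add: maj_def maj_coeff_def maj_mode_def)

text \<open>The two Majorana operators of mode \<open>j\<close> contribute with relative weight
  minus the product of the bit signs of \<open>x\<close> and \<open>y\<close>. They cancel where the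
  bits agree and double where the bits differ.\<close>

lemma wick_kernel_modes:
  "wick_kernel d f g x y = (\<Sum>j<d. jw_sign j x * jw_sign j y * f (flip_bit j x) * g (flip_bit j y) *
     (if bit x j = bit y j then 0 else 2))"
  unfolding wick_kernel_def sum_two_times
proof (intro sum.cong refl)
  fix j assume "j \<in> {..<d}"
  have i_i: "\<i> * (\<i> * a) = - a" for a :: complex by (simp add: mult.assoc[symmetric])
  show "maj d j f x * maj d j g y + maj d (d + j) f x * maj d (d + j) g y =
      jw_sign j x * jw_sign j y * f (flip_bit j x) * g (flip_bit j y) *
        (if bit x j = bit y j then 0 else 2)"
    using \<open>j \<in> {..<d}\<close> by (auto simp: maj_upper bit_sign_def mult_ac i_i)
qed

text \<open>If both strings have bit \<open>b\<close> at \<open>i\<close>, then mode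
  \<open>i\<close> does not contribute and the other modes leave this bit alone, so nothing changes.
  Otherwise each term vanishes: a wrong bit at \<open>i\<close> survives the flip of any other mode,
  and mode \<open>i\<close> contributes only if the bits differ, in which case its flip makes the
  right one wrong.\<close>

lemma wick_restrict_bit:
  assumes "wick d f" "i < d"
  shows "wick d (\<lambda>x. if bit x i = b then f x else 0)"
  unfolding wick_def
proof (intro allI impI)
  fix x y :: nat
  assume xy: "x < 2 ^ d" "y < 2 ^ d"
  let ?f = "\<lambda>x. if bit x i = b then f x else 0"
  have kernel: "wick_kernel d f f x y = 0" using assms(1) xy by (simp add: wick_def)
  show "wick_kernel d ?f ?f x y = 0"
  proof (cases "bit x i = b \<and> bit y i = b")
    case True
    then have "wick_kernel d ?f ?f x y = wick_kernel d f f x y"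
      unfolding wick_kernel_modes by (intro sum.cong refl) auto
    then show ?thesis using kernel by simp
  next
    case False
    then show ?thesis unfolding wick_kernel_modes by (intro sum.neutral) auto
  qed
qed

lemma wick_scale:
  assumes "wick d f"
  shows "wick d (\<lambda>x. c * f x)"
proof -
  have "wick_kernel d (\<lambda>x. c * f x) (\<lambda>x. c * f x) x y = c\<^sup>2 * wick_kernel d f f x y" for x y
    by (simp add: wick_kernel_def maj_def sum_distrib_left power2_eq_square mult_ac)
  then show ?thesis using assms by (simp add: wick_def)
qed

lemma wick_cong:
  assumes "\<And>x. x < 2 ^ d \<Longrightarrow> f x = g x"
  shows "wick d f \<longleftrightarrow> wick d g"
  unfolding wick_def using wick_kernel_cong[of d f g f g] assms by auto

text \<open>Both factors of a term can be nonzero only if \<open>x = y\<close>, and then no mode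
  contributes.\<close>

lemma wick_unit: "wick d (\<lambda>r. if r = x0 then 1 else 0)"
  unfolding wick_def
proof (intro allI impI)
  fix x y :: nat
  have "x = y" if "flip_bit j x = x0" "flip_bit j y = x0" for j
    using that by (metis flip_bit_involution)
  then show "wick_kernel d (\<lambda>r. if r = x0 then 1 else 0) (\<lambda>r. if r = x0 then 1 else 0) x y = 0"
    unfolding wick_kernel_modes by (intro sum.neutral) auto
qed

text \<open>The adjoint of \<open>c\<^sub>j c\<^sub>k\<close> is \<open>c\<^sub>k c\<^sub>j\<close>,
  and exchanging the indices of \<open>h\<close> gives the sign. It makes the evolution preserve the
  norm.\<close>

lemma hop_antihermitian:
  assumes h: "\<And>j k. j < 2 * d \<Longrightarrow> k < 2 * d \<Longrightarrow> h j k = - h k j"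
  shows "ip d (hop d h f) g = - ip d f (hop d h g)"
proof -
  have "ip d (hop d h f) g = (\<Sum>x<2 ^ d. \<Sum>j<2 * d. \<Sum>k<2 * d. of_real (h j k) / 4 *
      (cnj (maj d j (maj d k f) x) * g x))"
    by (simp add: ip_def hop_def sum_distrib_right sum_distrib_left mult_ac)
  also have "\<dots> = (\<Sum>j<2 * d. \<Sum>x<2 ^ d. \<Sum>k<2 * d. of_real (h j k) / 4 *
      (cnj (maj d j (maj d k f) x) * g x))"
    by (rule sum.swap)
  also have "\<dots> = (\<Sum>j<2 * d. \<Sum>k<2 * d. \<Sum>x<2 ^ d. of_real (h j k) / 4 *
      (cnj (maj d j (maj d k f) x) * g x))"
    by (intro sum.cong refl sum.swap)
  also have "\<dots> = (\<Sum>j<2 * d. \<Sum>k<2 * d. of_real (h j k) / 4 * ip d (maj d j (maj d k f)) g)"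
    by (simp add: ip_def sum_distrib_left)
  also have "\<dots> = (\<Sum>j<2 * d. \<Sum>k<2 * d. of_real (h j k) / 4 * ip d f (maj d k (maj d j g)))"
    by (intro sum.cong refl) (simp add: ip_maj)
  also have "\<dots> = (\<Sum>k<2 * d. \<Sum>j<2 * d. of_real (h j k) / 4 * ip d f (maj d k (maj d j g)))"
    by (rule sum.swap)
  also have "\<dots> = (\<Sum>k<2 * d. \<Sum>j<2 * d. - (of_real (h k j) / 4 * ip d f (maj d k (maj d j g))))"
    by (intro sum.cong refl, subst h) auto
  also have "\<dots> = - (\<Sum>k<2 * d. \<Sum>j<2 * d. \<Sum>x<2 ^ d. of_real (h k j) / 4 *
      (cnj (f x) * maj d k (maj d j g) x))"
    by (simp add: ip_def sum_distrib_left sum_negf)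
  also have "(\<Sum>k<2 * d. \<Sum>j<2 * d. \<Sum>x<2 ^ d. of_real (h k j) / 4 *
      (cnj (f x) * maj d k (maj d j g) x)) =
      (\<Sum>k<2 * d. \<Sum>x<2 ^ d. \<Sum>j<2 * d. of_real (h k j) / 4 * (cnj (f x) * maj d k (maj d j g) x))"
    by (intro sum.cong refl sum.swap)
  also have "\<dots> = (\<Sum>x<2 ^ d. \<Sum>k<2 * d. \<Sum>j<2 * d. of_real (h k j) / 4 *
    (cnj (f x) * maj d k (maj d j g) x))"
    by (rule sum.swap)
  also have "\<dots> = ip d f (hop d h g)"
    by (simp add: ip_def hop_def sum_distrib_left mult_ac)
  finally show ?thesis .
qed

lemma gaussian_state_wick_and_norm:
  assumes "gaussian_state d \<psi>"
  shows "wick d (($) \<psi>)" and "ip d (($) \<psi>) (($) \<psi>) = 1" and "\<psi> \<in> carrier_vec (2 ^ d)"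
proof -
  obtain h x0 c where h0: "\<forall>j<2 * d. \<forall>k<2 * d. h j k = - h k j" and x0: "x0 < 2 ^ d"
    and c: "cmod c = 1"
    and psi: "\<psi> = c \<cdot>\<^sub>v (exp_mat (- \<i> \<cdot>\<^sub>m quadratic_hamiltonian d h) *\<^sub>v unit_vec (2 ^ d) x0)"
    using assms unfolding gaussian_state_def by blast
  have h: "h j k = - h k j" if "j < 2 * d" "k < 2 * d" for j k using h0 that by blast
  define A where "A = - \<i> \<cdot>\<^sub>m quadratic_hamiltonian d h"
  define u where "u m r = (A ^\<^sub>m m *\<^sub>v unit_vec (2 ^ d) x0) $ r" for m r
  have A: "A \<in> carrier_mat (2 ^ d) (2 ^ d)" by (simp add: A_def)
  have Apow: "A ^\<^sub>m m *\<^sub>v unit_vec (2 ^ d) x0 \<in> carrier_vec (2 ^ d)" for m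
    using A by (intro mult_mat_vec_carrier[of _ _ "2 ^ d"] pow_carrier_mat) auto
  have e: "unit_vec (2 ^ d) x0 \<in> carrier_vec (2 ^ d)" by simp
  have u_Suc: "u (Suc m) r = hop d h (u m) r" if "r < 2 ^ d" for m r
    unfolding u_def pow_mat_mult_vec_Suc[OF A e]
    unfolding A_def using quadratic_hamiltonian_mult_vec[OF Apow[of m, unfolded A_def] that] by simp
  have u_0: "u 0 r = (if r = x0 then 1 else 0)" if "r < 2 ^ d" for r
    using that x0 A by (simp add: u_def)
  have summ: "summable (\<lambda>m. norm (u m r / fact m))" if "r < 2 ^ d" for r
    unfolding u_def by (rule exp_mat_mult_vec(1)[OF A e that])
  define w where "w r = (\<Sum>m. u m r / fact m)" for r
  have w: "\<psi> $ r = c * w r" if "r < 2 ^ d" for r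
    using that A exp_mat_mult_vec(2)[OF A e that]
    by (simp add: psi A_def[symmetric] w_def u_def exp_mat_def)
  show "\<psi> \<in> carrier_vec (2 ^ d)"
    unfolding psi A_def[symmetric]
  proof (intro smult_carrier_vec[THEN iffD2] mult_mat_vec_carrier[OF _ e])
    show "exp_mat A \<in> carrier_mat (2 ^ d) (2 ^ d)" using A by (auto simp: exp_mat_def)
  qed
  have "wick d w"
    unfolding wick_def
  proof (intro allI impI)
    fix x y :: nat
    assume xy: "x < 2 ^ d" "y < 2 ^ d"
    \<comment> \<open>At fixed \<open>x\<close> and \<open>y\<close> the kernel is a bilinear form
      in the amplitudes with these coefficients, the shape required by
      \<open>bilinear_exp\<close>.\<close>
    define b where "b r s = (\<Sum>m<2 * d. (if r = flip_bit (maj_mode d m) x then maj_coeff d m x else 0) *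
        (if s = flip_bit (maj_mode d m) y then maj_coeff d m y else 0))" for r s
    have kernel: "wick_kernel d f g x y = (\<Sum>r<2 ^ d. \<Sum>s<2 ^ d. b r s * (f r * g s))" for f g
    proof -
      have "(\<Sum>r<2 ^ d. \<Sum>s<2 ^ d. b r s * (f r * g s)) =
          (\<Sum>r<2 ^ d. \<Sum>s<2 ^ d. \<Sum>m<2 * d. (if r = flip_bit (maj_mode d m) x then maj_coeff d m x
            * f r else 0) *
            (if s = flip_bit (maj_mode d m) y then maj_coeff d m y * g s else 0))"
        unfolding b_def sum_distrib_right by (intro sum.cong refl) auto
      also have "\<dots> = (\<Sum>r<2 ^ d. \<Sum>m<2 * d. \<Sum>s<2 ^ d.
        (if r = flip_bit (maj_mode d m) x then maj_coeff d m x * f r else 0) *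
            (if s = flip_bit (maj_mode d m) y then maj_coeff d m y * g s else 0))"
        by (intro sum.cong refl sum.swap)
      also have "\<dots> = (\<Sum>m<2 * d. \<Sum>r<2 ^ d. \<Sum>s<2 ^ d.
        (if r = flip_bit (maj_mode d m) x then maj_coeff d m x * f r else 0) *
            (if s = flip_bit (maj_mode d m) y then maj_coeff d m y * g s else 0))"
        by (rule sum.swap)
      also have "\<dots> = (\<Sum>m<2 * d. (\<Sum>r<2 ^ d. if r = flip_bit (maj_mode d m) x then maj_coeff d m x
        * f r else 0) *
            (\<Sum>s<2 ^ d. if s = flip_bit (maj_mode d m) y then maj_coeff d m y * g s else 0))"
        by (simp only: sum_product)
      also have "\<dots> = wick_kernel d f g x y"
        using xy by (simp add: wick_kernel_def maj_def flip_bit_less maj_mode_less)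
      finally show ?thesis by simp
    qed
    \<comment> \<open>The induction runs over all \<open>x\<close> and \<open>y\<close> at once: the
      derivative of order \<open>k + 1\<close> is \<open>hop\<close> applied, in \<open>x\<close>
      and in \<open>y\<close>, to the derivative of order \<open>k\<close> as a function on pairs of
      strings, and \<open>hop\<close> moves these strings.\<close>
    have derivative: "(\<Sum>i\<le>k. of_nat (k choose i) *
        (wick_kernel d (u (Suc i)) (u (k - i)) x y + wick_kernel d (u i) (u (Suc (k - i))) x y)) = 0"
      if "x < 2 ^ d" "y < 2 ^ d" for k x y
      using that
    proof (induction k arbitrary: x y rule: less_induct)
      case (less k)
      define T where "T x y = (\<Sum>i\<le>k. of_nat (k choose i) * wick_kernel d (u i) (u (k - i)) x y)" for x y
      have T: "T x y = 0" if "x < 2 ^ d" "y < 2 ^ d" for x y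
      proof (cases k)
        case 0
        then have "T x y = wick_kernel d (\<lambda>r. if r = x0 then 1 else 0) (\<lambda>r. if r = x0 then 1 else 0) x y"
          using that u_0 unfolding T_def by (auto intro: wick_kernel_cong)
        then show ?thesis using wick_unit[of d x0] that by (simp add: wick_def)
      next
        case (Suc l)
        then have "T x y = (\<Sum>i\<le>Suc l. of_nat (Suc l choose i) * wick_kernel d (u i) (u (Suc l - i)) x y)"
          by (simp only: T_def)
        also have "\<dots> = (\<Sum>i\<le>l. of_nat (l choose i) *
            (wick_kernel d (u (Suc i)) (u (l - i)) x y + wick_kernel d (u i) (u (Suc (l - i))) x y))"
          by (rule binomial_step)
        also have "\<dots> = 0" using less.IH[of l, OF _ that] Suc by simp
        finally show ?thesis .
      qed
      have "(\<Sum>i\<le>k. of_nat (k choose i) *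
          (wick_kernel d (u (Suc i)) (u (k - i)) x y + wick_kernel d (u i) (u (Suc (k - i))) x y)) =
          (\<Sum>i\<le>k. of_nat (k choose i) * (wick_kernel d (hop d h (u i)) (u (k - i)) x y +
            wick_kernel d (u i) (hop d h (u (k - i))) x y))"
        using less.prems u_Suc
        by (intro sum.cong refl arg_cong2[of _ _ _ _ "(*)"] arg_cong2[of _ _ _ _ "(+)"]
          wick_kernel_cong) auto
      also have "\<dots> = hop d h (\<lambda>x. T x y) x + hop d h (\<lambda>y. T x y) y"
        unfolding T_def hop_sum sum.distrib[symmetric] distrib_left[symmetric]
        by (intro sum.cong refl arg_cong2[of _ _ _ _ "(*)"] wick_kernel_hop h) auto
      also have "\<dots> = hop d h (\<lambda>x. 0) x + hop d h (\<lambda>y. 0) y"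
        using less.prems T by (intro arg_cong2[of _ _ _ _ "(+)"] hop_cong) auto
      also have "\<dots> = 0" by (simp add: hop_def maj_def)
      finally show ?case .
    qed
    have "wick_kernel d w w x y = wick_kernel d (u 0) (u 0) x y"
      unfolding kernel w_def
      by (rule bilinear_exp) (use summ derivative[OF xy] in \<open>auto simp only: kernel lessThan_iff\<close>)
    also have "\<dots> = wick_kernel d (\<lambda>r. if r = x0 then 1 else 0) (\<lambda>r. if r = x0 then 1 else 0) x y"
      using xy u_0 by (intro wick_kernel_cong) auto
    finally show "wick_kernel d w w x y = 0" using wick_unit[of d x0] xy by (simp add: wick_def)
  qed
  then have "wick d (\<lambda>r. c * w r)" by (rule wick_scale)
  then show "wick d (($) \<psi>)" using wick_cong[of d "($) \<psi>" "\<lambda>r. c * w r"] w by auto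
  have diag: "(\<Sum>r<2 ^ d. \<Sum>s<2 ^ d. (if r = s then 1 else 0) * (f r * g s)) = (\<Sum>r<2 ^ d. f r * g r)"
    for f g :: "nat \<Rightarrow> complex"
    by (simp add: if_distrib[of "\<lambda>t. t * _"] cong: if_cong)
  \<comment> \<open>The norm is sesquilinear while \<open>bilinear_exp\<close> is bilinear. The
    second sequence is therefore the conjugated one, and the conjugation is pulled out of the series
    afterwards.\<close>
  have "(\<Sum>r<2 ^ d. w r * (\<Sum>m. cnj (u m r) / fact m)) = (\<Sum>r<2 ^ d. u 0 r * cnj (u 0 r))"
  proof -
    have "(\<Sum>r<2 ^ d. u (Suc i) r * cnj (u j r)) + (\<Sum>r<2 ^ d. u i r * cnj (u (Suc j) r)) = 0" for i j
    proof -
      have "(\<Sum>r<2 ^ d. u (Suc i) r * cnj (u j r)) = ip d (u j) (hop d h (u i))"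
        "(\<Sum>r<2 ^ d. u i r * cnj (u (Suc j) r)) = ip d (hop d h (u j)) (u i)"
        by (auto simp: ip_def u_Suc mult.commute intro!: sum.cong)
      then show ?thesis using hop_antihermitian[of d h, OF h] by simp
    qed
    then show ?thesis
      using bilinear_exp[of "2 ^ d" u "\<lambda>m r. cnj (u m r)" "\<lambda>r s. if r = s then 1 else 0"] summ
      by (simp add: diag w_def norm_divide)
  qed
  moreover have "(\<Sum>m. cnj (u m r) / fact m) = cnj (w r)" if "r < 2 ^ d" for r
  proof -
    have "(\<lambda>m. u m r / fact m) sums w r"
      unfolding w_def by (intro summable_sums summable_norm_cancel[OF summ[OF that]])
    then have "(\<lambda>m. cnj (u m r / fact m)) sums cnj (w r)" by (simp only: sums_cnj)
    then show ?thesis by (simp add: sums_iff)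
  qed
  ultimately have "(\<Sum>r<2 ^ d. w r * cnj (w r)) = (\<Sum>r<2 ^ d. u 0 r * cnj (u 0 r))" by simp
  also have "\<dots> = (\<Sum>r<2 ^ d. if r = x0 then 1 else 0)"
    by (intro sum.cong) (auto simp: u_0)
  also have "\<dots> = 1" using x0 by simp
  finally have norm_w: "(\<Sum>r<2 ^ d. w r * cnj (w r)) = 1" .
  have "ip d (($) \<psi>) (($) \<psi>) = (\<Sum>r<2 ^ d. (c * cnj c) * (w r * cnj (w r)))"
    unfolding ip_def by (intro sum.cong) (auto simp: w)
  also have "\<dots> = 1"
    using c norm_w by (simp add: sum_distrib_left[symmetric] complex_norm_square[symmetric])
  finally show "ip d (($) \<psi>) (($) \<psi>) = 1" .
qed

section \<open>Correlations of occupation numbers\<close>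

definition sqnorm :: "nat \<Rightarrow> (nat \<Rightarrow> complex) \<Rightarrow> real" where
  "sqnorm d f = (\<Sum>x<2 ^ d. (cmod (f x))\<^sup>2)"

text \<open>The covariance matrix of a vector that need not be normalised.\<close>

definition gcov :: "nat \<Rightarrow> (nat \<Rightarrow> complex) \<Rightarrow> nat \<Rightarrow> nat \<Rightarrow> real" where
  "gcov d f m n = Im (ip d f (maj d m (maj d n f)))"

lemma i_mult_i: "\<i> * (\<i> * a) = - a"
  by (simp add: mult.assoc[symmetric])

lemma ip_self: "ip d f f = of_real (sqnorm d f)"
  by (simp add: ip_def sqnorm_def complex_norm_square[symmetric] mult.commute)

lemma sqnorm_nonneg: "0 \<le> sqnorm d f"
  by (simp add: sqnorm_def sum_nonneg)

lemma cnj_ip: "cnj (ip d f g) = ip d g f"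
  by (simp add: ip_def mult.commute)

lemma ip_cong:
  assumes "\<And>x. x < 2 ^ d \<Longrightarrow> f x = f' x" "\<And>x. x < 2 ^ d \<Longrightarrow> g x = g' x"
  shows "ip d f g = ip d f' g'"
  unfolding ip_def using assms by (intro sum.cong) auto

lemma ip_sum_right: "ip d f (\<lambda>x. \<Sum>i\<in>I. c i * g i x) = (\<Sum>i\<in>I. c i * ip d f (g i))"
  unfolding ip_def sum_distrib_left by (subst sum.swap) (simp add: mult_ac)

lemma ip_minus_right: "ip d f (\<lambda>x. - g x) = - ip d f g"
  by (simp add: ip_def sum_negf)

lemma maj_neg: "maj d m (\<lambda>x. - g x) = (\<lambda>x. - maj d m g x)"
  by (auto simp: maj_def)

lemma maj_anticommute_fun:
  assumes "m < 2 * d" "n < 2 * d" "m \<noteq> n"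
  shows "maj d m (maj d n f) = (\<lambda>x. - maj d n (maj d m f) x)"
  using maj_anticommute[OF assms] by auto

lemma ip_maj_maj:
  assumes "m < 2 * d" "n < 2 * d"
  shows "ip d f (maj d m (maj d n f)) =
    (if m = n then of_real (sqnorm d f) else \<i> * of_real (gcov d f m n))"
proof (cases "m = n")
  case True
  then show ?thesis by (simp add: ip_self[symmetric] ip_def maj_square)
next
  case False
  have "cnj (ip d f (maj d m (maj d n f))) = ip d f (maj d n (maj d m f))"
    using assms by (simp add: cnj_ip ip_maj)
  also have "\<dots> = - ip d f (maj d m (maj d n f))"
    using assms False by (simp add: maj_anticommute_fun[of m d n] ip_minus_right)
  finally show ?thesis using False by (auto simp: gcov_def complex_eq_iff)
qed

lemma gcov_diag [simp]:
  assumes "m < 2 * d"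
  shows "gcov d f m m = 0"
  using ip_maj_maj[OF assms assms, of f] by (simp add: gcov_def)

lemma gcov_antisym:
  assumes "m < 2 * d" "n < 2 * d"
  shows "gcov d f m n = - gcov d f n m"
proof (cases "m = n")
  case True
  then show ?thesis using gcov_diag[OF assms(2), of f] by simp
next
  case False
  then show ?thesis using assms by (simp add: gcov_def maj_anticommute_fun[of m d n] ip_minus_right)
qed

text \<open>One copy of the quadratic relations is contracted with \<open>c\<^sub>m f\<close>. The
  coefficients become two-point functions, and the term for \<open>m\<close> itself is isolated. For
  nonzero \<open>f\<close> these are the linear combinations of Majorana operators that annihilate
  it.\<close>

lemma wick_linear:
  assumes "wick d f" "m < 2 * d" "x < 2 ^ d"
  shows "of_real (sqnorm d f) * maj d m f x = (\<Sum>l<2 * d. (- \<i> * of_real (gcov d f m l)) * maj d l f x)"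
proof -
  have inner: "ip d f (maj d m (maj d l f)) = (\<Sum>y<2 ^ d. cnj (maj d m f y) * maj d l f y)" for l
    by (subst ip_maj[OF assms(2), symmetric]) (simp add: ip_def)
  have "(\<Sum>l<2 * d. ip d f (maj d m (maj d l f)) * maj d l f x) =
      (\<Sum>l<2 * d. \<Sum>y<2 ^ d. cnj (maj d m f y) * (maj d l f y * maj d l f x))"
    by (simp only: inner sum_distrib_right mult.assoc)
  also have "\<dots> = (\<Sum>y<2 ^ d. cnj (maj d m f y) * wick_kernel d f f y x)"
    unfolding wick_kernel_def sum_distrib_left by (rule sum.swap)
  also have "\<dots> = 0" using assms by (simp add: wick_def)
  finally have "(\<Sum>l<2 * d. ip d f (maj d m (maj d l f)) * maj d l f x) = 0" .
  moreover have "(\<Sum>l<2 * d. ip d f (maj d m (maj d l f)) * maj d l f x) =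
      (\<Sum>l<2 * d. (if m = l then of_real (sqnorm d f) * maj d m f x else 0) +
        \<i> * of_real (gcov d f m l) * maj d l f x)"
    using assms(2) by (intro sum.cong refl) (auto simp: ip_maj_maj)
  moreover have "\<dots> = of_real (sqnorm d f) * maj d m f x +
      (\<Sum>l<2 * d. \<i> * of_real (gcov d f m l) * maj d l f x)"
    unfolding sum.distrib using assms(2) by simp
  ultimately show ?thesis by (simp add: sum_negf eq_neg_iff_add_eq_0)
qed

text \<open>The inner product of \<open>wick_linear\<close> with \<open>c\<^sub>m f\<close>. For
  unit vectors it says that the rows of the covariance matrix are unit vectors, as for every pure
  Gaussian state.\<close>

lemma gcov_purity:
  assumes "wick d f" "m < 2 * d"
  shows "(\<Sum>l<2 * d. (gcov d f m l)\<^sup>2) = (sqnorm d f)\<^sup>2"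
proof -
  have "of_real ((sqnorm d f)\<^sup>2) = ip d (maj d m f) (\<lambda>x. of_real (sqnorm d f) * maj d m f x)"
    using ip_sum_right[of d "maj d m f" "\<lambda>_. of_real (sqnorm d f)" "\<lambda>_. maj d m f" "{0::nat}"] assms(2)
    by (simp add: ip_maj ip_maj_maj power2_eq_square)
  also have "\<dots> = ip d (maj d m f) (\<lambda>x. \<Sum>l<2 * d. (- \<i> * of_real (gcov d f m l)) * maj d l f x)"
    using wick_linear[OF assms] by (intro ip_cong) auto
  also have "\<dots> = (\<Sum>l<2 * d. (- \<i> * of_real (gcov d f m l)) * ip d f (maj d m (maj d l f)))"
    using assms(2) by (simp only: ip_sum_right ip_maj)
  also have "\<dots> = (\<Sum>l<2 * d. of_real ((gcov d f m l)\<^sup>2))"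
    using assms(2) by (intro sum.cong) (auto simp: ip_maj_maj power2_eq_square complex_eq_iff)
  finally show ?thesis by (simp only: of_real_sum[symmetric] of_real_eq_iff)
qed

text \<open>Wick's theorem for four distinct operators. The rightmost one is replaced through
  \<open>wick_linear\<close> by a combination of operators \<open>c\<^sub>l\<close>, each of which
  is moved to the left end. The anticommutators on the way are the contractions.\<close>

lemma wick_four:
  assumes "wick d f" and lt: "j < 2 * d" "k < 2 * d" "p < 2 * d" "m < 2 * d"
    and ne: "j \<noteq> k" "j \<noteq> p" "j \<noteq> m" "k \<noteq> p" "k \<noteq> m" "p \<noteq> m"
  defines "G \<equiv> gcov d f"
  shows "of_real (sqnorm d f) * ip d f (maj d j (maj d k (maj d p (maj d m f)))) =
    - of_real (G j k * G p m - G j p * G k m + G j m * G k p)"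
proof -
  define N where "N = complex_of_real (sqnorm d f)"
  define Y where "Y = maj d j (maj d k (maj d p f))"
  define Q where "Q = ip d f (maj d j (maj d k (maj d p (maj d m f))))"
  have maj_lincomb: "maj d a (\<lambda>x. \<Sum>l\<in>I. c l * F l x) = (\<lambda>x. \<Sum>l\<in>I. c l * maj d a (F l) x)"
    for a I c and F :: "nat \<Rightarrow> nat \<Rightarrow> complex"
    by (auto simp: maj_def sum_distrib_left mult_ac)
  have maj_sub: "maj d a (\<lambda>x. (if P then 2 * g x else 0) - h x) =
      (\<lambda>x. (if P then 2 * maj d a g x else 0) - maj d a h x)" for a P g h
    by (auto simp: maj_def algebra_simps)
  have maj_swap: "maj d a (maj d b g) = (\<lambda>x. (if a = b then 2 * g x else 0) - maj d b (maj d a g) x)"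
    if "a < 2 * d" "b < 2 * d" for a b g
    using maj_maj[OF that] by auto
  have pull: "ip d f (maj d j (maj d k (maj d p (maj d l f)))) =
      (if l = p then 2 * ip d f (maj d j (maj d k f)) else 0) -
      (if l = k then 2 * ip d f (maj d j (maj d p f)) else 0) +
      (if l = j then 2 * ip d f (maj d k (maj d p f)) else 0) -
        ip d (maj d l f) Y" if l: "l < 2 * d" for l
  proof -
    have "maj d j (maj d k (maj d p (maj d l f))) x =
        (if l = p then 2 * maj d j (maj d k f) x else 0) -
        (if l = k then 2 * maj d j (maj d p f) x else 0) +
        (if l = j then 2 * maj d k (maj d p f) x else 0) - maj d l Y x" for x
      unfolding maj_swap[OF lt(3) l] maj_sub maj_swap[OF lt(2) l] Y_def
      using maj_maj[OF lt(1) l, of "maj d k (maj d p f)" x] by auto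
    then have "ip d f (maj d j (maj d k (maj d p (maj d l f)))) =
        ip d f (\<lambda>x. (if l = p then 2 * maj d j (maj d k f) x else 0) -
        (if l = k then 2 * maj d j (maj d p f) x else 0) +
        (if l = j then 2 * maj d k (maj d p f) x else 0) - maj d l Y x)"
      by (intro ip_cong) auto
    also have "\<dots> = (if l = p then 2 * ip d f (maj d j (maj d k f)) else 0) -
      (if l = k then 2 * ip d f (maj d j (maj d p f)) else 0) +
      (if l = j then 2 * ip d f (maj d k (maj d p f)) else 0) - ip d f (maj d l Y)"
      by (auto simp: ip_def sum_subtractf sum.distrib sum_distrib_left algebra_simps)
    finally show ?thesis by (simp add: ip_maj l)
  qed
  have left: "N * ip d (maj d m f) Y = (\<Sum>l<2 * d. (\<i> * of_real (G m l)) * ip d (maj d l f) Y)"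
  proof -
    have "N * ip d (maj d m f) Y = ip d (\<lambda>x. N * maj d m f x) Y"
      by (simp add: ip_def N_def sum_distrib_left mult_ac)
    also have "\<dots> = ip d (\<lambda>x. \<Sum>l<2 * d. (- \<i> * of_real (G m l)) * maj d l f x) Y"
      using wick_linear[OF assms(1) lt(4)] by (intro ip_cong) (auto simp: N_def G_def)
    also have "\<dots> = cnj (\<Sum>l<2 * d. (- \<i> * of_real (G m l)) * ip d Y (maj d l f))"
      by (simp only: cnj_ip[of d Y, symmetric] ip_sum_right)
    finally show ?thesis by (simp add: cnj_ip)
  qed
  have "ip d (maj d m f) Y = - Q"
    unfolding Y_def Q_def using lt ne
    by (simp add: ip_maj maj_anticommute_fun[of m d] maj_neg ip_minus_right)
  have "N * Q = ip d f (maj d j (maj d k (maj d p (\<lambda>x. N * maj d m f x))))"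
    by (simp add: Q_def ip_def maj_def sum_distrib_left mult_ac)
  also have "\<dots> = ip d f (maj d j (maj d k
    (maj d p (\<lambda>x. \<Sum>l<2 * d. (- \<i> * of_real (G m l)) * maj d l f x))))"
    using lt wick_linear[OF assms(1) lt(4)]
    by (intro ip_cong maj_cong) (auto simp: N_def G_def)
  also have "\<dots> = ip d f (\<lambda>x. \<Sum>l<2 * d. (- \<i> * of_real (G m l)) *
    maj d j (maj d k (maj d p (maj d l f))) x)"
    by (simp only: maj_lincomb)
  also have "\<dots> = (\<Sum>l<2 * d. (- \<i> * of_real (G m l)) * ip d f (maj d j (maj d k (maj d p (maj d l f)))))"
    by (rule ip_sum_right)
  also have "\<dots> = (\<Sum>l<2 * d. (if l = p then - 2 * \<i> * of_real (G m l) *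
    ip d f (maj d j (maj d k f)) else 0) +
      (if l = k then 2 * \<i> * of_real (G m l) * ip d f (maj d j (maj d p f)) else 0) +
      (if l = j then - 2 * \<i> * of_real (G m l) * ip d f (maj d k (maj d p f)) else 0) +
      (\<i> * of_real (G m l)) * ip d (maj d l f) Y)"
  proof (intro sum.cong refl)
    fix l assume "l \<in> {..<2 * d}"
    then show "(- \<i> * of_real (G m l)) * ip d f (maj d j (maj d k (maj d p (maj d l f)))) =
      (if l = p then - 2 * \<i> * of_real (G m l) * ip d f (maj d j (maj d k f)) else 0) +
      (if l = k then 2 * \<i> * of_real (G m l) * ip d f (maj d j (maj d p f)) else 0) +
      (if l = j then - 2 * \<i> * of_real (G m l) * ip d f (maj d k (maj d p f)) else 0) +
      (\<i> * of_real (G m l)) * ip d (maj d l f) Y"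
      by (subst pull) (auto simp: algebra_simps)
  qed
  also have "\<dots> = - 2 * \<i> * of_real (G m p) * ip d f (maj d j (maj d k f)) +
      2 * \<i> * of_real (G m k) * ip d f (maj d j (maj d p f)) -
      2 * \<i> * of_real (G m j) * ip d f (maj d k (maj d p f)) + N * ip d (maj d m f) Y"
    unfolding sum.distrib left using lt by simp
  \<comment> \<open>At the left end \<open>wick_linear\<close>, used on the other argument of the
    inner product, recombines the \<open>c\<^sub>l\<close> into \<open>c\<^sub>m\<close>. Moving
    \<open>c\<^sub>m\<close> back past three operators gives \<open>- N * Q\<close>, so the
    contractions equal twice \<open>N * Q\<close>.\<close>
  finally have "2 * (N * Q) = - 2 * \<i> * of_real (G m p) * ip d f (maj d j (maj d k f)) +
      2 * \<i> * of_real (G m k) * ip d f (maj d j (maj d p f)) -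
      2 * \<i> * of_real (G m j) * ip d f (maj d k (maj d p f))"
    using \<open>ip d (maj d m f) Y = - Q\<close> by simp
  also have "\<dots> = 2 * of_real (G m p * G j k - G m k * G j p + G m j * G k p)"
    using lt ne by (simp add: ip_maj_maj G_def algebra_simps)
  finally have "N * Q = of_real (G m p * G j k - G m k * G j p + G m j * G k p)"
    by (simp del: of_real_mult of_real_diff of_real_add)
  then show ?thesis
    using gcov_antisym[OF lt(4,1)] gcov_antisym[OF lt(4,2)] gcov_antisym[OF lt(4,3)]
    by (simp add: N_def Q_def G_def algebra_simps)
qed

definition zsign :: "nat \<Rightarrow> nat \<Rightarrow> real" where
  "zsign x i = (if bit x i then - 1 else 1)"

lemma maj_pair:
  assumes "i < d"
  shows "maj d i (maj d (d + i) f) = (\<lambda>x. \<i> * of_real (zsign x i) * f x)"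
proof
  fix x
  show "maj d i (maj d (d + i) f) x = \<i> * of_real (zsign x i) * f x"
    using assms jw_sign_cases[of i x]
    by (auto simp: maj_upper jw_sign_flip_bit bit_sign_def zsign_def)
qed

lemma gcov_pair:
  assumes "i < d"
  shows "gcov d f i (d + i) = (\<Sum>x<2 ^ d. zsign x i * (cmod (f x))\<^sup>2)"
proof -
  have "ip d f (maj d i (maj d (d + i) f)) = (\<Sum>x<2 ^ d. \<i> * of_real (zsign x i) * (f x * cnj (f x)))"
    unfolding maj_pair[OF assms] ip_def by (intro sum.cong) auto
  then show ?thesis
    by (simp add: gcov_def complex_norm_square[symmetric])
qed

lemma wick_pairs:
  assumes "wick d f" "i < d" "j < d" "i \<noteq> j"
  defines "G \<equiv> gcov d f"
  shows "sqnorm d f * (\<Sum>x<2 ^ d. zsign x i * zsign x j * (cmod (f x))\<^sup>2) =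
    G i (d + i) * G j (d + j) - G i j * G (d + i) (d + j) + G i (d + j) * G (d + i) j"
proof -
  have "ip d f (maj d i (maj d (d + i) (maj d j (maj d (d + j) f)))) =
      (\<Sum>x<2 ^ d. - (of_real (zsign x i * zsign x j) * (f x * cnj (f x))))"
    unfolding maj_pair[OF assms(2)] maj_pair[OF assms(3)] ip_def
    by (intro sum.cong) (auto simp: mult_ac i_mult_i)
  also have "\<dots> = - of_real (\<Sum>x<2 ^ d. zsign x i * zsign x j * (cmod (f x))\<^sup>2)"
    by (simp add: complex_norm_square[symmetric] sum_negf)
  finally have pairs: "ip d f (maj d i (maj d (d + i) (maj d j (maj d (d + j) f)))) =
      - of_real (\<Sum>x<2 ^ d. zsign x i * zsign x j * (cmod (f x))\<^sup>2)" .
  have "complex_of_real (sqnorm d f * (\<Sum>x<2 ^ d. zsign x i * zsign x j * (cmod (f x))\<^sup>2)) =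
      - (of_real (sqnorm d f) * ip d f (maj d i (maj d (d + i) (maj d j (maj d (d + j) f)))))"
    unfolding pairs by simp
  also have "\<dots> = of_real (G i (d + i) * G j (d + j) - G i j * G (d + i) (d + j) +
    G i (d + j) * G (d + i) j)"
    using wick_four[OF assms(1), of i "d + i" j "d + j"] assms
    by (simp del: of_real_mult of_real_diff of_real_add)
  finally have "complex_of_real (sqnorm d f * (\<Sum>x<2 ^ d. zsign x i * zsign x j * (cmod (f x))\<^sup>2)) =
      of_real (G i (d + i) * G j (d + j) - G i j * G (d + i) (d + j) + G i (d + j) * G (d + i) j)" .
  then show ?thesis by (simp only: of_real_eq_iff)
qed

text \<open>
  The correlations of the occupation numbers of a Gaussian vector are quadratic in the covariance
  matrix, and purity bounds the squared entries in one row.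
\<close>

lemma wick_correlations:
  assumes "wick d f"
  obtains T where "\<And>i j. T i j = T j i" "\<And>i j. (0 :: real) \<le> T i j"
    "\<And>i j. i < d \<Longrightarrow> j < d \<Longrightarrow> i \<noteq> j \<Longrightarrow>
       \<bar>sqnorm d f * (\<Sum>x<2 ^ d. zsign x i * zsign x j * (cmod (f x))\<^sup>2) -
        (\<Sum>x<2 ^ d. zsign x i * (cmod (f x))\<^sup>2) * (\<Sum>x<2 ^ d. zsign x j * (cmod (f x))\<^sup>2)\<bar> \<le> T i j"
    "\<And>i. i < d \<Longrightarrow> (\<Sum>j\<in>{..<d} - {i}. T i j) =
       (sqnorm d f)\<^sup>2 - (\<Sum>x<2 ^ d. zsign x i * (cmod (f x))\<^sup>2)\<^sup>2"
proof -
  define G where "G = gcov d f"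
  \<comment> \<open>Half the sum of squares of the 2 by 2 block of the covariance matrix between
    modes \<open>i\<close> and \<open>j\<close>. By the arithmetic-geometric mean inequality it
    bounds the two products in \<open>wick_pairs\<close>. With the factor one half, the average of
    the purity relations of the two rows of mode \<open>i\<close> makes the row sum exactly the
    variance.\<close>
  define S where "S i j = ((G i j)\<^sup>2 + (G i (d + j))\<^sup>2 + (G (d + i) j)\<^sup>2 + (G (d + i) (d + j))\<^sup>2) / 2"
    for i j
  define T where "T i j = (if i < d \<and> j < d then S i j else 0)" for i j
  have anti: "(G m n)\<^sup>2 = (G n m)\<^sup>2" if "m < 2 * d" "n < 2 * d" for m n
    unfolding G_def using gcov_antisym[OF that] by simp
  show ?thesis
  proof
    show "T i j = T j i" for i j
      unfolding T_def S_def using anti[of i j] anti[of i "d + j"] anti[of "d + i"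
        j] anti[of "d + i" "d + j"]
      by auto
    show "0 \<le> T i j" for i j by (simp add: T_def S_def)
  next
    fix i j assume ij: "i < d" "j < d" "i \<noteq> j"
    have "\<bar>a * b - c * e\<bar> \<le> (c\<^sup>2 + a\<^sup>2 + b\<^sup>2 + e\<^sup>2) / 2" for a b c e :: real
    proof -
      have "0 \<le> (a - b)\<^sup>2 + (c + e)\<^sup>2" "0 \<le> (a + b)\<^sup>2 + (c - e)\<^sup>2" by simp_all
      then show ?thesis unfolding abs_le_iff by (simp add: power2_eq_square algebra_simps)
    qed
    then have "\<bar>G i (d + j) * G (d + i) j - G i j * G (d + i) (d + j)\<bar> \<le> S i j"
      unfolding S_def by blast
    then show "\<bar>sqnorm d f * (\<Sum>x<2 ^ d. zsign x i * zsign x j * (cmod (f x))\<^sup>2) -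
        (\<Sum>x<2 ^ d. zsign x i * (cmod (f x))\<^sup>2) * (\<Sum>x<2 ^ d. zsign x j * (cmod (f x))\<^sup>2)\<bar> \<le> T i j"
      using ij wick_pairs[OF assms ij] gcov_pair[OF ij(1), of f] gcov_pair[OF ij(2), of f]
      by (simp add: T_def G_def)
  next
    fix i assume i: "i < d"
    have row: "(\<Sum>j\<in>{..<d} - {i}. (G m j)\<^sup>2 + (G m (d + j))\<^sup>2) =
        (sqnorm d f)\<^sup>2 - (G m i)\<^sup>2 - (G m (d + i))\<^sup>2" if "m < 2 * d" for m
      using gcov_purity[OF assms that] i
      unfolding sum_two_times G_def by (simp add: sum.remove[of "{..<d}" i])
    have "(\<Sum>j\<in>{..<d} - {i}. T i j) = (\<Sum>j\<in>{..<d} - {i}.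
        ((G i j)\<^sup>2 + (G i (d + j))\<^sup>2) / 2 + ((G (d + i) j)\<^sup>2 + (G (d + i) (d + j))\<^sup>2) / 2)"
      using i by (intro sum.cong) (auto simp: T_def S_def add_divide_distrib)
    also have "\<dots> = (sqnorm d f)\<^sup>2 - (G i (d + i))\<^sup>2"
      using i row[of i] row[of "d + i"] anti[of "d + i" i]
      by (simp add: sum.distrib[of "\<lambda>j. (_ j) / 2"] sum_divide_distrib[symmetric] G_def)
    finally show "(\<Sum>j\<in>{..<d} - {i}. T i j) =
       (sqnorm d f)\<^sup>2 - (\<Sum>x<2 ^ d. zsign x i * (cmod (f x))\<^sup>2)\<^sup>2"
      using gcov_pair[OF i, of f] by (simp add: G_def)
  qed
qed

section \<open>A Poincare inequality for pairs of qubits\<close>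

text \<open>
  The squared norm of the component of \<open>v\<close> orthogonal to \<open>\<phi>\<close>, on the coordinates in \<open>A\<close>; it is
  the squared norm of \<open>v\<close> if \<open>\<phi>\<close> vanishes on \<open>A\<close>.
\<close>

definition defect :: "'a set \<Rightarrow> ('a \<Rightarrow> complex) \<Rightarrow> ('a \<Rightarrow> complex) \<Rightarrow> real" where
  "defect A \<phi> v = (\<Sum>x\<in>A. (cmod (v x))\<^sup>2) -
     (cmod (\<Sum>x\<in>A. cnj (\<phi> x) * v x))\<^sup>2 / (\<Sum>x\<in>A. (cmod (\<phi> x))\<^sup>2)"

lemma Cauchy_Schwarz_cmod:
  fixes w v :: "'a \<Rightarrow> complex"
  shows "(cmod (\<Sum>x\<in>A. cnj (w x) * v x))\<^sup>2 \<le> (\<Sum>x\<in>A. (cmod (w x))\<^sup>2) * (\<Sum>x\<in>A. (cmod (v x))\<^sup>2)"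
proof -
  have "cmod (\<Sum>x\<in>A. cnj (w x) * v x) \<le> (\<Sum>x\<in>A. \<bar>cmod (w x)\<bar> * \<bar>cmod (v x)\<bar>)"
    by (rule order_trans[OF norm_sum]) (simp add: norm_mult)
  also have "\<dots> \<le> L2_set (\<lambda>x. cmod (w x)) A * L2_set (\<lambda>x. cmod (v x)) A"
    by (rule L2_set_mult_ineq)
  finally have "(cmod (\<Sum>x\<in>A. cnj (w x) * v x))\<^sup>2 \<le>
      (L2_set (\<lambda>x. cmod (w x)) A * L2_set (\<lambda>x. cmod (v x)) A)\<^sup>2"
    by (rule power_mono) simp
  also have "\<dots> = (\<Sum>x\<in>A. (cmod (w x))\<^sup>2) * (\<Sum>x\<in>A. (cmod (v x))\<^sup>2)"
    by (simp add: power_mult_distrib L2_set_def sum_nonneg)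
  finally show ?thesis .
qed

lemma defect_eq_sqnorm:
  fixes \<phi> v :: "'a \<Rightarrow> complex" and A :: "'a set"
  defines "N \<equiv> \<Sum>x\<in>A. (cmod (\<phi> x))\<^sup>2" and "a \<equiv> \<Sum>x\<in>A. cnj (\<phi> x) * v x"
  assumes "N \<noteq> 0"
  shows "(\<Sum>x\<in>A. (cmod (v x - a / of_real N * \<phi> x))\<^sup>2) = defect A \<phi> v"
proof -
  define c where "c = a / of_real N"
  have "complex_of_real (\<Sum>x\<in>A. (cmod (v x - c * \<phi> x))\<^sup>2) =
      (\<Sum>x\<in>A. v x * cnj (v x)) - c * cnj (\<Sum>x\<in>A. cnj (\<phi> x) * v x) -
      cnj c * (\<Sum>x\<in>A. cnj (\<phi> x) * v x) + c * cnj c * (\<Sum>x\<in>A. \<phi> x * cnj (\<phi> x))"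
    by (simp add: complex_norm_square sum_subtractf sum.distrib sum_distrib_left algebra_simps
        del: of_real_power)
  also have "(\<Sum>x\<in>A. cnj (\<phi> x) * v x) = c * of_real N"
    using assms(3) by (simp add: c_def a_def)
  also have "(\<Sum>x\<in>A. \<phi> x * cnj (\<phi> x)) = of_real N"
    by (simp only: N_def of_real_sum complex_norm_square)
  also have "(\<Sum>x\<in>A. v x * cnj (v x)) = of_real (\<Sum>x\<in>A. (cmod (v x))\<^sup>2)"
    by (simp only: of_real_sum complex_norm_square)
  finally have "complex_of_real (\<Sum>x\<in>A. (cmod (v x - c * \<phi> x))\<^sup>2) =
      of_real (\<Sum>x\<in>A. (cmod (v x))\<^sup>2) - c * cnj c * of_real N"
    by (simp add: algebra_simps)
  also have "c * cnj c = of_real ((cmod c)\<^sup>2)" by (simp only: complex_norm_square)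
  finally have "(\<Sum>x\<in>A. (cmod (v x - c * \<phi> x))\<^sup>2) = (\<Sum>x\<in>A. (cmod (v x))\<^sup>2) - (cmod c)\<^sup>2 * N"
    by (simp only: of_real_mult[symmetric] of_real_diff[symmetric] of_real_eq_iff)
  also have "(cmod c)\<^sup>2 * N = (cmod a)\<^sup>2 / N"
    using assms(3) by (simp add: c_def norm_divide power2_eq_square)
  finally show ?thesis by (simp add: c_def defect_def a_def N_def)
qed

lemma defect_nonneg: "0 \<le> defect A \<phi> v"
proof (cases "(\<Sum>x\<in>A. (cmod (\<phi> x))\<^sup>2) = 0")
  case True
  then show ?thesis by (simp add: defect_def sum_nonneg)
next
  case False
  from defect_eq_sqnorm[OF False, of v, symmetric] show ?thesis by (simp add: sum_nonneg)
qed

text \<open>\<open>P, Q\<close> are the weights of the target on the two halves of a set and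
  \<open>a, b\<close> the overlaps there. The left-hand side is what is gained by projecting on the
  two halves separately instead of on their sum. \<open>P - Q\<close> will be the expectation of a
  bit sign, and the last factor its unnormalised variance \<open>4 * P * Q\<close>.\<close>

lemma split_quotient:
  fixes a b :: complex and P Q :: real
  assumes "0 \<le> P" "0 \<le> Q" "P = 0 \<Longrightarrow> a = 0" "Q = 0 \<Longrightarrow> b = 0"
  shows "(cmod a)\<^sup>2 / P + (cmod b)\<^sup>2 / Q - (cmod (a + b))\<^sup>2 / (P + Q) =
    (cmod (of_real (2 * Q) * a - of_real (2 * P) * b))\<^sup>2 / ((P + Q) * ((P + Q)\<^sup>2 - (P - Q)\<^sup>2))"
proof (cases "P = 0 \<or> Q = 0")
  case True
  then show ?thesis using assms by auto
next
  case False
  then have "P > 0" "Q > 0" using assms by auto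
  then have "P + Q > 0" by simp
  have sq: "(P + Q)\<^sup>2 - (P - Q)\<^sup>2 = 4 * (P * Q)"
    by (simp add: power2_eq_square algebra_simps)
  have num: "(cmod (of_real (2 * Q) * a - of_real (2 * P) * b))\<^sup>2 = 4 *
      ((P + Q) * (Q * (cmod a)\<^sup>2 + P * (cmod b)\<^sup>2) - P * Q * (cmod (a + b))\<^sup>2)"
    unfolding cmod_power2 by (simp add: power2_eq_square algebra_simps)
  have "(cmod a)\<^sup>2 / P + (cmod b)\<^sup>2 / Q - (cmod (a + b))\<^sup>2 / (P + Q) =
      ((P + Q) * (Q * (cmod a)\<^sup>2 + P * (cmod b)\<^sup>2) - P * Q * (cmod (a + b))\<^sup>2) / ((P + Q) * (P * Q))"
    using \<open>P > 0\<close> \<open>Q > 0\<close> \<open>P + Q > 0\<close> by (simp add: divide_simps)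
  moreover have cancel: "(4 * x) / (y * (4 * w)) = x / (y * w)" for x y w :: real by simp
  ultimately show ?thesis unfolding sq num cancel by simp
qed

text \<open>
  One step of the descent: the vectors \<open>(N s\<^sub>i - Z\<^sub>i) \<phi>\<close> span the functions of single bits in the
  complement of \<open>\<phi>\<close>, and by Schur's test their normalised Gram matrix has norm at most 2.
\<close>

lemma defect_single_bits:
  fixes \<phi> v :: "'a \<Rightarrow> complex" and s :: "'i \<Rightarrow> 'a \<Rightarrow> real" and T :: "'i \<Rightarrow> 'i \<Rightarrow> real"
    and A :: "'a set" and F :: "'i set"
  assumes "finite A" "finite F" and s: "\<And>i x. s i x = 1 \<or> s i x = - 1"
  defines "N \<equiv> \<Sum>x\<in>A. (cmod (\<phi> x))\<^sup>2" and "Z \<equiv> \<lambda>i. \<Sum>x\<in>A. s i x * (cmod (\<phi> x))\<^sup>2"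
  assumes T_sym: "\<And>i j. T i j = T j i" and T_nonneg: "\<And>i j. 0 \<le> T i j"
    and T_bound: "\<And>i j. i \<in> F \<Longrightarrow> j \<in> F \<Longrightarrow> i \<noteq> j \<Longrightarrow>
      \<bar>N * (\<Sum>x\<in>A. s i x * s j x * (cmod (\<phi> x))\<^sup>2) - Z i * Z j\<bar> \<le> T i j"
    and T_row: "\<And>i. i \<in> F \<Longrightarrow> (\<Sum>j\<in>F - {i}. T i j) \<le> N\<^sup>2 - (Z i)\<^sup>2"
  shows "(real (card F) - 2) * defect A \<phi> v \<le>
    (\<Sum>i\<in>F. defect {x\<in>A. s i x = 1} \<phi> v + defect {x\<in>A. s i x = - 1} \<phi> v)"
proof -
  define V where "V = defect A \<phi> v"
  define h where "h i x = of_real (N * s i x - Z i) * \<phi> x" for i x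
  define H where "H i = (\<Sum>x\<in>A. cnj (h i x) * v x)" for i
  define K where "K i = N\<^sup>2 - (Z i)\<^sup>2" for i
  define D where "D i = (cmod (H i))\<^sup>2 / (N * K i)" for i
  have V: "0 \<le> V" unfolding V_def by (rule defect_nonneg)
  have N: "0 \<le> N" by (simp add: N_def sum_nonneg)
  have split: "(\<Sum>x\<in>A. g x) = (\<Sum>x\<in>{x\<in>A. s i x = 1}. g x) + (\<Sum>x\<in>{x\<in>A. s i x = - 1}. g x)"
    for g :: "'a \<Rightarrow> 'b :: comm_monoid_add" and i
  proof -
    have "A = {x\<in>A. s i x = 1} \<union> {x\<in>A. s i x = - 1}" using s by blast
    moreover have "{x\<in>A. s i x = 1} \<inter> {x\<in>A. s i x = - 1} = {}" by auto
    ultimately show ?thesis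
      using \<open>finite A\<close> by (metis (no_types, lifting) finite_Un sum.union_disjoint)
  qed
  \<comment> \<open>The two halves of \<open>\<phi>\<close> span \<open>\<phi>\<close> and the
    orthogonal vector \<open>h i\<close>, whose squared norm is \<open>N * K i\<close>. Hence
    splitting the set lowers the defect by the squared overlap with the normalised
    \<open>h i\<close>.\<close>
  have parts: "defect {x\<in>A. s i x = 1} \<phi> v + defect {x\<in>A. s i x = - 1} \<phi> v = V - D i" for i
  proof -
    let ?p = "{x\<in>A. s i x = 1}" and ?m = "{x\<in>A. s i x = - 1}"
    define P where "P = (\<Sum>x\<in>?p. (cmod (\<phi> x))\<^sup>2)"
    define Q where "Q = (\<Sum>x\<in>?m. (cmod (\<phi> x))\<^sup>2)"
    define a where "a = (\<Sum>x\<in>?p. cnj (\<phi> x) * v x)"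
    define b where "b = (\<Sum>x\<in>?m. cnj (\<phi> x) * v x)"
    have NPQ: "N = P + Q" unfolding N_def P_def Q_def by (rule split)
    have ZPQ: "Z i = P - Q"
      unfolding Z_def split[of _ i] P_def Q_def by (simp add: sum_negf)
    have vanish: "(\<Sum>x\<in>B. cnj (\<phi> x) * v x) = 0"
      if "(\<Sum>x\<in>B. (cmod (\<phi> x))\<^sup>2) = 0" "finite B" for B
      using that by (subst (asm) sum_nonneg_eq_0_iff) auto
    have H: "H i = of_real (2 * Q) * a - of_real (2 * P) * b"
    proof -
      have "H i = (\<Sum>x\<in>?p. of_real (2 * Q) * (cnj (\<phi> x) * v x)) +
          (\<Sum>x\<in>?m. - of_real (2 * P) * (cnj (\<phi> x) * v x))"
        unfolding H_def split[of _ i] h_def NPQ ZPQ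
        by (intro arg_cong2[of _ _ _ _ "(+)"] sum.cong refl) (auto simp: algebra_simps)
      then show ?thesis by (simp add: a_def b_def sum_distrib_left sum_negf)
    qed
    have "(cmod a)\<^sup>2 / P + (cmod b)\<^sup>2 / Q - (cmod (a + b))\<^sup>2 / (P + Q) = D i"
      unfolding D_def K_def NPQ ZPQ H
      by (rule split_quotient)
         (auto simp: P_def Q_def a_def b_def sum_nonneg vanish \<open>finite A\<close>)
    moreover have "(\<Sum>x\<in>A. (cmod (v x))\<^sup>2) = (\<Sum>x\<in>?p. (cmod (v x))\<^sup>2) + (\<Sum>x\<in>?m. (cmod (v x))\<^sup>2)"
      "(\<Sum>x\<in>A. cnj (\<phi> x) * v x) = a + b"
      unfolding a_def b_def by (rule split)+
    ultimately show ?thesis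
      unfolding V_def defect_def P_def[symmetric] Q_def[symmetric] a_def[symmetric] b_def[symmetric]
        N_def[symmetric] NPQ by simp
  qed
  have "(\<Sum>i\<in>F. D i) \<le> 2 * V"
  proof (cases "N = 0")
    case True
    then show ?thesis using V by (simp add: D_def)
  next
    case False
    with N have "N > 0" by simp
    \<comment> \<open>The test vector \<open>w\<close> built from these coefficients has overlap
      \<open>X\<close> with \<open>v\<close>, and its squared norm is at most
      \<open>2 * N * X\<close>. Cauchy--Schwarz then bounds \<open>X\<close>, which is
      \<open>N\<close> times the sum of all \<open>D i\<close>. If \<open>K i = 0\<close>, then
      \<open>\<beta> i\<close> and \<open>D i\<close> are both zero by the convention for
      quotients.\<close>
    define \<beta> where "\<beta> i = H i / of_real (K i)" for i
    define X where "X = (\<Sum>i\<in>F. (cmod (H i))\<^sup>2 / K i)"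
    define w where "w x = (\<Sum>i\<in>F. \<beta> i * h i x)" for x
    define C where "C i j = N * (\<Sum>x\<in>A. s i x * s j x * (cmod (\<phi> x))\<^sup>2) - Z i * Z j" for i j
    have K: "0 \<le> K i" if "i \<in> F" for i
      using T_row[OF that] sum_nonneg[of "F - {i}" "T i"] T_nonneg by (simp add: K_def)
    have X_nonneg: "0 \<le> X" unfolding X_def using K by (intro sum_nonneg) auto
    have C_diag: "C i i = K i" for i
    proof -
      have "s i x * s i x = 1" for x using s[of i x] by auto
      then show ?thesis by (simp add: C_def K_def power2_eq_square N_def)
    qed
    have gram: "(\<Sum>x\<in>A. cnj (h i x) * h j x) = of_real (N * C i j)" for i j
    proof -
      have "(\<Sum>x\<in>A. cnj (h i x) * h j x) =
          of_real (\<Sum>x\<in>A. (N * s i x - Z i) * (N * s j x - Z j) * (cmod (\<phi> x))\<^sup>2)"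
        unfolding of_real_sum
        by (intro sum.cong refl) (simp add: h_def complex_norm_square mult_ac del: of_real_diff
          of_real_power)
      also have "(\<Sum>x\<in>A. (N * s i x - Z i) * (N * s j x - Z j) * (cmod (\<phi> x))\<^sup>2) =
          N * N * (\<Sum>x\<in>A. s i x * s j x * (cmod (\<phi> x))\<^sup>2) - N * Z j * Z i - N * Z i * Z j + Z i * Z j * N"
      proof -
        have "(N * s i x - Z i) * (N * s j x - Z j) * (cmod (\<phi> x))\<^sup>2 =
            N * N * (s i x * s j x * (cmod (\<phi> x))\<^sup>2) - N * Z j * (s i x * (cmod (\<phi> x))\<^sup>2) -
            N * Z i * (s j x * (cmod (\<phi> x))\<^sup>2) + Z i * Z j * (cmod (\<phi> x))\<^sup>2" for x
          by (simp add: algebra_simps)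
        moreover have Z_sum: "(\<Sum>x\<in>A. s i x * (cmod (\<phi> x))\<^sup>2) = Z i" for i
          by (simp add: Z_def)
        ultimately show ?thesis
          by (simp add: sum.distrib sum_subtractf sum_distrib_left[symmetric] Z_sum N_def[symmetric])
      qed
      finally show ?thesis by (simp add: C_def algebra_simps)
    qed
    have beta_sq: "(cmod (\<beta> i))\<^sup>2 * K i = (cmod (H i))\<^sup>2 / K i" for i
      by (simp add: \<beta>_def norm_divide power2_eq_square)
    have w_v: "(\<Sum>x\<in>A. cnj (w x) * v x) = of_real X"
    proof -
      have "(\<Sum>x\<in>A. cnj (w x) * v x) = (\<Sum>i\<in>F. cnj (\<beta> i) * H i)"
        unfolding w_def H_def by (simp add: sum_distrib_left sum_distrib_right mult_ac, rule sum.swap)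
      also have "\<dots> = of_real X"
        unfolding X_def \<beta>_def of_real_sum
        by (intro sum.cong refl) (simp add: complex_norm_square mult.commute del: of_real_power)
      finally show ?thesis .
    qed
    have w_phi: "(\<Sum>x\<in>A. cnj (w x) * \<phi> x) = 0"
    proof -
      have "(\<Sum>x\<in>A. cnj (h i x) * \<phi> x) = of_real (\<Sum>x\<in>A. (N * s i x - Z i) * (cmod (\<phi> x))\<^sup>2)" for i
        unfolding of_real_sum
        by (intro sum.cong refl) (simp add: h_def complex_norm_square mult_ac del: of_real_diff
          of_real_power)
      moreover have "(\<Sum>x\<in>A. (N * s i x - Z i) * (cmod (\<phi> x))\<^sup>2) = 0" for i
      proof -
        have "(\<Sum>x\<in>A. s i x * (cmod (\<phi> x))\<^sup>2) = Z i" by (simp add: Z_def)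
        then show ?thesis
          by (simp add: left_diff_distrib mult.assoc sum_subtractf sum_distrib_left[symmetric]
              N_def[symmetric])
      qed
      moreover have "(\<Sum>x\<in>A. cnj (w x) * \<phi> x) = (\<Sum>i\<in>F. cnj (\<beta> i) * (\<Sum>x\<in>A. cnj (h i x) * \<phi> x))"
        unfolding w_def by (simp add: sum_distrib_left sum_distrib_right mult_ac, rule sum.swap)
      ultimately show ?thesis by simp
    qed
    have "(\<Sum>x\<in>A. (cmod (w x))\<^sup>2) \<le> 2 * N * X"
    proof -
      have "complex_of_real (\<Sum>x\<in>A. (cmod (w x))\<^sup>2) =
          (\<Sum>x\<in>A. \<Sum>i\<in>F. \<Sum>j\<in>F. cnj (\<beta> i) * \<beta> j * (cnj (h i x) * h j x))"
        unfolding of_real_sum complex_norm_square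
      proof (rule sum.cong[OF refl])
        fix x
        have "w x * cnj (w x) = (\<Sum>i\<in>F. cnj (\<beta> i) * cnj (h i x)) * (\<Sum>j\<in>F. \<beta> j * h j x)"
          by (simp add: w_def mult.commute)
        also have "\<dots> = (\<Sum>i\<in>F. \<Sum>j\<in>F. (cnj (\<beta> i) * cnj (h i x)) * (\<beta> j * h j x))"
          by (rule sum_product)
        also have "\<dots> = (\<Sum>i\<in>F. \<Sum>j\<in>F. cnj (\<beta> i) * \<beta> j * (cnj (h i x) * h j x))"
          by (intro sum.cong refl) (simp only: mult_ac)
        finally show "w x * cnj (w x) = (\<Sum>i\<in>F. \<Sum>j\<in>F. cnj (\<beta> i) * \<beta> j * (cnj (h i x) * h j x))" .
      qed
      also have "\<dots> = (\<Sum>i\<in>F. \<Sum>x\<in>A. \<Sum>j\<in>F. cnj (\<beta> i) * \<beta> j * (cnj (h i x) * h j x))"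
        by (rule sum.swap)
      also have "\<dots> = (\<Sum>i\<in>F. \<Sum>j\<in>F. \<Sum>x\<in>A. cnj (\<beta> i) * \<beta> j * (cnj (h i x) * h j x))"
        by (intro sum.cong refl sum.swap)
      also have "\<dots> = (\<Sum>i\<in>F. \<Sum>j\<in>F. cnj (\<beta> i) * \<beta> j * of_real (N * C i j))"
        by (simp add: sum_distrib_left[symmetric] gram)
      finally have "complex_of_real (\<Sum>x\<in>A. (cmod (w x))\<^sup>2) =
          (\<Sum>i\<in>F. \<Sum>j\<in>F. cnj (\<beta> i) * \<beta> j * of_real (N * C i j))" .
      from arg_cong[OF this, of cmod]
      have "(\<Sum>x\<in>A. (cmod (w x))\<^sup>2) = cmod (\<Sum>i\<in>F. \<Sum>j\<in>F. cnj (\<beta> i) * \<beta> j * of_real (N * C i j))"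
        unfolding norm_of_real by (simp only: abs_of_nonneg sum_nonneg zero_le_power2)
      also have "\<dots> \<le> (\<Sum>i\<in>F. \<Sum>j\<in>F. cmod (\<beta> i) * cmod (\<beta> j) * (N * \<bar>C i j\<bar>))"
      proof (rule order_trans[OF norm_sum], rule sum_mono, rule order_trans[OF norm_sum], rule sum_mono)
        fix i j
        show "cmod (cnj (\<beta> i) * \<beta> j * of_real (N * C i j)) \<le> cmod (\<beta> i) * cmod (\<beta> j) * (N * \<bar>C i j\<bar>)"
          unfolding norm_mult norm_of_real abs_mult using N by simp
      qed
      also have "\<dots> \<le> (\<Sum>i\<in>F. N * ((cmod (\<beta> i))\<^sup>2 * K i) +
          N * (\<Sum>j\<in>F - {i}. T i j * ((cmod (\<beta> i))\<^sup>2 + (cmod (\<beta> j))\<^sup>2) / 2))"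
      proof (rule sum_mono)
        fix i assume i: "i \<in> F"
        have "(\<Sum>j\<in>F. cmod (\<beta> i) * cmod (\<beta> j) * (N * \<bar>C i j\<bar>)) =
            N * ((cmod (\<beta> i))\<^sup>2 * K i) + (\<Sum>j\<in>F - {i}. cmod (\<beta> i) * cmod (\<beta> j) * (N * \<bar>C i j\<bar>))"
          using i \<open>finite F\<close> K[OF i] by (simp add: sum.remove C_diag power2_eq_square)
        also have "\<dots> \<le> N * ((cmod (\<beta> i))\<^sup>2 * K i) +
            (\<Sum>j\<in>F - {i}. N * (T i j * ((cmod (\<beta> i))\<^sup>2 + (cmod (\<beta> j))\<^sup>2) / 2))"
        proof (intro add_left_mono sum_mono)
          fix j assume j: "j \<in> F - {i}"
          have "cmod (\<beta> i) * cmod (\<beta> j) \<le> ((cmod (\<beta> i))\<^sup>2 + (cmod (\<beta> j))\<^sup>2) / 2"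
            using sum_squares_bound[of "cmod (\<beta> i)" "cmod (\<beta> j)"] by simp
          moreover have "\<bar>C i j\<bar> \<le> T i j" using T_bound[OF i] j by (auto simp: C_def)
          ultimately have "cmod (\<beta> i) * cmod (\<beta> j) * \<bar>C i j\<bar> \<le>
              ((cmod (\<beta> i))\<^sup>2 + (cmod (\<beta> j))\<^sup>2) / 2 * T i j"
            by (intro mult_mono) auto
          from mult_left_mono[OF this N]
          show "cmod (\<beta> i) * cmod (\<beta> j) * (N * \<bar>C i j\<bar>) \<le>
              N * (T i j * ((cmod (\<beta> i))\<^sup>2 + (cmod (\<beta> j))\<^sup>2) / 2)"
            by (simp add: mult_ac)
        qed
        finally show "(\<Sum>j\<in>F. cmod (\<beta> i) * cmod (\<beta> j) * (N * \<bar>C i j\<bar>)) \<le>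
          N * ((cmod (\<beta> i))\<^sup>2 * K i) +
          N * (\<Sum>j\<in>F - {i}. T i j * ((cmod (\<beta> i))\<^sup>2 + (cmod (\<beta> j))\<^sup>2) / 2)"
          by (simp add: sum_distrib_left)
      qed
      also have "\<dots> = N * X + N * (\<Sum>i\<in>F. \<Sum>j\<in>F - {i}. T i j * ((cmod (\<beta> i))\<^sup>2 + (cmod (\<beta> j))\<^sup>2) / 2)"
        by (simp add: X_def beta_sq sum.distrib sum_distrib_left)
      \<comment> \<open>Schur's test: by symmetry of \<open>T\<close> the halves for
        \<open>i\<close> and for \<open>j\<close> are equal, so each row is weighted by its own sum,
        at most \<open>K i\<close>. The off-diagonal part thus contributes at most as much as the
        diagonal, and the constant is 2.\<close>
      also have "(\<Sum>i\<in>F. \<Sum>j\<in>F - {i}. T i j * ((cmod (\<beta> i))\<^sup>2 + (cmod (\<beta> j))\<^sup>2) / 2) =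
          (\<Sum>i\<in>F. \<Sum>j\<in>F - {i}. T i j * (cmod (\<beta> i))\<^sup>2)"
      proof -
        have "(\<Sum>i\<in>F. \<Sum>j\<in>F - {i}. T i j * (cmod (\<beta> j))\<^sup>2) =
            (\<Sum>i\<in>F. \<Sum>j\<in>{j\<in>F. i \<noteq> j}. T i j * (cmod (\<beta> j))\<^sup>2)"
          by (intro sum.cong refl) auto
        also have "\<dots> = (\<Sum>j\<in>F. \<Sum>i\<in>{i\<in>F. i \<noteq> j}. T i j * (cmod (\<beta> j))\<^sup>2)"
          by (rule sum.swap_restrict[OF \<open>finite F\<close> \<open>finite F\<close>])
        also have "\<dots> = (\<Sum>j\<in>F. \<Sum>i\<in>F - {j}. T i j * (cmod (\<beta> j))\<^sup>2)"
          by (intro sum.cong refl) auto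
        also have "\<dots> = (\<Sum>i\<in>F. \<Sum>j\<in>F - {i}. T i j * (cmod (\<beta> i))\<^sup>2)"
          by (intro sum.cong refl) (simp only: T_sym)
        finally show ?thesis
          by (simp add: distrib_left sum.distrib add_divide_distrib sum_divide_distrib[symmetric])
      qed
      also have "\<dots> \<le> X"
        unfolding X_def beta_sq[symmetric]
      proof (rule sum_mono)
        fix i assume "i \<in> F"
        have "(\<Sum>j\<in>F - {i}. T i j * (cmod (\<beta> i))\<^sup>2) = (cmod (\<beta> i))\<^sup>2 * (\<Sum>j\<in>F - {i}. T i j)"
          by (simp add: sum_distrib_left mult.commute)
        also have "\<dots> \<le> (cmod (\<beta> i))\<^sup>2 * K i"
          using T_row[OF \<open>i \<in> F\<close>] by (intro mult_left_mono) (auto simp: K_def)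
        finally show "(\<Sum>j\<in>F - {i}. T i j * (cmod (\<beta> i))\<^sup>2) \<le> (cmod (\<beta> i))\<^sup>2 * K i" .
      qed
      finally show ?thesis using N by (simp add: mult_left_mono)
    qed
    define a where "a = (\<Sum>x\<in>A. cnj (\<phi> x) * v x)"
    \<comment> \<open>Since \<open>w\<close> is orthogonal to \<open>\<phi>\<close>, the vector
      \<open>v\<close> may be replaced by its component orthogonal to \<open>\<phi>\<close>. So the
      defect, and not the whole squared norm of \<open>v\<close>, enters.\<close>
    have "X\<^sup>2 = (cmod (\<Sum>x\<in>A. cnj (w x) * (v x - a / of_real N * \<phi> x)))\<^sup>2"
    proof -
      have "(\<Sum>x\<in>A. cnj (w x) * (v x - a / of_real N * \<phi> x)) =
          (\<Sum>x\<in>A. cnj (w x) * v x) - a / of_real N * (\<Sum>x\<in>A. cnj (w x) * \<phi> x)"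
        by (simp add: algebra_simps sum_subtractf sum_distrib_left)
      then show ?thesis unfolding w_v w_phi by simp
    qed
    also have "\<dots> \<le> (\<Sum>x\<in>A. (cmod (w x))\<^sup>2) * (\<Sum>x\<in>A. (cmod (v x - a / of_real N * \<phi> x))\<^sup>2)"
      by (rule Cauchy_Schwarz_cmod)
    also have "(\<Sum>x\<in>A. (cmod (v x - a / of_real N * \<phi> x))\<^sup>2) = V"
      using False unfolding V_def N_def a_def by (rule defect_eq_sqnorm)
    also have "(\<Sum>x\<in>A. (cmod (w x))\<^sup>2) * V \<le> 2 * N * X * V"
      using \<open>(\<Sum>x\<in>A. (cmod (w x))\<^sup>2) \<le> 2 * N * X\<close> V by (rule mult_right_mono)
    finally have "X * X \<le> X * (2 * N * V)" by (simp add: power2_eq_square mult_ac)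
    then have "X \<le> 2 * N * V"
      using X_nonneg N V by (cases "X = 0") auto
    moreover have "(\<Sum>i\<in>F. D i) = X / N"
      by (simp add: D_def X_def sum_divide_distrib mult.commute)
    ultimately have "(\<Sum>i\<in>F. D i) \<le> (2 * N * V) / N"
      using N by (simp only: divide_right_mono)
    then show ?thesis using \<open>N > 0\<close> by simp
  qed
  then show ?thesis
    unfolding parts by (simp add: sum_subtractf V_def algebra_simps)
qed

section \<open>Blocks of fixed outcomes and the descent to pairs\<close>

definition block :: "nat \<Rightarrow> nat set \<Rightarrow> nat \<Rightarrow> nat set" where
  "block d F z = {x. x < 2 ^ d \<and> (\<forall>i<d. i \<notin> F \<longrightarrow> bit x i = bit z i)}"

text \<open>One representative for each block: the block of \<open>z\<close> does not depend on the
  bits of \<open>z\<close> in \<open>F\<close>, so these are normalised to zero.\<close>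

definition anchors :: "nat \<Rightarrow> nat set \<Rightarrow> nat set" where
  "anchors d F = {z. z < 2 ^ d \<and> (\<forall>i\<in>F. \<not> bit z i)}"

definition block_defect :: "nat \<Rightarrow> (nat \<Rightarrow> complex) \<Rightarrow> (nat \<Rightarrow> complex) \<Rightarrow> nat set \<Rightarrow> real" where
  "block_defect d \<phi> v F = (\<Sum>z\<in>anchors d F. defect (block d F z) \<phi> v)"

lemma finite_block [simp]: "finite (block d F z)"
  by (rule finite_subset[of _ "{..<2 ^ d}"]) (auto simp: block_def)

lemma finite_anchors [simp]: "finite (anchors d F)"
  by (rule finite_subset[of _ "{..<2 ^ d}"]) (auto simp: anchors_def)

lemma wick_restrict:
  assumes "wick d f" "finite S" "S \<subseteq> {..<d}"
  shows "wick d (\<lambda>x. if \<forall>i\<in>S. bit x i = bit z i then f x else 0)"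
  using assms(2,3)
proof (induction S)
  case (insert i S)
  then have "wick d (\<lambda>x. if bit x i = bit z i then (if \<forall>i\<in>S. bit x i = bit z i then f x else 0) else 0)"
    by (intro wick_restrict_bit) auto
  moreover have "(\<lambda>x. if bit x i = bit z i then (if \<forall>i\<in>S. bit x i = bit z i then f x else 0) else 0) =
      (\<lambda>x. if \<forall>i\<in>insert i S. bit x i = bit z i then f x else 0)"
    by auto
  ultimately show ?case by simp
qed (use assms in simp)

lemma sum_anchors_remove:
  fixes g :: "nat \<Rightarrow> real"
  assumes "i \<in> F" "F \<subseteq> {..<d}"
  shows "(\<Sum>z\<in>anchors d F. g z + g (flip_bit i z)) = (\<Sum>z\<in>anchors d (F - {i}). g z)"
proof -
  have i: "i < d" using assms by auto
  have "anchors d (F - {i}) = anchors d F \<union> flip_bit i ` anchors d F"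
  proof (intro equalityI subsetI)
    fix z assume z: "z \<in> anchors d (F - {i})"
    show "z \<in> anchors d F \<union> flip_bit i ` anchors d F"
    proof (cases "bit z i")
      case True
      then have "flip_bit i z \<in> anchors d F"
        using z i by (auto simp: anchors_def flip_bit_less)
      then have "flip_bit i (flip_bit i z) \<in> flip_bit i ` anchors d F" by (rule imageI)
      then show ?thesis by simp
    next
      case False
      then show ?thesis using z by (auto simp: anchors_def)
    qed
  next
    fix z assume "z \<in> anchors d F \<union> flip_bit i ` anchors d F"
    then show "z \<in> anchors d (F - {i})"
      using i by (auto simp: anchors_def flip_bit_less)
  qed
  moreover have "anchors d F \<inter> flip_bit i ` anchors d F = {}"
    using assms by (auto simp: anchors_def)
  moreover have "inj_on (flip_bit i) (anchors d F)"
    by (rule inj_on_inverseI[of _ "flip_bit i"]) simp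
  ultimately show ?thesis
    by (simp add: sum.union_disjoint sum.reindex sum.distrib)
qed

text \<open>On a block the restriction of \<open>\<psi>\<close> is again Gaussian, so
  \<open>wick_correlations\<close> supplies the matrix for \<open>defect_single_bits\<close>. That
  lemma asks only for the correlations of the weights \<open>(cmod (\<phi> x))\<^sup>2\<close>,
  which are those of \<open>\<psi>\<close>; here the phases drop out.\<close>

lemma block_defect_step:
  assumes "wick d \<psi>" and same: "\<And>x. x < 2 ^ d \<Longrightarrow> cmod (\<phi> x) = cmod (\<psi> x)" and F: "F \<subseteq> {..<d}"
  shows "(real (card F) - 2) * block_defect d \<phi> v F \<le> (\<Sum>i\<in>F. block_defect d \<phi> v (F - {i}))"
proof -
  have fin: "finite F" using F by (rule finite_subset) simp
  have "(real (card F) - 2) * defect (block d F z) \<phi> v \<le>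
      (\<Sum>i\<in>F. defect (block d (F - {i}) z) \<phi> v + defect (block d (F - {i}) (flip_bit i z)) \<phi> v)"
    if z: "z \<in> anchors d F" for z
  proof -
    define f where "f x = (if \<forall>i\<in>{..<d} - F. bit x i = bit z i then \<psi> x else 0)" for x
    have "wick d f" unfolding f_def by (rule wick_restrict[OF assms(1)]) auto
    obtain T where T: "\<And>i j. T i j = T j i" "\<And>i j. (0 :: real) \<le> T i j"
      "\<And>i j. i < d \<Longrightarrow> j < d \<Longrightarrow> i \<noteq> j \<Longrightarrow>
         \<bar>sqnorm d f * (\<Sum>x<2 ^ d. zsign x i * zsign x j * (cmod (f x))\<^sup>2) -
          (\<Sum>x<2 ^ d. zsign x i * (cmod (f x))\<^sup>2) * (\<Sum>x<2 ^ d. zsign x j * (cmod (f x))\<^sup>2)\<bar> \<le> T i j"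
      "\<And>i. i < d \<Longrightarrow> (\<Sum>j\<in>{..<d} - {i}. T i j) =
         (sqnorm d f)\<^sup>2 - (\<Sum>x<2 ^ d. zsign x i * (cmod (f x))\<^sup>2)\<^sup>2"
      by (rule wick_correlations[OF \<open>wick d f\<close>], rule that, assumption+)
    have sums: "(\<Sum>x<2 ^ d. g x * (cmod (f x))\<^sup>2) = (\<Sum>x\<in>block d F z. g x * (cmod (\<phi> x))\<^sup>2)" for g
      by (rule sum.mono_neutral_cong_right) (auto simp: f_def block_def same)
    from sums[of "\<lambda>_. 1"] have norm: "sqnorm d f = (\<Sum>x\<in>block d F z. (cmod (\<phi> x))\<^sup>2)"
      by (simp add: sqnorm_def)
    have "{x\<in>block d F z. zsign x i = 1} = block d (F - {i}) z"
      "{x\<in>block d F z. zsign x i = - 1} = block d (F - {i}) (flip_bit i z)" if "i \<in> F" for i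
      using that z F by (auto simp: block_def zsign_def anchors_def split: if_splits)
    then have "(\<Sum>i\<in>F. defect {x\<in>block d F z. zsign x i = 1} \<phi> v +
        defect {x\<in>block d F z. zsign x i = - 1} \<phi> v) =
      (\<Sum>i\<in>F. defect (block d (F - {i}) z) \<phi> v + defect (block d (F - {i}) (flip_bit i z)) \<phi> v)"
      by (intro sum.cong) auto
    moreover have "(real (card F) - 2) * defect (block d F z) \<phi> v \<le>
      (\<Sum>i\<in>F. defect {x\<in>block d F z. zsign x i = 1} \<phi> v +
        defect {x\<in>block d F z. zsign x i = - 1} \<phi> v)"
    proof (rule defect_single_bits[where T = T and s = "\<lambda>i x. zsign x i"])
      fix i j assume "i \<in> F" "j \<in> F" "i \<noteq> j"
      then show "\<bar>(\<Sum>x\<in>block d F z. (cmod (\<phi> x))\<^sup>2) *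
          (\<Sum>x\<in>block d F z. zsign x i * zsign x j * (cmod (\<phi> x))\<^sup>2) -
          (\<Sum>x\<in>block d F z. zsign x i * (cmod (\<phi> x))\<^sup>2) *
          (\<Sum>x\<in>block d F z. zsign x j * (cmod (\<phi> x))\<^sup>2)\<bar> \<le> T i j"
        using T(3)[of i j] F unfolding sums norm by auto
    next
      fix i assume i: "i \<in> F"
      have "(\<Sum>j\<in>F - {i}. T i j) \<le> (\<Sum>j\<in>{..<d} - {i}. T i j)"
        using F T(2) by (intro sum_mono2) auto
      also have "\<dots> = (\<Sum>x\<in>block d F z. (cmod (\<phi> x))\<^sup>2)\<^sup>2 -
          (\<Sum>x\<in>block d F z. zsign x i * (cmod (\<phi> x))\<^sup>2)\<^sup>2"
        using T(4)[of i] F i unfolding sums norm by auto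
      finally show "(\<Sum>j\<in>F - {i}. T i j) \<le> (\<Sum>x\<in>block d F z. (cmod (\<phi> x))\<^sup>2)\<^sup>2 -
          (\<Sum>x\<in>block d F z. zsign x i * (cmod (\<phi> x))\<^sup>2)\<^sup>2" .
    qed (auto simp: fin T(2) zsign_def intro: T(1))
    ultimately show ?thesis by simp
  qed
  then have "(real (card F) - 2) * block_defect d \<phi> v F \<le> (\<Sum>z\<in>anchors d F. \<Sum>i\<in>F.
      defect (block d (F - {i}) z) \<phi> v + defect (block d (F - {i}) (flip_bit i z)) \<phi> v)"
    unfolding block_defect_def sum_distrib_left by (rule sum_mono)
  also have "\<dots> = (\<Sum>i\<in>F. \<Sum>z\<in>anchors d F.
      defect (block d (F - {i}) z) \<phi> v + defect (block d (F - {i}) (flip_bit i z)) \<phi> v)"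
    by (rule sum.swap)
  also have "\<dots> = (\<Sum>i\<in>F. block_defect d \<phi> v (F - {i}))"
    unfolding block_defect_def using F by (intro sum.cong refl sum_anchors_remove) auto
  finally show ?thesis .
qed

text \<open>A pair in \<open>F\<close> survives the removal of each of the \<open>card F - 2\<close>
  elements outside it. This multiplicity cancels the factor in the hypothesis, and no constant
  accumulates.\<close>

lemma sum_pairs_descent:
  fixes E :: "'a set \<Rightarrow> real"
  assumes "finite F" "2 \<le> card F"
    and step: "\<And>F'. F' \<subseteq> F \<Longrightarrow> (real (card F') - 2) * E F' \<le> (\<Sum>i\<in>F'. E (F' - {i}))"
  shows "E F \<le> (\<Sum>K | K \<subseteq> F \<and> card K = 2. E K)"
  using assms
proof (induction "card F" arbitrary: F rule: less_induct)
  case less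
  show ?case
  proof (cases "card F = 2")
    case True
    then have "K = F" if "K \<subseteq> F" "card K = 2" for K
      using that card_subset_eq[OF less.prems(1) that(1)] by simp
    with True have "{K. K \<subseteq> F \<and> card K = 2} = {F}" by blast
    then show ?thesis by simp
  next
    case False
    define m where "m = card F"
    have m: "3 \<le> m" using False less.prems(2) by (simp add: m_def)
    have fin: "finite {K. K \<subseteq> F \<and> card K = 2}"
      by (rule finite_subset[of _ "Pow F"]) (use less.prems(1) in auto)
    have "(real m - 2) * E F \<le> (\<Sum>i\<in>F. E (F - {i}))"
      unfolding m_def by (rule less.prems(3)) simp
    also have "\<dots> \<le> (\<Sum>i\<in>F. \<Sum>K | K \<subseteq> F - {i} \<and> card K = 2. E K)"
    proof (rule sum_mono)
      fix i assume i: "i \<in> F"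
      have card: "card (F - {i}) = m - 1" using i less.prems(1) by (simp add: m_def)
      show "E (F - {i}) \<le> (\<Sum>K | K \<subseteq> F - {i} \<and> card K = 2. E K)"
      proof (rule less.hyps)
        show "card (F - {i}) < card F" "2 \<le> card (F - {i})" using m card by (simp_all add: m_def)
        show "finite (F - {i})" using less.prems(1) by simp
        show "(real (card F') - 2) * E F' \<le> (\<Sum>i\<in>F'. E (F' - {i}))" if "F' \<subseteq> F - {i}" for F'
          using that by (intro less.prems(3)) auto
      qed
    qed
    also have "\<dots> = (\<Sum>i\<in>F. \<Sum>K\<in>{K \<in> {K. K \<subseteq> F \<and> card K = 2}. i \<notin> K}. E K)"
      by (intro sum.cong refl) auto
    also have "\<dots> = (\<Sum>K | K \<subseteq> F \<and> card K = 2. \<Sum>i\<in>{i \<in> F. i \<notin> K}. E K)"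
      using less.prems(1) fin by (rule sum.swap_restrict)
    also have "\<dots> = (\<Sum>K | K \<subseteq> F \<and> card K = 2. (real m - 2) * E K)"
    proof (intro sum.cong refl)
      fix K assume "K \<in> {K. K \<subseteq> F \<and> card K = 2}"
      then have K: "K \<subseteq> F" "card K = 2" by auto
      have "{i \<in> F. i \<notin> K} = F - K" by auto
      then have "real (card {i \<in> F. i \<notin> K}) = real m - 2"
        using K m finite_subset[OF K(1) less.prems(1)] card_mono[OF less.prems(1) K(1)]
        by (simp add: card_Diff_subset m_def)
      then show "(\<Sum>i\<in>{i \<in> F. i \<notin> K}. E K) = (real m - 2) * E K" by simp
    qed
    also have "\<dots> = (real m - 2) * (\<Sum>K | K \<subseteq> F \<and> card K = 2. E K)"
      by (simp add: sum_distrib_left)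
    finally show ?thesis using m by simp
  qed
qed

theorem defect_le_sum_pairs:
  assumes "wick d \<psi>" "\<And>x. x < 2 ^ d \<Longrightarrow> cmod (\<phi> x) = cmod (\<psi> x)" "2 \<le> d"
  shows "defect {..<2 ^ d} \<phi> v \<le> (\<Sum>K | K \<subseteq> {..<d} \<and> card K = 2. block_defect d \<phi> v K)"
proof -
  have "x = 0" if "x \<in> anchors d {..<d}" for x
    using that by (intro eq_if_bits_eq[of x d 0]) (simp_all add: anchors_def)
  then have "anchors d {..<d} = {0}" by (auto simp: anchors_def)
  moreover have "block d {..<d} 0 = {..<2 ^ d}" by (auto simp: block_def)
  ultimately have "block_defect d \<phi> v {..<d} = defect {..<2 ^ d} \<phi> v"
    by (simp add: block_defect_def)
  moreover have "block_defect d \<phi> v {..<d} \<le>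
      (\<Sum>K | K \<subseteq> {..<d} \<and> card K = 2. block_defect d \<phi> v K)"
    using assms(3) by (intro sum_pairs_descent block_defect_step[OF assms(1,2)]) auto
  ultimately show ?thesis by simp
qed

section \<open>Acceptance on pure states\<close>

text \<open>
  A measurement of one qubit projects the amplitude function, so the
  acceptance probability is a quadratic form in the amplitudes.
\<close>

definition qproj :: "nat \<Rightarrow> complex vec \<Rightarrow> (nat \<Rightarrow> complex) \<Rightarrow> nat \<Rightarrow> complex" where
  "qproj q u f x = u $ bitn x q *
     (cnj (u $ bitn x q) * f x + cnj (u $ (1 - bitn x q)) * f (flip_bit q x))"

fun pure_accept :: "nat \<Rightarrow> protocol \<Rightarrow> (nat \<Rightarrow> complex) \<Rightarrow> real" where
  "pure_accept d Accept f = sqnorm d f"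
| "pure_accept d Reject f = 0"
| "pure_accept d (Pick Ps) f = (\<Sum>P\<leftarrow>Ps. pure_accept d P f) / length Ps"
| "pure_accept d (Measure q u v P Q) f = pure_accept d P (qproj q u f) + pure_accept d Q (qproj q v f)"

lemma index_on_qubit_outer:
  assumes "q < d" "u \<in> carrier_vec 2" "r < 2 ^ d" "s < 2 ^ d"
  shows "on_qubit d q (outer u u) $$ (r, s) =
    (if s = r \<or> s = flip_bit q r then u $ bitn r q * cnj (u $ bitn s q) else 0)"
proof -
  let ?g = "\<lambda>j. (if j = q then outer u u else 1\<^sub>m 2) $$ (bitn r j, bitn s j) :: complex"
  have entry: "on_qubit d q (outer u u) $$ (r, s) = (\<Prod>j<d. ?g j)"
    using assms by (simp add: on_qubit_def tensor_def)
  have g: "?g j = (if j = q then u $ bitn r q * cnj (u $ bitn s q)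
      else if bit r j = bit s j then 1 else 0)" for j
    using assms(2) by (auto simp: outer_def bitn_def)
  show ?thesis
  proof (cases "s = r \<or> s = flip_bit q r")
    case True
    then have "?g j = (if j = q then u $ bitn r q * cnj (u $ bitn s q) else 1)" for j
      unfolding g by auto
    then have "(\<Prod>j<d. ?g j) = u $ bitn r q * cnj (u $ bitn s q)"
      using assms(1) by simp
    then show ?thesis using True unfolding entry by simp
  next
    case False
    have "\<exists>j<d. j \<noteq> q \<and> bit r j \<noteq> bit s j"
    proof (rule ccontr)
      assume *: "\<not> (\<exists>j<d. j \<noteq> q \<and> bit r j \<noteq> bit s j)"
      show False
      proof (cases "bit r q = bit s q")
        case True
        with * have "s = r" using assms by (intro eq_if_bits_eq[of _ d]) metis+
        with False show ?thesis by simp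
      next
        case neq: False
        have "s = flip_bit q r"
        proof (rule eq_if_bits_eq[of _ d])
          show "bit s i = bit (flip_bit q r) i" if "i < d" for i
            using * neq that by (cases "i = q") auto
        qed (use assms in \<open>simp_all add: flip_bit_less\<close>)
        with False show ?thesis by simp
      qed
    qed
    then obtain j where j: "j < d" "j \<noteq> q" "bit r j \<noteq> bit s j" by blast
    then have "?g j = 0" unfolding g by simp
    with j(1) have "(\<Prod>j<d. ?g j) = 0" by (intro prod_zero bexI[of _ j]) auto
    then show ?thesis unfolding entry using False by auto
  qed
qed

lemma bitn_flip_bit: "bitn (flip_bit q x) q = 1 - bitn x q"
  by (simp add: bitn_def)

lemma flip_bit_neq [simp]: "flip_bit q x \<noteq> x" "x \<noteq> flip_bit q x" for x :: nat
  by (metis bit_flip_bit_nat)+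

lemma on_qubit_outer_mult_vec:
  assumes "q < d" "u \<in> carrier_vec 2" "v \<in> carrier_vec (2 ^ d)" "x < 2 ^ d"
  shows "(on_qubit d q (outer u u) *\<^sub>v v) $ x = qproj q u (($) v) x"
proof -
  have "(on_qubit d q (outer u u) *\<^sub>v v) $ x = (\<Sum>k<2 ^ d. on_qubit d q (outer u u) $$ (x, k) * v $ k)"
    using assms by (intro mult_mat_vec_index) auto
  also have "\<dots> = (\<Sum>k<2 ^ d. (if k = x then u $ bitn x q * cnj (u $ bitn x q) * v $ x else 0) +
      (if k = flip_bit q x then u $ bitn x q * cnj (u $ (1 - bitn x q)) * v $ flip_bit q x else 0))"
    using assms by (intro sum.cong refl) (auto simp: index_on_qubit_outer bitn_flip_bit)
  also have "\<dots> = qproj q u (($) v) x"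
    unfolding sum.distrib using assms by (simp add: qproj_def flip_bit_less algebra_simps)
  finally show ?thesis .
qed

lemma on_qubit_outer_hermitian:
  assumes "q < d" "u \<in> carrier_vec 2" "r < 2 ^ d" "s < 2 ^ d"
  shows "cnj (on_qubit d q (outer u u) $$ (r, s)) = on_qubit d q (outer u u) $$ (s, r)"
  using assms by (auto simp: index_on_qubit_outer)

lemma sandwich_outer:
  assumes E: "E \<in> carrier_mat n n" and v: "v \<in> carrier_vec n"
    and herm: "\<And>r s. r < n \<Longrightarrow> s < n \<Longrightarrow> cnj (E $$ (r, s)) = E $$ (s, r)"
  shows "E * outer v v * E = outer (E *\<^sub>v v) (E *\<^sub>v v)"
proof (rule eq_matI)
  fix i j assume "i < dim_row (outer (E *\<^sub>v v) (E *\<^sub>v v))" "j < dim_col (outer (E *\<^sub>v v) (E *\<^sub>v v))"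
  then have ij: "i < n" "j < n" using E by (auto simp: outer_def)
  have outer: "outer v v \<in> carrier_mat n n" using v by (auto simp: outer_def)
  have "(E * outer v v) $$ (i, k) = (E *\<^sub>v v) $ i * cnj (v $ k)" if "k < n" for k
    using that ij E v outer
    by (simp add: scalar_prod_def outer_def sum_distrib_right mult.assoc)
  then have "(E * outer v v * E) $$ (i, j) = (\<Sum>k<n. (E *\<^sub>v v) $ i * cnj (v $ k) * E $$ (k, j))"
    using ij E outer
    by (subst index_mult_mat(1)) (auto simp: scalar_prod_def lessThan_atLeast0 intro!: sum.cong)
  also have "\<dots> = (E *\<^sub>v v) $ i * cnj (\<Sum>k<n. E $$ (j, k) * v $ k)"
    unfolding sum_distrib_left cnj_sum using ij herm by (intro sum.cong) (auto simp: mult_ac)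
  also have "\<dots> = outer (E *\<^sub>v v) (E *\<^sub>v v) $$ (i, j)"
    using ij E v mult_mat_vec_index[OF E v ij(2)] by (simp add: outer_def)
  finally show "(E * outer v v * E) $$ (i, j) = outer (E *\<^sub>v v) (E *\<^sub>v v) $$ (i, j)" .
qed (use E v in \<open>auto simp: outer_def\<close>)

lemma qproj_cong:
  assumes "\<And>x. x < 2 ^ d \<Longrightarrow> f x = g x" "q < d" "x < 2 ^ d"
  shows "qproj q u f x = qproj q u g x"
  using assms by (simp add: qproj_def flip_bit_less)

lemma sqnorm_cong: "(\<And>x. x < 2 ^ d \<Longrightarrow> f x = g x) \<Longrightarrow> sqnorm d f = sqnorm d g"
  unfolding sqnorm_def by (intro sum.cong) auto

lemma pure_accept_cong:
  assumes "single_qubit_protocol S P" "S \<subseteq> {..<d}" "\<And>x. x < 2 ^ d \<Longrightarrow> f x = g x"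
  shows "pure_accept d P f = pure_accept d P g"
  using assms
proof (induction P arbitrary: S f g)
  case Accept
  then show ?case by (simp cong: sqnorm_cong)
next
  case (Pick Ps)
  then have "map (\<lambda>P. pure_accept d P f) Ps = map (\<lambda>P. pure_accept d P g) Ps"
    by (intro map_cong refl) (metis single_qubit_protocol.simps(3))
  then show ?case by (simp only: pure_accept.simps)
next
  case (Measure q u v P Q)
  have sub: "S - {q} \<subseteq> {..<d}" "q < d" using Measure.prems by auto
  have "pure_accept d P (qproj q u f) = pure_accept d P (qproj q u g)"
    using Measure.prems(1) sub(1) qproj_cong[OF Measure.prems(3) sub(2)]
    by (intro Measure.IH(1)) simp_all
  moreover have "pure_accept d Q (qproj q v f) = pure_accept d Q (qproj q v g)"
    using Measure.prems(1) sub(1) qproj_cong[OF Measure.prems(3) sub(2)]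
    by (intro Measure.IH(2)) simp_all
  ultimately show ?case by simp
qed simp

lemma accept_prob_outer:
  assumes "single_qubit_protocol S P" "S \<subseteq> {..<d}" "v \<in> carrier_vec (2 ^ d)"
  shows "accept_prob d P (outer v v) = pure_accept d P (($) v)"
  using assms
proof (induction P arbitrary: S v)
  case Accept
  have "mtrace (outer v v) = (\<Sum>i<2 ^ d. of_real ((cmod (v $ i))\<^sup>2))"
    unfolding complex_norm_square using Accept.prems by (simp add: mtrace_def outer_def)
  then show ?case by (simp add: sqnorm_def)
next
  case (Pick Ps)
  then have "map (\<lambda>P. accept_prob d P (outer v v)) Ps = map (\<lambda>P. pure_accept d P (($) v)) Ps"
    by (intro map_cong refl) (metis single_qubit_protocol.simps(3))
  then show ?case by (simp only: pure_accept.simps accept_prob.simps)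
next
  case (Measure q u w P Q)
  have sub: "S - {q} \<subseteq> {..<d}" "q < d" using Measure.prems by auto
  have basis: "u \<in> carrier_vec 2" "w \<in> carrier_vec 2"
    using Measure.prems(1) by (auto simp: qubit_basis_def)
  have step: "accept_prob d R (on_qubit d q (outer e e) * outer v v * on_qubit d q (outer e e)) =
      pure_accept d R (qproj q e (($) v))"
    if e: "e \<in> carrier_vec 2" and R: "single_qubit_protocol (S - {q}) R"
      and IH: "\<And>S v. single_qubit_protocol S R \<Longrightarrow> S \<subseteq> {..<d} \<Longrightarrow> v \<in> carrier_vec (2 ^ d) \<Longrightarrow>
        accept_prob d R (outer v v) = pure_accept d R (($) v)" for e R
  proof -
    let ?E = "on_qubit d q (outer e e)"
    have "?E * outer v v * ?E = outer (?E *\<^sub>v v) (?E *\<^sub>v v)"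
      using Measure.prems(3) sub(2) e
      by (intro sandwich_outer[of _ "2 ^ d"] on_qubit_outer_hermitian) auto
    moreover have "?E *\<^sub>v v \<in> carrier_vec (2 ^ d)"
      using Measure.prems(3) by (intro mult_mat_vec_carrier[of _ _ "2 ^ d"]) auto
    ultimately have "accept_prob d R (?E * outer v v * ?E) = pure_accept d R (($) (?E *\<^sub>v v))"
      using IH[OF R sub(1)] by simp
    also have "\<dots> = pure_accept d R (qproj q e (($) v))"
      using on_qubit_outer_mult_vec[OF sub(2) e Measure.prems(3)]
      by (intro pure_accept_cong[OF R sub(1)]) simp
    finally show ?thesis .
  qed
  show ?case
    using step[OF basis(1) _ Measure.IH(1)] step[OF basis(2) _ Measure.IH(2)] Measure.prems(1)
    by (simp add: Let_def)
qed simp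

lemma sum_lessThan_2: "(\<Sum>i<2. g i) = g 0 + g (1 :: nat)"
  by (simp add: numeral_2_eq_2)

lemma scalar_prod_2:
  assumes "u \<in> carrier_vec 2" "v \<in> carrier_vec 2"
  shows "u \<bullet>c v = u $ 0 * cnj (v $ 0) + u $ 1 * cnj (v $ 1)"
  using assms by (simp add: scalar_prod_def numeral_2_eq_2)

lemma qubit_bessel:
  assumes "qubit_basis u v"
  shows "(cmod (cnj (u $ 0) * a + cnj (u $ 1) * b))\<^sup>2 + (cmod (cnj (v $ 0) * a + cnj (v $ 1) * b))\<^sup>2
    \<le> (cmod a)\<^sup>2 + (cmod b)\<^sup>2"
proof -
  define p where "p = cnj (u $ 0) * a + cnj (u $ 1) * b"
  define q where "q = cnj (v $ 0) * a + cnj (v $ 1) * b"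
  \<comment> \<open>\<open>X, Y\<close> are the entries of what remains of \<open>(a, b)\<close>
    after subtracting its components along \<open>u\<close> and \<open>v\<close>. Its squared norm
    is nonnegative, which is Bessel's inequality.\<close>
  define X where "X = a - p * u $ 0 - q * v $ 0"
  define Y where "Y = b - p * u $ 1 - q * v $ 1"
  have uu: "u $ 0 * cnj (u $ 0) + u $ 1 * cnj (u $ 1) = 1"
    and vv: "v $ 0 * cnj (v $ 0) + v $ 1 * cnj (v $ 1) = 1"
    and uv: "u $ 0 * cnj (v $ 0) + u $ 1 * cnj (v $ 1) = 0"
    using assms by (auto simp: qubit_basis_def scalar_prod_2)
  have vu: "v $ 0 * cnj (u $ 0) + v $ 1 * cnj (u $ 1) = 0"
    using arg_cong[OF uv, of cnj] by (simp add: mult.commute)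
  have p': "cnj p = u $ 0 * cnj a + u $ 1 * cnj b" and q': "cnj q = v $ 0 * cnj a + v $ 1 * cnj b"
    by (simp_all add: p_def q_def)
  have "X * cnj X + Y * cnj Y = a * cnj a + b * cnj b
      - p * (u $ 0 * cnj a + u $ 1 * cnj b) - q * (v $ 0 * cnj a + v $ 1 * cnj b)
      - cnj p * (cnj (u $ 0) * a + cnj (u $ 1) * b) - cnj q * (cnj (v $ 0) * a + cnj (v $ 1) * b)
      + p * cnj p * (u $ 0 * cnj (u $ 0) + u $ 1 * cnj (u $ 1))
      + q * cnj q * (v $ 0 * cnj (v $ 0) + v $ 1 * cnj (v $ 1))
      + p * cnj q * (u $ 0 * cnj (v $ 0) + u $ 1 * cnj (v $ 1))
      + q * cnj p * (v $ 0 * cnj (u $ 0) + v $ 1 * cnj (u $ 1))"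
    unfolding X_def Y_def by (simp add: algebra_simps)
  also have "\<dots> = a * cnj a + b * cnj b - p * cnj p - q * cnj q"
    unfolding uu vv uv vu p'[symmetric] q'[symmetric] p_def[symmetric] q_def[symmetric]
    by (simp add: mult.commute)
  finally have "complex_of_real ((cmod X)\<^sup>2 + (cmod Y)\<^sup>2) =
      of_real ((cmod a)\<^sup>2 + (cmod b)\<^sup>2 - (cmod p)\<^sup>2 - (cmod q)\<^sup>2)"
    unfolding of_real_add of_real_diff complex_norm_square .
  then have "(cmod X)\<^sup>2 + (cmod Y)\<^sup>2 = (cmod a)\<^sup>2 + (cmod b)\<^sup>2 - (cmod p)\<^sup>2 - (cmod q)\<^sup>2"
    by (simp only: of_real_eq_iff)
  moreover have "0 \<le> (cmod X)\<^sup>2 + (cmod Y)\<^sup>2" by simp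
  ultimately show ?thesis unfolding p_def q_def by linarith
qed

text \<open>Summing over all strings together with their flips counts each pair twice. The factor 2
  replaces a choice of representatives of the pairs.\<close>

lemma double_sqnorm:
  assumes "q < d"
  shows "2 * sqnorm d f = (\<Sum>x<2 ^ d. (cmod (f x))\<^sup>2 + (cmod (f (flip_bit q x)))\<^sup>2)"
  using sum_flip_bit[OF assms, of "\<lambda>x. (cmod (f x))\<^sup>2"] by (simp add: sum.distrib sqnorm_def)

lemma sqnorm_qproj_pair:
  assumes "u \<in> carrier_vec 2" "u \<bullet>c u = 1"
  shows "(cmod (qproj q u f x))\<^sup>2 + (cmod (qproj q u f (flip_bit q x)))\<^sup>2 =
    (cmod (cnj (u $ bitn x q) * f x + cnj (u $ (1 - bitn x q)) * f (flip_bit q x)))\<^sup>2"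
proof -
  have "complex_of_real ((cmod (u $ 0))\<^sup>2 + (cmod (u $ 1))\<^sup>2) = 1"
    using assms unfolding of_real_add complex_norm_square by (simp add: scalar_prod_2)
  then have unit: "(cmod (u $ 0))\<^sup>2 + (cmod (u $ 1))\<^sup>2 = 1"
    by (metis of_real_eq_1_iff)
  let ?c = "cnj (u $ bitn x q) * f x + cnj (u $ (1 - bitn x q)) * f (flip_bit q x)"
  have "qproj q u f (flip_bit q x) = u $ (1 - bitn x q) * ?c"
    by (auto simp: qproj_def bitn_def)
  then have "(cmod (qproj q u f x))\<^sup>2 + (cmod (qproj q u f (flip_bit q x)))\<^sup>2 =
      ((cmod (u $ bitn x q))\<^sup>2 + (cmod (u $ (1 - bitn x q)))\<^sup>2) * (cmod ?c)\<^sup>2"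
    by (simp add: qproj_def norm_mult power_mult_distrib distrib_right)
  also have "(cmod (u $ bitn x q))\<^sup>2 + (cmod (u $ (1 - bitn x q)))\<^sup>2 = 1"
    using unit by (auto simp: bitn_def)
  finally show ?thesis by simp
qed

lemma sqnorm_qproj_le:
  assumes "qubit_basis u v" "q < d"
  shows "sqnorm d (qproj q u f) + sqnorm d (qproj q v f) \<le> sqnorm d f"
proof -
  have basis: "u \<in> carrier_vec 2" "u \<bullet>c u = 1" "v \<in> carrier_vec 2" "v \<bullet>c v = 1"
    using assms(1) by (auto simp: qubit_basis_def)
  have "2 * (sqnorm d (qproj q u f) + sqnorm d (qproj q v f)) = (\<Sum>x<2 ^ d.
      (cmod (cnj (u $ bitn x q) * f x + cnj (u $ (1 - bitn x q)) * f (flip_bit q x)))\<^sup>2 +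
      (cmod (cnj (v $ bitn x q) * f x + cnj (v $ (1 - bitn x q)) * f (flip_bit q x)))\<^sup>2)"
    unfolding distrib_left double_sqnorm[OF assms(2)] sqnorm_qproj_pair[OF basis(1,2)]
      sqnorm_qproj_pair[OF basis(3,4)] by (rule sum.distrib[symmetric])
  also have "\<dots> \<le> (\<Sum>x<2 ^ d. (cmod (f x))\<^sup>2 + (cmod (f (flip_bit q x)))\<^sup>2)"
  proof (rule sum_mono)
    fix x :: nat
    show "(cmod (cnj (u $ bitn x q) * f x + cnj (u $ (1 - bitn x q)) * f (flip_bit q x)))\<^sup>2 +
      (cmod (cnj (v $ bitn x q) * f x + cnj (v $ (1 - bitn x q)) * f (flip_bit q x)))\<^sup>2
      \<le> (cmod (f x))\<^sup>2 + (cmod (f (flip_bit q x)))\<^sup>2"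
      using qubit_bessel[OF assms(1), of "f x" "f (flip_bit q x)"]
        qubit_bessel[OF assms(1), of "f (flip_bit q x)" "f x"]
      by (cases "bit x q") (simp_all add: bitn_def add.commute)
  qed
  finally show ?thesis unfolding double_sqnorm[OF assms(2), symmetric] by simp
qed

lemma pure_accept_bounds:
  assumes "single_qubit_protocol S P" "S \<subseteq> {..<d}"
  shows "0 \<le> pure_accept d P f \<and> pure_accept d P f \<le> sqnorm d f"
  using assms
proof (induction P arbitrary: S f)
  case (Pick Ps)
  then have each: "0 \<le> pure_accept d P f" "pure_accept d P f \<le> sqnorm d f" if "P \<in> set Ps" for P
    using that by auto
  have ne: "length Ps > 0" using Pick.prems by simp
  have "0 \<le> (\<Sum>P\<leftarrow>Ps. pure_accept d P f)" using each(1) by (intro sum_list_nonneg) auto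
  moreover have "(\<Sum>P\<leftarrow>Ps. pure_accept d P f) \<le> (\<Sum>P\<leftarrow>Ps. sqnorm d f)"
    using each(2) by (intro sum_list_mono)
  ultimately show ?case using ne by (simp add: sum_list_triv field_simps)
next
  case (Measure q u v P Q)
  have sub: "S - {q} \<subseteq> {..<d}" "q < d" using Measure.prems by auto
  have sp: "single_qubit_protocol (S - {q}) P" "single_qubit_protocol (S - {q}) Q" "qubit_basis u v"
    using Measure.prems(1) by simp_all
  show ?case
    using Measure.IH(1)[OF sp(1) sub(1), of "qproj q u f"]
      Measure.IH(2)[OF sp(2) sub(1), of "qproj q v f"]
      sqnorm_qproj_le[OF sp(3) sub(2), of f] by simp
qed (simp_all add: sqnorm_nonneg)

section \<open>Measurements in the computational basis\<close>

lemma qproj_ket: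
  "qproj q ket0 f = (\<lambda>x. if bit x q then 0 else f x)"
  "qproj q ket1 f = (\<lambda>x. if bit x q then f x else 0)"
  by (auto simp: qproj_def ket0_def ket1_def bitn_def)

lemma block_insert:
  assumes "q \<notin> F" "q < d" "z < 2 ^ d"
  shows "block d (insert q F) z = block d F z \<union> block d F (flip_bit q z)"
    and "block d F z \<inter> block d F (flip_bit q z) = {}"
  using assms by (auto simp: block_def)

text \<open>Projections in the computational basis restrict the amplitude function, and successive
  restrictions intersect. The tree of outcomes becomes a sum over final strings. As \<open>z\<close>
  starts with zeros on the measured qubits, recording outcome 1 is the same as flipping the
  bit.\<close>

lemma pure_accept_measure_comp:
  assumes "distinct qs" "set qs \<subseteq> {..<d}" "z < 2 ^ d" "\<forall>q\<in>set qs. \<not> bit z q"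
    and K: "\<And>y. pure_accept d (K y) (\<lambda>x. 0) = 0"
  shows "pure_accept d (measure_comp qs z K) f =
    (\<Sum>y\<in>block d (set qs) z. pure_accept d (K y) (\<lambda>x. if \<forall>q\<in>set qs. bit x q = bit y q then f x else 0))"
  using assms(1-4)
proof (induction qs arbitrary: z f)
  case Nil
  have "block d (set []) z = {z}"
  proof -
    have "x = z" if "x \<in> block d {} z" for x
      using that Nil.prems(3) by (intro eq_if_bits_eq[of x d z]) (simp_all add: block_def)
    then show ?thesis using Nil.prems(3) by (auto simp: block_def)
  qed
  then show ?case by simp
next
  case (Cons q qs)
  have q: "q < d" "q \<notin> set qs" "\<not> bit z q" "\<forall>p\<in>set qs. \<not> bit z p" "distinct qs" "set qs \<subseteq> {..<d}"
    using Cons.prems by auto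
  have set_flip: "set_bit q z = flip_bit q z" using q(3) by (auto intro!: bit_eqI simp: bit_set_bit_iff)
  have nested_if: "(if C then if b then 0 else e else 0) = (if \<not> b \<and> C then e else 0)"
    for C b and e :: complex by simp
  have bits: "bit y q = bit z q" if "y \<in> block d (set qs) z" for y z
    using that q by (auto simp: block_def)
  have "pure_accept d (measure_comp (q # qs) z K) f =
      (\<Sum>y\<in>block d (set qs) z. pure_accept d (K y)
        (\<lambda>x. if \<forall>p\<in>set qs. bit x p = bit y p then (if bit x q then 0 else f x) else 0)) +
      (\<Sum>y\<in>block d (set qs) (flip_bit q z). pure_accept d (K y)
        (\<lambda>x. if \<forall>p\<in>set qs. bit x p = bit y p then (if bit x q then f x else 0) else 0))"
  proof -
    have flip: "flip_bit q z < 2 ^ d" "\<forall>p\<in>set qs. \<not> bit (flip_bit q z) p"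
      using q Cons.prems(3) by (auto simp: flip_bit_less)
    show ?thesis
      using Cons.IH[OF q(5,6) Cons.prems(3) q(4), of "\<lambda>x. if bit x q then 0 else f x"]
        Cons.IH[OF q(5,6) flip, of "\<lambda>x. if bit x q then f x else 0"]
      by (simp only: measure_comp.simps pure_accept.simps qproj_ket set_flip)
  qed
  also have "\<dots> = (\<Sum>y\<in>block d (set qs) z. pure_accept d (K y)
        (\<lambda>x. if \<forall>p\<in>set (q # qs). bit x p = bit y p then f x else 0)) +
      (\<Sum>y\<in>block d (set qs) (flip_bit q z). pure_accept d (K y)
        (\<lambda>x. if \<forall>p\<in>set (q # qs). bit x p = bit y p then f x else 0))"
  proof (intro arg_cong2[of _ _ _ _ "(+)"] sum.cong refl arg_cong[of _ _ "pure_accept d (K _)"] ext)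
    fix y x :: nat
    assume "y \<in> block d (set qs) z"
    then have "\<not> bit y q" using bits q(3) by blast
    then have cond: "(\<forall>p\<in>set (q # qs). bit x p = bit y p) \<longleftrightarrow>
        \<not> bit x q \<and> (\<forall>p\<in>set qs. bit x p = bit y p)"
      by (simp only: list.set ball_simps) blast
    show "(if \<forall>p\<in>set qs. bit x p = bit y p then if bit x q then 0 else f x else 0) =
        (if \<forall>p\<in>set (q # qs). bit x p = bit y p then f x else 0)"
      unfolding cond by (rule nested_if)
  next
    fix y x :: nat
    assume "y \<in> block d (set qs) (flip_bit q z)"
    then have "bit y q" using bits q(3) bit_flip_bit_nat by blast
    then have cond: "(\<forall>p\<in>set (q # qs). bit x p = bit y p) \<longleftrightarrow>
        \<not> \<not> bit x q \<and> (\<forall>p\<in>set qs. bit x p = bit y p)"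
      by (simp only: list.set ball_simps) blast
    have swap: "(if bit x q then f x else 0) = (if \<not> bit x q then 0 else f x)" by simp
    show "(if \<forall>p\<in>set qs. bit x p = bit y p then if bit x q then f x else 0 else 0) =
        (if \<forall>p\<in>set (q # qs). bit x p = bit y p then f x else 0)"
      unfolding cond swap by (rule nested_if)
  qed
  also have "\<dots> = (\<Sum>y\<in>block d (set (q # qs)) z. pure_accept d (K y)
        (\<lambda>x. if \<forall>p\<in>set (q # qs). bit x p = bit y p then f x else 0))"
    unfolding list.set(2) block_insert(1)[OF q(2,1) Cons.prems(3)]
    by (rule sum.union_disjoint[symmetric])
      (simp_all only: finite_block block_insert(2)[OF q(2,1) Cons.prems(3)])
  finally show ?case .
qed

lemma single_qubit_measure_comp:
  assumes "distinct qs" "set qs \<subseteq> S" "\<And>z. single_qubit_protocol (S - set qs) (K z)"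
  shows "single_qubit_protocol S (measure_comp qs z K)"
  using assms
proof (induction qs arbitrary: z S)
  case (Cons q qs)
  have "qubit_basis ket0 ket1"
    by (simp add: qubit_basis_def ket0_def ket1_def scalar_prod_def numeral_2_eq_2)
  moreover have "S - {q} - set qs = S - set (q # qs)" by auto
  ultimately have "single_qubit_protocol (S - {q}) (measure_comp qs z' K)" for z'
    using Cons.prems by (intro Cons.IH) auto
  with \<open>qubit_basis ket0 ket1\<close> show ?case using Cons.prems(2) by simp
qed (use assms in simp)

lemma flip_bit_eq_add: "\<not> bit z k \<Longrightarrow> flip_bit k z = z + 2 ^ k" for z :: nat
  by (simp add: flip_bit_eq_if set_bit_eq)

lemma block_empty: "z < 2 ^ d \<Longrightarrow> block d {} z = {z}"
proof -
  assume z: "z < 2 ^ d"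
  have "x = z" if "x \<in> block d {} z" for x
    using that z by (intro eq_if_bits_eq[of x d z]) (simp_all add: block_def)
  then show ?thesis using z by (auto simp: block_def)
qed

lemma sum_block_insert:
  assumes "q \<notin> F" "q < d" "z < 2 ^ d"
  shows "(\<Sum>x\<in>block d (insert q F) z. h x) = (\<Sum>x\<in>block d F z. h x) + (\<Sum>x\<in>block d F (flip_bit q z). h x)"
  unfolding block_insert(1)[OF assms]
  by (rule sum.union_disjoint) (simp_all only: finite_block block_insert(2)[OF assms])

lemma sum_block_pair:
  assumes "k1 < k2" "k2 < d" "z < 2 ^ d"
  shows "(\<Sum>x\<in>block d {k1, k2} z. h x) =
    h z + h (flip_bit k1 z) + h (flip_bit k2 z) + h (flip_bit k2 (flip_bit k1 z))"
  using assms
  by (simp add: sum_block_insert block_empty flip_bit_less add_ac)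

lemma outcome_parity_flip_bit:
  assumes "j < d"
  shows "outcome_parity d (flip_bit j x) = - outcome_parity d x"
proof -
  have "outcome_parity d (flip_bit j x) = (if bit (flip_bit j x) j then - 1 else 1) *
      (\<Prod>i\<in>{..<d} - {j}. if bit x i then - 1 else 1)"
    using assms unfolding outcome_parity_def by (simp add: prod.remove[of "{..<d}" j])
  also have "\<dots> = - outcome_parity d x"
    using assms unfolding outcome_parity_def by (simp add: prod.remove[of "{..<d}" j])
  finally show ?thesis .
qed

lemma outcome_parity_cases: "outcome_parity d x = 1 \<or> outcome_parity d x = - 1"
  by (induction d) (auto simp: outcome_parity_def)

definition parity_part :: "nat \<Rightarrow> int \<Rightarrow> (nat \<Rightarrow> complex) \<Rightarrow> nat \<Rightarrow> complex" where
  "parity_part d \<sigma> f x = (if outcome_parity d x = \<sigma> then f x else 0)"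

section \<open>The correlation test at one pair of qubits\<close>

lemma x_ket_index:
  "x_ket m $ 0 = of_real (1 / sqrt 2)"
  "x_ket m $ Suc 0 = of_real ((if m then - 1 else 1) / sqrt 2)"
  by (simp_all add: x_ket_def ket_plus_def ket_minus_def ket0_def ket1_def)

lemma x_ket_carrier [simp]: "x_ket m \<in> carrier_vec 2"
  by (simp add: x_ket_def ket_plus_def ket_minus_def ket0_def ket1_def)

lemma x_ket_unit: "x_ket m \<bullet>c x_ket m = 1"
proof -
  have "complex_of_real (1 / sqrt 2) * of_real (1 / sqrt 2) = 1 / 2"
    unfolding of_real_mult[symmetric] by (simp add: real_sqrt_mult_self flip: of_real_mult)
  then show ?thesis by (simp add: scalar_prod_2 x_ket_index)
qed

lemma qubit_basis_x_ket: "qubit_basis ket_plus ket_minus"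
  using x_ket_unit[of False] x_ket_unit[of True] x_ket_carrier[of False] x_ket_carrier[of True]
  unfolding qubit_basis_def
  by (simp add: scalar_prod_2 x_ket_def) (simp add: ket_plus_def ket_minus_def ket0_def ket1_def)

lemma cond_vec_index:
  assumes "\<not> bit z k1" "\<not> bit z k2" "k1 \<noteq> k2"
  shows "cond_vec \<phi> k1 k2 z m $ 0 =
      cnj (x_ket m $ 0) * \<phi> $ z + cnj (x_ket m $ 1) * \<phi> $ flip_bit k1 z"
    and "cond_vec \<phi> k1 k2 z m $ 1 =
      cnj (x_ket m $ 0) * \<phi> $ flip_bit k2 z + cnj (x_ket m $ 1) * \<phi> $ flip_bit k2 (flip_bit k1 z)"
proof -
  have "flip_bit k2 (flip_bit k1 z) = z + 2 ^ k1 + 2 ^ k2"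
  proof -
    have "\<not> bit (flip_bit k1 z) k2" using assms by simp
    then have "flip_bit k2 (flip_bit k1 z) = flip_bit k1 z + 2 ^ k2" by (rule flip_bit_eq_add)
    then show ?thesis by (simp only: flip_bit_eq_add[OF assms(1)])
  qed
  then show "cond_vec \<phi> k1 k2 z m $ 0 =
      cnj (x_ket m $ 0) * \<phi> $ z + cnj (x_ket m $ 1) * \<phi> $ flip_bit k1 z"
    "cond_vec \<phi> k1 k2 z m $ 1 =
      cnj (x_ket m $ 0) * \<phi> $ flip_bit k2 z + cnj (x_ket m $ 1) * \<phi> $ flip_bit k2 (flip_bit k1 z)"
    using assms by (simp_all add: cond_vec_def sum_lessThan_2 flip_bit_eq_add[of z])
qed

lemma outcome_prob_eq:
  "outcome_prob \<phi> k1 k2 z m =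
    (cmod (cond_vec \<phi> k1 k2 z m $ 0))\<^sup>2 + (cmod (cond_vec \<phi> k1 k2 z m $ 1))\<^sup>2"
proof -
  have "cond_vec \<phi> k1 k2 z m \<in> carrier_vec 2" by (simp add: cond_vec_def)
  then have "cond_vec \<phi> k1 k2 z m \<bullet>c cond_vec \<phi> k1 k2 z m =
      of_real ((cmod (cond_vec \<phi> k1 k2 z m $ 0))\<^sup>2 + (cmod (cond_vec \<phi> k1 k2 z m $ 1))\<^sup>2)"
    unfolding of_real_add complex_norm_square by (simp add: scalar_prod_2)
  then show ?thesis by (simp add: outcome_prob_def)
qed

lemma cond_state_basis:
  assumes "outcome_prob \<phi> k1 k2 z m \<noteq> 0"
  defines "u \<equiv> cond_state \<phi> k1 k2 z m"
  shows "qubit_basis u (orth_state u)"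
proof -
  let ?c = "cond_vec \<phi> k1 k2 z m" and ?p = "outcome_prob \<phi> k1 k2 z m"
  have p: "?p > 0" using assms(1) unfolding outcome_prob_eq by (simp add: sum_power2_gt_zero_iff)
  have c: "?c \<in> carrier_vec 2" by (simp add: cond_vec_def)
  have u: "u \<in> carrier_vec 2" "u $ 0 = ?c $ 0 / of_real (sqrt ?p)" "u $ 1 = ?c $ 1 / of_real (sqrt ?p)"
    using c by (simp_all add: u_def cond_state_def)
  have "u $ 0 * cnj (u $ 0) + u $ 1 * cnj (u $ 1) =
      of_real (((cmod (?c $ 0))\<^sup>2 + (cmod (?c $ 1))\<^sup>2) / ?p)"
  proof -
    have "complex_of_real (sqrt ?p) * of_real (sqrt ?p) = of_real ?p"
      unfolding of_real_mult[symmetric] using p by simp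
    then show ?thesis
      unfolding u of_real_divide of_real_add complex_norm_square by (simp add: add_divide_distrib)
  qed
  also have "\<dots> = 1" unfolding outcome_prob_eq[symmetric] using p by simp
  finally have unit: "u $ 0 * cnj (u $ 0) + u $ 1 * cnj (u $ 1) = 1" .
  have v: "orth_state u \<in> carrier_vec 2" "orth_state u $ 0 = - cnj (u $ 1)"
    "orth_state u $ 1 = cnj (u $ 0)"
    by (simp_all add: orth_state_def)
  show ?thesis
    unfolding qubit_basis_def using u(1) v unit by (simp add: scalar_prod_2 v mult.commute add.commute)
qed

text \<open>Projecting qubit \<open>k1\<close> and then qubit \<open>k2\<close> onto pure states
  leaves one overlap with a product vector, here up to normalisation the conditional state and the
  X-ket. In terms of the unnormalised \<open>cond_vec\<close> the formula also covers outcomes of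
  probability zero: the test rejects and the quotient is zero.\<close>

lemma accept_final_step:
  fixes g :: "nat \<Rightarrow> complex" and m :: bool
  assumes k: "k1 < k2" "k2 < d" and z: "z \<in> anchors d {k1, k2}"
    and supp: "\<And>x. x < 2 ^ d \<Longrightarrow> x \<notin> block d {k1, k2} z \<Longrightarrow> g x = 0"
  defines "w0 \<equiv> cnj (x_ket m $ 0) * g z + cnj (x_ket m $ 1) * g (flip_bit k1 z)"
    and "w1 \<equiv> cnj (x_ket m $ 0) * g (flip_bit k2 z) +
      cnj (x_ket m $ 1) * g (flip_bit k2 (flip_bit k1 z))"
  shows "pure_accept d (final_step \<phi> k1 k2 z m) (qproj k1 (x_ket m) g) =
    (cmod (cnj (cond_vec \<phi> k1 k2 z m $ 0) * w0 + cnj (cond_vec \<phi> k1 k2 z m $ 1) * w1))\<^sup>2 /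
      outcome_prob \<phi> k1 k2 z m"
proof (cases "outcome_prob \<phi> k1 k2 z m = 0")
  case True
  then show ?thesis by (simp add: final_step_def final_basis_def)
next
  case False
  let ?p = "outcome_prob \<phi> k1 k2 z m" and ?c = "cond_vec \<phi> k1 k2 z m"
  define u where "u = cond_state \<phi> k1 k2 z m"
  define h where "h = qproj k1 (x_ket m) g"
  have z': "z < 2 ^ d" "\<not> bit z k1" "\<not> bit z k2" using z by (auto simp: anchors_def)
  have k': "k1 < d" "k1 \<noteq> k2" using k by auto
  have basis: "u \<in> carrier_vec 2" "u \<bullet>c u = 1"
    using cond_state_basis[OF False] by (auto simp: qubit_basis_def u_def)
  have out: "flip_bit q x \<notin> block d {k1, k2} z"
    if "x \<notin> block d {k1, k2} z" "x < 2 ^ d" "q \<in> {k1, k2}" for q x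
    using that k by (auto simp: block_def)
  have h_out: "h x = 0" if "x < 2 ^ d" "x \<notin> block d {k1, k2} z" for x
    using that out[of x k1] k' supp by (simp add: h_def qproj_def flip_bit_less)
  have hu_out: "qproj k2 u h x = 0" if "x < 2 ^ d" "x \<notin> block d {k1, k2} z" for x
    using that out[of x k2] k h_out by (simp add: qproj_def flip_bit_less)
  have p: "?p > 0" using False unfolding outcome_prob_eq by (simp add: sum_power2_gt_zero_iff)
  have "pure_accept d (final_step \<phi> k1 k2 z m) h = sqnorm d (qproj k2 u h)"
    using False by (simp add: final_step_def final_basis_def u_def)
  also have "\<dots> = (\<Sum>x\<in>block d {k1, k2} z. (cmod (qproj k2 u h x))\<^sup>2)"
    unfolding sqnorm_def
    by (rule sum.mono_neutral_right) (auto simp: hu_out, simp add: block_def)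
  also have "\<dots> = ((cmod (qproj k2 u h z))\<^sup>2 + (cmod (qproj k2 u h (flip_bit k2 z)))\<^sup>2) +
      ((cmod (qproj k2 u h (flip_bit k1 z)))\<^sup>2 + (cmod (qproj k2 u h (flip_bit k2 (flip_bit k1 z))))\<^sup>2)"
    using k z'(1) by (simp add: sum_block_pair)
  also have "\<dots> = (cmod (cnj (u $ 0) * h z + cnj (u $ 1) * h (flip_bit k2 z)))\<^sup>2 +
      (cmod (cnj (u $ 0) * h (flip_bit k1 z) + cnj (u $ 1) * h (flip_bit k2 (flip_bit k1 z))))\<^sup>2"
    unfolding sqnorm_qproj_pair[OF basis] using z' k' by (simp add: bitn_def)
  also have "\<dots> = ((cmod (x_ket m $ 0))\<^sup>2 + (cmod (x_ket m $ 1))\<^sup>2) *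
      (cmod (cnj (u $ 0) * w0 + cnj (u $ 1) * w1))\<^sup>2"
  proof -
    have h: "h z = x_ket m $ 0 * w0" "h (flip_bit k1 z) = x_ket m $ 1 * w0"
      "h (flip_bit k2 z) = x_ket m $ 0 * w1" "h (flip_bit k2 (flip_bit k1 z)) = x_ket m $ 1 * w1"
      using z' k' flip_bit_left_commute[of k1 k2]
      by (simp_all add: h_def qproj_def bitn_def w0_def w1_def add.commute)
    have factor: "cnj (u $ 0) * (t * w0) + cnj (u $ 1) * (t * w1) =
      t * (cnj (u $ 0) * w0 + cnj (u $ 1) * w1)" for t
      by (simp add: algebra_simps)
    show ?thesis unfolding h factor norm_mult power_mult_distrib by (simp add: distrib_right)
  qed
  also have "(cmod (x_ket m $ 0))\<^sup>2 + (cmod (x_ket m $ 1))\<^sup>2 = 1"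
    unfolding One_nat_def x_ket_index norm_of_real by (simp add: power_divide)
  also have "cnj (u $ 0) * w0 + cnj (u $ 1) * w1 =
    (cnj (?c $ 0) * w0 + cnj (?c $ 1) * w1) / of_real (sqrt ?p)"
    by (simp add: u_def cond_state_def cond_vec_def add_divide_distrib)
  also have "1 * (cmod \<dots>)\<^sup>2 = (cmod (cnj (?c $ 0) * w0 + cnj (?c $ 1) * w1))\<^sup>2 / ?p"
    using p by (simp add: norm_divide power_divide)
  finally show ?thesis by (simp add: h_def)
qed

text \<open>
  Restricted to the right parity, the test at one pair projects on the conditional states of the
  target on that pair.
\<close>

lemma accept_correlation_tail:
  fixes \<phi> :: "complex vec"
  assumes k: "k1 < k2" "k2 < d" and z: "z \<in> anchors d {k1, k2}"
    and supp: "\<And>x. x < 2 ^ d \<Longrightarrow> x \<notin> block d {k1, k2} z \<Longrightarrow> g x = 0"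
    and par: "\<And>x. x < 2 ^ d \<Longrightarrow> outcome_parity d x \<noteq> \<sigma> \<Longrightarrow> \<phi> $ x = 0" "\<sigma> \<in> {1, - 1}"
  defines "n \<equiv> \<Sum>x\<in>block d {k1, k2} z. (cmod (\<phi> $ x))\<^sup>2"
  obtains B where
    "pure_accept d (Measure k1 ket_plus ket_minus (final_step \<phi> k1 k2 z False)
      (final_step \<phi> k1 k2 z True)) g =
      ((cmod (\<Sum>x\<in>block d {k1, k2} z. cnj (\<phi> $ x) * parity_part d \<sigma> g x))\<^sup>2 + (cmod B)\<^sup>2) / n"
    "(cmod B)\<^sup>2 \<le> n * (\<Sum>x\<in>block d {k1, k2} z. (cmod (g x - parity_part d \<sigma> g x))\<^sup>2)"
proof -
  have z': "z < 2 ^ d" "\<not> bit z k1" "\<not> bit z k2" using z by (auto simp: anchors_def)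
  have k': "k1 < d" "k1 \<noteq> k2" using k by auto
  define a0 where "a0 = \<phi> $ z"
  define a1 where "a1 = \<phi> $ flip_bit k1 z"
  define a2 where "a2 = \<phi> $ flip_bit k2 z"
  define a3 where "a3 = \<phi> $ flip_bit k2 (flip_bit k1 z)"
  define b0 where "b0 = g z"
  define b1 where "b1 = g (flip_bit k1 z)"
  define b2 where "b2 = g (flip_bit k2 z)"
  define b3 where "b3 = g (flip_bit k2 (flip_bit k1 z))"
  note defs = a0_def a1_def a2_def a3_def b0_def b1_def b2_def b3_def
  define r where "r = 1 / sqrt 2"
  have rr: "complex_of_real r * of_real r = 1 / 2" "r * r = 1 / 2"
  proof -
    show "r * r = 1 / 2" by (simp add: r_def)
    then have "complex_of_real (r * r) = of_real (1 / 2)" by (simp only:)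
    then show "complex_of_real r * of_real r = 1 / 2"
      by (simp only: of_real_mult of_real_divide of_real_1 of_real_numeral)
  qed
  have x: "x_ket m $ 0 = of_real r" "x_ket m $ 1 = of_real ((if m then - 1 else 1) * r)"
    "x_ket m $ Suc 0 = of_real ((if m then - 1 else 1) * r)" for m
    by (simp_all add: x_ket_index r_def)
  have n: "n = (cmod a0)\<^sup>2 + (cmod a1)\<^sup>2 + (cmod a2)\<^sup>2 + (cmod a3)\<^sup>2"
    unfolding n_def sum_block_pair[OF k z'(1)] defs ..
  define S where "S m = pure_accept d (final_step \<phi> k1 k2 z m) (qproj k1 (x_ket m) g)" for m
  have split: "pure_accept d (Measure k1 ket_plus ket_minus (final_step \<phi> k1 k2 z False)
    (final_step \<phi> k1 k2 z True)) g =
      S False + S True"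
    by (simp add: S_def x_ket_def)
  let ?s = "\<lambda>m. (if m then - 1 else 1) :: complex"
  have c: "cond_vec \<phi> k1 k2 z m $ 0 = of_real r * (a0 + ?s m * a1)"
    "cond_vec \<phi> k1 k2 z m $ 1 = of_real r * (a2 + ?s m * a3)" for m
    using cond_vec_index[OF z'(2,3) k'(2), of \<phi> m] by (auto simp: x defs algebra_simps)
  have w: "cnj (x_ket m $ 0) * g z + cnj (x_ket m $ 1) * g (flip_bit k1 z) =
    of_real r * (b0 + ?s m * b1)"
    "cnj (x_ket m $ 0) * g (flip_bit k2 z) + cnj (x_ket m $ 1) * g (flip_bit k2 (flip_bit k1 z)) =
      of_real r * (b2 + ?s m * b3)" for m
    by (auto simp: x defs algebra_simps)
  have S: "S m = (cmod (cnj (of_real r * (a0 + ?s m * a1)) * (of_real r * (b0 + ?s m * b1)) +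
      cnj (of_real r * (a2 + ?s m * a3)) * (of_real r * (b2 + ?s m * b3))))\<^sup>2 /
      ((cmod (of_real r * (a0 + ?s m * a1)))\<^sup>2 + (cmod (of_real r * (a2 + ?s m * a3)))\<^sup>2)" for m
  proof -
    have "S m = (cmod (cnj (cond_vec \<phi> k1 k2 z m $ 0) *
        (cnj (x_ket m $ 0) * g z + cnj (x_ket m $ 1) * g (flip_bit k1 z)) +
          cnj (cond_vec \<phi> k1 k2 z m $ 1) *
        (cnj (x_ket m $ 0) * g (flip_bit k2 z) +
          cnj (x_ket m $ 1) * g (flip_bit k2 (flip_bit k1 z)))))\<^sup>2 /
        outcome_prob \<phi> k1 k2 z m"
      unfolding S_def by (rule accept_final_step[OF k z]) (rule supp)
    then show ?thesis unfolding c w outcome_prob_eq .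
  qed
  have par_flip: "outcome_parity d (flip_bit k1 z) = - outcome_parity d z"
    "outcome_parity d (flip_bit k2 z) = - outcome_parity d z"
    "outcome_parity d (flip_bit k2 (flip_bit k1 z)) = outcome_parity d z"
    using k k' by (simp_all add: outcome_parity_flip_bit)
  \<comment> \<open>By the parallelogram law the cross terms of the two X outcomes cancel, so right
    and wrong parity contribute separately. Both outcomes have weight \<open>n / 2\<close> in the
    target, since in a block only two of its amplitudes survive, at strings differing in both
    bits.\<close>
  have sum_two: "(cmod ((A + B) / 2))\<^sup>2 / (t / 2) + (cmod ((A - B) / 2))\<^sup>2 / (t / 2) =
      ((cmod A)\<^sup>2 + (cmod B)\<^sup>2) / t" for A B t
  proof -
    have "(cmod (A + B))\<^sup>2 + (cmod (A - B))\<^sup>2 = 2 * ((cmod A)\<^sup>2 + (cmod B)\<^sup>2)"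
      unfolding cmod_power2 by (simp add: power2_eq_square algebra_simps)
    then have "((cmod (A + B))\<^sup>2 + (cmod (A - B))\<^sup>2) / (2 * t) =
      (2 * ((cmod A)\<^sup>2 + (cmod B)\<^sup>2)) / (2 * t)"
      by (simp only:)
    also have "\<dots> = ((cmod A)\<^sup>2 + (cmod B)\<^sup>2) / t" by (rule mult_divide_mult_cancel_left) simp
    finally have "(cmod (A + B))\<^sup>2 / (2 * t) + (cmod (A - B))\<^sup>2 / (2 * t) =
      ((cmod A)\<^sup>2 + (cmod B)\<^sup>2) / t"
      by (simp only: add_divide_distrib)
    moreover have quarter: "x / 2\<^sup>2 / (t / 2) = x / (2 * t)" for x :: real by simp
    ultimately show ?thesis unfolding norm_divide power_divide norm_numeral quarter by simp
  qed
  have CS: "(cmod (cnj p * s + cnj q * t))\<^sup>2 \<le>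
    ((cmod p)\<^sup>2 + (cmod q)\<^sup>2) * ((cmod s)\<^sup>2 + (cmod t)\<^sup>2)" for p q s t
    using Cauchy_Schwarz_cmod[of "\<lambda>i. if i = 0 then p else q" "\<lambda>i. if i = 0 then s else t"
      "{0, 1 :: nat}"] by simp
  have half: "cnj (of_real r * u) * (of_real r * v) = cnj u * v / 2" for u v
  proof -
    have "cnj (of_real r * u) * (of_real r * v) = (of_real r * of_real r) * (cnj u * v)"
      by (simp add: mult_ac)
    then show ?thesis unfolding rr by simp
  qed
  have half_sq: "(cmod (of_real r * u))\<^sup>2 = (cmod u)\<^sup>2 / 2" for u
    unfolding norm_mult power_mult_distrib norm_of_real by (simp add: r_def power_divide)
  show ?thesis
  proof (cases "outcome_parity d z = \<sigma>")
    case True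
    then have a: "a1 = 0" "a2 = 0"
      using par(1)[of "flip_bit k1 z"] par(1)[of "flip_bit k2 z"] par(2) par_flip z' k k'
      by (auto simp: defs flip_bit_less)
    define A where "A = cnj a0 * b0 + cnj a3 * b3"
    \<comment> \<open>\<open>B\<close> pairs the amplitudes of the target with those of the lab
      state at the strings flipped at \<open>k1\<close>, which have the wrong parity. Measuring X on
      \<open>k1\<close> does not distinguish a string from this flip.\<close>
    define B where "B = cnj a0 * b1 + cnj a3 * b2"
    have inner: "(\<Sum>x\<in>block d {k1, k2} z. cnj (\<phi> $ x) * parity_part d \<sigma> g x) = A"
      unfolding sum_block_pair[OF k z'(1)] using True par(2)
      by (auto simp: parity_part_def par_flip A_def defs)
    have rest: "(\<Sum>x\<in>block d {k1, k2} z. (cmod (g x - parity_part d \<sigma> g x))\<^sup>2) =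
      (cmod b1)\<^sup>2 + (cmod b2)\<^sup>2"
      unfolding sum_block_pair[OF k z'(1)] using True par(2)
      by (auto simp: parity_part_def par_flip defs)
    have outcomes: "S False = (cmod ((A + B) / 2))\<^sup>2 / (n / 2)"
      "S True = (cmod ((A - B) / 2))\<^sup>2 / (n / 2)"
      unfolding S half half_sq n a A_def B_def
      by (simp_all add: add_divide_distrib[symmetric] algebra_simps)
    have "S False + S True = ((cmod A)\<^sup>2 + (cmod B)\<^sup>2) / n"
      unfolding outcomes by (rule sum_two)
    moreover have "(cmod B)\<^sup>2 \<le> n * ((cmod b1)\<^sup>2 + (cmod b2)\<^sup>2)"
      using CS[of a0 b1 a3 b2] by (simp add: B_def n a)
    ultimately show ?thesis by (intro that[of B]) (simp_all only: split inner rest)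
  next
    case False
    then have a: "a0 = 0" "a3 = 0"
      using par(1)[of z] par(1)[of "flip_bit k2 (flip_bit k1 z)"] par_flip z' k k'
      by (auto simp: defs flip_bit_less)
    have opp: "outcome_parity d z = - \<sigma>" using False par(2) outcome_parity_cases[of d z] by auto
    define A where "A = cnj a1 * b1 + cnj a2 * b2"
    define B where "B = cnj a1 * b0 + cnj a2 * b3"
    have inner: "(\<Sum>x\<in>block d {k1, k2} z. cnj (\<phi> $ x) * parity_part d \<sigma> g x) = A"
      unfolding sum_block_pair[OF k z'(1)] using opp par(2)
      by (auto simp: parity_part_def par_flip A_def defs)
    have rest: "(\<Sum>x\<in>block d {k1, k2} z. (cmod (g x - parity_part d \<sigma> g x))\<^sup>2) =
      (cmod b0)\<^sup>2 + (cmod b3)\<^sup>2"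
      unfolding sum_block_pair[OF k z'(1)] using opp par(2)
      by (auto simp: parity_part_def par_flip defs)
    have outcomes: "S False = (cmod ((A + B) / 2))\<^sup>2 / (n / 2)"
      "S True = (cmod ((A - B) / 2))\<^sup>2 / (n / 2)"
      unfolding S half half_sq n a A_def B_def
      by (simp_all add: add_divide_distrib[symmetric] algebra_simps)
    have "S False + S True = ((cmod A)\<^sup>2 + (cmod B)\<^sup>2) / n"
      unfolding outcomes by (rule sum_two)
    moreover have "(cmod B)\<^sup>2 \<le> n * ((cmod b0)\<^sup>2 + (cmod b3)\<^sup>2)"
      using CS[of a1 b0 a2 b3] by (simp add: B_def n a)
    ultimately show ?thesis by (intro that[of B]) (simp_all only: split inner rest)
  qed
qed

lemma sum_blocks:
  fixes h :: "nat \<Rightarrow> 'b :: comm_monoid_add"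
  assumes "k1 < k2" "k2 < d"
  shows "(\<Sum>z\<in>anchors d {k1, k2}. \<Sum>x\<in>block d {k1, k2} z. h x) = (\<Sum>x<2 ^ d. h x)"
proof -
  define clear where "clear k x = (if bit x k then flip_bit k x else x)" for k x :: nat
  \<comment> \<open>Clearing the two bits sends a string to the anchor of its block, so the blocks
    are the fibres of \<open>r\<close>.\<close>
  define r where "r x = clear k1 (clear k2 x)" for x
  have bit_clear: "bit (clear k x) i \<longleftrightarrow> bit x i \<and> i \<noteq> k" for k x i
    by (auto simp: clear_def)
  have bit_r: "bit (r x) i \<longleftrightarrow> bit x i \<and> i \<noteq> k1 \<and> i \<noteq> k2" for x i
    by (auto simp: r_def bit_clear)
  have r_less: "r x < 2 ^ d" if "x < 2 ^ d" for x
    using that assms by (auto simp: r_def clear_def flip_bit_less)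
  have "block d {k1, k2} z = {x\<in>{..<2 ^ d}. r x = z}" if z: "z \<in> anchors d {k1, k2}" for z
  proof (intro equalityI subsetI)
    fix x assume x: "x \<in> block d {k1, k2} z"
    have "r x = z"
    proof (rule eq_if_bits_eq[of _ d])
      show "bit (r x) i = bit z i" if "i < d" for i
        using x z that by (cases "i \<in> {k1, k2}") (auto simp: bit_r block_def anchors_def)
    qed (use x z r_less in \<open>auto simp: block_def anchors_def\<close>)
    then show "x \<in> {x\<in>{..<2 ^ d}. r x = z}" using x by (simp add: block_def)
  next
    fix x assume "x \<in> {x\<in>{..<2 ^ d}. r x = z}"
    then show "x \<in> block d {k1, k2} z" using bit_r[of x] by (auto simp: block_def)
  qed
  then have "(\<Sum>z\<in>anchors d {k1, k2}. \<Sum>x\<in>block d {k1, k2} z. h x) =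
      (\<Sum>z\<in>anchors d {k1, k2}. \<Sum>x\<in>{x\<in>{..<2 ^ d}. r x = z}. h x)"
    by (intro sum.cong) auto
  also have "\<dots> = (\<Sum>x<2 ^ d. h x)"
    by (rule sum.group) (auto simp: anchors_def r_less bit_r)
  finally show ?thesis .
qed

lemma pure_accept_zero: "pure_accept d P (\<lambda>x. 0) = 0"
proof (induction P)
  case (Pick Ps)
  then have "map (\<lambda>P. pure_accept d P (\<lambda>x. 0)) Ps = map (\<lambda>P. 0) Ps" by simp
  then show ?case by (simp only: pure_accept.simps) simp
next
  case (Measure q u v P Q)
  have "qproj q w (\<lambda>x. 0) = (\<lambda>x. 0)" for w by (auto simp: qproj_def)
  then show ?case using Measure by simp
qed (simp_all add: sqnorm_def)

lemma single_qubit_correlation_test_at: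
  assumes "k1 < k2" "k2 < d"
  shows "single_qubit_protocol {..<d} (correlation_test_at d \<phi> k1 k2)"
  unfolding correlation_test_at_def
proof (rule single_qubit_measure_comp)
  fix z
  have "{..<d} - set (filter (\<lambda>q. q \<noteq> k1 \<and> q \<noteq> k2) [0..<d]) = {k1, k2}" using assms by auto
  moreover have "single_qubit_protocol {k2} (final_step \<phi> k1 k2 z m)" for m
    using cond_state_basis[of \<phi> k1 k2 z m] by (simp add: final_step_def final_basis_def)
  moreover have "{k1, k2} - {k1} = {k2}" using assms by auto
  ultimately show "single_qubit_protocol ({..<d} - set (filter (\<lambda>q. q \<noteq> k1 \<and> q \<noteq> k2) [0..<d]))
      (Measure k1 ket_plus ket_minus (final_step \<phi> k1 k2 z False) (final_step \<phi> k1 k2 z True))"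
    using qubit_basis_x_ket by simp
qed auto

text \<open>In each block the term \<open>B\<close> is bounded by the full weight of the
  wrong-parity part, whose rejection is left to the parity test. The right-parity part is projected
  on the target and loses its defect.\<close>

lemma accept_correlation_test_at:
  fixes \<phi> :: "complex vec"
  assumes k: "k1 < k2" "k2 < d"
    and par: "\<And>x. x < 2 ^ d \<Longrightarrow> outcome_parity d x \<noteq> \<sigma> \<Longrightarrow> \<phi> $ x = 0" "\<sigma> \<in> {1, - 1}"
  shows "pure_accept d (correlation_test_at d \<phi> k1 k2) v \<le>
      sqnorm d v - block_defect d (($) \<phi>) (parity_part d \<sigma> v) {k1, k2}" (is ?bound)
    and "pure_accept d (correlation_test_at d \<phi> k1 k2) (($) \<phi>) = sqnorm d (($) \<phi>)" (is ?eq)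
proof -
  define qs where "qs = filter (\<lambda>q. q \<noteq> k1 \<and> q \<noteq> k2) [0..<d]"
  define tail where "tail z = Measure k1 ket_plus ket_minus (final_step \<phi> k1 k2 z False)
    (final_step \<phi> k1 k2 z True)" for z
  define g where "g v z x = (if \<forall>q\<in>set qs. bit x q = bit z q then v x else 0)" for v :: "nat \<Rightarrow> complex"
    and z x :: nat
  have qs: "set qs = {..<d} - {k1, k2}" by (auto simp: qs_def)
  have anchors: "block d (set qs) 0 = anchors d {k1, k2}"
  proof (intro equalityI subsetI)
    fix x assume x: "x \<in> block d (set qs) 0"
    have "bit x i = bit (0 :: nat) i" if "i < d" "i \<in> {k1, k2}" for i
      using x that unfolding block_def qs by blast
    then show "x \<in> anchors d {k1, k2}"
      using x k order.strict_trans[OF k] by (simp add: anchors_def block_def)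
  qed (auto simp: block_def anchors_def qs)
  have sum_form: "pure_accept d (correlation_test_at d \<phi> k1 k2) v =
      (\<Sum>z\<in>anchors d {k1, k2}. pure_accept d (tail z) (g v z))" for v
    unfolding correlation_test_at_def g_def tail_def qs_def[symmetric] anchors[symmetric]
    by (rule pure_accept_measure_comp) (auto simp: qs pure_accept_zero qs_def)
  have g: "g v z x = (if x \<in> block d {k1, k2} z then v x else 0)" if "x < 2 ^ d" for v z x
    using that by (auto simp: g_def qs block_def)
  have in_block: "x < 2 ^ d" if "x \<in> block d {k1, k2} z" for x z using that by (simp add: block_def)
  have tail: "\<exists>B. pure_accept d (tail z) (g v z) =
      ((cmod (\<Sum>x\<in>block d {k1, k2} z. cnj (\<phi> $ x) * parity_part d \<sigma> v x))\<^sup>2 + (cmod B)\<^sup>2) /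
        (\<Sum>x\<in>block d {k1, k2} z. (cmod (\<phi> $ x))\<^sup>2) \<and>
      (cmod B)\<^sup>2 \<le> (\<Sum>x\<in>block d {k1, k2} z. (cmod (\<phi> $ x))\<^sup>2) *
        (\<Sum>x\<in>block d {k1, k2} z. (cmod (v x - parity_part d \<sigma> v x))\<^sup>2)"
    if z: "z \<in> anchors d {k1, k2}" for v z
  proof -
    have g_in: "g v z x = v x" "parity_part d \<sigma> (g v z) x = parity_part d \<sigma> v x"
      if "x \<in> block d {k1, k2} z" for x
      using that g in_block by (simp_all add: parity_part_def)
    have supp: "g v z x = 0" if "x < 2 ^ d" "x \<notin> block d {k1, k2} z" for x
      using that g by simp
    obtain B where B: "pure_accept d (tail z) (g v z) =
      ((cmod (\<Sum>x\<in>block d {k1, k2} z. cnj (\<phi> $ x) * parity_part d \<sigma> (g v z) x))\<^sup>2 + (cmod B)\<^sup>2) /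
        (\<Sum>x\<in>block d {k1, k2} z. (cmod (\<phi> $ x))\<^sup>2)"
      "(cmod B)\<^sup>2 \<le> (\<Sum>x\<in>block d {k1, k2} z. (cmod (\<phi> $ x))\<^sup>2) *
        (\<Sum>x\<in>block d {k1, k2} z. (cmod (g v z x - parity_part d \<sigma> (g v z) x))\<^sup>2)"
      unfolding tail_def by (rule accept_correlation_tail[OF k z supp par])
    have "(\<Sum>x\<in>block d {k1, k2} z. cnj (\<phi> $ x) * parity_part d \<sigma> (g v z) x) =
        (\<Sum>x\<in>block d {k1, k2} z. cnj (\<phi> $ x) * parity_part d \<sigma> v x)"
      "(\<Sum>x\<in>block d {k1, k2} z. (cmod (g v z x - parity_part d \<sigma> (g v z) x))\<^sup>2) =
        (\<Sum>x\<in>block d {k1, k2} z. (cmod (v x - parity_part d \<sigma> v x))\<^sup>2)"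
      using g_in by (auto intro!: sum.cong)
    then show ?thesis using B by (intro exI[of _ B]) simp
  qed
  have "pure_accept d (tail z) (g v z) \<le>
      (\<Sum>x\<in>block d {k1, k2} z. (cmod (v x))\<^sup>2) - defect (block d {k1, k2} z) (($) \<phi>) (parity_part d \<sigma> v)"
    if z: "z \<in> anchors d {k1, k2}" for z
  proof -
    define n where "n = (\<Sum>x\<in>block d {k1, k2} z. (cmod (\<phi> $ x))\<^sup>2)"
    define A where "A = (\<Sum>x\<in>block d {k1, k2} z. cnj (\<phi> $ x) * parity_part d \<sigma> v x)"
    define R where "R = (\<Sum>x\<in>block d {k1, k2} z. (cmod (v x - parity_part d \<sigma> v x))\<^sup>2)"
    obtain B where B: "pure_accept d (tail z) (g v z) = ((cmod A)\<^sup>2 + (cmod B)\<^sup>2) / n"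
      "(cmod B)\<^sup>2 \<le> n * R"
      using tail[OF z, of v] unfolding n_def A_def R_def by blast
    have n: "0 \<le> n" and R: "0 \<le> R" by (simp_all add: n_def R_def sum_nonneg)
    have "(cmod B)\<^sup>2 / n \<le> R"
      using B(2) n R by (cases "n = 0") (simp_all add: pos_divide_le_eq mult.commute)
    then have "pure_accept d (tail z) (g v z) \<le> (cmod A)\<^sup>2 / n + R"
      using B(1) by (simp add: add_divide_distrib)
    moreover have "(\<Sum>x\<in>block d {k1, k2} z. (cmod (v x))\<^sup>2) =
        (\<Sum>x\<in>block d {k1, k2} z. (cmod (parity_part d \<sigma> v x))\<^sup>2) + R"
      unfolding R_def sum.distrib[symmetric] by (intro sum.cong) (auto simp: parity_part_def)
    ultimately show ?thesis by (simp add: defect_def n_def A_def)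
  qed
  then have "pure_accept d (correlation_test_at d \<phi> k1 k2) v \<le> (\<Sum>z\<in>anchors d {k1, k2}.
      (\<Sum>x\<in>block d {k1, k2} z. (cmod (v x))\<^sup>2) - defect (block d {k1, k2} z) (($) \<phi>) (parity_part d \<sigma> v))"
    unfolding sum_form by (rule sum_mono)
  also have "\<dots> = sqnorm d v - block_defect d (($) \<phi>) (parity_part d \<sigma> v) {k1, k2}"
    by (simp add: sum_subtractf sum_blocks[OF k] sqnorm_def block_defect_def)
  finally show ?bound .
  have "pure_accept d (tail z) (g (($) \<phi>) z) = (\<Sum>x\<in>block d {k1, k2} z. (cmod (\<phi> $ x))\<^sup>2)"
    if z: "z \<in> anchors d {k1, k2}" for z
  proof -
    define n where "n = (\<Sum>x\<in>block d {k1, k2} z. (cmod (\<phi> $ x))\<^sup>2)"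
    have part: "parity_part d \<sigma> (($) \<phi>) x = \<phi> $ x" if "x \<in> block d {k1, k2} z" for x
      using par(1)[OF in_block[OF that]] by (auto simp: parity_part_def)
    have "(\<Sum>x\<in>block d {k1, k2} z. cnj (\<phi> $ x) * parity_part d \<sigma> (($) \<phi>) x) = of_real n"
      unfolding n_def of_real_sum complex_norm_square
      by (intro sum.cong) (simp_all add: part mult.commute)
    moreover have "(\<Sum>x\<in>block d {k1, k2} z. (cmod (\<phi> $ x - parity_part d \<sigma> (($) \<phi>) x))\<^sup>2) = 0"
      by (intro sum.neutral) (simp add: part)
    ultimately obtain B where "pure_accept d (tail z) (g (($) \<phi>) z) =
      ((cmod (of_real n))\<^sup>2 + (cmod B)\<^sup>2) / n"
      "(cmod B)\<^sup>2 \<le> n * 0"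
      using tail[OF z, of "($) \<phi>"] unfolding n_def[symmetric] by auto
    then have "pure_accept d (tail z) (g (($) \<phi>) z) = n\<^sup>2 / n" by simp
    then show ?thesis by (simp add: n_def power2_eq_square)
  qed
  then show ?eq
    unfolding sum_form by (simp add: sum_blocks[OF k] sqnorm_def)
qed

section \<open>Averages over pairs and the test of one copy\<close>

lemma sum_list_pairs:
  "sum_list (map F (concat (map (\<lambda>k2. map (\<lambda>k1. G k1 k2) [0..<k2]) [0..<d]))) =
    (\<Sum>k2<d. \<Sum>k1<k2. F (G k1 k2))" for F :: "'a \<Rightarrow> real"
  by (induction d) (simp_all add: interv_sum_list_conv_sum_set_nat comp_def lessThan_atLeast0)

lemma length_pairs:
  "real (length (concat (map (\<lambda>k2. map (\<lambda>k1. G k1 k2) [0..<k2]) [0..<d]))) = real d * (real d - 1) / 2"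
  by (induction d) (simp_all add: field_simps)

lemma sum_two_subsets:
  fixes E :: "nat set \<Rightarrow> real"
  shows "(\<Sum>k2<d. \<Sum>k1<k2. E {k1, k2}) = (\<Sum>K | K \<subseteq> {..<d} \<and> card K = 2. E K)"
proof -
  have "(\<Sum>k2<d. \<Sum>k1<k2. E {k1, k2}) = (\<Sum>(k2, k1)\<in>(SIGMA k2:{..<d}. {..<k2}). E {k1, k2})"
    by (rule sum.Sigma) auto
  also have "\<dots> = (\<Sum>K | K \<subseteq> {..<d} \<and> card K = 2. E K)"
  proof (rule sum.reindex_bij_witness[of _ "\<lambda>K. (Max K, Min K)" "\<lambda>(k2, k1). {k1, k2}"])
    fix K assume "K \<in> {K. K \<subseteq> {..<d} \<and> card K = 2}"
    then obtain a b where K: "K = {a, b}" "a \<noteq> b" "a < d" "b < d"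
      by (auto simp: card_2_iff)
    then show "(\<lambda>(k2, k1). {k1, k2}) (Max K, Min K) = K" "(Max K, Min K) \<in> (SIGMA k2:{..<d}. {..<k2})"
      by (cases "a < b"; auto simp: min_def max_def)+
  qed auto
  finally show ?thesis .
qed

lemma accept_correlation_test:
  fixes \<phi> :: "complex vec"
  assumes wick: "wick d \<psi>" and same: "\<And>x. x < 2 ^ d \<Longrightarrow> cmod (\<phi> $ x) = cmod (\<psi> x)" and d: "2 \<le> d"
    and par: "\<And>x. x < 2 ^ d \<Longrightarrow> outcome_parity d x \<noteq> \<sigma> \<Longrightarrow> \<phi> $ x = 0" "\<sigma> \<in> {1, - 1}"
  shows "pure_accept d (correlation_test d \<phi>) v \<le>
      sqnorm d v - 2 / (real d * (real d - 1)) * defect {..<2 ^ d} (($) \<phi>) (parity_part d \<sigma> v)"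
    and "pure_accept d (correlation_test d \<phi>) (($) \<phi>) = sqnorm d (($) \<phi>)"
    and "single_qubit_protocol {..<d} (correlation_test d \<phi>)"
proof -
  define M where "M = real d * (real d - 1) / 2"
  have M: "0 < M" using d by (simp add: M_def)
  have form: "pure_accept d (correlation_test d \<phi>) v =
      (\<Sum>k2<d. \<Sum>k1<k2. pure_accept d (correlation_test_at d \<phi> k1 k2) v) / M" for v
    unfolding correlation_test_def M_def pure_accept.simps sum_list_pairs length_pairs ..
  have const: "(\<Sum>k2<d. \<Sum>k1<k2. c) = M * c" for c :: real
  proof -
    have "(\<Sum>k2<d. real k2) = real d * (real d - 1) / 2"
      by (induction d) (simp_all add: field_simps)
    then show ?thesis by (simp add: M_def sum_distrib_right[symmetric])
  qed
  have "(\<Sum>k2<d. \<Sum>k1<k2. pure_accept d (correlation_test_at d \<phi> k1 k2) v) \<le>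
      (\<Sum>k2<d. \<Sum>k1<k2. sqnorm d v - block_defect d (($) \<phi>) (parity_part d \<sigma> v) {k1, k2})"
    by (intro sum_mono accept_correlation_test_at(1) par) auto
  also have "\<dots> = M * sqnorm d v -
      (\<Sum>K | K \<subseteq> {..<d} \<and> card K = 2. block_defect d (($) \<phi>) (parity_part d \<sigma> v) K)"
    unfolding sum_subtractf const sum_two_subsets ..
  also have "\<dots> \<le> M * sqnorm d v - defect {..<2 ^ d} (($) \<phi>) (parity_part d \<sigma> v)"
    using defect_le_sum_pairs[OF wick same d] by simp
  finally have "pure_accept d (correlation_test d \<phi>) v \<le>
      (M * sqnorm d v - defect {..<2 ^ d} (($) \<phi>) (parity_part d \<sigma> v)) / M"
    unfolding form using M by (simp add: divide_right_mono)
  also have "\<dots> = sqnorm d v - 2 / (real d * (real d - 1)) * defect {..<2 ^ d} (($) \<phi>)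
    (parity_part d \<sigma> v)"
    using M by (simp add: diff_divide_distrib) (simp add: M_def)
  finally show "pure_accept d (correlation_test d \<phi>) v \<le>
      sqnorm d v - 2 / (real d * (real d - 1)) * defect {..<2 ^ d} (($) \<phi>) (parity_part d \<sigma> v)" .
  have "(\<Sum>k2<d. \<Sum>k1<k2. pure_accept d (correlation_test_at d \<phi> k1 k2) (($) \<phi>)) =
      (\<Sum>k2<d. \<Sum>k1<k2. sqnorm d (($) \<phi>))"
    by (intro sum.cong refl accept_correlation_test_at(2) par(1)) (use par(2) in auto)
  then show "pure_accept d (correlation_test d \<phi>) (($) \<phi>) = sqnorm d (($) \<phi>)"
    unfolding form const using M by simp
  show "single_qubit_protocol {..<d} (correlation_test d \<phi>)"
  proof -
    have "correlation_test_at d \<phi> 0 1 \<in> set [correlation_test_at d \<phi> k1 k2. k2 \<leftarrow> [0..<d], k1 \<leftarrow> [0..<k2]]"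
      using d by (auto intro!: bexI[of _ 1])
    then have "[correlation_test_at d \<phi> k1 k2. k2 \<leftarrow> [0..<d], k1 \<leftarrow> [0..<k2]] \<noteq> []" by force
    then show ?thesis
      unfolding correlation_test_def by (auto intro: single_qubit_correlation_test_at)
  qed
qed

lemma accept_parity_test:
  "pure_accept d (parity_test d \<sigma>) v = sqnorm d (parity_part d \<sigma> v)"
  "single_qubit_protocol {..<d} (parity_test d \<sigma>)"
proof -
  have "pure_accept d (parity_test d \<sigma>) v = (\<Sum>y\<in>block d (set [0..<d]) 0.
      pure_accept d (if outcome_parity d y = \<sigma> then Accept else Reject)
        (\<lambda>x. if \<forall>q\<in>set [0..<d]. bit x q = bit y q then v x else 0))"
    unfolding parity_test_def by (rule pure_accept_measure_comp) (auto simp: sqnorm_def)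
  also have "block d (set [0..<d]) 0 = {..<2 ^ d}" by (auto simp: block_def)
  also have "(\<Sum>y<2 ^ d. pure_accept d (if outcome_parity d y = \<sigma> then Accept else Reject)
        (\<lambda>x. if \<forall>q\<in>set [0..<d]. bit x q = bit y q then v x else 0)) =
      (\<Sum>y<2 ^ d. (cmod (parity_part d \<sigma> v y))\<^sup>2)"
  proof (intro sum.cong refl)
    fix y :: nat assume y: "y \<in> {..<2 ^ d}"
    have "sqnorm d (\<lambda>x. if \<forall>q\<in>set [0..<d]. bit x q = bit y q then v x else 0) =
        (\<Sum>x<2 ^ d. if x = y then (cmod (v y))\<^sup>2 else 0)"
      unfolding sqnorm_def
    proof (intro sum.cong refl)
      fix x :: nat assume x: "x \<in> {..<2 ^ d}"
      have "(\<forall>q\<in>set [0..<d]. bit x q = bit y q) \<longleftrightarrow> x = y"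
        using x y eq_if_bits_eq[of x d y] by auto
      then show "(cmod (if \<forall>q\<in>set [0..<d]. bit x q = bit y q then v x else 0))\<^sup>2 =
          (if x = y then (cmod (v y))\<^sup>2 else 0)" by simp
    qed
    also have "\<dots> = (cmod (v y))\<^sup>2" using y by simp
    finally show "pure_accept d (if outcome_parity d y = \<sigma> then Accept else Reject)
        (\<lambda>x. if \<forall>q\<in>set [0..<d]. bit x q = bit y q then v x else 0) = (cmod (parity_part d \<sigma> v y))\<^sup>2"
      by (simp add: parity_part_def)
  qed
  finally show "pure_accept d (parity_test d \<sigma>) v = sqnorm d (parity_part d \<sigma> v)"
    by (simp add: sqnorm_def)
  show "single_qubit_protocol {..<d} (parity_test d \<sigma>)"
    unfolding parity_test_def by (rule single_qubit_measure_comp) auto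
qed

text \<open>On the right parity the parity test accepts everything, so the coin halves the gap
  \<open>2 / (d (d - 1))\<close> of the correlation test. On the wrong parity the parity test
  rejects, and acceptance is at most one half, which for \<open>2 \<le> d\<close> does not exceed
  the claimed factor.\<close>

theorem accept_copy_test:
  fixes \<phi> :: "complex vec"
  assumes wick: "wick d \<psi>" and same: "\<And>x. x < 2 ^ d \<Longrightarrow> cmod (\<phi> $ x) = cmod (\<psi> x)" and d: "2 \<le> d"
    and par: "\<And>x. x < 2 ^ d \<Longrightarrow> outcome_parity d x \<noteq> \<sigma> \<Longrightarrow> \<phi> $ x = 0" "\<sigma> \<in> {1, - 1}"
  shows "single_qubit_protocol {..<d} (copy_test d \<sigma> \<phi>)"
    and "pure_accept d (copy_test d \<sigma> \<phi>) (($) \<phi>) = sqnorm d (($) \<phi>)"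
    and "ip d (($) \<phi>) v = 0 \<Longrightarrow>
      pure_accept d (copy_test d \<sigma> \<phi>) v \<le> (1 - 1 / (real d * (real d - 1))) * sqnorm d v"
proof -
  note corr = accept_correlation_test[OF wick same d par]
  show "single_qubit_protocol {..<d} (copy_test d \<sigma> \<phi>)"
    using corr(3) accept_parity_test(2) by (simp add: copy_test_def)
  have "sqnorm d (parity_part d \<sigma> (($) \<phi>)) = sqnorm d (($) \<phi>)"
    using par(1) by (intro sqnorm_cong) (auto simp: parity_part_def)
  then show "pure_accept d (copy_test d \<sigma> \<phi>) (($) \<phi>) = sqnorm d (($) \<phi>)"
    by (simp add: copy_test_def corr(2) accept_parity_test(1))
  assume orth: "ip d (($) \<phi>) v = 0"
  define p where "p = parity_part d \<sigma> v"
  have "(\<Sum>x<2 ^ d. cnj (\<phi> $ x) * p x) = ip d (($) \<phi>) v"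
    unfolding ip_def p_def using par(1) by (intro sum.cong) (auto simp: parity_part_def)
  then have defect: "defect {..<2 ^ d} (($) \<phi>) p = sqnorm d p"
    using orth by (simp add: defect_def sqnorm_def)
  define t where "t = 1 / (real d * (real d - 1))"
  have "1 * 1 \<le> real d * (real d - 1) / 2 * 1"
    using d mult_mono[of 2 "real d" 1 "real d - 1"] by simp
  then have t: "t \<le> 1 / 2" unfolding t_def using d by (simp add: divide_simps)
  have pv: "sqnorm d p \<le> sqnorm d v"
    unfolding sqnorm_def p_def by (intro sum_mono) (auto simp: parity_part_def)
  have "pure_accept d (copy_test d \<sigma> \<phi>) v \<le> (sqnorm d p + (sqnorm d v - 2 * t * sqnorm d p)) / 2"
    using corr(1)[of v] accept_parity_test(1)[of d \<sigma> v] defect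
    by (simp add: copy_test_def p_def t_def)
  also have "\<dots> \<le> (1 - t) * sqnorm d v"
  proof -
    have "0 \<le> (1 - 2 * t) * (sqnorm d v - sqnorm d p)" using t pv by (intro mult_nonneg_nonneg) auto
    then have "sqnorm d p + (sqnorm d v - 2 * t * sqnorm d p) \<le> 2 * ((1 - t) * sqnorm d v)"
      by (simp add: algebra_simps)
    then show ?thesis by simp
  qed
  finally show "pure_accept d (copy_test d \<sigma> \<phi>) v \<le> (1 - 1 / (real d * (real d - 1))) * sqnorm d v"
    by (simp add: t_def)
qed

lemma parity_op_mult_vec:
  assumes "\<psi> \<in> carrier_vec (2 ^ d)" "x < 2 ^ d"
  shows "(parity_op d *\<^sub>v \<psi>) $ x = of_int (outcome_parity d x) * \<psi> $ x"
proof -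
  have Zgate_diag: "Zgate $$ (bitn x j, bitn x j) = (if bit x j then - 1 else 1)" for x j
    by (simp add: Zgate_def outer_def ket0_def ket1_def bitn_def)
  have entry: "parity_op d $$ (x, y) = (if x = y then of_int (outcome_parity d x) else 0)"
    if "y < 2 ^ d" for y
  proof (cases "x = y")
    case True
    then show ?thesis
      using that by (simp add: parity_op_def tensor_def outcome_parity_def Zgate_diag
        if_distrib[of of_int] cong: if_cong)
  next
    case False
    have "\<exists>j<d. bit x j \<noteq> bit y j"
    proof (rule ccontr)
      assume "\<not> (\<exists>j<d. bit x j \<noteq> bit y j)"
      then have "x = y" by (intro eq_if_bits_eq[OF assms(2) that]) blast
      with False show False by simp
    qed
    then obtain j where j: "j < d" "bit x j \<noteq> bit y j" by blast
    then have "Zgate $$ (bitn x j, bitn y j) = 0"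
      by (auto simp: Zgate_def outer_def ket0_def ket1_def bitn_def)
    then have "(\<Prod>i<d. Zgate $$ (bitn x i, bitn y i)) = 0"
      using j(1) by (intro prod_zero bexI[of _ j]) auto
    then show ?thesis using False that assms(2) by (simp add: parity_op_def tensor_def)
  qed
  have "parity_op d \<in> carrier_mat (2 ^ d) (2 ^ d)" by (simp add: parity_op_def tensor_def)
  then have "(parity_op d *\<^sub>v \<psi>) $ x = (\<Sum>k<2 ^ d. parity_op d $$ (x, k) * \<psi> $ k)"
    using assms by (intro mult_mat_vec_index) auto
  also have "\<dots> = (\<Sum>k<2 ^ d. if k = x then of_int (outcome_parity d x) * \<psi> $ x else 0)"
    by (intro sum.cong refl) (auto simp: entry)
  finally show ?thesis using assms(2) by simp
qed

lemma has_parity_vanishes: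
  assumes "has_parity d \<sigma> \<psi>" "\<psi> \<in> carrier_vec (2 ^ d)" "x < 2 ^ d" "outcome_parity d x \<noteq> \<sigma>"
  shows "\<psi> $ x = 0"
proof -
  have "of_int (outcome_parity d x) * \<psi> $ x = of_int \<sigma> * \<psi> $ x"
    using parity_op_mult_vec[OF assms(2,3)] assms by (simp add: has_parity_def)
  then have "(of_int (outcome_parity d x - \<sigma>) :: complex) * \<psi> $ x = 0"
    by (simp add: algebra_simps)
  then show ?thesis using assms(4) by (simp only: mult_eq_0_iff of_int_eq_0_iff) simp
qed

section \<open>The spectral gap and the number of copies\<close>

lemma cscalar_prod_sum:
  "u \<in> carrier_vec n \<Longrightarrow> v \<in> carrier_vec n \<Longrightarrow> u \<bullet>c v = (\<Sum>i<n. u $ i * cnj (v $ i))"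
  by (auto simp: scalar_prod_def lessThan_atLeast0 intro!: sum.cong)

lemma hermitian_cscalar_prod:
  assumes A: "A \<in> carrier_mat n n" and herm: "\<And>r s. r < n \<Longrightarrow> s < n \<Longrightarrow> cnj (A $$ (r, s)) = A $$ (s, r)"
    and u: "u \<in> carrier_vec n" and v: "v \<in> carrier_vec n"
  shows "(A *\<^sub>v u) \<bullet>c v = u \<bullet>c (A *\<^sub>v v)"
proof -
  have "(A *\<^sub>v u) \<bullet>c v = (\<Sum>i<n. \<Sum>k<n. A $$ (i, k) * u $ k * cnj (v $ i))"
    using A u v mult_mat_vec_index[OF A u]
    by (simp add: cscalar_prod_sum[of _ n] sum_distrib_right)
  also have "\<dots> = (\<Sum>k<n. \<Sum>i<n. A $$ (i, k) * u $ k * cnj (v $ i))"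
    by (rule sum.swap)
  also have "\<dots> = (\<Sum>k<n. u $ k * cnj (\<Sum>i<n. A $$ (k, i) * v $ i))"
    unfolding cnj_sum sum_distrib_left using herm by (intro sum.cong) (auto simp: mult_ac)
  also have "\<dots> = u \<bullet>c (A *\<^sub>v v)"
    using A u v mult_mat_vec_index[OF A v] by (simp add: cscalar_prod_sum[of _ n])
  finally show ?thesis .
qed

text \<open>The Schur form is triangular with the eigenvalues on its diagonal, and conjugation keeps
  the trace. It serves to exclude that all eigenvalues of a shifted matrix coincide.\<close>

lemma mtrace_eq_sum_eigenvalues:
  assumes M: "M \<in> carrier_mat n n" and es: "char_poly M = (\<Prod>e\<leftarrow>es. [:- e, 1:])"
  shows "mtrace M = sum_list es"
proof -
  obtain B P Q where "schur_decomposition M es = (B, P, Q)" by (metis prod_cases3)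
  from schur_decomposition[OF M es this]
  have sim: "similar_mat_wit M B P Q" and diag: "diag_mat B = es" by auto
  from similar_mat_witD2[OF M sim]
  have PQ: "Q * P = 1\<^sub>m n" "M = P * B * Q" "B \<in> carrier_mat n n" "P \<in> carrier_mat n n"
    "Q \<in> carrier_mat n n"
    by auto
  have "mtrace M = mtrace (Q * (P * B))"
    unfolding PQ(2) using PQ by (intro mtrace_comm[of _ n]) auto
  also have "Q * (P * B) = B"
    using PQ by (simp add: assoc_mult_mat[symmetric, of Q n n P n B n])
  also have "mtrace B = sum_list (diag_mat B)"
    by (simp add: mtrace_def diag_mat_def interv_sum_list_conv_sum_set_nat lessThan_atLeast0)
  finally show ?thesis using diag by simp
qed

definition eigen_family :: "nat \<Rightarrow> complex mat \<Rightarrow> nat \<Rightarrow> (nat \<Rightarrow> complex vec) \<Rightarrow> (nat \<Rightarrow> real) \<Rightarrow> bool" where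
  "eigen_family n A k u e \<longleftrightarrow>
     (\<forall>i<k. u i \<in> carrier_vec n \<and> A *\<^sub>v u i = of_real (e i) \<cdot>\<^sub>v u i) \<and>
     (\<forall>i<k. \<forall>j<k. u i \<bullet>c u j = (if i = j then 1 else 0))"

text \<open>
  Moving the eigenvalues of the eigenvectors found so far to a number \<open>t\<close> that is not the mean of
  the remaining ones leaves an eigenvalue other than \<open>t\<close>, by the trace; its eigenvectors are
  orthogonal to the old ones.
\<close>

lemma eigen_family_extend:
  assumes A: "A \<in> carrier_mat n n" and herm: "\<And>r s. r < n \<Longrightarrow> s < n \<Longrightarrow> cnj (A $$ (r, s)) = A $$ (s, r)"
    and fam: "eigen_family n A k u e" and k: "k < n"
  shows "\<exists>u' e'. eigen_family n A (Suc k) u' e'"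
proof -
  have u: "u i \<in> carrier_vec n" "A *\<^sub>v u i = of_real (e i) \<cdot>\<^sub>v u i" if "i < k" for i
    using fam that by (auto simp: eigen_family_def)
  have orth: "u i \<bullet>c u j = (if i = j then 1 else 0)" if "i < k" "j < k" for i j
    using fam that by (auto simp: eigen_family_def)
  define c where "c = mtrace A - (\<Sum>i<k. of_real (e i))"
  define t where "t = Re c / (real n - real k) + 1"
  define M where "M = mat n n (\<lambda>(r, s). A $$ (r, s) -
    (\<Sum>i<k. of_real (e i - t) * (u i $ r * cnj (u i $ s))))"
  have M: "M \<in> carrier_mat n n" by (simp add: M_def)
  have Mv: "(M *\<^sub>v v) $ r = (A *\<^sub>v v) $ r - (\<Sum>i<k. of_real (e i - t) * (v \<bullet>c u i) * u i $ r)"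
    if v: "v \<in> carrier_vec n" and r: "r < n" for v r
  proof -
    have "(M *\<^sub>v v) $ r = (\<Sum>s<n. A $$ (r, s) * v $ s) -
        (\<Sum>s<n. \<Sum>i<k. of_real (e i - t) * (u i $ r * cnj (u i $ s)) * v $ s)"
      using r unfolding mult_mat_vec_index[OF M v r] sum_subtractf[symmetric]
      by (intro sum.cong) (auto simp: M_def left_diff_distrib sum_distrib_right)
    also have "(\<Sum>s<n. \<Sum>i<k. of_real (e i - t) * (u i $ r * cnj (u i $ s)) * v $ s) =
        (\<Sum>i<k. \<Sum>s<n. of_real (e i - t) * (u i $ r * cnj (u i $ s)) * v $ s)"
      by (rule sum.swap)
    also have "\<dots> = (\<Sum>i<k. of_real (e i - t) * (v \<bullet>c u i) * u i $ r)"
      using u(1) v by (intro sum.cong refl)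
        (simp add: cscalar_prod_sum[of _ n] sum_distrib_left sum_distrib_right mult_ac)
    finally show ?thesis using mult_mat_vec_index[OF A v r] by simp
  qed
  have Mherm: "cnj (M $$ (r, s)) = M $$ (s, r)" if "r < n" "s < n" for r s
    using that herm by (simp add: M_def mult_ac)
  have Mu: "M *\<^sub>v u i = of_real t \<cdot>\<^sub>v u i" if i: "i < k" for i
  proof (rule eq_vecI)
    fix r assume "r < dim_vec (of_real t \<cdot>\<^sub>v u i)"
    then have r: "r < n" using u(1)[OF i] by auto
    have "(\<Sum>j<k. of_real (e j - t) * (u i \<bullet>c u j) * u j $ r) =
        (\<Sum>j<k. if j = i then of_real (e i - t) * u i $ r else 0)"
      using orth i by (intro sum.cong) auto
    also have "\<dots> = of_real (e i - t) * u i $ r" using i by simp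
    finally have shift: "(\<Sum>j<k. of_real (e j - t) * (u i \<bullet>c u j) * u j $ r) =
      of_real (e i - t) * u i $ r" .
    show "(M *\<^sub>v u i) $ r = (of_real t \<cdot>\<^sub>v u i) $ r"
      unfolding Mv[OF u(1)[OF i] r] shift using r u[OF i] by (simp add: algebra_simps)
  qed (use M u(1)[OF i] in auto)
  have trace: "mtrace M = c + of_real (real k * t)"
  proof -
    have "mtrace M = mtrace A - (\<Sum>r<n. \<Sum>i<k. of_real (e i - t) * (u i $ r * cnj (u i $ r)))"
      using A by (simp add: mtrace_def M_def sum_subtractf)
    also have "(\<Sum>r<n. \<Sum>i<k. of_real (e i - t) * (u i $ r * cnj (u i $ r))) =
        (\<Sum>i<k. \<Sum>r<n. of_real (e i - t) * (u i $ r * cnj (u i $ r)))"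
      by (rule sum.swap)
    also have "\<dots> = (\<Sum>i<k. of_real (e i - t) * (u i \<bullet>c u i))"
      using u(1) by (intro sum.cong refl) (simp add: cscalar_prod_sum[of _ n] sum_distrib_left)
    also have "\<dots> = (\<Sum>i<k. of_real (e i)) - of_real (real k * t)"
      using orth by (simp add: sum_subtractf)
    finally show ?thesis by (simp add: c_def)
  qed
  obtain es where es: "char_poly M = (\<Prod>e\<leftarrow>es. [:- e, 1:])" "length es = n"
    using char_poly_factorized[OF M] by blast
  have "\<exists>l\<in>set es. l \<noteq> of_real t"
  proof (rule ccontr)
    assume "\<not> ?thesis"
    then have "es = replicate n (of_real t)" using es(2) by (intro replicate_eqI) auto
    then have "mtrace M = of_nat n * of_real t"
      using mtrace_eq_sum_eigenvalues[OF M es(1)] by (simp add: sum_list_replicate)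
    then have "Re c + real k * t = real n * t"
      using trace by (metis Re_complex_of_real of_real_mult of_real_of_nat_eq plus_complex.sel(1))
    moreover have "(real n - real k) * t = Re c + (real n - real k)"
      using k by (simp add: t_def field_simps)
    ultimately show False using k by (simp add: algebra_simps)
  qed
  then obtain l where l: "l \<in> set es" "l \<noteq> of_real t" by blast
  have "poly (char_poly M) l = 0" unfolding es(1) using l(1)
    by (auto simp: poly_prod_list prod_list_zero_iff)
  then have "eigenvalue M l" using eigenvalue_root_char_poly[OF M] by blast
  then obtain v where v: "v \<in> carrier_vec n" "v \<noteq> 0\<^sub>v n" "M *\<^sub>v v = l \<cdot>\<^sub>v v"
    using M by (auto simp: eigenvalue_def eigenvector_def)
  have perp: "v \<bullet>c u i = 0" if i: "i < k" for i
  proof -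
    have "l * (v \<bullet>c u i) = (M *\<^sub>v v) \<bullet>c u i" using v u(1)[OF i] by (simp add: v(3))
    also have "\<dots> = v \<bullet>c (M *\<^sub>v u i)" by (rule hermitian_cscalar_prod[OF M Mherm v(1) u(1)[OF i]])
    also have "\<dots> = of_real t * (v \<bullet>c u i)"
      using v(1) u(1)[OF i] unfolding Mu[OF i]
        by (simp add: cscalar_prod_sum[of _ n] sum_distrib_left mult_ac)
    finally show ?thesis using l(2) by simp
  qed
  have Av: "A *\<^sub>v v = l \<cdot>\<^sub>v v"
  proof (rule eq_vecI)
    fix r assume "r < dim_vec (l \<cdot>\<^sub>v v)"
    then have r: "r < n" using v by auto
    have "(\<Sum>i<k. of_real (e i - t) * (v \<bullet>c u i) * u i $ r) = 0"
      using perp by (intro sum.neutral) auto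
    then show "(A *\<^sub>v v) $ r = (l \<cdot>\<^sub>v v) $ r" using Mv[OF v(1) r] v(3) by simp
  qed (use A v in auto)
  have vv: "v \<bullet>c v = of_real (\<Sum>i<n. (cmod (v $ i))\<^sup>2)"
    unfolding cscalar_prod_sum[OF v(1) v(1)] of_real_sum complex_norm_square ..
  have pos: "(\<Sum>i<n. (cmod (v $ i))\<^sup>2) > 0"
  proof -
    obtain i where "i < n" "v $ i \<noteq> 0" using v(1,2) by (auto simp: vec_eq_iff)
    then show ?thesis by (intro sum_pos2[of _ i]) auto
  qed
  have "l * (v \<bullet>c v) = (A *\<^sub>v v) \<bullet>c v" using v by (simp add: Av)
  also have "\<dots> = v \<bullet>c (A *\<^sub>v v)" by (rule hermitian_cscalar_prod[OF A herm v(1) v(1)])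
  also have "\<dots> = cnj l * (v \<bullet>c v)"
    using v(1) unfolding Av by (simp add: cscalar_prod_sum[of _ n] sum_distrib_left mult_ac)
  finally have "l * (v \<bullet>c v) = cnj l * (v \<bullet>c v)" .
  moreover have "v \<bullet>c v \<noteq> 0" unfolding vv of_real_eq_0_iff using pos by simp
  ultimately have "cnj l = l" by simp
  then have l_real: "l = of_real (Re l)" by (simp add: complex_eq_iff)
  define q where "q = 1 / sqrt (\<Sum>i<n. (cmod (v $ i))\<^sup>2)"
  define w where "w = of_real q \<cdot>\<^sub>v v"
  have w: "w \<in> carrier_vec n" "A *\<^sub>v w = of_real (Re l) \<cdot>\<^sub>v w"
    using v A l_real[symmetric] mult_mat_vec[OF A v(1), of "of_real q"]
    by (simp_all add: w_def Av smult_smult_assoc mult.commute)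
  have ww: "w \<bullet>c w = 1"
  proof -
    have "w \<bullet>c w = of_real (q * q) * (v \<bullet>c v)"
      unfolding cscalar_prod_sum[OF w(1) w(1)] cscalar_prod_sum[OF v(1) v(1)] sum_distrib_left
      using v(1) by (intro sum.cong refl) (simp add: w_def)
    also have "\<dots> = of_real (q * q * (\<Sum>i<n. (cmod (v $ i))\<^sup>2))"
      unfolding vv of_real_mult ..
    also have "q * q * (\<Sum>i<n. (cmod (v $ i))\<^sup>2) = 1" using pos by (simp add: q_def)
    finally show ?thesis by simp
  qed
  have wu: "w \<bullet>c u i = 0" "u i \<bullet>c w = 0" if i: "i < k" for i
  proof -
    show 1: "w \<bullet>c u i = 0"
      using perp[OF i] v(1) u(1)[OF i] by (simp add: w_def)
    have "u i \<bullet>c w = cnj (w \<bullet>c u i)"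
      using w(1) u(1)[OF i] by (simp add: cscalar_prod_sum[of _ n] mult.commute)
    then show "u i \<bullet>c w = 0" using 1 by simp
  qed
  have "eigen_family n A (Suc k) (u(k := w)) (e(k := Re l))"
    unfolding eigen_family_def using u w orth ww wu by (auto simp: less_Suc_eq)
  then show ?thesis by blast
qed

lemma mult_mat_index:
  assumes "X \<in> carrier_mat n m" "Y \<in> carrier_mat m k" "i < n" "j < k"
  shows "(X * Y) $$ (i, j) = (\<Sum>l<m. X $$ (i, l) * Y $$ (l, j))"
  using assms by (auto simp: scalar_prod_def lessThan_atLeast0 intro!: sum.cong)

theorem hermitian_eigenbasis:
  assumes A: "A \<in> carrier_mat n n" and herm: "\<And>r s. r < n \<Longrightarrow> s < n \<Longrightarrow> cnj (A $$ (r, s)) = A $$ (s, r)"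
  obtains u e where "eigen_family n A n u e"
    "\<And>r s. r < n \<Longrightarrow> s < n \<Longrightarrow> (\<Sum>i<n. u i $ r * cnj (u i $ s)) = (if r = s then 1 else 0)"
    "\<And>r s. r < n \<Longrightarrow> s < n \<Longrightarrow> A $$ (r, s) = (\<Sum>i<n. of_real (e i) * (u i $ r * cnj (u i $ s)))"
    "char_poly A = (\<Prod>i\<leftarrow>[0..<n]. [:- of_real (e i), 1:])"
proof -
  have "\<exists>u e. eigen_family n A k u e" if "k \<le> n" for k
    using that
  proof (induction k)
    case (Suc k)
    then show ?case using eigen_family_extend[OF A herm] by (meson Suc_le_lessD Suc_leD)
  next
    case 0
    have "eigen_family n A 0 undefined undefined" by (simp add: eigen_family_def)
    then show ?case by blast
  qed
  from this[of n] obtain u e where fam: "eigen_family n A n u e" by blast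
  have u: "u i \<in> carrier_vec n" "A *\<^sub>v u i = of_real (e i) \<cdot>\<^sub>v u i" if "i < n" for i
    using fam that by (auto simp: eigen_family_def)
  have orth: "u i \<bullet>c u j = (if i = j then 1 else 0)" if "i < n" "j < n" for i j
    using fam that by (auto simp: eigen_family_def)
  define U where "U = mat n n (\<lambda>(r, i). u i $ r)"
  define V where "V = mat n n (\<lambda>(i, r). cnj (u i $ r))"
  define D where "D = mat n n (\<lambda>(i, j). if i = j then complex_of_real (e i) else 0)"
  have carrier: "U \<in> carrier_mat n n" "V \<in> carrier_mat n n" "D \<in> carrier_mat n n"
    by (simp_all add: U_def V_def D_def)
  have index_mult: "(X * Y) $$ (i, j) = (\<Sum>k<n. X $$ (i, k) * Y $$ (k, j))"
    if "X \<in> carrier_mat n n" "Y \<in> carrier_mat n n" "i < n" "j < n" for X Y :: "complex mat" and i j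
    using that by (rule mult_mat_index)
  have "V * U = 1\<^sub>m n"
  proof (rule eq_matI)
    fix i j assume "i < dim_row (1\<^sub>m n :: complex mat)" "j < dim_col (1\<^sub>m n :: complex mat)"
    then have ij: "i < n" "j < n" by auto
    have "(V * U) $$ (i, j) = u j \<bullet>c u i"
      unfolding index_mult[OF carrier(2,1) ij] cscalar_prod_sum[OF u(1)[OF ij(2)] u(1)[OF ij(1)]]
      using ij by (intro sum.cong refl) (simp add: U_def V_def)
    then show "(V * U) $$ (i, j) = 1\<^sub>m n $$ (i, j)" using orth ij by simp
  qed (use carrier in auto)
  then have UV: "U * V = 1\<^sub>m n" using mat_mult_left_right_inverse carrier by blast
  have complete: "(\<Sum>i<n. u i $ r * cnj (u i $ s)) = (if r = s then 1 else 0)" if "r < n" "s < n" for r s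
    using arg_cong[OF UV, of "\<lambda>X. X $$ (r, s)"] that
    by (simp add: index_mult carrier U_def V_def del: index_mult_mat)
  have entry: "A $$ (r, s) = (\<Sum>i<n. of_real (e i) * (u i $ r * cnj (u i $ s)))"
    if rs: "r < n" "s < n" for r s
  proof -
    have "A $$ (r, s) = (\<Sum>k<n. A $$ (r, k) * (\<Sum>i<n. u i $ k * cnj (u i $ s)))"
      using rs by (simp add: complete if_distrib[of "\<lambda>x. _ * x"] cong: if_cong)
    also have "\<dots> = (\<Sum>i<n. \<Sum>k<n. A $$ (r, k) * u i $ k * cnj (u i $ s))"
      unfolding sum_distrib_left by (subst sum.swap) (simp add: mult.assoc)
    also have "\<dots> = (\<Sum>i<n. (A *\<^sub>v u i) $ r * cnj (u i $ s))"
      using u(1) rs by (intro sum.cong refl)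
        (simp add: mult_mat_vec_index[OF A] sum_distrib_right del: index_mult_mat_vec)
    also have "\<dots> = (\<Sum>i<n. of_real (e i) * (u i $ r * cnj (u i $ s)))"
    proof (intro sum.cong refl)
      fix i assume "i \<in> {..<n}"
      then have i: "i < n" by simp
      show "(A *\<^sub>v u i) $ r * cnj (u i $ s) = of_real (e i) * (u i $ r * cnj (u i $ s))"
        unfolding u(2)[OF i] using u(1)[OF i] rs by (simp add: mult.assoc)
    qed
    finally show ?thesis .
  qed
  have "A = U * D * V"
  proof (rule eq_matI)
    fix r s assume "r < dim_row (U * D * V)" "s < dim_col (U * D * V)"
    then have rs: "r < n" "s < n" using carrier by auto
    have UD: "(U * D) $$ (r, i) = of_real (e i) * u i $ r" if "i < n" for i
    proof -
      have "(U * D) $$ (r, i) = (\<Sum>k<n. if k = i then of_real (e i) * u i $ r else 0)"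
        unfolding index_mult[OF carrier(1,3) rs(1) that] using rs that
        by (intro sum.cong) (auto simp: U_def D_def)
      then show ?thesis using that by simp
    qed
    have "(U * D * V) $$ (r, s) = (\<Sum>i<n. (U * D) $$ (r, i) * V $$ (i, s))"
      by (rule index_mult[OF mult_carrier_mat[OF carrier(1,3)] carrier(2) rs])
    also have "\<dots> = A $$ (r, s)"
      unfolding entry[OF rs] using rs by (intro sum.cong refl)
        (simp add: UD V_def mult.assoc del: index_mult_mat)
    finally show "A $$ (r, s) = (U * D * V) $$ (r, s)" ..
  qed (use A carrier in auto)
  then have "similar_mat A D"
    using A carrier UV \<open>V * U = 1\<^sub>m n\<close> by (intro similar_matI[of _ _ U V n]) auto
  then have "char_poly A = char_poly D" by (rule char_poly_similar)
  also have "\<dots> = (\<Prod>a\<leftarrow>diag_mat D. [:- a, 1:])"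
    by (rule char_poly_upper_triangular[OF carrier(3)]) (auto simp: D_def)
  also have "diag_mat D = map (\<lambda>i. complex_of_real (e i)) [0..<n]"
    by (auto simp: diag_mat_def D_def)
  finally have "char_poly A = (\<Prod>i\<leftarrow>[0..<n]. [:- of_real (e i), 1:])"
    by (simp add: comp_def)
  with fam complete entry show ?thesis by (rule that)
qed

text \<open>The description in \<open>eigenvalues_desc\<close> has a unique solution: the roots of
  the characteristic polynomial determine the multiset of the entries, and a multiset has one
  decreasing arrangement.\<close>

lemma eigenvalues_desc_eqI:
  assumes "char_poly A = (\<Prod>e\<leftarrow>xs. [:- complex_of_real e, 1:])" "sorted_wrt (\<ge>) ys" "mset ys = mset xs"
  shows "eigenvalues_desc A = ys"
proof -
  have roots: "proots (\<Prod>e\<leftarrow>zs. [:- complex_of_real e, 1:]) = image_mset complex_of_real (mset zs)" for zs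
  proof (induction zs)
    case (Cons z zs)
    have "(\<Prod>e\<leftarrow>zs. [:- complex_of_real e, 1:]) \<noteq> 0" by (auto simp: prod_list_zero_iff)
    then have "proots ([:- complex_of_real z, 1:] * (\<Prod>e\<leftarrow>zs. [:- complex_of_real e, 1:])) =
        {#complex_of_real z#} + image_mset complex_of_real (mset zs)"
      by (subst proots_mult) (simp_all add: Cons)
    then show ?case by simp
  qed simp
  have mset_eq: "mset zs = mset xs" if "char_poly A = (\<Prod>e\<leftarrow>zs. [:- complex_of_real e, 1:])" for zs
  proof -
    have "image_mset complex_of_real (mset zs) = image_mset complex_of_real (mset xs)"
      using roots[of zs] roots[of xs] that assms(1) by simp
    then have "image_mset Re (image_mset complex_of_real (mset zs)) =
      image_mset Re (image_mset complex_of_real (mset xs))"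
      by simp
    then show ?thesis by (simp add: image_mset.compositionality comp_def)
  qed
  have "char_poly A = (\<Prod>e\<leftarrow>ys. [:- complex_of_real e, 1:])"
  proof -
    have "mset (map (\<lambda>e. [:- complex_of_real e, 1:]) ys) =
      mset (map (\<lambda>e. [:- complex_of_real e, 1:]) xs)"
      using assms(3) by simp
    then have "prod_mset (mset (map (\<lambda>e. [:- complex_of_real e, 1:]) ys)) =
        prod_mset (mset (map (\<lambda>e. [:- complex_of_real e, 1:]) xs))" by (simp only:)
    then show ?thesis unfolding assms(1) prod_mset_prod_list by simp
  qed
  moreover have "zs = ys" if zs: "sorted_wrt (\<ge>) zs"
    "char_poly A = (\<Prod>e\<leftarrow>zs. [:- complex_of_real e, 1:])" for zs
  proof -
    have "mset (rev zs) = mset (rev ys)" using mset_eq[OF zs(2)] assms(3) by simp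
    moreover have "sorted (rev zs)" "sorted (rev ys)" using zs(1) assms(2)
      by (simp_all add: sorted_wrt_rev)
    ultimately have "rev zs = rev ys" by (metis properties_for_sort)
    then show ?thesis by simp
  qed
  ultimately show ?thesis
    unfolding eigenvalues_desc_def using assms(2) by (intro the_equality) blast+
qed

text \<open>Multiplicities count: one index of a largest eigenvalue is removed, and the largest
  among all other indices is the entry at position 1.\<close>

lemma second_eigenvalue:
  assumes fam: "char_poly A = (\<Prod>i\<leftarrow>[0..<n]. [:- complex_of_real (e i), 1:])"
    and n: "2 \<le> n" and i0: "i0 < n" and top: "\<And>i. i < n \<Longrightarrow> e i \<le> e i0"
  obtains i1 where "i1 < n" "i1 \<noteq> i0" "eigenvalues_desc A ! 1 = e i1"
    "\<And>i. i < n \<Longrightarrow> i \<noteq> i0 \<Longrightarrow> e i \<le> e i1"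
proof -
  define xs where "xs = map e (filter (\<lambda>i. i \<noteq> i0) [0..<n])"
  define ys where "ys = rev (sort xs)"
  have set_ys: "set ys = e ` ({..<n} - {i0})" by (auto simp: ys_def xs_def)
  have "card ({..<n} - {i0}) > 0" using n i0 by simp
  then have ys_ne: "ys \<noteq> []" using set_ys by (metis card_gt_0_iff image_is_empty set_empty)
  have sorted_ys: "sorted_wrt (\<ge>) ys" by (simp add: ys_def sorted_wrt_rev)
  have "eigenvalues_desc A = e i0 # ys"
  proof (rule eigenvalues_desc_eqI)
    show "char_poly A = (\<Prod>x\<leftarrow>map e [0..<n]. [:- complex_of_real x, 1:])"
      unfolding fam by (simp add: comp_def)
    show "sorted_wrt (\<ge>) (e i0 # ys)" using sorted_ys set_ys top by auto
    have "filter (\<lambda>i. \<not> i \<noteq> i0) [0..<n] = [i0]"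
    proof -
      have "set (filter (\<lambda>i. \<not> i \<noteq> i0) [0..<n]) = {i0}" using i0 by auto
      moreover have "distinct (filter (\<lambda>i. \<not> i \<noteq> i0) [0..<n])" by simp
      ultimately show ?thesis
        by (metis distinct_singleton set_empty2 sorted_distinct_set_unique sorted_wrt1 list.set(1)
          list.simps(15)
            sorted_filter sorted_upt map_ident)
    qed
    then have "mset [0..<n] = {#i0#} + mset (filter (\<lambda>i. i \<noteq> i0) [0..<n])"
      by (metis mset.simps(1) mset.simps(2) mset_filter multiset_partition add.commute)
    then have "image_mset e (mset [0..<n]) = {#e i0#} + mset xs"
      by (simp only: image_mset_union) (simp add: xs_def)
    then show "mset (e i0 # ys) = mset (map e [0..<n])" by (simp add: ys_def)
  qed
  then have second: "eigenvalues_desc A ! 1 = ys ! 0" by simp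
  have "ys ! 0 \<in> set ys" using ys_ne by simp
  then obtain i1 where "i1 < n" "i1 \<noteq> i0" "ys ! 0 = e i1" unfolding set_ys by auto
  moreover have "y \<le> ys ! 0" if "y \<in> set ys" for y
    using sorted_ys that ys_ne by (cases ys) auto
  ultimately show ?thesis using second set_ys by (intro that[of i1]) auto
qed

section \<open>Accept operators with a spectral gap\<close>

lemma cscalar_self:
  assumes "v \<in> carrier_vec n"
  shows "v \<bullet>c v = of_real (\<Sum>i<n. (cmod (v $ i))\<^sup>2)"
  unfolding cscalar_prod_sum[OF assms assms] of_real_sum complex_norm_square ..

lemma mtrace_mult_outer:
  assumes X: "X \<in> carrier_mat n n" and v: "v \<in> carrier_vec n"
  shows "mtrace (X * outer v v) = (X *\<^sub>v v) \<bullet>c v"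
  unfolding cscalar_prod_sum[OF mult_mat_vec_carrier[OF X v] v] using X v
  by (auto simp: mtrace_def outer_def scalar_prod_def lessThan_atLeast0 sum_distrib_right mult.assoc
    intro!: sum.cong)

text \<open>As \<open>W\<close> has no eigenvalue above 1, expectation 1 in \<open>\<phi>\<close>
  puts \<open>\<phi>\<close> into the eigenspace of 1, and the bound on the orthogonal complement
  makes this space one-dimensional. So \<open>\<phi>\<close> is an eigenvector of the basis up to a
  phase, and acceptance of \<open>\<rho>\<close> is the mean of the eigenvalues under the
  populations of \<open>\<rho>\<close>, with the fidelity as weight of the eigenvalue 1.\<close>

lemma accept_operator_gap:
  assumes W: "W \<in> carrier_mat n n" and herm: "\<And>r s. r < n \<Longrightarrow> s < n \<Longrightarrow> cnj (W $$ (r, s)) = W $$ (s, r)"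
    and n: "2 \<le> n" and phi: "\<phi> \<in> carrier_vec n" "\<phi> \<bullet>c \<phi> = 1"
    and nonneg: "\<And>v. v \<in> carrier_vec n \<Longrightarrow> 0 \<le> Re ((W *\<^sub>v v) \<bullet>c v)"
    and le: "\<And>v. v \<in> carrier_vec n \<Longrightarrow> Re ((W *\<^sub>v v) \<bullet>c v) \<le> Re (v \<bullet>c v)"
    and fixed: "Re ((W *\<^sub>v \<phi>) \<bullet>c \<phi>) = 1"
    and perp: "\<And>v. v \<in> carrier_vec n \<Longrightarrow> v \<bullet>c \<phi> = 0 \<Longrightarrow> Re ((W *\<^sub>v v) \<bullet>c v) \<le> \<mu> * Re (v \<bullet>c v)"
    and mu: "\<mu> < 1"
  defines "l \<equiv> eigenvalues_desc W ! 1"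
  shows "0 \<le> l" "l \<le> \<mu>"
    and "\<And>\<rho>. density_op n \<rho> \<Longrightarrow> 0 \<le> Re (mtrace (W * \<rho>)) \<and>
      Re (mtrace (W * \<rho>)) \<le> 1 - (1 - l) * (1 - Re ((\<rho> *\<^sub>v \<phi>) \<bullet>c \<phi>))"
proof -
  obtain u e where fam: "eigen_family n W n u e"
    and complete: "\<And>r s. r < n \<Longrightarrow> s < n \<Longrightarrow> (\<Sum>i<n. u i $ r * cnj (u i $ s)) = (if r = s then 1 else 0)"
    and entry: "\<And>r s. r < n \<Longrightarrow> s < n \<Longrightarrow> W $$ (r, s) = (\<Sum>i<n. of_real (e i) * (u i $ r * cnj (u i $ s)))"
    and cp: "char_poly W = (\<Prod>i\<leftarrow>[0..<n]. [:- of_real (e i), 1:])"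
  proof (rule hermitian_eigenbasis[OF W])
    show "cnj (W $$ (r, s)) = W $$ (s, r)" if "r < n" "s < n" for r s by (rule herm[OF that])
  qed (rule that)
  have u: "u i \<in> carrier_vec n" "W *\<^sub>v u i = of_real (e i) \<cdot>\<^sub>v u i" if "i < n" for i
    using fam that by (auto simp: eigen_family_def)
  have orth: "u i \<bullet>c u j = (if i = j then 1 else 0)" if "i < n" "j < n" for i j
    using fam that by (auto simp: eigen_family_def)
  have e_form: "Re ((W *\<^sub>v u i) \<bullet>c u i) = e i" if "i < n" for i
    using u[OF that] orth[OF that that] by simp
  have e_bounds: "0 \<le> e i" "e i \<le> 1" if "i < n" for i
    using nonneg[OF u(1)[OF that]] le[OF u(1)[OF that]] e_form[OF that] orth[OF that that] by auto
  define w where "w i = \<phi> \<bullet>c u i" for i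
  have trace_form: "mtrace (X * \<rho>) = (\<Sum>i<n. of_real (c i) * ((\<rho> *\<^sub>v u i) \<bullet>c u i))"
    if X: "X \<in> carrier_mat n n" and \<rho>: "\<rho> \<in> carrier_mat n n"
      and X_entry: "\<And>r s. r < n \<Longrightarrow> s < n \<Longrightarrow> X $$ (r, s) =
        (\<Sum>i<n. of_real (c i) * (u i $ r * cnj (u i $ s)))"
    for X \<rho> c
  proof -
    have "mtrace (X * \<rho>) = mtrace (\<rho> * X)" by (rule mtrace_comm[OF X \<rho>])
    also have "\<dots> = (\<Sum>s<n. \<Sum>r<n. \<rho> $$ (s, r) * X $$ (r, s))"
      using X \<rho> by (auto simp: mtrace_def scalar_prod_def lessThan_atLeast0 intro!: sum.cong)
    also have "\<dots> = (\<Sum>s<n. \<Sum>r<n. \<Sum>i<n. of_real (c i) * (\<rho> $$ (s, r) * u i $ r * cnj (u i $ s)))"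
      by (intro sum.cong refl) (simp add: X_entry sum_distrib_left mult_ac)
    also have "\<dots> = (\<Sum>s<n. \<Sum>i<n. \<Sum>r<n. of_real (c i) * (\<rho> $$ (s, r) * u i $ r * cnj (u i $ s)))"
      by (intro sum.cong refl sum.swap)
    also have "\<dots> = (\<Sum>i<n. \<Sum>s<n. \<Sum>r<n. of_real (c i) * (\<rho> $$ (s, r) * u i $ r * cnj (u i $ s)))"
      by (rule sum.swap)
    also have "\<dots> = (\<Sum>i<n. of_real (c i) * ((\<rho> *\<^sub>v u i) \<bullet>c u i))"
    proof (intro sum.cong refl)
      fix i assume "i \<in> {..<n}"
      then have i: "u i \<in> carrier_vec n" using u by simp
      show "(\<Sum>s<n. \<Sum>r<n. of_real (c i) * (\<rho> $$ (s, r) * u i $ r * cnj (u i $ s))) =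
          of_real (c i) * ((\<rho> *\<^sub>v u i) \<bullet>c u i)"
        unfolding cscalar_prod_sum[OF mult_mat_vec_carrier[OF \<rho> i] i] sum_distrib_left
        by (intro sum.cong refl) (simp add: mult_mat_vec_index[OF \<rho> i] sum_distrib_left sum_distrib_right
          del: index_mult_mat_vec)
    qed
    finally show ?thesis .
  qed
  have one: "1\<^sub>m n $$ (r, s) = (\<Sum>i<n. of_real 1 * (u i $ r * cnj (u i $ s)))" if "r < n" "s < n" for r s
    using complete that by simp
  have outer: "outer \<phi> \<phi> \<in> carrier_mat n n" using phi by (simp add: outer_def)
  have outer_form: "(outer \<phi> \<phi> *\<^sub>v u i) \<bullet>c u i = of_real ((cmod (w i))\<^sup>2)" if i: "i < n" for i
  proof -
    have "(outer \<phi> \<phi> *\<^sub>v u i) $ r = \<phi> $ r * cnj (w i)" if "r < n" for r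
      unfolding mult_mat_vec_index[OF outer u(1)[OF i] that] w_def cscalar_prod_sum[OF phi(1) u(1)[OF i]]
        cnj_sum sum_distrib_left
      using that phi by (intro sum.cong refl) (simp add: outer_def)
    then have "(outer \<phi> \<phi> *\<^sub>v u i) \<bullet>c u i = (\<Sum>r<n. \<phi> $ r * cnj (u i $ r)) * cnj (w i)"
      unfolding cscalar_prod_sum[OF mult_mat_vec_carrier[OF outer u(1)[OF i]] u(1)[OF i]]
        sum_distrib_right
      by (intro sum.cong) auto
    then show ?thesis unfolding complex_norm_square w_def cscalar_prod_sum[OF phi(1) u(1)[OF i]] .
  qed
  note tr_outer = mtrace_mult_outer[OF _ phi(1)]
  have sum_e_w: "(\<Sum>i<n. e i * (cmod (w i))\<^sup>2) = 1"
    using fixed trace_form[OF W outer entry] tr_outer[OF W]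
    by (simp add: outer_form flip: of_real_mult of_real_power)
  have sum_w: "(\<Sum>i<n. (cmod (w i))\<^sup>2) = 1"
  proof -
    have "mtrace (1\<^sub>m n * outer \<phi> \<phi>) = 1" unfolding tr_outer[OF one_carrier_mat] using phi by simp
    then have "complex_of_real (\<Sum>i<n. (cmod (w i))\<^sup>2) = of_real 1"
      using trace_form[OF one_carrier_mat outer one] by (simp add: outer_form flip: of_real_power)
    then show ?thesis by (simp only: of_real_eq_iff)
  qed
  have e_one: "e i = 1" if i: "i < n" "w i \<noteq> 0" for i
  proof -
    have "(\<Sum>i<n. (1 - e i) * (cmod (w i))\<^sup>2) = 0"
      using sum_e_w sum_w by (simp add: left_diff_distrib sum_subtractf)
    moreover have "0 \<le> (1 - e i) * (cmod (w i))\<^sup>2" if "i \<in> {..<n}" for i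
      using e_bounds(2)[of i] that by simp
    ultimately have "(1 - e i) * (cmod (w i))\<^sup>2 = 0"
      using i(1) by (subst (asm) sum_nonneg_eq_0_iff) auto
    then show ?thesis using i(2) by simp
  qed
  have "\<exists>i<n. w i \<noteq> 0" using sum_w by (metis (mono_tags, lifting) lessThan_iff norm_zero sum.neutral
    zero_neq_one zero_power2)
  then obtain i0 where i0: "i0 < n" "w i0 \<noteq> 0" by blast
  have u_phi: "u i \<bullet>c \<phi> = cnj (w i)" if "i < n" for i
    using u(1)[OF that] phi by (simp add: w_def cscalar_prod_sum[of _ n] mult.commute)
  have w_zero: "w j = 0" if j: "j < n" "j \<noteq> i0" for j
  proof (rule ccontr)
    assume wj: "w j \<noteq> 0"
    \<comment> \<open>If \<open>\<phi>\<close> overlapped with two basis vectors, both would have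
      eigenvalue 1. This combination of them is orthogonal to \<open>\<phi>\<close> and fixed by
      \<open>W\<close>, against \<open>\<mu> < 1\<close>.\<close>
    define v where "v = cnj (w j) \<cdot>\<^sub>v u i0 + (- cnj (w i0)) \<cdot>\<^sub>v u j"
    have v: "v \<in> carrier_vec n" using u(1)[OF i0(1)] u(1)[OF j(1)] by (simp add: v_def)
    have v_sum: "v \<bullet>c x = cnj (w j) * (u i0 \<bullet>c x) - cnj (w i0) * (u j \<bullet>c x)"
      if x: "x \<in> carrier_vec n" for x
    proof -
      have "v \<bullet>c x = (\<Sum>i<n. cnj (w j) * (u i0 $ i * cnj (x $ i)) - cnj (w i0) * (u j $ i * cnj (x $ i)))"
        unfolding cscalar_prod_sum[OF v x] using u(1)[OF i0(1)] u(1)[OF j(1)]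
        by (intro sum.cong refl) (simp add: v_def algebra_simps)
      then show ?thesis
        unfolding cscalar_prod_sum[OF u(1)[OF i0(1)] x] cscalar_prod_sum[OF u(1)[OF j(1)] x]
        by (simp add: sum_subtractf sum_distrib_left)
    qed
    have v_conj: "x \<bullet>c v = cnj (v \<bullet>c x)" if x: "x \<in> carrier_vec n" for x
      using x v by (simp add: cscalar_prod_sum[of _ n] mult.commute)
    have "v \<bullet>c \<phi> = 0" using v_sum[OF phi(1)] u_phi i0(1) j(1) by simp
    moreover have "W *\<^sub>v v = v"
    proof -
      have "W *\<^sub>v v = cnj (w j) \<cdot>\<^sub>v (W *\<^sub>v u i0) + (- cnj (w i0)) \<cdot>\<^sub>v (W *\<^sub>v u j)"
        unfolding v_def using W u(1)[OF i0(1)] u(1)[OF j(1)]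
        by (simp add: mult_add_distrib_mat_vec[of _ n n] mult_mat_vec[of _ n n])
      then show ?thesis
        using u(2)[OF i0(1)] u(2)[OF j(1)] e_one[OF i0] e_one[OF j(1) wj] by (simp add: v_def)
    qed
    ultimately have "Re (v \<bullet>c v) \<le> \<mu> * Re (v \<bullet>c v)" using perp[OF v] by simp
    moreover have "v \<bullet>c v = of_real ((cmod (w j))\<^sup>2 + (cmod (w i0))\<^sup>2)"
    proof -
      have "u i0 \<bullet>c v = w j" "u j \<bullet>c v = - w i0"
        using v_conj[OF u(1)[OF i0(1)]] v_conj[OF u(1)[OF j(1)]] v_sum[OF u(1)[OF i0(1)]]
          v_sum[OF u(1)[OF j(1)]]
          orth[OF i0(1) i0(1)] orth[OF j(1) j(1)] orth[OF i0(1) j(1)] orth[OF j(1) i0(1)] j(2) by auto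
      then show ?thesis unfolding of_real_add complex_norm_square using v_sum[OF v]
        by (simp add: mult.commute)
    qed
    ultimately have "(1 - \<mu>) * ((cmod (w j))\<^sup>2 + (cmod (w i0))\<^sup>2) \<le> 0" by (simp add: algebra_simps)
    then have "(cmod (w j))\<^sup>2 + (cmod (w i0))\<^sup>2 \<le> 0" using mu by (simp add: mult_le_0_iff)
    then show False using wj i0(2) by (simp add: sum_power2_le_zero_iff)
  qed
  have e_mu: "e j \<le> \<mu>" if j: "j < n" "j \<noteq> i0" for j
    using perp[OF u(1)[OF j(1)]] u_phi[OF j(1)] w_zero[OF j] e_form[OF j(1)] orth[OF j(1) j(1)] by simp
  have top: "e i \<le> e i0" if "i < n" for i using e_bounds(2)[OF that] e_one[OF i0] by simp
  obtain i1 where i1: "i1 < n" "i1 \<noteq> i0" "l = e i1" "\<And>i. i < n \<Longrightarrow> i \<noteq> i0 \<Longrightarrow> e i \<le> e i1"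
    unfolding l_def using second_eigenvalue[OF cp n i0(1) top] by metis
  show "0 \<le> l" "l \<le> \<mu>" using e_bounds(1) e_mu i1 by auto
  fix \<rho> assume dens: "density_op n \<rho>"
  define r where "r i = Re ((\<rho> *\<^sub>v u i) \<bullet>c u i)" for i
  have \<rho>: "\<rho> \<in> carrier_mat n n" using dens by (simp add: density_op_def)
  have r: "0 \<le> r i" if "i < n" for i using dens u(1)[OF that] by (simp add: density_op_def r_def)
  have tr_W: "Re (mtrace (W * \<rho>)) = (\<Sum>i<n. e i * r i)"
    using trace_form[OF W \<rho> entry] by (simp add: r_def)
  have tr_1: "(\<Sum>i<n. r i) = 1"
  proof -
    have "mtrace (1\<^sub>m n * \<rho>) = 1" using dens \<rho> by (simp add: density_op_def)
    then show ?thesis using trace_form[OF one_carrier_mat \<rho> one] by (simp add: r_def flip: Re_sum)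
  qed
  have "cmod (w i0) = 1"
  proof -
    have "(\<Sum>i<n. (cmod (w i))\<^sup>2) = (\<Sum>i<n. if i = i0 then (cmod (w i0))\<^sup>2 else 0)"
      using w_zero by (intro sum.cong) auto
    then have "(cmod (w i0))\<^sup>2 = 1\<^sup>2" using sum_w i0(1) by simp
    then show ?thesis by (rule power2_eq_imp_eq) simp_all
  qed
  have phi_u: "\<phi> = w i0 \<cdot>\<^sub>v u i0"
  proof (rule eq_vecI)
    fix s assume "s < dim_vec (w i0 \<cdot>\<^sub>v u i0)"
    then have s: "s < n" using u(1)[OF i0(1)] by simp
    have "\<phi> $ s = (\<Sum>r<n. \<phi> $ r * (if s = r then 1 else 0))"
      using s by (simp add: if_distrib[of "\<lambda>x. _ * x"] cong: if_cong)
    also have "\<dots> = (\<Sum>r<n. \<phi> $ r * (\<Sum>i<n. u i $ s * cnj (u i $ r)))"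
      by (intro sum.cong refl, subst complete) (use s in auto)
    also have "\<dots> = (\<Sum>i<n. w i * u i $ s)"
      unfolding sum_distrib_left w_def
      by (subst sum.swap, intro sum.cong refl)
        (simp add: cscalar_prod_sum[OF phi(1) u(1)] sum_distrib_left sum_distrib_right mult_ac)
    also have "\<dots> = (\<Sum>i<n. if i = i0 then w i0 * u i0 $ s else 0)"
      using w_zero by (intro sum.cong) auto
    also have "\<dots> = w i0 * u i0 $ s" using i0(1) by simp
    finally show "\<phi> $ s = (w i0 \<cdot>\<^sub>v u i0) $ s" using s u(1)[OF i0(1)] by simp
  qed (use phi u(1)[OF i0(1)] in auto)
  have F: "Re ((\<rho> *\<^sub>v \<phi>) \<bullet>c \<phi>) = r i0"
  proof -
    have "(\<rho> *\<^sub>v \<phi>) \<bullet>c \<phi> = (w i0 * cnj (w i0)) * ((\<rho> *\<^sub>v u i0) \<bullet>c u i0)"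
    proof -
      have ui: "u i0 \<in> carrier_vec n" by (rule u(1)[OF i0(1)])
      have "\<rho> *\<^sub>v \<phi> = w i0 \<cdot>\<^sub>v (\<rho> *\<^sub>v u i0)" unfolding phi_u by (rule mult_mat_vec[OF \<rho> ui])
      then show ?thesis
        unfolding cscalar_prod_sum[OF mult_mat_vec_carrier[OF \<rho> phi(1)] phi(1)]
          cscalar_prod_sum[OF mult_mat_vec_carrier[OF \<rho> ui] ui] sum_distrib_left
        using ui \<rho> by (intro sum.cong refl) (subst phi_u, simp add: mult_ac del: index_mult_mat_vec)
    qed
    also have "w i0 * cnj (w i0) = 1" unfolding complex_norm_square[symmetric]
      using \<open>cmod (w i0) = 1\<close> by simp
    finally show ?thesis by (simp add: r_def)
  qed
  have "(\<Sum>i<n. e i * r i) \<le> r i0 + (\<Sum>i\<in>{..<n} - {i0}. l * r i)"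
    using i0(1) e_one[OF i0] i1(3,4) r
    by (subst sum.remove[of _ i0]) (auto intro!: sum_mono mult_right_mono)
  also have "\<dots> = r i0 + l * (1 - r i0)"
    using tr_1 i0(1) by (simp add: sum_distrib_left[symmetric] sum_diff1)
  also have "\<dots> = 1 - (1 - l) * (1 - r i0)" by (simp add: algebra_simps)
  finally show "0 \<le> Re (mtrace (W * \<rho>)) \<and>
      Re (mtrace (W * \<rho>)) \<le> 1 - (1 - l) * (1 - Re ((\<rho> *\<^sub>v \<phi>) \<bullet>c \<phi>))"
    unfolding tr_W F using e_bounds(1) r by (auto intro!: sum_nonneg)
qed

text \<open>Comparing each factor \<open>a j\<close> with \<open>b exp (a j / b - 1)\<close> replaces the arithmetic-geometric mean inequality.\<close>

lemma prod_le_power_of_mean: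
  fixes a :: "nat \<Rightarrow> real"
  assumes "\<And>j. j < N \<Longrightarrow> 0 \<le> a j" "0 < b" "(\<Sum>j<N. a j) \<le> real N * b"
  shows "(\<Prod>j<N. a j) \<le> b ^ N"
proof -
  have "a j \<le> b * exp (a j / b - 1)" for j
  proof -
    have "a j / b \<le> exp (a j / b - 1)" using exp_ge_add_one_self[of "a j / b - 1"] by simp
    then have "b * (a j / b) \<le> b * exp (a j / b - 1)" using assms(2) by (intro mult_left_mono) auto
    then show ?thesis using assms(2) by simp
  qed
  then have "(\<Prod>j<N. a j) \<le> (\<Prod>j<N. b * exp (a j / b - 1))"
    using assms(1) by (intro prod_mono) auto
  also have "\<dots> = b ^ N * exp ((\<Sum>j<N. a j) / b - real N)"
    by (simp add: prod.distrib exp_sum[symmetric] sum_subtractf sum_divide_distrib)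
  also have "\<dots> \<le> b ^ N * 1"
    using assms(2,3) by (intro mult_left_mono) (simp_all add: pos_divide_le_eq)
  finally show ?thesis by simp
qed

text \<open>Everything rests on \<open>ln (1 - x) \<le> - x\<close>. The rate is the true gap
  \<open>\<gamma>\<close>, of which only the lower bound \<open>g\<close> is known; a smaller gap
  only increases the number of copies.\<close>

lemma number_of_copies:
  fixes \<gamma> g \<epsilon> \<delta> :: real
  assumes "0 < g" "g \<le> \<gamma>" "\<gamma> \<le> 1" "0 < \<epsilon>" "\<epsilon> < 1" "0 < \<delta>" "\<delta> < 1"
  defines "N \<equiv> nat \<lceil>ln \<delta> / ln (1 - \<gamma> * \<epsilon>)\<rceil>"
  shows "0 < N" "(1 - \<gamma> * \<epsilon>) ^ N \<le> \<delta>" "int N \<le> \<lceil>1 / g / \<epsilon> * ln (1 / \<delta>)\<rceil>"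
proof -
  have ge: "0 < \<gamma> * \<epsilon>" using assms by simp
  have "\<gamma> * \<epsilon> \<le> 1 * \<epsilon>" using assms by (intro mult_right_mono) auto
  then have b: "0 < 1 - \<gamma> * \<epsilon>" "1 - \<gamma> * \<epsilon> < 1" using assms ge by linarith+
  have ln_b: "ln (1 - \<gamma> * \<epsilon>) \<le> - (\<gamma> * \<epsilon>)" using ln_le_minus_one[OF b(1)] by simp
  have neg: "ln (1 - \<gamma> * \<epsilon>) < 0" using ln_b ge by linarith
  have ln_d: "ln \<delta> < 0" using assms by simp
  define q where "q = ln \<delta> / ln (1 - \<gamma> * \<epsilon>)"
  have q: "0 < q" unfolding q_def by (rule divide_neg_neg[OF ln_d neg])
  show "0 < N" unfolding N_def q_def[symmetric] using q by simp
  have "q \<le> real N" unfolding N_def q_def[symmetric] using q by linarith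
  then have "real N * ln (1 - \<gamma> * \<epsilon>) \<le> q * ln (1 - \<gamma> * \<epsilon>)" using neg by (intro mult_right_mono_neg) auto
  also have "\<dots> = ln \<delta>" using neg by (simp add: q_def)
  finally have "exp (real N * ln (1 - \<gamma> * \<epsilon>)) \<le> exp (ln \<delta>)" by simp
  then show "(1 - \<gamma> * \<epsilon>) ^ N \<le> \<delta>" using b assms by (simp add: exp_of_nat_mult)
  have "q \<le> 1 / g / \<epsilon> * ln (1 / \<delta>)"
  proof -
    have "q = ln (1 / \<delta>) / (- ln (1 - \<gamma> * \<epsilon>))" using assms by (simp add: q_def ln_div)
    also have "\<dots> \<le> ln (1 / \<delta>) / (\<gamma> * \<epsilon>)"
    proof (rule divide_left_mono)
      show "0 < - ln (1 - \<gamma> * \<epsilon>) * (\<gamma> * \<epsilon>)" using neg assms(1,2,4) by (intro mult_pos_pos) auto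
    qed (use ln_b ln_d assms in \<open>simp_all add: ln_div\<close>)
    also have "\<dots> \<le> ln (1 / \<delta>) / (g * \<epsilon>)"
      using assms ln_d by (intro divide_left_mono mult_right_mono)
        (auto simp: ln_div intro!: mult_pos_pos)
    finally show ?thesis by (simp add: mult.commute)
  qed
  then show "int N \<le> \<lceil>1 / g / \<epsilon> * ln (1 / \<delta>)\<rceil>"
    unfolding N_def q_def[symmetric] using q by (simp add: ceiling_mono)
qed

section \<open>Hermitian accept operators and certification\<close>

lemma sandwich_hermitian:
  assumes E: "E \<in> carrier_mat n n" and X: "X \<in> carrier_mat n n"
    and E_herm: "\<And>r s. r < n \<Longrightarrow> s < n \<Longrightarrow> cnj (E $$ (r, s)) = E $$ (s, r)"
    and X_herm: "\<And>r s. r < n \<Longrightarrow> s < n \<Longrightarrow> cnj (X $$ (r, s)) = X $$ (s, r)"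
    and rs: "r < n" "s < n"
  shows "cnj ((E * X * E) $$ (r, s)) = (E * X * E) $$ (s, r)"
proof -
  have index: "(E * X * E) $$ (r, s) = (\<Sum>k<n. \<Sum>l<n. E $$ (r, l) * X $$ (l, k) * E $$ (k, s))"
    if "r < n" "s < n" for r s
  proof -
    have "(E * X * E) $$ (r, s) = (\<Sum>k<n. (E * X) $$ (r, k) * E $$ (k, s))"
      using that mult_carrier_mat[OF E X] E by (intro mult_mat_index)
    also have "\<dots> = (\<Sum>k<n. (\<Sum>l<n. E $$ (r, l) * X $$ (l, k)) * E $$ (k, s))"
      using that mult_mat_index[OF E X] by (intro sum.cong) auto
    finally show ?thesis by (simp add: sum_distrib_right)
  qed
  have "cnj ((E * X * E) $$ (r, s)) = (\<Sum>k<n. \<Sum>l<n. E $$ (l, r) * X $$ (k, l) * E $$ (s, k))"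
    unfolding index[OF rs] cnj_sum using rs E_herm X_herm by (intro sum.cong refl) simp
  also have "\<dots> = (\<Sum>l<n. \<Sum>k<n. E $$ (l, r) * X $$ (k, l) * E $$ (s, k))"
    by (rule sum.swap)
  also have "\<dots> = (E * X * E) $$ (s, r)"
    unfolding index[OF rs(2,1)] by (intro sum.cong refl) (simp add: mult_ac)
  finally show ?thesis .
qed

lemma accept_op_hermitian:
  assumes "single_qubit_protocol S P" "S \<subseteq> {..<d}" "r < 2 ^ d" "s < 2 ^ d"
  shows "cnj (accept_op d P $$ (r, s)) = accept_op d P $$ (s, r)"
  using assms
proof (induction P arbitrary: S r s)
  case (Pick Ps)
  have cnj_list: "cnj (\<Sum>P\<leftarrow>Qs. g P) = (\<Sum>P\<leftarrow>Qs. cnj (g P))" for Qs :: "protocol list" and g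
    by (induction Qs) simp_all
  have "map (\<lambda>P. cnj (accept_op d P $$ (r, s))) Ps = map (\<lambda>P. accept_op d P $$ (s, r)) Ps"
    using Pick by (intro map_cong refl) (metis single_qubit_protocol.simps(3))
  then have "(\<Sum>P\<leftarrow>Ps. cnj (accept_op d P $$ (r, s))) = (\<Sum>P\<leftarrow>Ps. accept_op d P $$ (s, r))"
    by (simp only:)
  then show ?case using Pick.prems(3,4) by (simp add: cnj_list)
next
  case (Measure q u v P Q)
  have sub: "S - {q} \<subseteq> {..<d}" "q < d" using Measure.prems by auto
  have sp: "single_qubit_protocol (S - {q}) P" "single_qubit_protocol (S - {q}) Q"
    and basis: "u \<in> carrier_vec 2" "v \<in> carrier_vec 2"
    using Measure.prems(1) by (simp_all add: qubit_basis_def)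
  have part: "cnj ((on_qubit d q (outer w w) * accept_op d R * on_qubit d q (outer w w)) $$ (r, s)) =
      (on_qubit d q (outer w w) * accept_op d R * on_qubit d q (outer w w)) $$ (s, r)"
    if w: "w \<in> carrier_vec 2"
      and R: "\<And>r s. r < 2 ^ d \<Longrightarrow> s < 2 ^ d \<Longrightarrow> cnj (accept_op d R $$ (r, s)) =
        accept_op d R $$ (s, r)" for w R
    by (rule sandwich_hermitian[of _ "2 ^ d"])
      (use Measure.prems(3,4) R on_qubit_outer_hermitian[OF sub(2) w] in simp_all)
  have carrier: "on_qubit d q (outer w w) * accept_op d R * on_qubit d q (outer w w) \<in> carrier_mat
    (2 ^ d) (2 ^ d)" for w R
    by (auto intro!: mult_carrier_mat[of _ "2 ^ d" "2 ^ d"])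
  have index_add: "(X + Y) $$ (r, s) = X $$ (r, s) + Y $$ (r, s)"
    if "X \<in> carrier_mat (2 ^ d) (2 ^ d)" "Y \<in> carrier_mat (2 ^ d) (2 ^ d)" "r < 2 ^ d" "s < 2 ^ d"
    for X Y :: "complex mat" and r s
    using that by auto
  show ?case
    unfolding accept_op.simps Let_def index_add[OF carrier carrier Measure.prems(3,4)]
      index_add[OF carrier carrier Measure.prems(4,3)] complex_cnj_add
    using part[OF basis(1) Measure.IH(1)[OF sp(1) sub(1)]]
      part[OF basis(2) Measure.IH(2)[OF sp(2) sub(1)]]
    by (simp only:)
qed auto

theorem copy_test_certifies:
  fixes \<phi> :: "complex vec" and \<epsilon> \<delta> :: real
  assumes wick: "wick d \<psi>" and same: "\<And>x. x < 2 ^ d \<Longrightarrow> cmod (\<phi> $ x) = cmod (\<psi> x)" and d: "2 \<le> d"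
    and par: "\<And>x. x < 2 ^ d \<Longrightarrow> outcome_parity d x \<noteq> \<sigma> \<Longrightarrow> \<phi> $ x = 0" "\<sigma> \<in> {1, - 1}"
    and phi: "\<phi> \<in> carrier_vec (2 ^ d)" "sqnorm d (($) \<phi>) = 1"
    and range: "0 < \<epsilon>" "\<epsilon> < 1" "0 < \<delta>" "\<delta> < 1"
  defines "P \<equiv> copy_test d \<sigma> \<phi>"
  shows "certifies d P \<phi> (num_copies d P \<epsilon> \<delta>) \<epsilon> \<delta>"
    and "int (num_copies d P \<epsilon> \<delta>) \<le> \<lceil>real d * (real d - 1) / \<epsilon> * ln (1 / \<delta>)\<rceil>"
proof -
  note test = accept_copy_test[OF wick same d par, folded P_def]
  define W where "W = accept_op d P"
  define g where "g = 1 / (real d * (real d - 1))"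
  define l where "l = eigenvalues_desc W ! 1"
  have W: "W \<in> carrier_mat (2 ^ d) (2 ^ d)" by (simp add: W_def)
  have form: "Re ((W *\<^sub>v v) \<bullet>c v) = pure_accept d P (($) v)" if v: "v \<in> carrier_vec (2 ^ d)" for v
  proof -
    have "outer v v \<in> carrier_mat (2 ^ d) (2 ^ d)" using v by (simp add: outer_def)
    then have "Re (mtrace (W * outer v v)) = accept_prob d P (outer v v)"
      unfolding W_def by (rule accept_prob_accept_op[symmetric])
    then show ?thesis
      using mtrace_mult_outer[OF W v] accept_prob_outer[OF test(1) order_refl v] by simp
  qed
  have norm: "Re (v \<bullet>c v) = sqnorm d (($) v)" if "v \<in> carrier_vec (2 ^ d)" for v
    unfolding cscalar_self[OF that] sqnorm_def by simp
  have d2: "(2 :: nat) \<le> 2 ^ d"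
    using d power_increasing[of 1 d "2 :: nat"] by simp
  have "0 < real d * (real d - 1)" using d by simp
  then have g: "0 < g" by (simp add: g_def)
  have gap: "0 \<le> l \<and> l \<le> 1 - g \<and> (\<forall>\<rho>. density_op (2 ^ d) \<rho> \<longrightarrow> 0 \<le> Re (mtrace (W * \<rho>)) \<and>
      Re (mtrace (W * \<rho>)) \<le> 1 - (1 - l) * (1 - Re ((\<rho> *\<^sub>v \<phi>) \<bullet>c \<phi>)))"
  proof -
    have herm: "cnj (W $$ (r, s)) = W $$ (s, r)" if "r < 2 ^ d" "s < 2 ^ d" for r s
      unfolding W_def by (rule accept_op_hermitian[OF test(1) order_refl that])
    have unit: "\<phi> \<bullet>c \<phi> = 1"
      unfolding cscalar_self[OF phi(1)] using phi(2) by (simp add: sqnorm_def)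
    have nonneg: "0 \<le> Re ((W *\<^sub>v v) \<bullet>c v)" "Re ((W *\<^sub>v v) \<bullet>c v) \<le> Re (v \<bullet>c v)"
      if "v \<in> carrier_vec (2 ^ d)" for v
      using pure_accept_bounds[OF test(1) order_refl] by (simp_all add: form norm that)
    have fixed: "Re ((W *\<^sub>v \<phi>) \<bullet>c \<phi>) = 1" using form[OF phi(1)] test(2) phi(2) by simp
    have perp: "Re ((W *\<^sub>v v) \<bullet>c v) \<le> (1 - g) * Re (v \<bullet>c v)"
      if v: "v \<in> carrier_vec (2 ^ d)" "v \<bullet>c \<phi> = 0" for v
    proof -
      have "ip d (($) \<phi>) (($) v) = 0"
        using v phi(1) by (simp add: cscalar_prod_sum[of _ "2 ^ d"] ip_def mult.commute)
      then show ?thesis using test(3)[of "($) v"] by (simp add: form norm v(1) g_def)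
    qed
    have mu: "1 - g < 1" using g by simp
    have "0 \<le> l" unfolding l_def
      by (rule accept_operator_gap(1)[OF W herm d2 phi(1) unit nonneg fixed perp mu])
    moreover have "l \<le> 1 - g" unfolding l_def
      by (rule accept_operator_gap(2)[OF W herm d2 phi(1) unit nonneg fixed perp mu])
    moreover have "0 \<le> Re (mtrace (W * \<rho>)) \<and>
        Re (mtrace (W * \<rho>)) \<le> 1 - (1 - l) * (1 - Re ((\<rho> *\<^sub>v \<phi>) \<bullet>c \<phi>))"
      if "density_op (2 ^ d) \<rho>" for \<rho>
      unfolding l_def by (rule accept_operator_gap(3)[OF W herm d2 phi(1) unit nonneg fixed
        perp mu that])
    ultimately show ?thesis by blast
  qed
  have gamma: "spectral_gap (accept_op d P) = 1 - l" by (simp add: spectral_gap_def l_def W_def)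
  have N: "num_copies d P \<epsilon> \<delta> = nat \<lceil>ln \<delta> / ln (1 - (1 - l) * \<epsilon>)\<rceil>"
    by (simp add: num_copies_def gamma)
  have "g \<le> 1 - l" "1 - l \<le> 1" using gap by simp_all
  note copies = number_of_copies[OF g this range, folded N]
  show "int (num_copies d P \<epsilon> \<delta>) \<le> \<lceil>real d * (real d - 1) / \<epsilon> * ln (1 / \<delta>)\<rceil>"
    using copies(3) by (simp add: g_def)
  have "accept_prob d P (outer \<phi> \<phi>) = 1"
    using accept_prob_outer[OF test(1) order_refl phi(1)] test(2) phi(2) by simp
  moreover have "all_accept_prob d P (num_copies d P \<epsilon> \<delta>) \<rho> \<le> \<delta>"
    if dens: "\<forall>j<num_copies d P \<epsilon> \<delta>. density_op (2 ^ d) (\<rho> j)"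
      and infid: "(1 / num_copies d P \<epsilon> \<delta>) * (\<Sum>j<num_copies d P \<epsilon> \<delta>. 1 - Re ((\<rho> j *\<^sub>v \<phi>) \<bullet>c \<phi>)) \<ge> \<epsilon>"
        for \<rho>
  proof -
    define n where "n = num_copies d P \<epsilon> \<delta>"
    define b where "b = 1 - (1 - l) * \<epsilon>"
    have "(1 - l) * \<epsilon> \<le> 1 * \<epsilon>" using gap range by (intro mult_right_mono) auto
    then have b: "0 < b" unfolding b_def using range by linarith
    have n: "0 < n" using copies(1) by (simp add: n_def)
    have prob: "accept_prob d P (\<rho> j) = Re (mtrace (W * \<rho> j))" "density_op (2 ^ d) (\<rho> j)"
      if "j < n" for j
      using dens that unfolding W_def by (auto simp: n_def density_op_def intro!: accept_prob_accept_op)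
    \<comment> \<open>The copies may differ and only their mean infidelity is bounded below. The
      linear bounds on the single acceptance probabilities are therefore summed before the product
      is estimated.\<close>
    have "(\<Sum>j<n. accept_prob d P (\<rho> j)) \<le> (\<Sum>j<n. 1 - (1 - l) * (1 - Re ((\<rho> j *\<^sub>v \<phi>) \<bullet>c \<phi>)))"
      using gap prob by (intro sum_mono) auto
    also have "\<dots> = real n - (1 - l) * (\<Sum>j<n. 1 - Re ((\<rho> j *\<^sub>v \<phi>) \<bullet>c \<phi>))"
    proof -
      have "(\<Sum>j<n. 1 - c * t j) = real n - c * (\<Sum>j<n. t j)" for c and t :: "nat \<Rightarrow> real"
        by (simp add: sum_subtractf sum_distrib_left)
      then show ?thesis .
    qed
    also have "\<dots> \<le> real n - (1 - l) * (real n * \<epsilon>)"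
    proof -
      have "real n * \<epsilon> \<le> (\<Sum>j<n. 1 - Re ((\<rho> j *\<^sub>v \<phi>) \<bullet>c \<phi>))"
        using infid n unfolding n_def[symmetric] by (simp add: field_simps)
      then have "(1 - l) * (real n * \<epsilon>) \<le> (1 - l) * (\<Sum>j<n. 1 - Re ((\<rho> j *\<^sub>v \<phi>) \<bullet>c \<phi>))"
        using \<open>g \<le> 1 - l\<close> g by (intro mult_left_mono) auto
      then show ?thesis by linarith
    qed
    also have "\<dots> = real n * b" by (simp add: b_def algebra_simps)
    finally have "(\<Prod>j<n. accept_prob d P (\<rho> j)) \<le> b ^ n"
      using gap prob b by (intro prod_le_power_of_mean) auto
    also have "\<dots> \<le> \<delta>" using copies(2) by (simp add: b_def n_def)
    finally show ?thesis by (simp add: all_accept_prob_def n_def)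
  qed
  ultimately show "certifies d P \<phi> (num_copies d P \<epsilon> \<delta>) \<epsilon> \<delta>"
    unfolding certifies_def using copies(1) by (simp add: all_accept_prob_def)
qed

section \<open>Programs\<close>

text \<open>Relocation of a program by \<open>k\<close> arrays, so that copies can run side by side in one store.\<close>

primrec shift_nexp :: "nat \<Rightarrow> nexp \<Rightarrow> nexp" where
  "shift_nexp k (NConst n) = NConst n"
| "shift_nexp k (NCell a i) = NCell (a + k) (shift_nexp k i)"
| "shift_nexp k (NAdd e f) = NAdd (shift_nexp k e) (shift_nexp k f)"
| "shift_nexp k (NSub e f) = NSub (shift_nexp k e) (shift_nexp k f)"

primrec shift_rexp :: "nat \<Rightarrow> rexp \<Rightarrow> rexp" where
  "shift_rexp k (RConst n) = RConst n"
| "shift_rexp k (RCell a i j) = RCell (a + k) (shift_nexp k i) (shift_nexp k j)"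
| "shift_rexp k (RAdd e f) = RAdd (shift_rexp k e) (shift_rexp k f)"
| "shift_rexp k (RSub e f) = RSub (shift_rexp k e) (shift_rexp k f)"
| "shift_rexp k (RMul e f) = RMul (shift_rexp k e) (shift_rexp k f)"
| "shift_rexp k (RDiv e f) = RDiv (shift_rexp k e) (shift_rexp k f)"
| "shift_rexp k (RFun g e) = RFun g (shift_rexp k e)"

primrec shift_bexp :: "nat \<Rightarrow> bexp \<Rightarrow> bexp" where
  "shift_bexp k (NLess e f) = NLess (shift_nexp k e) (shift_nexp k f)"
| "shift_bexp k (RLess e f) = RLess (shift_rexp k e) (shift_rexp k f)"
| "shift_bexp k (BNot b) = BNot (shift_bexp k b)"
| "shift_bexp k (BAnd b c) = BAnd (shift_bexp k b) (shift_bexp k c)"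

primrec shift_com :: "nat \<Rightarrow> com \<Rightarrow> com" where
  "shift_com k Skip = Skip"
| "shift_com k (NAssign a i e) = NAssign (a + k) (shift_nexp k i) (shift_nexp k e)"
| "shift_com k (RAssign a i j e) = RAssign (a + k) (shift_nexp k i) (shift_nexp k j) (shift_rexp k e)"
| "shift_com k (Seq c1 c2) = Seq (shift_com k c1) (shift_com k c2)"
| "shift_com k (Cond b c1 c2) = Cond (shift_bexp k b) (shift_com k c1) (shift_com k c2)"
| "shift_com k (While b c) = While (shift_bexp k b) (shift_com k c)"

text \<open>Array names are constants of the program and only positions inside an array are
  computed. So the text of a program bounds the arrays it can reach, and a relocated copy stays
  inside a window of this size.\<close>

primrec arrays_nexp :: "nexp \<Rightarrow> nat" where
  "arrays_nexp (NConst n) = 0"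
| "arrays_nexp (NCell a i) = max (Suc a) (arrays_nexp i)"
| "arrays_nexp (NAdd e f) = max (arrays_nexp e) (arrays_nexp f)"
| "arrays_nexp (NSub e f) = max (arrays_nexp e) (arrays_nexp f)"

primrec arrays_rexp :: "rexp \<Rightarrow> nat" where
  "arrays_rexp (RConst n) = 0"
| "arrays_rexp (RCell a i j) = max (Suc a) (max (arrays_nexp i) (arrays_nexp j))"
| "arrays_rexp (RAdd e f) = max (arrays_rexp e) (arrays_rexp f)"
| "arrays_rexp (RSub e f) = max (arrays_rexp e) (arrays_rexp f)"
| "arrays_rexp (RMul e f) = max (arrays_rexp e) (arrays_rexp f)"
| "arrays_rexp (RDiv e f) = max (arrays_rexp e) (arrays_rexp f)"
| "arrays_rexp (RFun g e) = arrays_rexp e"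

primrec arrays_bexp :: "bexp \<Rightarrow> nat" where
  "arrays_bexp (NLess e f) = max (arrays_nexp e) (arrays_nexp f)"
| "arrays_bexp (RLess e f) = max (arrays_rexp e) (arrays_rexp f)"
| "arrays_bexp (BNot b) = arrays_bexp b"
| "arrays_bexp (BAnd b c) = max (arrays_bexp b) (arrays_bexp c)"

primrec arrays_com :: "com \<Rightarrow> nat" where
  "arrays_com Skip = 0"
| "arrays_com (NAssign a i e) = max (Suc a) (max (arrays_nexp i) (arrays_nexp e))"
| "arrays_com (RAssign a i j e) = max (Suc a)
  (max (arrays_nexp i) (max (arrays_nexp j) (arrays_rexp e)))"
| "arrays_com (Seq c1 c2) = max (arrays_com c1) (arrays_com c2)"
| "arrays_com (Cond b c1 c2) = max (arrays_bexp b) (max (arrays_com c1) (arrays_com c2))"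
| "arrays_com (While b c) = max (arrays_bexp b) (arrays_com c)"

definition embeds :: "nat \<Rightarrow> nat \<Rightarrow> store \<Rightarrow> store \<Rightarrow> bool" where
  "embeds k B s S \<longleftrightarrow> (\<forall>a<B. nmem S (a + k) = nmem s a \<and> rmem S (a + k) = rmem s a)"

definition frame :: "nat set \<Rightarrow> nat set \<Rightarrow> store \<Rightarrow> store \<Rightarrow> bool" where
  "frame X Y s s' \<longleftrightarrow> (\<forall>a. a \<notin> X \<longrightarrow> nmem s' a = nmem s a) \<and> (\<forall>a. a \<notin> Y \<longrightarrow> rmem s' a = rmem s a)"

lemma frame_refl [simp]: "frame X Y s s"
  by (simp add: frame_def)

lemma frame_trans:
  assumes "frame X Y s s'" "frame X' Y' s' s''" "X \<subseteq> X''" "X' \<subseteq> X''" "Y \<subseteq> Y''" "Y' \<subseteq> Y''"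
  shows "frame X'' Y'' s s''"
  using assms unfolding frame_def by (metis subsetD)

lemma frame_nupd: "a \<in> X \<Longrightarrow> frame X Y s (nupd s' a i n) \<longleftrightarrow> frame X Y s s'"
  by (auto simp: frame_def nupd_def)

lemma frame_rupd: "a \<in> Y \<Longrightarrow> frame X Y s (rupd s' a i j r) \<longleftrightarrow> frame X Y s s'"
  by (auto simp: frame_def rupd_def)

lemma nmem_nupd [simp]: "nmem (nupd s a i n) b j = (if b = a \<and> j = i then n else nmem s b j)"
  "rmem (nupd s a i n) = rmem s"
  by (simp_all add: nupd_def)

lemma rmem_rupd [simp]: "rmem (rupd s a i j r) b k l =
  (if b = a \<and> k = i \<and> l = j then r else rmem s b k l)"
  "nmem (rupd s a i j r) = nmem s"
  by (simp_all add: rupd_def)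

lemma nval_shift:
  assumes "embeds k B s S" "arrays_nexp e \<le> B"
  shows "nval (shift_nexp k e) S = nval e s"
  using assms(2) by (induction e) (use assms(1) in \<open>auto simp: embeds_def\<close>)

lemma rval_shift:
  assumes "embeds k B s S" "arrays_rexp e \<le> B"
  shows "rval (shift_rexp k e) S = rval e s"
  using assms(2) by (induction e) (use assms(1) nval_shift[OF assms(1)] in \<open>auto simp: embeds_def\<close>)

lemma bval_shift:
  assumes "embeds k B s S" "arrays_bexp b \<le> B"
  shows "bval (shift_bexp k b) S = bval b s"
  using assms(2)
  by (induction b) (use nval_shift[OF assms(1)] rval_shift[OF assms(1)] in auto)

lemma ncost_shift [simp]: "ncost (shift_nexp k e) = ncost e"
  by (induction e) simp_all

lemma rcost_shift [simp]: "rcost (shift_rexp k e) = rcost e"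
  by (induction e) simp_all

lemma bcost_shift [simp]: "bcost (shift_bexp k b) = bcost b"
  by (induction b) simp_all

lemma embeds_nupd:
  "embeds k B s S \<Longrightarrow> embeds k B (nupd s a i n) (nupd S (a + k) i n)"
  by (auto simp: embeds_def nupd_def)

lemma embeds_rupd:
  "embeds k B s S \<Longrightarrow> embeds k B (rupd s a i j r) (rupd S (a + k) i j r)"
  by (auto simp: embeds_def rupd_def)

lemma exec_shift:
  assumes "exec c s t s'" "arrays_com c \<le> B" "embeds k B s S"
  shows "\<exists>S'. exec (shift_com k c) S t S' \<and> embeds k B s' S' \<and> frame {k..<k + B} {k..<k + B} S S'"
  using assms
proof (induction arbitrary: S rule: exec.induct)
  case (Skip s)
  then show ?case using exec.Skip[of S] by (intro exI[of _ S]) simp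
next
  case (NAssign a i e s)
  let ?S = "nupd S (a + k) (nval i s) (nval e s)"
  have "exec (shift_com k (com.NAssign a i e)) S (1 + ncost i + ncost e) ?S"
    using exec.NAssign[of "a + k" "shift_nexp k i" "shift_nexp k e" S] NAssign.prems
    by (simp add: nval_shift[of k B])
  then show ?case using NAssign.prems by (intro exI[of _ ?S]) (simp add: embeds_nupd frame_nupd)
next
  case (RAssign a i j e s)
  let ?S = "rupd S (a + k) (nval i s) (nval j s) (rval e s)"
  have "exec (shift_com k (com.RAssign a i j e)) S (1 + ncost i + ncost j + rcost e) ?S"
    using exec.RAssign[of "a + k" "shift_nexp k i" "shift_nexp k j" "shift_rexp k e" S] RAssign.prems
    by (simp add: nval_shift[of k B] rval_shift[of k B])
  then show ?case using RAssign.prems by (intro exI[of _ ?S]) (simp add: embeds_rupd frame_rupd)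
next
  case (Seq c1 s t1 s' c2 t2 s'')
  obtain S1 where S1: "exec (shift_com k c1) S t1 S1" "embeds k B s' S1"
    "frame {k..<k + B} {k..<k + B} S S1"
    using Seq.IH(1)[of S] Seq.prems by auto
  obtain S2 where S2: "exec (shift_com k c2) S1 t2 S2" "embeds k B s'' S2"
    "frame {k..<k + B} {k..<k + B} S1 S2"
    using Seq.IH(2)[of S1] Seq.prems S1(2) by auto
  show ?case
    using exec.Seq[OF S1(1) S2(1)] S2(2) frame_trans[OF S1(3) S2(3)] by (intro exI[of _ S2]) simp
next
  case (CondTrue b s c1 t s' c2)
  then obtain S1 where S1: "exec (shift_com k c1) S t S1" "embeds k B s' S1"
    "frame {k..<k + B} {k..<k + B} S S1"
    by auto
  have "bval (shift_bexp k b) S" using CondTrue.hyps CondTrue.prems by (simp add: bval_shift[of k B])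
  from exec.CondTrue[OF this S1(1), of "shift_com k c2"] show ?case
    using S1(2,3) by (intro exI[of _ S1]) simp
next
  case (CondFalse b s c2 t s' c1)
  then obtain S1 where S1: "exec (shift_com k c2) S t S1" "embeds k B s' S1"
    "frame {k..<k + B} {k..<k + B} S S1"
    by auto
  have "\<not> bval (shift_bexp k b) S" using CondFalse.hyps CondFalse.prems by (simp add: bval_shift[of k B])
  from exec.CondFalse[OF this S1(1), of "shift_com k c1"] show ?case
    using S1(2,3) by (intro exI[of _ S1]) simp
next
  case (WhileFalse b s c)
  have "\<not> bval (shift_bexp k b) S" using WhileFalse by (simp add: bval_shift[of k B])
  then show ?case using exec.WhileFalse[of "shift_bexp k b" S "shift_com k c"] WhileFalse.prems
    by (intro exI[of _ S]) simp
next
  case (WhileTrue b s c t1 s' t2 s'')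
  obtain S1 where S1: "exec (shift_com k c) S t1 S1" "embeds k B s' S1"
    "frame {k..<k + B} {k..<k + B} S S1"
    using WhileTrue.IH(1)[of S] WhileTrue.prems by auto
  obtain S2 where S2: "exec (shift_com k (While b c)) S1 t2 S2" "embeds k B s'' S2"
    "frame {k..<k + B} {k..<k + B} S1 S2"
    using WhileTrue.IH(2)[of S1] WhileTrue.prems S1(2) by auto
  have "bval (shift_bexp k b) S" using WhileTrue.hyps WhileTrue.prems by (simp add: bval_shift[of k B])
  then show ?case
    using exec.WhileTrue[OF _ S1(1) S2(1)[unfolded shift_com.simps]] S2(2) frame_trans[OF S1(3) S2(3)]
    by (intro exI[of _ S2]) simp
qed

text \<open>Total correctness with a time bound, for one initial store; the rules below are those of
  a Hoare logic.\<close>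

definition run :: "com \<Rightarrow> store \<Rightarrow> nat \<Rightarrow> (store \<Rightarrow> bool) \<Rightarrow> bool" where
  "run c s T Q \<longleftrightarrow> (\<exists>t s'. exec c s t s' \<and> t \<le> T \<and> Q s')"

lemma run_mono: "run c s T Q \<Longrightarrow> T \<le> T' \<Longrightarrow> (\<And>s'. Q s' \<Longrightarrow> Q' s') \<Longrightarrow> run c s T' Q'"
  unfolding run_def by (meson order_trans)

lemma run_Skip: "Q s \<Longrightarrow> 1 \<le> T \<Longrightarrow> run Skip s T Q"
  unfolding run_def using exec.Skip by blast

lemma run_NAssign:
  "Q (nupd s a (nval i s) (nval e s)) \<Longrightarrow> 1 + ncost i + ncost e \<le> T \<Longrightarrow> run (NAssign a i e) s T Q"
  unfolding run_def using exec.NAssign by blast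

lemma run_RAssign:
  "Q (rupd s a (nval i s) (nval j s) (rval e s)) \<Longrightarrow> 1 + ncost i + ncost j + rcost e \<le> T \<Longrightarrow>
    run (RAssign a i j e) s T Q"
  unfolding run_def using exec.RAssign by blast

lemma run_Seq:
  assumes "run c1 s T1 R" "\<And>s'. R s' \<Longrightarrow> run c2 s' T2 Q" "1 + T1 + T2 \<le> T"
  shows "run (Seq c1 c2) s T Q"
proof -
  obtain t1 s1 where 1: "exec c1 s t1 s1" "t1 \<le> T1" "R s1" using assms(1) by (auto simp: run_def)
  obtain t2 s2 where 2: "exec c2 s1 t2 s2" "t2 \<le> T2" "Q s2" using assms(2)[OF 1(3)]
    by (auto simp: run_def)
  have "1 + t1 + t2 \<le> T" using 1(2) 2(2) assms(3) by simp
  then show ?thesis using exec.Seq[OF 1(1) 2(1)] 2(3) unfolding run_def by blast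
qed

lemma run_Cond:
  assumes "bval b s \<Longrightarrow> run c1 s T1 Q" "\<not> bval b s \<Longrightarrow> run c2 s T1 Q" "1 + bcost b + T1 \<le> T"
  shows "run (Cond b c1 c2) s T Q"
proof (cases "bval b s")
  case True
  then obtain t s' where 1: "exec c1 s t s'" "t \<le> T1" "Q s'" using assms(1) by (auto simp: run_def)
  have "1 + bcost b + t \<le> T" using 1(2) assms(3) by simp
  then show ?thesis using exec.CondTrue[OF True 1(1)] 1(3) unfolding run_def by blast
next
  case False
  then obtain t s' where 1: "exec c2 s t s'" "t \<le> T1" "Q s'" using assms(2) by (auto simp: run_def)
  have "1 + bcost b + t \<le> T" using 1(2) assms(3) by simp
  then show ?thesis using exec.CondFalse[OF False 1(1)] 1(3) unfolding run_def by blast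
qed

abbreviation ncell :: "nat \<Rightarrow> nexp" where
  "ncell a \<equiv> NCell a (NConst 0)"

definition For :: "nat \<Rightarrow> nexp \<Rightarrow> com \<Rightarrow> com" where
  "For v n c = Seq (NAssign v (NConst 0) (NConst 0))
     (While (NLess (ncell v) n) (Seq c (NAssign v (NConst 0) (NAdd (ncell v) (NConst 1)))))"

text \<open>The invariant for \<open>Suc i\<close> is demanded of the store with the counter already
  incremented, so the body has to leave the counter unchanged. One pass costs at most 12 steps
  besides the body and the bound; the additional pass in \<open>m + 1\<close> pays for the
  initialisation and the last test.\<close>

lemma run_For:
  assumes start: "I 0 (nupd s v 0 0)"
    and counter: "\<And>i s. I i s \<Longrightarrow> nmem s v 0 = i \<and> nval n s = m"
    and step: "\<And>i s. i < m \<Longrightarrow> I i s \<Longrightarrow> run c s T (\<lambda>s'. nmem s' v 0 = i \<and> I (Suc i) (nupd s' v 0 (Suc i)))"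
  shows "run (For v n c) s ((m + 1) * (T + ncost n + 12)) (I m)"
proof -
  let ?w = "While (NLess (ncell v) n) (Seq c (NAssign v (NConst 0) (NAdd (ncell v) (NConst 1))))"
  have loop: "run ?w s (k * (T + ncost n + 12) + ncost n + 4) (I m)" if "I i s" "i + k = m" for i k s
    using that
  proof (induction k arbitrary: i s)
    case 0
    then have "\<not> bval (NLess (ncell v) n) s" using counter[OF 0(1)] by simp
    from exec.WhileFalse[OF this] show ?case
      using 0 unfolding run_def by (intro exI[of _ "1 + bcost (NLess (ncell v) n)"] exI[of _ s]) simp
  next
    case (Suc k)
    then have b: "bval (NLess (ncell v) n) s" using counter[OF Suc.prems(1)] by simp
    obtain t1 s1 where 1: "exec c s t1 s1" "t1 \<le> T" "nmem s1 v 0 = i" "I (Suc i) (nupd s1 v 0 (Suc i))"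
      using step[of i s] Suc.prems by (auto simp: run_def)
    have inc: "exec (NAssign v (NConst 0) (NAdd (ncell v) (NConst 1))) s1 6 (nupd s1 v 0 (Suc i))"
      using exec.NAssign[of v "NConst 0" "NAdd (ncell v) (NConst 1)" s1] 1(3)
      by (simp add: eval_nat_numeral)
    obtain t2 s2 where 2: "exec ?w (nupd s1 v 0 (Suc i)) t2 s2"
      "t2 \<le> k * (T + ncost n + 12) + ncost n + 4" "I m s2"
      using Suc.IH[OF 1(4)] Suc.prems by (auto simp: run_def)
    show ?case
      unfolding run_def using exec.WhileTrue[OF b exec.Seq[OF 1(1) inc] 2(1)] 2(2,3) 1(2)
      by (intro exI conjI) auto
  qed
  show ?thesis
    unfolding For_def
  proof (rule run_Seq)
    show "run (NAssign v (NConst 0) (NConst 0)) s 3 (I 0)"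
      by (rule run_NAssign) (use start in simp_all)
    show "run ?w s' (m * (T + ncost n + 12) + ncost n + 4) (I m)" if "I 0 s'" for s'
      using loop[OF that, of m] by simp
  qed simp
qed

section \<open>Loops over matrix entries and evaluation of the phase\<close>

definition dim2 :: nexp where
  "dim2 = NAdd (ncell 0) (ncell 0)"

definition mat_assign :: "nat \<Rightarrow> rexp \<Rightarrow> com" where
  "mat_assign a e = For 4 dim2 (For 5 dim2 (RAssign a (ncell 4) (ncell 5) e))"

definition mat_assign_cost :: "nat \<Rightarrow> rexp \<Rightarrow> nat" where
  "mat_assign_cost m e = (m + 1) * ((m + 1) * (rcost e + 22) + 17)"

text \<open>The value of \<open>e\<close> is required in all stores that differ from the initial one
  in the target array, so \<open>e\<close> must not depend on entries already overwritten. An update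
  in place therefore needs a copy of the matrix.\<close>

lemma run_mat_assign:
  assumes m: "m = 2 * nmem s 0 0"
    and e: "\<And>s' j k. frame {4, 5} {a} s s' \<Longrightarrow> nmem s' 4 0 = j \<Longrightarrow> nmem s' 5 0 = k \<Longrightarrow> j < m \<Longrightarrow> k < m \<Longrightarrow>
      rval e s' = f j k"
  shows "run (mat_assign a e) s (mat_assign_cost m e)
    (\<lambda>s'. frame {4, 5} {a} s s' \<and> (\<forall>j<m. \<forall>k<m. rmem s' a j k = f j k))"
proof -
  define J where "J j s' \<longleftrightarrow> frame {4, 5} {a} s s' \<and> nmem s' 4 0 = j \<and>
    (\<forall>j'<j. \<forall>k'<m. rmem s' a j' k' = f j' k')" for j s'
  define I where "I j k s' \<longleftrightarrow> J j s' \<and> nmem s' 5 0 = k \<and> (\<forall>k'<k. rmem s' a j k' = f j k')" for j k s'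
  have dim2: "nval dim2 s' = m" if "frame {4, 5} {a} s s'" for s'
    using that m by (simp add: dim2_def frame_def)
  have inner: "run (For 5 dim2 (RAssign a (ncell 4) (ncell 5) e)) s'
    ((m + 1) * (rcost e + 5 + ncost dim2 + 12)) (I j m)"
    if j: "j < m" and J: "J j s'" for j s'
  proof (rule run_For)
    show "I j 0 (nupd s' 5 0 0)" using J by (simp add: I_def J_def frame_nupd)
    show "nmem s 5 0 = i \<and> nval dim2 s = m" if "I j i s" for i s
      using that dim2 by (auto simp: I_def J_def)
    fix k s1 assume k: "k < m" and I: "I j k s1"
    have "rval e s1 = f j k" using I j k by (intro e) (auto simp: I_def J_def)
    then show "run (RAssign a (ncell 4) (ncell 5) e) s1 (rcost e + 5)
        (\<lambda>s'. nmem s' 5 0 = k \<and> I j (Suc k) (nupd s' 5 0 (Suc k)))"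
      using I by (intro run_RAssign) (auto simp: I_def J_def frame_nupd frame_rupd less_Suc_eq)
  qed
  have "run (For 4 dim2 (For 5 dim2 (RAssign a (ncell 4) (ncell 5) e))) s
      ((m + 1) * ((m + 1) * (rcost e + 5 + ncost dim2 + 12) + ncost dim2 + 12)) (J m)"
  proof (rule run_For)
    show "J 0 (nupd s 4 0 0)" by (simp add: J_def frame_nupd)
    show "nmem s' 4 0 = i \<and> nval dim2 s' = m" if "J i s'" for i s'
      using that dim2 by (auto simp: J_def)
    fix j s1 assume j: "j < m" and J: "J j s1"
    show "run (For 5 dim2 (RAssign a (ncell 4) (ncell 5) e)) s1
      ((m + 1) * (rcost e + 5 + ncost dim2 + 12))
        (\<lambda>s'. nmem s' 4 0 = j \<and> J (Suc j) (nupd s' 4 0 (Suc j)))"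
      by (rule run_mono[OF inner[OF j J]]) (auto simp: I_def J_def frame_nupd less_Suc_eq)
  qed
  then show ?thesis
    unfolding mat_assign_def
    by (rule run_mono) (auto simp: J_def mat_assign_cost_def dim2_def algebra_simps)
qed

text \<open>
  One evaluation of \<open>\<theta>\<close> by a relocated copy of its program: its input arrays \<open>k\<close> and \<open>k + 1\<close> get the
  outcomes, with the bits of the two remaining qubits replaced by \<open>a\<close> and \<open>b\<close>.
\<close>

definition phase_run :: "com \<Rightarrow> nat \<Rightarrow> nat \<Rightarrow> nat \<Rightarrow> com" where
  "phase_run c k a b =
     Seq (For 3 (ncell 0) (NAssign (k + 1) (ncell 3) (NCell 1 (ncell 3))))
    (Seq (NAssign (k + 1) (NCell 0 (NConst 1)) (NConst a))
    (Seq (NAssign (k + 1) (NCell 0 (NConst 2)) (NConst b))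
    (Seq (NAssign k (NConst 0) (ncell 0)) (shift_com k c))))"

text \<open>The relocated program expects zeros wherever it gets no input, so its window has to be
  fresh. \<open>2 \<le> B\<close> puts both input arrays inside the window.\<close>

lemma run_phase_run:
  fixes B :: nat
  assumes c: "exec c (phase_input d x) t s1" "t \<le> T" "rmem s1 0 0 0 = r" "arrays_com c \<le> B" "2 \<le> B"
    and k: "6 \<le> k" and empty: "\<And>a. a \<in> {k..<k + B} \<Longrightarrow> nmem s a = (\<lambda>_. 0) \<and> rmem s a = (\<lambda>_ _. 0)"
    and input: "nmem s 0 0 = d" "nmem s 0 1 = k1" "nmem s 0 2 = k2" "k1 < k2" "k2 < d"
    and bits: "\<And>i. i < d \<Longrightarrow> bitn x i = (if i = k1 then a else if i = k2 then b else nmem s 1 i)"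
  shows "run (phase_run c k a b) s ((d + 1) * 20 + T + 30)
    (\<lambda>s'. frame ({3} \<union> {k..<k + B}) {k..<k + B} s s' \<and> rmem s' k 0 0 = r)"
proof -
  let ?X = "{3} \<union> {k, k + 1}"
  define I where "I i s' \<longleftrightarrow> frame ?X {} s s' \<and> nmem s' 3 0 = i \<and> nmem s' k = (\<lambda>_. 0) \<and>
    nmem s' (k + 1) = (\<lambda>j. if j < i then nmem s 1 j else 0)" for i s'
  have range: "k \<in> {k..<k + B}" "k + 1 \<in> {k..<k + B}" using c(5) by auto
  have eq_upd: "nmem (nupd s' a i n) b = (if b = a then (nmem s' a)(i := n) else nmem s' b)"
    for s' a i n b
    by (simp add: nupd_def)
  have "run (For 3 (ncell 0) (NAssign (k + 1) (ncell 3) (NCell 1 (ncell 3)))) s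
    ((d + 1) * (6 + ncost (ncell 0) + 12)) (I d)"
  proof (rule run_For)
    show "I 0 (nupd s 3 0 0)" using empty[OF range(1)] empty[OF range(2)] k
      by (simp add: I_def frame_nupd eq_upd)
    show "nmem s' 3 0 = i \<and> nval (ncell 0) s' = d" if "I i s'" for i s'
      using that k input by (auto simp: I_def frame_def)
    fix i s' assume i: "i < d" and I: "I i s'"
    have "nmem s' 1 = nmem s 1" using I k by (auto simp: I_def frame_def)
    then show "run (NAssign (k + 1) (ncell 3) (NCell 1 (ncell 3))) s' 6
        (\<lambda>s'. nmem s' 3 0 = i \<and> I (Suc i) (nupd s' 3 0 (Suc i)))"
      using I k by (intro run_NAssign) (auto simp: I_def frame_nupd eq_upd fun_eq_iff less_Suc_eq)
  qed
  then have copy: "run (For 3 (ncell 0) (NAssign (k + 1) (ncell 3) (NCell 1 (ncell 3)))) s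
    ((d + 1) * 20) (I d)"
    by (rule run_mono) auto
  define Q1 where "Q1 s' \<longleftrightarrow> frame ?X {} s s' \<and> nmem s' k = (\<lambda>_. 0) \<and>
    nmem s' (k + 1) = (\<lambda>j. if j < d then nmem s 1 j else 0)(k1 := a)" for s'
  define Q2 where "Q2 s' \<longleftrightarrow> frame ?X {} s s' \<and> nmem s' k = (\<lambda>_. 0) \<and>
    nmem s' (k + 1) = (\<lambda>j. if j < d then nmem s 1 j else 0)(k1 := a, k2 := b)" for s'
  define Q3 where "Q3 s' \<longleftrightarrow> frame ?X {} s s' \<and> nmem s' k = (\<lambda>_. 0)(0 := d) \<and>
    nmem s' (k + 1) = (\<lambda>j. if j < d then nmem s 1 j else 0)(k1 := a, k2 := b)" for s'
  have fr0: "nmem s' 0 = nmem s 0" if "frame ?X {} s s'" for s' using that k by (auto simp: frame_def)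
  have 1: "run (NAssign (k + 1) (NCell 0 (NConst 1)) (NConst a)) s' 4 Q1" if "I d s'" for s'
    using that fr0[of s'] input by (intro run_NAssign) (auto simp: I_def Q1_def frame_nupd eq_upd)
  have 2: "run (NAssign (k + 1) (NCell 0 (NConst 2)) (NConst b)) s' 4 Q2" if "Q1 s'" for s'
    using that fr0[of s'] input by (intro run_NAssign) (auto simp: Q1_def Q2_def frame_nupd eq_upd)
  have 3: "run (NAssign k (NConst 0) (ncell 0)) s' 4 Q3" if "Q2 s'" for s'
    using that fr0[of s'] input by (intro run_NAssign) (auto simp: Q2_def Q3_def frame_nupd eq_upd)
  have 4: "run (shift_com k c) s' T (\<lambda>s'. frame ({3} \<union> {k..<k + B}) {k..<k + B} s s' \<and>
    rmem s' k 0 0 = r)"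
    if Q3: "Q3 s'" for s'
  proof -
    have "embeds k B (phase_input d x) s'"
      unfolding embeds_def
    proof (intro allI impI conjI)
      fix j assume j: "j < B"
      have rm: "rmem s' = rmem s" using Q3 by (auto simp: Q3_def frame_def)
      show "rmem s' (j + k) = rmem (phase_input d x) j"
        using empty[of "j + k"] j rm by (simp add: phase_input_def)
      show "nmem s' (j + k) = nmem (phase_input d x) j"
      proof (cases "j = 0 \<or> j = 1")
        case True
        then show ?thesis
          using Q3 bits input by (auto simp: Q3_def phase_input_def fun_eq_iff add.commute)
      next
        case False
        then have "nmem s' (j + k) = nmem s (j + k)" using Q3 k by (auto simp: Q3_def frame_def)
        then show ?thesis using empty[of "j + k"] j False by (simp add: phase_input_def)
      qed
    qed
    from exec_shift[OF c(1,4) this] obtain S' where S': "exec (shift_com k c) s' t S'" "embeds k B s1 S'"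
      "frame {k..<k + B} {k..<k + B} s' S'" by blast
    have "rmem S' (0 + k) = rmem s1 0" using S'(2) c(5) unfolding embeds_def
      by (metis less_le_trans pos2)
    moreover have "frame ({3} \<union> {k..<k + B}) {k..<k + B} s S'"
    proof -
      have "frame ?X {} s s'" using Q3 by (simp add: Q3_def)
      then show ?thesis by (rule frame_trans[OF _ S'(3)]) (use range in auto)
    qed
    ultimately show ?thesis
      using S'(1) c(2,3) unfolding run_def by (intro exI[of _ t] exI[of _ S']) simp
  qed
  show ?thesis
    unfolding phase_run_def
    by (rule run_Seq[OF copy run_Seq[OF 1 run_Seq[OF 2 run_Seq[OF 3 4 order_refl] order_refl]
      order_refl]]) auto
qed

section \<open>Conditioning the covariance matrix\<close>

definition pin :: "nat \<Rightarrow> bool \<Rightarrow> (nat \<Rightarrow> complex) \<Rightarrow> nat \<Rightarrow> complex" where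
  "pin q b f x = (if bit x q = b then f x else 0)"

lemma sqnorm_pin:
  assumes "q < d"
  shows "sqnorm d (pin q b f) = (sqnorm d f + (if b then - 1 else 1) * gcov d f q (d + q)) / 2"
proof -
  define s where "s = (if b then - 1 else 1 :: real)"
  have "sqnorm d (pin q b f) = (\<Sum>x<2 ^ d. ((cmod (f x))\<^sup>2 + s * (zsign x q * (cmod (f x))\<^sup>2)) / 2)"
    unfolding sqnorm_def by (intro sum.cong refl) (simp add: pin_def zsign_def s_def)
  also have "\<dots> = (sqnorm d f + s * gcov d f q (d + q)) / 2"
    by (simp add: sqnorm_def gcov_pair[OF assms] sum.distrib sum_divide_distrib[symmetric]
      sum_distrib_left[symmetric])
  finally show ?thesis by (simp add: s_def)
qed

lemma maj_pin:
  assumes "maj_mode d m \<noteq> q"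
  shows "maj d m (pin q b f) = pin q b (maj d m f)"
  using assms by (auto simp: maj_def pin_def)

lemma maj_zsign:
  assumes "maj_mode d m \<noteq> q"
  shows "maj d m (\<lambda>x. c * of_real (zsign x q) * f x) = (\<lambda>x. c * of_real (zsign x q) * maj d m f x)"
  using assms by (auto simp: maj_def zsign_def)

lemma sqnorm_eq_0_iff: "sqnorm d f = 0 \<longleftrightarrow> (\<forall>x<2 ^ d. f x = 0)"
  unfolding sqnorm_def by (subst sum_nonneg_eq_0_iff) auto

text \<open>
  Conditioning a Gaussian vector on an occupation number updates its covariance matrix by a rank-two
  term.  If the old vector vanishes then both sides are zero, by the convention for division by zero.
\<close>

lemma gcov_pin:
  assumes w: "wick d f" and q: "q < d" and jk: "j < 2 * d" "k < 2 * d" "j \<noteq> k"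
    and modes: "maj_mode d j \<noteq> q" "maj_mode d k \<noteq> q"
  defines "G \<equiv> gcov d f"
  shows "gcov d (pin q b f) j k = (G j k + (if b then - 1 else 1) / sqnorm d f *
    (G j k * G q (d + q) - G j q * G k (d + q) + G j (d + q) * G k q)) / 2"
proof -
  define s where "s = (if b then - 1 else 1 :: real)"
  define h where "h = maj d j (maj d k f)"
  define R where "R = G j k * G q (d + q) - G j q * G k (d + q) + G j (d + q) * G k q"
  \<comment> \<open>The projector on outcome \<open>b\<close> is \<open>(1 + s Z) / 2\<close> with
    \<open>Z\<close> the sign of bit \<open>q\<close>. The new entry is half the old one plus half a
    correlation with \<open>Z\<close>, and since \<open>\<i> Z\<close> is the product of the two
    Majorana operators of mode \<open>q\<close>, this correlation is a four-point function.\<close>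
  define W where "W = (\<Sum>x<2 ^ d. of_real (zsign x q) * (cnj (f x) * h x))"
  have "ip d (pin q b f) (maj d j (maj d k (pin q b f))) = (\<Sum>x<2 ^ d. cnj (pin q b f x) * pin q b h x)"
    using modes by (simp add: maj_pin h_def ip_def)
  also have "\<dots> = (\<Sum>x<2 ^ d. (cnj (f x) * h x +
    of_real s * (of_real (zsign x q) * (cnj (f x) * h x))) / 2)"
    by (intro sum.cong refl) (simp add: pin_def zsign_def s_def)
  also have "\<dots> = (ip d f h + of_real s * W) / 2"
    by (simp add: W_def sum.distrib sum_divide_distrib[symmetric] sum_distrib_left[symmetric] ip_def)
  finally have "2 * ip d (pin q b f) (maj d j (maj d k (pin q b f))) = ip d f h + of_real s * W"
    by (simp add: mult.commute)
  from arg_cong[OF this, of Im] have split: "gcov d (pin q b f) j k = (G j k + s * Im W) / 2"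
    by (simp add: gcov_def G_def h_def)
  have "ip d f (maj d j (maj d k (maj d q (maj d (d + q) f)))) =
      \<i> * W"
    unfolding W_def maj_pair[OF q] maj_zsign[OF modes(2)] maj_zsign[OF modes(1)] h_def ip_def
      sum_distrib_left
    by (intro sum.cong refl) simp
  moreover have "of_real (sqnorm d f) * ip d f (maj d j (maj d k (maj d q (maj d (d + q) f))))
    = - of_real R"
    unfolding R_def G_def
    using q jk modes by (intro wick_four[OF w]) (auto simp: maj_mode_def split: if_splits)
  ultimately have four: "of_real (sqnorm d f) * (\<i> * W) = - of_real R"
    by simp
  have "Im W = R / sqnorm d f"
  proof (cases "sqnorm d f = 0")
    case True
    then have "f x = 0" if "x < 2 ^ d" for x using that by (simp add: sqnorm_eq_0_iff)
    then show ?thesis using True by (simp add: W_def)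
  next
    case False
    from arg_cong[OF four, of Re] have "sqnorm d f * Im W = R"
      by (simp add: Im_i_times)
    then show ?thesis using False by (simp add: field_simps)
  qed
  then show ?thesis unfolding split R_def s_def by simp
qed

lemma covariance_eq_gcov:
  assumes psi: "\<psi> \<in> carrier_vec (2 ^ d)" and jk: "j < 2 * d" "k < 2 * d" "j \<noteq> k"
  shows "covariance d \<psi> j k = gcov d (($) \<psi>) j k"
proof -
  let ?M = "majorana d j * majorana d k - majorana d k * majorana d j"
  have prod: "majorana d a * majorana d b \<in> carrier_mat (2 ^ d) (2 ^ d)" for a b
    by (rule mult_carrier_mat[OF majorana_carrier majorana_carrier])
  have M: "?M \<in> carrier_mat (2 ^ d) (2 ^ d)" using prod by (intro minus_carrier_mat)
  have "(?M *\<^sub>v \<psi>) $ x = maj d j (maj d k (($) \<psi>)) x - maj d k (maj d j (($) \<psi>)) x"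
    if x: "x < 2 ^ d" for x
  proof -
    have "(?M *\<^sub>v \<psi>) $ x = (\<Sum>s<2 ^ d. (majorana d j * majorana d k) $$ (x, s) * \<psi> $ s) -
        (\<Sum>s<2 ^ d. (majorana d k * majorana d j) $$ (x, s) * \<psi> $ s)"
      unfolding mult_mat_vec_index[OF M psi x] sum_subtractf[symmetric]
      using x prod by (intro sum.cong refl) (simp add: left_diff_distrib del: index_mult_mat(1))
    then show ?thesis
      using jk x psi by (simp add: index_majorana_mult del: index_mult_mat(1) index_mult_mat_vec)
  qed
  then have "(?M *\<^sub>v \<psi>) \<bullet>c \<psi> = (\<Sum>x<2 ^ d. (maj d j (maj d k (($) \<psi>)) x - maj d k (maj d j (($) \<psi>)) x)
    * cnj (\<psi> $ x))"
    unfolding cscalar_prod_sum[OF mult_mat_vec_carrier[OF M psi] psi] by (intro sum.cong refl) simp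
  also have "\<dots> = ip d (($) \<psi>) (maj d j (maj d k (($) \<psi>))) - ip d (($) \<psi>) (maj d k (maj d j (($) \<psi>)))"
    unfolding ip_def sum_subtractf[symmetric] by (intro sum.cong refl) (simp add: algebra_simps)
  also have "\<dots> = 2 * \<i> * of_real (gcov d (($) \<psi>) j k)"
    using jk gcov_antisym[of k d j "($) \<psi>"] by (simp add: ip_maj_maj)
  finally show ?thesis by (simp add: covariance_def)
qed

lemma jw_sign_less: "k1 \<le> k2 \<Longrightarrow> jw_sign k2 x = jw_sign k1 x * (\<Prod>i\<in>{k1..<k2}. bit_sign x i)"
  unfolding jw_sign_def lessThan_atLeast0 by (simp add: prod.atLeastLessThan_concat)

text \<open>
  After all other qubits have been measured only four amplitudes remain, and the covariance matrix
  contains their squared moduli and relative phases.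
\<close>

lemma gcov_two_qubits:
  fixes f :: "nat \<Rightarrow> complex"
  assumes k: "k1 < k2" "k2 < d" and z: "z \<in> anchors d {k1, k2}"
    and supp: "\<And>x. x < 2 ^ d \<Longrightarrow> x \<notin> block d {k1, k2} z \<Longrightarrow> f x = 0"
  defines "a0 \<equiv> f z" and "a1 \<equiv> f (flip_bit k1 z)" and "a2 \<equiv> f (flip_bit k2 z)"
    and "a3 \<equiv> f (flip_bit k2 (flip_bit k1 z))"
  defines "G \<equiv> gcov d f" and "S \<equiv> (\<Prod>i\<in>{k1<..<k2}. zsign z i)"
  shows "sqnorm d f = (cmod a0)\<^sup>2 + (cmod a1)\<^sup>2 + (cmod a2)\<^sup>2 + (cmod a3)\<^sup>2"
    and "G k2 (d + k2) = (cmod a0)\<^sup>2 + (cmod a1)\<^sup>2 - (cmod a2)\<^sup>2 - (cmod a3)\<^sup>2"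
    and "Complex (- (G k1 (d + k2) + G (d + k1) k2) / 4) ((G k1 k2 - G (d + k1) (d + k2)) / 4) =
      - of_real S * (cnj a0 * a3)"
    and "Complex ((G (d + k1) k2 - G k1 (d + k2)) / 4) ((G k1 k2 + G (d + k1) (d + k2)) / 4) =
      of_real S * (cnj a1 * a2)"
proof -
  have z': "z < 2 ^ d" "\<not> bit z k1" "\<not> bit z k2" using z by (auto simp: anchors_def)
  have k': "k1 < d" "k1 \<noteq> k2" "k2 \<noteq> k1" using k by auto
  have restrict: "(\<Sum>x<2 ^ d. h x) = h z + h (flip_bit k1 z) + h (flip_bit k2 z) +
    h (flip_bit k2 (flip_bit k1 z))"
    if "\<And>x. f x = 0 \<Longrightarrow> h x = 0" for h :: "nat \<Rightarrow> 'b :: comm_monoid_add"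
  proof -
    have "(\<Sum>x<2 ^ d. h x) = (\<Sum>x\<in>block d {k1, k2} z. h x)"
      by (rule sum.mono_neutral_right) (use that supp in \<open>auto simp: block_def\<close>)
    then show ?thesis unfolding sum_block_pair[OF k z'(1)] .
  qed
  show "sqnorm d f = (cmod a0)\<^sup>2 + (cmod a1)\<^sup>2 + (cmod a2)\<^sup>2 + (cmod a3)\<^sup>2"
    unfolding sqnorm_def by (subst restrict) (simp_all add: a0_def a1_def a2_def a3_def)
  show "G k2 (d + k2) = (cmod a0)\<^sup>2 + (cmod a1)\<^sup>2 - (cmod a2)\<^sup>2 - (cmod a3)\<^sup>2"
    unfolding G_def gcov_pair[OF k(2)] using z' k'
    by (subst restrict) (simp_all add: a0_def a1_def a2_def a3_def zsign_def)
  \<comment> \<open>The two Jordan--Wigner strings cancel below \<open>k1\<close>, and bit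
    \<open>k1\<close> of \<open>z\<close> is zero, so only the qubits strictly between
    \<open>k1\<close> and \<open>k2\<close> contribute to the sign.\<close>
  define t where "t = jw_sign k1 z * jw_sign k2 z"
  have t: "t = of_real S"
  proof -
    have "jw_sign k2 z = jw_sign k1 z * (\<Prod>i\<in>{k1..<k2}. bit_sign z i)" using k
      by (intro jw_sign_less) simp
    also have "(\<Prod>i\<in>{k1..<k2}. bit_sign z i) = bit_sign z k1 * (\<Prod>i\<in>{k1<..<k2}. bit_sign z i)"
    proof -
      have "{k1..<k2} = insert k1 {k1<..<k2}" using k(1) by auto
      then show ?thesis by simp
    qed
    also have "bit_sign z k1 = 1" using z' by (simp add: bit_sign_def)
    finally have "t = (jw_sign k1 z * jw_sign k1 z) * (\<Prod>i\<in>{k1<..<k2}. bit_sign z i)" by (simp add: t_def)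
    also have "\<dots> = of_real S" by (simp add: S_def bit_sign_def zsign_def
      if_distrib[of complex_of_real] cong: if_cong)
    finally show ?thesis .
  qed
  have C: "ip d f (maj d m (maj d n f)) = \<i> * of_real (G m n)" if "m < 2 * d" "n < 2 * d" "m \<noteq> n" for m n
    using that by (simp add: ip_maj_maj G_def)
  have flips: "flip_bit k2 (flip_bit k1 (flip_bit k2 z)) = flip_bit k1 z"
    "flip_bit k1 (flip_bit k2 z) = flip_bit k2 (flip_bit k1 z)"
    "flip_bit k2 (flip_bit k1 (flip_bit k2 (flip_bit k1 z))) = z"
    by (metis flip_bit_left_commute flip_bit_involution)+
  have val: "ip d f (maj d k1 (maj d k2 f)) =
    t * (- (cnj a0 * a3) + cnj a1 * a2 - cnj a2 * a1 + cnj a3 * a0)"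
    "ip d f (maj d k1 (maj d (d + k2) f)) =
      \<i> * t * (cnj a0 * a3 - cnj a1 * a2 - cnj a2 * a1 + cnj a3 * a0)"
    "ip d f (maj d (d + k1) (maj d k2 f)) =
      \<i> * t * (cnj a0 * a3 + cnj a1 * a2 + cnj a2 * a1 + cnj a3 * a0)"
    "ip d f (maj d (d + k1) (maj d (d + k2) f)) =
      t * (cnj a0 * a3 + cnj a1 * a2 - cnj a2 * a1 - cnj a3 * a0)"
    unfolding ip_def using z' k k'
    by (subst restrict, simp, simp add: maj_upper[OF k'(1)] maj_upper[OF k(2)] jw_sign_flip_bit flips
        bit_sign_def a0_def a1_def a2_def a3_def t_def, simp add: algebra_simps i_mult_i)+
  define c12 where "c12 = \<i> * complex_of_real (G k1 k2)"
  define c12' where "c12' = \<i> * complex_of_real (G k1 (d + k2))"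
  define c1'2 where "c1'2 = \<i> * complex_of_real (G (d + k1) k2)"
  define c1'2' where "c1'2' = \<i> * complex_of_real (G (d + k1) (d + k2))"
  have c_ip: "c12 = ip d f (maj d k1 (maj d k2 f))" "c12' = ip d f (maj d k1 (maj d (d + k2) f))"
    "c1'2 = ip d f (maj d (d + k1) (maj d k2 f))" "c1'2' = ip d f (maj d (d + k1) (maj d (d + k2) f))"
    using k k' by (simp_all add: C c12_def c12'_def c1'2_def c1'2'_def)
  have c: "c12 = t * (- (cnj a0 * a3) + cnj a1 * a2 - cnj a2 * a1 + cnj a3 * a0)"
    "c12' = \<i> * t * (cnj a0 * a3 - cnj a1 * a2 - cnj a2 * a1 + cnj a3 * a0)"
    "c1'2 = \<i> * t * (cnj a0 * a3 + cnj a1 * a2 + cnj a2 * a1 + cnj a3 * a0)"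
    "c1'2' = t * (cnj a0 * a3 + cnj a1 * a2 - cnj a2 * a1 - cnj a3 * a0)"
    unfolding c_ip val by simp_all
  \<comment> \<open>As \<open>c + \<i> c'\<close> is twice the annihilator of a mode, this
    combination is the expectation of the two annihilators, which connects the doubly occupied
    string to the empty one. With a creator for \<open>k1\<close> instead, the second combination
    connects the two singly occupied strings.\<close>
  have "Complex (- (G k1 (d + k2) + G (d + k1) k2) / 4) ((G k1 k2 - G (d + k1) (d + k2)) / 4) =
      (c12 + \<i> * c12' + \<i> * c1'2 - c1'2') / 4"
    by (simp add: complex_eq_iff c12_def c12'_def c1'2_def c1'2'_def)
  also have "\<dots> = - t * (cnj a0 * a3)"
    unfolding c by (simp add: algebra_simps i_mult_i)
  finally show "Complex (- (G k1 (d + k2) + G (d + k1) k2) / 4) ((G k1 k2 - G (d + k1) (d + k2)) / 4) =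
      - of_real S * (cnj a0 * a3)" by (simp add: t)
  have "Complex ((G (d + k1) k2 - G k1 (d + k2)) / 4) ((G k1 k2 + G (d + k1) (d + k2)) / 4) =
      (c12 + \<i> * c12' - \<i> * c1'2 + c1'2') / 4"
    by (simp add: complex_eq_iff c12_def c12'_def c1'2_def c1'2'_def)
  also have "\<dots> = t * (cnj a1 * a2)"
    unfolding c by (simp add: algebra_simps i_mult_i)
  finally show "Complex ((G (d + k1) k2 - G k1 (d + k2)) / 4) ((G k1 k2 + G (d + k1) (d + k2)) / 4) =
      of_real S * (cnj a1 * a2)" by (simp add: t)
qed

section \<open>Programs without loops\<close>

primrec loop_free :: "com \<Rightarrow> bool" where
  "loop_free Skip = True"
| "loop_free (NAssign a i e) = True"
| "loop_free (RAssign a i j e) = True"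
| "loop_free (Seq c1 c2) = (loop_free c1 \<and> loop_free c2)"
| "loop_free (Cond b c1 c2) = (loop_free c1 \<and> loop_free c2)"
| "loop_free (While b c) = False"

text \<open>On programs without loops execution is a function of the store, which is computed by
  rewriting instead of a derivation of \<open>exec\<close>. The clause for \<open>While\<close> is a
  dummy value.\<close>

primrec result :: "com \<Rightarrow> store \<Rightarrow> store" where
  "result Skip s = s"
| "result (NAssign a i e) s = nupd s a (nval i s) (nval e s)"
| "result (RAssign a i j e) s = rupd s a (nval i s) (nval j s) (rval e s)"
| "result (Seq c1 c2) s = result c2 (result c1 s)"
| "result (Cond b c1 c2) s = (if bval b s then result c1 s else result c2 s)"
| "result (While b c) s = s"

primrec max_cost :: "com \<Rightarrow> nat" where
  "max_cost Skip = 1"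
| "max_cost (NAssign a i e) = 1 + ncost i + ncost e"
| "max_cost (RAssign a i j e) = 1 + ncost i + ncost j + rcost e"
| "max_cost (Seq c1 c2) = 1 + max_cost c1 + max_cost c2"
| "max_cost (Cond b c1 c2) = 1 + bcost b + max (max_cost c1) (max_cost c2)"
| "max_cost (While b c) = 0"

lemma run_loop_free:
  assumes "loop_free c" "Q (result c s)"
  shows "run c s (max_cost c) Q"
proof -
  have "run c s (max_cost c) (\<lambda>s'. s' = result c s)"
    using assms(1)
  proof (induction c arbitrary: s)
    case (Seq c1 c2)
    then show ?case
      by (intro run_Seq[where R = "\<lambda>s'. s' = result c1 s"]) auto
  next
    case (Cond b c1 c2)
    show ?case
    proof (rule run_Cond)
      show "run c1 s (max (max_cost c1) (max_cost c2)) (\<lambda>s'. s' = result (Cond b c1 c2) s)" if "bval b s"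
        using that Cond by (intro run_mono[OF Cond.IH(1)]) auto
      show "run c2 s (max (max_cost c1) (max_cost c2)) (\<lambda>s'. s' = result (Cond b c1 c2) s)"
        if "\<not> bval b s"
        using that Cond by (intro run_mono[OF Cond.IH(2)]) auto
    qed simp
  qed (auto intro: run_Skip run_NAssign run_RAssign)
  then show ?thesis by (rule run_mono) (use assms(2) in auto)
qed

section \<open>The loop that conditions the covariance matrix\<close>

abbreviation scalar :: "nat \<Rightarrow> rexp" where
  "scalar i \<equiv> RCell 4 (NConst i) (NConst 0)"

definition pos1 :: nexp where "pos1 = NCell 0 (NConst 1)"
definition pos2 :: nexp where "pos2 = NCell 0 (NConst 2)"

definition neq :: "nexp \<Rightarrow> nexp \<Rightarrow> bexp" where
  "neq e f = BNot (BAnd (BNot (NLess e f)) (BNot (NLess f e)))"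

lemma bval_neq [simp]: "bval (neq e f) s \<longleftrightarrow> nval e s \<noteq> nval f s"
  by (auto simp: neq_def)

text \<open>
  Real array 0 holds the covariance matrix and real array 3 its value before the current update.
  Cells 0, 1 and 2 of real array 4 hold the squared norm, the Jordan--Wigner sign between the two
  remaining qubits and the sign of the current outcome; the loop over the qubits counts in array 3.
\<close>

definition update_entry :: rexp where
  "update_entry = (let j = ncell 4; k = ncell 5; q = ncell 3; q' = NAdd (ncell 0) (ncell 3) in
     RDiv (RAdd (RCell 3 j k) (RMul (RDiv (scalar 2) (scalar 0))
       (RAdd (RSub (RMul (RCell 3 j k) (RCell 3 q q')) (RMul (RCell 3 j q) (RCell 3 k q')))
         (RMul (RCell 3 j q') (RCell 3 k q))))) (RConst 2))"

definition set_signs :: com where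
  "set_signs = Seq
     (Cond (NLess (NConst 0) (NCell 1 (ncell 3)))
       (RAssign 4 (NConst 2) (NConst 0) (RConst (- 1))) (RAssign 4 (NConst 2) (NConst 0) (RConst 1)))
     (Cond (BAnd (NLess pos1 (ncell 3)) (NLess (ncell 3) pos2))
       (RAssign 4 (NConst 1) (NConst 0) (RMul (scalar 1) (scalar 2))) Skip)"

definition set_norm :: com where
  "set_norm = RAssign 4 (NConst 0) (NConst 0) (RDiv (RAdd (scalar 0)
     (RMul (scalar 2) (RCell 3 (ncell 3) (NAdd (ncell 0) (ncell 3))))) (RConst 2))"

text \<open>The squared norm is updated last: the new entries divide by its old value, and its own
  update takes the expectation of the measured bit from the copy.\<close>

definition pin_body :: com where
  "pin_body = Cond (BAnd (neq (ncell 3) pos1) (neq (ncell 3) pos2))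
     (Seq set_signs (Seq (mat_assign 3 (RCell 0 (ncell 4) (ncell 5)))
       (Seq (mat_assign 0 update_entry) set_norm))) Skip"

definition pin_all :: com where
  "pin_all = For 3 (ncell 0) pin_body"

definition pin_body_cost :: "nat \<Rightarrow> nat" where
  "pin_body_cost d = bcost (BAnd (neq (ncell 3) pos1) (neq (ncell 3) pos2)) + max_cost set_signs +
     mat_assign_cost (2 * d) (RCell 0 (ncell 4) (ncell 5)) + mat_assign_cost (2 * d) update_entry +
     max_cost set_norm + 5"

definition pinned :: "nat \<Rightarrow> nat \<Rightarrow> nat \<Rightarrow> (nat \<Rightarrow> complex) \<Rightarrow> nat \<Rightarrow> nat \<Rightarrow> complex" where
  "pinned k1 k2 z f q x = (if \<forall>i<q. i \<notin> {k1, k2} \<longrightarrow> bit x i = bit z i then f x else 0)"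

lemma pinned_0: "pinned k1 k2 z f 0 = f"
  by (auto simp: pinned_def)

lemma pinned_Suc:
  "pinned k1 k2 z f (Suc q) =
    (if q \<in> {k1, k2} then pinned k1 k2 z f q else pin q (bit z q) (pinned k1 k2 z f q))"
  by (auto simp: pinned_def pin_def less_Suc_eq fun_eq_iff)

lemma wick_pinned:
  assumes "wick d f" "q \<le> d"
  shows "wick d (pinned k1 k2 z f q)"
  using assms(2)
proof (induction q)
  case 0
  then show ?case using assms(1) by (simp add: pinned_0)
next
  case (Suc q)
  then show ?case
    using wick_restrict_bit[of d "pinned k1 k2 z f q" q "bit z q"]
    by (auto simp: pinned_Suc pin_def[abs_def])
qed

text \<open>The part, from the qubits below \<open>q\<close>, of the Jordan--Wigner sign
  \<open>S\<close> in \<open>gcov_two_qubits\<close>, whose outcomes are read one after the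
  other.\<close>

definition gap_sign :: "nat \<Rightarrow> nat \<Rightarrow> nat \<Rightarrow> nat \<Rightarrow> real" where
  "gap_sign k1 k2 z q = (\<Prod>i<q. if k1 < i \<and> i < k2 then zsign z i else 1)"

text \<open>The rank-two update is justified for off-diagonal entries between modes that are not
  being measured, and only such entries are specified. Entries of measured modes and diagonal
  entries are overwritten as well, but do not enter the specified ones.\<close>

definition pin_inv :: "nat \<Rightarrow> nat \<Rightarrow> nat \<Rightarrow> nat \<Rightarrow> (nat \<Rightarrow> complex) \<Rightarrow> store \<Rightarrow> nat \<Rightarrow> store \<Rightarrow> bool" where
  "pin_inv d k1 k2 z f s0 q s \<longleftrightarrow> frame {3, 4, 5} {0, 3, 4} s0 s \<and> nmem s 3 0 = q \<and>
     rmem s 4 0 0 = sqnorm d (pinned k1 k2 z f q) \<and> rmem s 4 1 0 = gap_sign k1 k2 z q \<and>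
     (\<forall>j<2 * d. \<forall>k<2 * d. j \<noteq> k \<and> (q \<le> maj_mode d j \<or> maj_mode d j \<in> {k1, k2}) \<and>
        (q \<le> maj_mode d k \<or> maj_mode d k \<in> {k1, k2}) \<longrightarrow>
        rmem s 0 j k = gcov d (pinned k1 k2 z f q) j k)"

lemma run_pin_body:
  assumes w: "wick d f" and input: "nmem s0 0 0 = d" "nmem s0 0 1 = k1" "nmem s0 0 2 = k2"
    and bits: "\<And>i. i < d \<Longrightarrow> nmem s0 1 i = bitn z i"
    and q: "q < d" and inv: "pin_inv d k1 k2 z f s0 q s"
  shows "run pin_body s (pin_body_cost d)
    (\<lambda>s'. nmem s' 3 0 = q \<and> pin_inv d k1 k2 z f s0 (Suc q) (nupd s' 3 0 (Suc q)))"
proof -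
  have keep: "nmem s' 0 = nmem s0 0" "nmem s' 1 = nmem s0 1" if "frame {3, 4, 5} {0, 3, 4} s0 s'" for s'
    using that by (simp_all add: frame_def)
  have fr: "frame {3, 4, 5} {0, 3, 4} s0 s" and q_s: "nmem s 3 0 = q" using inv
    by (simp_all add: pin_inv_def)
  define F where "F = pinned k1 k2 z f q"
  define G where "G = gcov d F"
  define sg where "sg = (if bit z q then - 1 else 1 :: real)"
  define free where "free j \<longleftrightarrow> q \<le> maj_mode d j \<or> maj_mode d j \<in> {k1, k2}" for j
  have G0: "rmem s 0 j k = G j k" if "j < 2 * d" "k < 2 * d" "j \<noteq> k" "free j" "free k" for j k
    using inv that by (auto simp: pin_inv_def free_def G_def F_def)
  show ?thesis
  proof (cases "q \<in> {k1, k2}")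
    case True
    have "pin_inv d k1 k2 z f s0 (Suc q) (nupd s 3 0 (Suc q))"
    proof -
      have "gap_sign k1 k2 z (Suc q) = gap_sign k1 k2 z q" using True by (auto simp: gap_sign_def)
      moreover have "pinned k1 k2 z f (Suc q) = pinned k1 k2 z f q" using True by (simp add: pinned_Suc)
      moreover have "frame {3, 4, 5} {0, 3, 4} s0 (nupd s 3 0 (Suc q))" using fr
        by (simp add: frame_nupd)
      moreover have "rmem s 4 0 0 = sqnorm d (pinned k1 k2 z f q)" "rmem s 4 1 0 = gap_sign k1 k2 z q"
        using inv unfolding pin_inv_def by blast+
      moreover have "rmem s 0 j k = gcov d (pinned k1 k2 z f q) j k"
        if "j < 2 * d" "k < 2 * d" "j \<noteq> k" "Suc q \<le> maj_mode d j \<or> maj_mode d j \<in> {k1, k2}"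
          "Suc q \<le> maj_mode d k \<or> maj_mode d k \<in> {k1, k2}" for j k
      proof -
        have "free j" "free k" using that(4,5) unfolding free_def by linarith+
        from G0[OF that(1-3) this] show ?thesis by (simp add: G_def F_def)
      qed
      ultimately show ?thesis
        unfolding pin_inv_def by simp
    qed
    then show ?thesis
      unfolding pin_body_def using True keep[OF fr] q_s input
      by (intro run_Cond[where ?T1.0 = 1])
        (auto simp: pos1_def pos2_def pin_body_cost_def intro!: run_Skip)
  next
    case False
    define R2 where "R2 s' \<longleftrightarrow> frame {3, 4, 5} {0, 3, 4} s0 s' \<and> nmem s' 3 0 = q \<and>
      rmem s' 4 0 0 = sqnorm d F \<and> rmem s' 4 1 0 = gap_sign k1 k2 z (Suc q) \<and> rmem s' 4 2 0 = sg \<and>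
      rmem s' 0 = rmem s 0" for s'
    define R3 where "R3 s' \<longleftrightarrow> frame {3, 4, 5} {0, 3, 4} s0 s' \<and> nmem s' 3 0 = q \<and>
      rmem s' 4 0 0 = sqnorm d F \<and> rmem s' 4 1 0 = gap_sign k1 k2 z (Suc q) \<and> rmem s' 4 2 0 = sg \<and>
      (\<forall>j<2 * d. \<forall>k<2 * d. rmem s' 3 j k = rmem s 0 j k)" for s'
    define h where "h j k = (rmem s 0 j k + sg / sqnorm d F * (rmem s 0 j k * rmem s 0 q (d + q) -
      rmem s 0 j q * rmem s 0 k (d + q) + rmem s 0 j (d + q) * rmem s 0 k q)) / 2" for j k
    define R4 where "R4 s' \<longleftrightarrow> R3 s' \<and> (\<forall>j<2 * d. \<forall>k<2 * d. rmem s' 0 j k = h j k)" for s'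
    have 1: "run set_signs s (max_cost set_signs) R2"
    proof (rule run_loop_free)
      have "(0 < nmem s 1 q) = bit z q" using keep[OF fr] bits[OF q] by (simp add: bitn_def)
      then show "R2 (result set_signs s)"
        using inv keep[OF fr] input q
        by (auto simp: set_signs_def R2_def pin_inv_def F_def sg_def gap_sign_def zsign_def
          pos1_def pos2_def
            frame_rupd fun_eq_iff)
    qed (simp add: set_signs_def)
    have 2: "run (mat_assign 3 (RCell 0 (ncell 4) (ncell 5))) s1
        (mat_assign_cost (2 * d) (RCell 0 (ncell 4) (ncell 5))) R3" if R2: "R2 s1" for s1
    proof (rule run_mono[OF run_mat_assign[where f = "rmem s 0"]])
      show "2 * d = 2 * nmem s1 0 0" using R2 keep[of s1] input by (simp add: R2_def)
      show "rval (RCell 0 (ncell 4) (ncell 5)) s' = rmem s 0 j k"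
        if "frame {4, 5} {3} s1 s'" "nmem s' 4 0 = j" "nmem s' 5 0 = k" for s' j k
        using that R2 by (simp add: R2_def frame_def)
      show "R3 s'" if "frame {4, 5} {3} s1 s' \<and>
        (\<forall>j<2 * d. \<forall>k<2 * d. rmem s' 3 j k = rmem s 0 j k)" for s'
        using that R2 unfolding R2_def R3_def frame_def by simp
    qed simp
    have 3: "run (mat_assign 0 update_entry) s1 (mat_assign_cost (2 * d) update_entry) R4"
      if R3: "R3 s1" for s1
    proof (rule run_mono[OF run_mat_assign[where f = h]])
      show "2 * d = 2 * nmem s1 0 0" using R3 keep[of s1] input by (simp add: R3_def)
      show "rval update_entry s' = h j k"
        if "frame {4, 5} {0} s1 s'" "nmem s' 4 0 = j" "nmem s' 5 0 = k" "j < 2 * d"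
          "k < 2 * d" for s' j k
        using that R3 q input keep[of s1] by (simp add: update_entry_def Let_def R3_def frame_def h_def)
      show "R4 s'" if "frame {4, 5} {0} s1 s' \<and> (\<forall>j<2 * d. \<forall>k<2 * d. rmem s' 0 j k = h j k)" for s'
        using that R3 unfolding R3_def R4_def frame_def by simp
    qed simp
    have 4: "run set_norm s1 (max_cost set_norm)
        (\<lambda>s'. nmem s' 3 0 = q \<and> pin_inv d k1 k2 z f s0 (Suc q) (nupd s' 3 0 (Suc q)))" if R4:
          "R4 s1" for s1
    proof (rule run_loop_free)
      have Suc: "pinned k1 k2 z f (Suc q) = pin q (bit z q) F" using False
        by (simp add: pinned_Suc F_def)
      have fr1: "frame {3, 4, 5} {0, 3, 4} s0 s1" and q1: "nmem s1 3 0 = q"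
        and sc: "rmem s1 4 0 0 = sqnorm d F" "rmem s1 4 1 0 = gap_sign k1 k2 z (Suc q)"
          "rmem s1 4 2 0 = sg"
        and H: "\<And>j k. j < 2 * d \<Longrightarrow> k < 2 * d \<Longrightarrow> rmem s1 3 j k = rmem s 0 j k"
        and new: "\<And>j k. j < 2 * d \<Longrightarrow> k < 2 * d \<Longrightarrow> rmem s1 0 j k = h j k"
        using R4 unfolding R4_def R3_def by blast+
      \<comment> \<open>Mode \<open>q\<close> still counts as unmeasured during its own step,
        because \<open>free\<close> uses \<open>q \<le>\<close> and the invariant for
        \<open>Suc q\<close> no longer does. Its entries in the copy are therefore correct when the
        update reads them.\<close>
      have free_q: "free q" "free (d + q)" using q by (simp_all add: free_def maj_mode_def)
      have mode_q: "maj_mode d q = q" "maj_mode d (d + q) = q" using q by (simp_all add: maj_mode_def)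
      have norm: "(sqnorm d F + sg * rmem s1 3 q (d + q)) / 2 = sqnorm d (pin q (bit z q) F)"
        using q G0[of q "d + q"] free_q by (simp add: H sqnorm_pin sg_def G_def)
      have entries: "rmem s1 0 j k = gcov d (pin q (bit z q) F) j k"
        if jk: "j < 2 * d" "k < 2 * d" "j \<noteq> k" "Suc q \<le> maj_mode d j \<or> maj_mode d j \<in> {k1, k2}"
          "Suc q \<le> maj_mode d k \<or> maj_mode d k \<in> {k1, k2}" for j k
      proof -
        have fj: "free j" "free k" and mj: "maj_mode d j \<noteq> q" "maj_mode d k \<noteq> q"
          using jk False by (auto simp: free_def)
        then have "j \<noteq> q" "j \<noteq> d + q" "k \<noteq> q" "k \<noteq> d + q" using mode_q by auto
        then have "h j k = (G j k + sg / sqnorm d F *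
            (G j k * G q (d + q) - G j q * G k (d + q) + G j (d + q) * G k q)) / 2"
          unfolding h_def using jk q fj free_q by (simp add: G0)
        also have "\<dots> = gcov d (pin q (bit z q) F) j k"
          unfolding G_def sg_def
          by (rule gcov_pin[symmetric]) (use wick_pinned[OF w, of q] q jk mj in \<open>simp_all add: F_def\<close>)
        finally show ?thesis using new[OF jk(1,2)] by simp
      qed
      have res: "result set_norm s1 = rupd s1 4 0 0 (sqnorm d (pin q (bit z q) F))"
        using q1 sc keep[OF fr1] input norm by (simp add: set_norm_def)
      show "nmem (result set_norm s1) 3 0 = q \<and>
        pin_inv d k1 k2 z f s0 (Suc q) (nupd (result set_norm s1) 3 0 (Suc q))"
        unfolding res pin_inv_def using fr1 q1 sc entries
        by (simp add: frame_nupd frame_rupd Suc)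
    qed (simp add: set_norm_def)
    show ?thesis
      unfolding pin_body_def
    proof (rule run_Cond)
      show "run (Seq set_signs (Seq (mat_assign 3 (RCell 0 (ncell 4) (ncell 5)))
          (Seq (mat_assign 0 update_entry) set_norm))) s
          (max_cost set_signs + mat_assign_cost (2 * d) (RCell 0 (ncell 4) (ncell 5)) +
            mat_assign_cost (2 * d) update_entry + max_cost set_norm + 3)
          (\<lambda>s'. nmem s' 3 0 = q \<and> pin_inv d k1 k2 z f s0 (Suc q) (nupd s' 3 0 (Suc q)))"
        by (rule run_Seq[OF 1 run_Seq[OF 2 run_Seq[OF 3 4 order_refl] order_refl]]) auto
      show "1 + bcost (BAnd (neq (ncell 3) pos1) (neq (ncell 3) pos2)) +
          (max_cost set_signs + mat_assign_cost (2 * d) (RCell 0 (ncell 4) (ncell 5)) +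
            mat_assign_cost (2 * d) update_entry + max_cost set_norm + 3) \<le> pin_body_cost d"
        by (simp add: pin_body_cost_def)
    qed (use False keep[OF fr] q_s input in \<open>simp add: pos1_def pos2_def\<close>)
  qed
qed

lemma run_pin_all:
  assumes w: "wick d f" and input: "nmem s0 0 0 = d" "nmem s0 0 1 = k1" "nmem s0 0 2 = k2"
    and bits: "\<And>i. i < d \<Longrightarrow> nmem s0 1 i = bitn z i"
    and start: "pin_inv d k1 k2 z f s0 0 (nupd s 3 0 0)"
  shows "run pin_all s ((d + 1) * (pin_body_cost d + 14)) (pin_inv d k1 k2 z f s0 d)"
proof -
  have "run pin_all s ((d + 1) * (pin_body_cost d + ncost (ncell 0) + 12)) (pin_inv d k1 k2 z f s0 d)"
    unfolding pin_all_def
  proof (rule run_For[where I = "pin_inv d k1 k2 z f s0" and m = d])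
    show "nmem s 3 0 = i \<and> nval (ncell 0) s = d" if "pin_inv d k1 k2 z f s0 i s" for i s
      using that input by (simp add: pin_inv_def frame_def)
    show "run pin_body s (pin_body_cost d) (\<lambda>s'. nmem s' 3 0 = i \<and>
        pin_inv d k1 k2 z f s0 (Suc i) (nupd s' 3 0 (Suc i)))" if "i < d" "pin_inv d k1 k2 z f
          s0 i s" for i s
      by (rule run_pin_body[OF w input bits that])
  qed (rule start)
  then show ?thesis by (rule run_mono) auto
qed

section \<open>The program for the final basis\<close>

lemma orth_state_smult:
  assumes "u \<in> carrier_vec 2"
  shows "orth_state (\<alpha> \<cdot>\<^sub>v u) = cnj \<alpha> \<cdot>\<^sub>v orth_state u"
  using assms by (intro eq_vecI) (auto simp: orth_state_def)

text \<open>\<open>u0, u1\<close> are the conditional amplitudes without the factor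
  \<open>1 / sqrt 2\<close> of the X-ket. A common factor of modulus \<open>1 / sqrt N\<close>
  yields the conditional state up to a phase, and the completing vector then carries the conjugate
  phase.\<close>

lemma outputs_final_basisI:
  fixes u0 u1 :: complex
  assumes u: "cond_vec \<phi> k1 k2 z m $ 0 = of_real (1 / sqrt 2) * u0"
      "cond_vec \<phi> k1 k2 z m $ 1 = of_real (1 / sqrt 2) * u1"
    and N: "N = (cmod u0)\<^sup>2 + (cmod u1)\<^sup>2"
    and flag: "nmem s 2 0 = of_bool (0 < N)"
    and out: "0 < N \<Longrightarrow> output_vec s 2 = orth_state (output_vec s 1)"
      "0 < N \<Longrightarrow> cmod \<rho> = 1 / sqrt N"
      "0 < N \<Longrightarrow> output_vec s 1 $ 0 = \<rho> * u0" "0 < N \<Longrightarrow> output_vec s 1 $ 1 = \<rho> * u1"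
  shows "outputs_basis s (final_basis \<phi> k1 k2 z m)"
proof -
  have p: "outcome_prob \<phi> k1 k2 z m = N / 2"
    unfolding outcome_prob_eq u N by (simp add: norm_mult power_mult_distrib power_divide norm_divide)
  have "0 \<le> N" by (simp add: N)
  show ?thesis
  proof (cases "0 < N")
    case False
    then have "outcome_prob \<phi> k1 k2 z m = 0" using \<open>0 \<le> N\<close> p by simp
    then show ?thesis using flag False by (simp add: final_basis_def outputs_basis_def)
  next
    case True
    define \<alpha> where "\<alpha> = \<rho> * of_real (sqrt N)"
    let ?u = "cond_state \<phi> k1 k2 z m"
    have \<alpha>: "cmod \<alpha> = 1" using True by (simp add: \<alpha>_def norm_mult out(2))
    have carrier: "?u \<in> carrier_vec 2" by (simp add: cond_state_def cond_vec_def)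
    have "output_vec s 1 = \<alpha> \<cdot>\<^sub>v ?u"
    proof (rule eq_vecI)
      fix i assume "i < dim_vec (\<alpha> \<cdot>\<^sub>v ?u)"
      then have i: "i = 0 \<or> i = 1" using carrier by auto
      have norm: "\<alpha> * (of_real (1 / sqrt (N / 2)) * (of_real (1 / sqrt 2) * v)) = \<rho> * v" for v
        using True by (simp add: \<alpha>_def real_sqrt_divide)
      have entry: "(\<alpha> \<cdot>\<^sub>v ?u) $ i = \<alpha> * (of_real (1 / sqrt (N / 2)) * (cond_vec \<phi> k1 k2 z m $ i))"
        using i by (auto simp: cond_state_def p cond_vec_def)
      show "output_vec s 1 $ i = (\<alpha> \<cdot>\<^sub>v ?u) $ i"
        unfolding entry using i by (rule disjE) (simp_all only: u norm out(3,4)[OF True])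
    qed (use carrier in \<open>simp add: output_vec_def\<close>)
    then have "(\<exists>\<alpha> \<beta>. cmod \<alpha> = 1 \<and> cmod \<beta> = 1 \<and>
        output_vec s 1 = \<alpha> \<cdot>\<^sub>v ?u \<and> output_vec s 2 = \<beta> \<cdot>\<^sub>v orth_state ?u)"
      using orth_state_smult[OF carrier, of \<alpha>] True out(1) \<alpha>
      by (intro exI[of _ \<alpha>] exI[of _ "cnj \<alpha>"]) simp
    moreover have "final_basis \<phi> k1 k2 z m = Some (?u, orth_state ?u)"
      using True by (simp add: final_basis_def p)
    ultimately show ?thesis
      using flag True by (simp only: outputs_basis_def option.case prod.case of_bool_eq HOL.simp_thms)
  qed
qed

definition rot_re :: "rexp \<Rightarrow> rexp \<Rightarrow> rexp \<Rightarrow> rexp" where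
  "rot_re t e f = RSub (RMul (RFun Cos t) e) (RMul (RFun Sin t) f)"

definition rot_im :: "rexp \<Rightarrow> rexp \<Rightarrow> rexp \<Rightarrow> rexp" where
  "rot_im t e f = RAdd (RMul (RFun Cos t) f) (RMul (RFun Sin t) e)"

lemma rval_rot:
  "rval (rot_re t e f) s = Re (cis (rval t s) * Complex (rval e s) (rval f s))"
  "rval (rot_im t e f) s = Im (cis (rval t s) * Complex (rval e s) (rval f s))"
  by (simp_all add: rot_re_def rot_im_def)

definition set_scalar :: "nat \<Rightarrow> rexp \<Rightarrow> com" where
  "set_scalar i e = RAssign 4 (NConst i) (NConst 0) e"

text \<open>
  If \<open>u0, u1\<close> are the entries of the unnormalised conditional state, then the real and imaginary parts
  of \<open>cnj u0 * u1\<close> go to cells 3 and 4 of real array 4, and \<open>\<bar>u0\<bar>\<^sup>2\<close> goes to cell 5.  Up to a phase they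
  determine the state.  The four values of \<open>\<theta>\<close> are in the arrays \<open>th r\<close>.
\<close>

definition combine :: "(nat \<Rightarrow> nat) \<Rightarrow> com" where
  "combine th = (let G = RCell 0; p1 = NAdd (ncell 0) pos1; p2 = NAdd (ncell 0) pos2;
      T = (\<lambda>r. RCell (th r) (NConst 0) (NConst 0));
      a_re = RDiv (RSub (RConst 0) (RAdd (G pos1 p2) (G p1 pos2))) (RConst 4);
      a_im = RDiv (RSub (G pos1 pos2) (G p1 p2)) (RConst 4);
      b_re = RDiv (RSub (G p1 pos2) (G pos1 p2)) (RConst 4);
      b_im = RDiv (RAdd (G pos1 pos2) (G p1 p2)) (RConst 4);
      t = RSub (T 3) (T 0); t' = RSub (T 2) (T 1)
    in Seq (Cond (NLess (NConst 0) (NCell 0 (NConst 3))) (set_scalar 2 (RConst (- 1)))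
      (set_scalar 2 (RConst 1)))
      (Seq (set_scalar 3 (RMul (RMul (scalar 2) (scalar 1))
        (RSub (rot_re t' b_re b_im) (rot_re t a_re a_im))))
      (Seq (set_scalar 4 (RMul (RMul (scalar 2) (scalar 1))
        (RSub (rot_im t' b_re b_im) (rot_im t a_re a_im))))
      (set_scalar 5 (RDiv (RAdd (scalar 0) (G pos2 p2)) (RConst 2))))))"

text \<open>The phase is chosen so that the first entry is real: it becomes
  \<open>\<bar>u0\<bar> / sqrt N\<close>, and the second
  \<open>cnj u0 * u1 / (\<bar>u0\<bar> * sqrt N)\<close>. If \<open>u0\<close> vanishes, the state
  is \<open>ket1\<close> up to a phase and the first entry keeps its initial zero. The second vector
  is \<open>orth_state\<close> of the first, for which no conjugate of the real entry is
  needed.\<close>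

definition emit :: com where
  "emit = (let c = NConst; r = RFun Sqrt (scalar 5); n = RFun Sqrt (scalar 0) in
     Cond (RLess (RConst 0) (scalar 0))
       (Seq (NAssign 2 (c 0) (c 1))
       (Seq (Cond (RLess (RConst 0) (scalar 5))
         (Seq (RAssign 1 (c 0) (c 0) (RDiv r n))
         (Seq (RAssign 1 (c 1) (c 0) (RDiv (scalar 3) (RMul r n)))
           (RAssign 1 (c 1) (c 1) (RDiv (scalar 4) (RMul r n)))))
         (RAssign 1 (c 1) (c 0) (RConst 1)))
       (Seq (RAssign 2 (c 0) (c 0) (RSub (RConst 0) (RCell 1 (c 1) (c 0))))
       (Seq (RAssign 2 (c 0) (c 1) (RCell 1 (c 1) (c 1)))
         (RAssign 2 (c 1) (c 0) (RCell 1 (c 0) (c 0)))))))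
       Skip)"

lemma loop_free_combine [simp]: "loop_free (combine th)" "loop_free emit"
  by (simp_all add: combine_def emit_def Let_def set_scalar_def)

lemma result_combine:
  fixes s :: store and th :: "nat \<Rightarrow> nat"
  defines "d \<equiv> nmem s 0 0" and "k1 \<equiv> nmem s 0 1" and "k2 \<equiv> nmem s 0 2" and "g \<equiv> rmem s 0"
    and "T \<equiv> \<lambda>r. rmem s (th r) 0 0"
  assumes th: "\<And>r. th r \<noteq> 4"
    and A: "Complex (- (g k1 (d + k2) + g (d + k1) k2) / 4) ((g k1 k2 - g (d + k1) (d + k2)) / 4) = A"
    and B: "Complex ((g (d + k1) k2 - g k1 (d + k2)) / 4) ((g k1 k2 + g (d + k1) (d + k2)) / 4) = B"
    and sg: "sg = (if 0 < nmem s 0 3 then - 1 else 1)"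
    and \<kappa>: "\<kappa> = of_real (sg * rmem s 4 1 0) * (cis (T 2 - T 1) * B - cis (T 3 - T 0) * A)"
  shows "frame {} {4} s (result (combine th) s)"
    and "rmem (result (combine th) s) 4 0 0 = rmem s 4 0 0"
    and "rmem (result (combine th) s) 4 3 0 = Re \<kappa>" "rmem (result (combine th) s) 4 4 0 = Im \<kappa>"
    and "rmem (result (combine th) s) 4 5 0 = (rmem s 4 0 0 + g k2 (d + k2)) / 2"
proof -
  have pos: "nval pos1 s' = nmem s' 0 1" "nval pos2 s' = nmem s' 0 2" for s'
    by (simp_all add: pos1_def pos2_def)
  have res: "result (combine th) s = rupd (rupd (rupd (rupd s 4 2 0 sg) 4 3 0 (Re \<kappa>)) 4 4 0 (Im \<kappa>)) 4 5 0
      ((rmem s 4 0 0 + g k2 (d + k2)) / 2)"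
    unfolding combine_def Let_def set_scalar_def using th
    by (simp add: rval_rot pos d_def k1_def k2_def g_def T_def A[symmetric] B[symmetric] sg \<kappa> add.commute
      minus_diff_commute)
  show "frame {} {4} s (result (combine th) s)" unfolding res by (simp add: frame_rupd)
  show "rmem (result (combine th) s) 4 0 0 = rmem s 4 0 0"
    "rmem (result (combine th) s) 4 3 0 = Re \<kappa>" "rmem (result (combine th) s) 4 4 0 = Im \<kappa>"
    "rmem (result (combine th) s) 4 5 0 = (rmem s 4 0 0 + g k2 (d + k2)) / 2"
    unfolding res by simp_all
qed

lemma emit_outputs:
  fixes u0 u1 :: complex
  assumes u: "cond_vec \<phi> k1 k2 z m $ 0 = of_real (1 / sqrt 2) * u0"
      "cond_vec \<phi> k1 k2 z m $ 1 = of_real (1 / sqrt 2) * u1"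
    and cells: "rmem s 4 0 0 = (cmod u0)\<^sup>2 + (cmod u1)\<^sup>2" "rmem s 4 5 0 = (cmod u0)\<^sup>2"
      "rmem s 4 3 0 = Re (cnj u0 * u1)" "rmem s 4 4 0 = Im (cnj u0 * u1)"
    and zero: "nmem s 2 = (\<lambda>_. 0)" "rmem s 1 = (\<lambda>_ _. 0)" "rmem s 2 = (\<lambda>_ _. 0)"
  shows "outputs_basis (result emit s) (final_basis \<phi> k1 k2 z m)"
proof -
  define N where "N = (cmod u0)\<^sup>2 + (cmod u1)\<^sup>2"
  \<comment> \<open>The factor between the output and \<open>(u0, u1)\<close>: the phase of
    \<open>cnj u0\<close>, or of \<open>cnj u1\<close> where \<open>u0\<close> vanishes, over the
    norm.\<close>
  define \<rho> where "\<rho> = (if u0 = 0 then cnj u1 / of_real N else cnj u0 / of_real (cmod u0 * sqrt N))"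
  show ?thesis
  proof (rule outputs_final_basisI[OF u N_def])
    show "nmem (result emit s) 2 0 = of_bool (0 < N)"
      using cells(1) zero(1) by (simp add: emit_def Let_def N_def[symmetric])
    assume N: "0 < N"
    have "output_vec (result emit s) 1 = vec 2 (\<lambda>b. if u0 = 0 then of_nat b
        else if b = 0 then of_real (cmod u0 / sqrt N) else cnj u0 * u1 / of_real (cmod u0 * sqrt N))"
      using N cells zero
      by (intro eq_vecI) (auto simp: emit_def Let_def N_def[symmetric] output_vec_def complex_eq_iff)
    then have entries: "output_vec (result emit s) 1 $ 0 =
      (if u0 = 0 then 0 else of_real (cmod u0 / sqrt N))"
      "output_vec (result emit s) 1 $ 1 =
        (if u0 = 0 then 1 else cnj u0 * u1 / of_real (cmod u0 * sqrt N))"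
      by simp_all
    have sq: "cnj v * v = of_real ((cmod v)\<^sup>2)" for v
      by (subst complex_norm_square) (simp add: mult.commute)
    show "cmod \<rho> = 1 / sqrt N"
    proof (cases "u0 = 0")
      case True
      then have "sqrt N = cmod u1" "N = (cmod u1)\<^sup>2" by (simp_all add: N_def)
      then show ?thesis using True by (simp add: \<rho>_def norm_divide norm_mult power2_eq_square)
    next
      case False
      then show ?thesis using N by (simp add: \<rho>_def norm_divide norm_mult)
    qed
    show "output_vec (result emit s) 1 $ 0 = \<rho> * u0"
      unfolding entries(1) by (simp add: \<rho>_def sq power2_eq_square)
    show "output_vec (result emit s) 1 $ 1 = \<rho> * u1"
      using N unfolding entries(2) by (auto simp: \<rho>_def sq N_def)
    show "output_vec (result emit s) 2 = orth_state (output_vec (result emit s) 1)"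
      using N cells zero
      by (intro eq_vecI) (auto simp: emit_def Let_def N_def[symmetric] output_vec_def orth_state_def
        complex_eq_iff less_2_cases_iff)
  qed
qed


text \<open>Copy \<open>n\<close> evaluates the phase at the string whose bits at \<open>k1\<close>
  and \<open>k2\<close> are the binary digits of \<open>n\<close>. It gets its own window, since the
  windows used before are no longer zero.\<close>

primrec phases :: "com \<Rightarrow> nat \<Rightarrow> nat \<Rightarrow> com" where
  "phases c B 0 = Skip"
| "phases c B (Suc n) = Seq (phases c B n) (phase_run c (6 + n * B) (n mod 2) (n div 2))"

definition set_pair :: "nat \<Rightarrow> nat \<Rightarrow> nat \<Rightarrow> nat \<Rightarrow> nat" where
  "set_pair k1 k2 z r = (if r div 2 = 0 then id else flip_bit k2)
    ((if r mod 2 = 0 then id else flip_bit k1) z)"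

lemma set_pair_simps:
  "set_pair k1 k2 z 0 = z" "set_pair k1 k2 z 1 = flip_bit k1 z"
  "set_pair k1 k2 z 2 = flip_bit k2 z" "set_pair k1 k2 z 3 = flip_bit k2 (flip_bit k1 z)"
  by (simp_all add: set_pair_def)

lemma run_phases:
  assumes exec: "\<And>x. x < 2 ^ d \<Longrightarrow> \<exists>t s'. exec c (phase_input d x) t s' \<and> t \<le> T \<and> rmem s' 0 0 0 = \<theta> x"
    and B: "arrays_com c \<le> B" "2 \<le> B"
    and empty: "\<And>a. 6 \<le> a \<Longrightarrow> nmem s a = (\<lambda>_. 0) \<and> rmem s a = (\<lambda>_ _. 0)"
    and input: "nmem s 0 0 = d" "nmem s 0 1 = k1" "nmem s 0 2 = k2" "k1 < k2" "k2 < d"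
    and bits: "\<And>i. i < d \<Longrightarrow> nmem s 1 i = bitn z i"
    and z: "z < 2 ^ d" "\<not> bit z k1" "\<not> bit z k2"
    and n: "n \<le> 4"
  shows "run (phases c B n) s (n * ((d + 1) * 20 + T + 31) + 1)
    (\<lambda>s'. frame ({3} \<union> {6..<6 + n * B}) {6..<6 + n * B} s s' \<and>
      (\<forall>r<n. rmem s' (6 + r * B) 0 0 = \<theta> (set_pair k1 k2 z r)))"
  using n
proof (induction n)
  case 0
  show ?case by (auto intro: run_Skip)
next
  case (Suc n)
  let ?Q = "\<lambda>n s'. frame ({3} \<union> {6..<6 + n * B}) {6..<6 + n * B} s s' \<and>
      (\<forall>r<n. rmem s' (6 + r * B) 0 0 = \<theta> (set_pair k1 k2 z r))"
  let ?k = "6 + n * B" and ?x = "set_pair k1 k2 z n"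
  have step: "run (phase_run c ?k (n mod 2) (n div 2)) s' ((d + 1) * 20 + T + 30) (?Q (Suc n))"
    if Q: "?Q n s'" for s'
  proof -
    have fr: "frame ({3} \<union> {6..<?k}) {6..<?k} s s'" using Q by blast
    have same: "nmem s' a = nmem s a" if "a \<noteq> 3" "a < 6 \<or> ?k \<le> a" for a
      using that fr by (auto simp: frame_def)
    have rsame: "rmem s' a = rmem s a" if "?k \<le> a" for a
      using that fr by (auto simp: frame_def)
    have x: "?x < 2 ^ d" using z input by (simp add: set_pair_def flip_bit_less)
    obtain t s1 where 1: "exec c (phase_input d ?x) t s1" "t \<le> T" "rmem s1 0 0 0 = \<theta> ?x"
      using exec[OF x] by blast
    have "run (phase_run c ?k (n mod 2) (n div 2)) s' ((d + 1) * 20 + T + 30)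
      (\<lambda>s''. frame ({3} \<union> {?k..<?k + B}) {?k..<?k + B} s' s'' \<and> rmem s'' ?k 0 0 = \<theta> ?x)"
    proof (rule run_phase_run[OF 1 B])
      show "nmem s' a = (\<lambda>_. 0) \<and> rmem s' a = (\<lambda>_ _. 0)" if "a \<in> {?k..<?k + B}" for a
        using that same[of a] rsame[of a] empty[of a] by simp
      show "nmem s' 0 0 = d" "nmem s' 0 1 = k1" "nmem s' 0 2 = k2" using same[of 0] input by simp_all
      show "bitn ?x i = (if i = k1 then n mod 2 else if i = k2 then n div 2 else nmem s' 1 i)"
        if "i < d" for i
      proof -
        have "n \<in> {0, 1, 2, 3}" using Suc.prems by auto
        then show ?thesis
          using same[of 1] bits[OF that] z(2,3) input(4)
          by (auto simp: set_pair_def bitn_def)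
      qed
    qed (use input in auto)
    then show ?thesis
    proof (rule run_mono[OF _ order_refl])
      fix s'' assume post: "frame ({3} \<union> {?k..<?k + B}) {?k..<?k + B} s' s'' \<and> rmem s'' ?k 0 0 = \<theta> ?x"
      have "frame ({3} \<union> {6..<6 + Suc n * B}) {6..<6 + Suc n * B} s s''"
        by (rule frame_trans[OF fr conjunct1[OF post]]) auto
      moreover have "rmem s'' (6 + r * B) 0 0 = \<theta> (set_pair k1 k2 z r)" if "r < n" for r
      proof -
        have "r * B < n * B" using that B by simp
        then have "6 + r * B < ?k" by simp
        then have "rmem s'' (6 + r * B) = rmem s' (6 + r * B)" using post by (auto simp: frame_def)
        then show ?thesis using Q that by simp
      qed
      ultimately show "?Q (Suc n) s''" using post by (auto simp: less_Suc_eq)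
    qed
  qed
  show ?case
    unfolding phases.simps by (rule run_Seq[OF Suc.IH step]) (use Suc.prems in auto)
qed

lemma gap_sign_eq:
  assumes "k2 < d"
  shows "gap_sign k1 k2 z d = (\<Prod>i\<in>{k1<..<k2}. zsign z i)"
proof -
  have "gap_sign k1 k2 z d = (\<Prod>i\<in>{i \<in> {..<d}. k1 < i \<and> i < k2}. zsign z i)"
    unfolding gap_sign_def by (subst prod.inter_filter) simp_all
  also have "{i \<in> {..<d}. k1 < i \<and> i < k2} = {k1<..<k2}" using assms by auto
  finally show ?thesis .
qed

text \<open>For states of definite parity only one of the pairs \<open>a0, a3\<close> and \<open>a1, a2\<close> is nonzero.\<close>

lemma dressed_pairs:
  fixes a0 a1 a2 a3 :: complex and sg S t0 t1 t2 t3 :: real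
  assumes pairs: "a0 = 0 \<and> a3 = 0 \<or> a1 = 0 \<and> a2 = 0" and signs: "sg * sg = 1" "S * S = 1"
    and u0: "u0 = cis t0 * a0 + of_real sg * (cis t1 * a1)"
    and u1: "u1 = cis t2 * a2 + of_real sg * (cis t3 * a3)"
  shows "(cmod u0)\<^sup>2 = (cmod a0)\<^sup>2 + (cmod a1)\<^sup>2" and "(cmod u1)\<^sup>2 = (cmod a2)\<^sup>2 + (cmod a3)\<^sup>2"
    and "of_real (sg * S) * (cis (t2 - t1) * (of_real S * (cnj a1 * a2)) -
      cis (t3 - t0) * (- of_real S * (cnj a0 * a3))) = cnj u0 * u1"
proof -
  have sg: "\<bar>sg\<bar> = 1" using signs(1) by (metis abs_mult_self_eq abs_1 abs_square_eq_1 power2_eq_square)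
  show "(cmod u0)\<^sup>2 = (cmod a0)\<^sup>2 + (cmod a1)\<^sup>2" "(cmod u1)\<^sup>2 = (cmod a2)\<^sup>2 + (cmod a3)\<^sup>2"
    using pairs sg by (auto simp: u0 u1 norm_mult)
  have "of_real (S * S) = (1 :: complex)" using signs by simp
  then have SS: "of_real S * (of_real S * x) = x" for x :: complex
    by (simp only: of_real_mult mult.assoc[symmetric] mult_1)
  have "of_real (sg * S) * (cis (t2 - t1) * (of_real S * (cnj a1 * a2)) -
      cis (t3 - t0) * (- of_real S * (cnj a0 * a3))) =
    of_real sg * (cis t2 * cnj (cis t1) * (cnj a1 * a2) + cis t3 * cnj (cis t0) * (cnj a0 * a3))"
    by (simp add: cis_cnj cis_mult algebra_simps SS)
  also have "\<dots> = cnj u0 * u1"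
    using pairs by (auto simp: u0 u1)
  finally show "of_real (sg * S) * (cis (t2 - t1) * (of_real S * (cnj a1 * a2)) -
      cis (t3 - t0) * (- of_real S * (cnj a0 * a3))) = cnj u0 * u1" .
qed

lemma phase_dressed_index:
  assumes "\<psi> \<in> carrier_vec (2 ^ d)" "x < 2 ^ d"
  shows "phase_dressed d \<theta> \<psi> $ x = cis (\<theta> x) * \<psi> $ x"
proof -
  have "phase_dressed d \<theta> \<psi> $ x = (\<Sum>y<2 ^ d. (if x = y then exp (\<i> * \<theta> x) else 0) * \<psi> $ y)"
    using assms unfolding phase_dressed_def
    by (subst mult_mat_vec_index[of _ "2 ^ d" "2 ^ d"]) (auto simp: phase_unitary_def intro!: sum.cong)
  also have "\<dots> = (\<Sum>y<2 ^ d. if x = y then cis (\<theta> x) * \<psi> $ y else 0)"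
    by (intro sum.cong refl) (simp add: cis_conv_exp)
  also have "\<dots> = cis (\<theta> x) * \<psi> $ x" using assms(2) by simp
  finally show ?thesis .
qed

text \<open>The two initial values 1 are the squared norm of the state and the empty Jordan--Wigner
  sign. Arrays 0 to 5 belong to this program, and the copies of \<open>c\<close> use windows from
  array 6 on.\<close>

definition basis_program :: "com \<Rightarrow> com" where
  "basis_program c = (let B = max 2 (arrays_com c) in
     Seq (phases c B 4) (Seq (set_scalar 0 (RConst 1)) (Seq (set_scalar 1 (RConst 1))
       (Seq pin_all (Seq (combine (\<lambda>r. 6 + r * B)) emit)))))"

definition basis_cost :: "com \<Rightarrow> nat \<Rightarrow> nat \<Rightarrow> nat" where
  "basis_cost c T d = 4 * ((d + 1) * 20 + T + 31) + (d + 1) * (pin_body_cost d + 14) +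
     max_cost (combine (\<lambda>r. 6 + r * max 2 (arrays_com c))) + max_cost emit + 16"

text \<open>The phases are diagonal and commute with the restriction to the measured bits. So the
  Gaussian \<open>\<psi>\<close> itself is conditioned through its covariance matrix, and the phases
  are attached to the four remaining amplitudes at the end.\<close>

lemma computes_final_basis:
  assumes w: "wick d (($) \<psi>)" and psi: "\<psi> \<in> carrier_vec (2 ^ d)" "sqnorm d (($) \<psi>) = 1"
    and par: "\<And>x. x < 2 ^ d \<Longrightarrow> outcome_parity d x \<noteq> \<sigma> \<Longrightarrow> \<psi> $ x = 0"
    and exec: "\<And>x. x < 2 ^ d \<Longrightarrow> \<exists>t s. exec c (phase_input d x) t s \<and> t \<le> T \<and> rmem s 0 0 0 = \<theta> x"
  shows "computes_final_basis (basis_program c) (basis_cost c T d) d \<theta> \<psi>"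
  unfolding computes_final_basis_def
proof (intro allI impI)
  fix k1 k2 z :: nat and m
  assume "k1 < k2 \<and> k2 < d \<and> z < 2 ^ d \<and> \<not> bit z k1 \<and> \<not> bit z k2"
  then have k: "k1 < k2" "k2 < d" and z: "z < 2 ^ d" "\<not> bit z k1" "\<not> bit z k2" by auto
  define B where "B = max 2 (arrays_com c)"
  define s0 where "s0 = basis_input d (covariance d \<psi>) k1 k2 z m"
  define \<phi> where "\<phi> = phase_dressed d \<theta> \<psi>"
  define f where "f = pinned k1 k2 z (($) \<psi>) d"
  define Q1 where "Q1 s \<longleftrightarrow> frame ({3} \<union> {6..<6 + 4 * B}) {6..<6 + 4 * B} s0 s \<and>
    (\<forall>r<4. rmem s (6 + r * B) 0 0 = \<theta> (set_pair k1 k2 z r))" for s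
  have input: "nmem s0 0 0 = d" "nmem s0 0 1 = k1" "nmem s0 0 2 = k2" "nmem s0 0 3 = of_bool m"
    "\<And>i. i < d \<Longrightarrow> nmem s0 1 i = bitn z i" "\<And>a. 2 \<le> a \<Longrightarrow> nmem s0 a = (\<lambda>_. 0)"
    "\<And>a. 1 \<le> a \<Longrightarrow> rmem s0 a = (\<lambda>_ _. 0)"
    "\<And>i j. i < 2 * d \<Longrightarrow> j < 2 * d \<Longrightarrow> rmem s0 0 i j = covariance d \<psi> i j"
    by (auto simp: s0_def basis_input_def fun_eq_iff)
  have 1: "run (phases c B 4) s0 (4 * ((d + 1) * 20 + T + 31) + 1) Q1"
    unfolding Q1_def
    by (rule run_phases[OF exec]) (use input k z in \<open>auto simp: B_def\<close>)
  have rest: "run (Seq (set_scalar 0 (RConst 1)) (Seq (set_scalar 1 (RConst 1))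
      (Seq pin_all (Seq (combine (\<lambda>r. 6 + r * B)) emit)))) s1
      ((d + 1) * (pin_body_cost d + 14) + max_cost (combine (\<lambda>r. 6 + r * B)) + max_cost emit + 12)
      (\<lambda>s. outputs_basis s (final_basis \<phi> k1 k2 z m))" if Q1: "Q1 s1" for s1
  proof -
    have fr1: "frame ({3} \<union> {6..<6 + 4 * B}) {6..<6 + 4 * B} s0 s1" using Q1 by (simp add: Q1_def)
    have s1: "nmem s1 0 = nmem s0 0" "nmem s1 1 = nmem s0 1" "nmem s1 2 = nmem s0 2"
      "rmem s1 0 = rmem s0 0" "rmem s1 1 = rmem s0 1" "rmem s1 2 = rmem s0 2"
      using fr1 by (simp_all add: frame_def)
    have a: "run (set_scalar 0 (RConst 1)) s1 4 (\<lambda>s. s = rupd s1 4 0 0 1)"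
      unfolding set_scalar_def by (rule run_RAssign) simp_all
    have b: "run (set_scalar 1 (RConst 1)) s 4 (\<lambda>s. s = rupd (rupd s1 4 0 0 1) 4 1 0 1)"
      if "s = rupd s1 4 0 0 1" for s
      unfolding set_scalar_def that by (rule run_RAssign) simp_all
    have c: "run pin_all s ((d + 1) * (pin_body_cost d + 14)) (pin_inv d k1 k2 z (($) \<psi>) s1 d)"
      if s: "s = rupd (rupd s1 4 0 0 1) 4 1 0 1" for s
    proof (rule run_pin_all[OF w])
      show "nmem s1 0 0 = d" "nmem s1 0 1 = k1" "nmem s1 0 2 = k2" "\<And>i. i < d \<Longrightarrow> nmem s1 1 i = bitn z i"
        using s1 input by simp_all
      have "rmem s 0 i j = gcov d (($) \<psi>) i j" if "i < 2 * d" "j < 2 * d" "i \<noteq> j" for i j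
        using that s1 input(8) covariance_eq_gcov[OF psi(1)] by (simp add: s)
      then show "pin_inv d k1 k2 z (($) \<psi>) s1 0 (nupd s 3 0 0)"
        using psi(2) by (simp add: pin_inv_def s frame_nupd frame_rupd pinned_0 gap_sign_def)
    qed
    have d: "run (Seq (combine (\<lambda>r. 6 + r * B)) emit) s (1 + max_cost (combine (\<lambda>r. 6 + r * B)) +
      max_cost emit)
      (\<lambda>s. outputs_basis s (final_basis \<phi> k1 k2 z m))" if inv: "pin_inv d k1 k2 z (($) \<psi>) s1 d s" for s
    proof -
      define sg :: real where "sg = (if m then - 1 else 1)"
      define a where "a r = \<psi> $ set_pair k1 k2 z r" for r
      define t where "t r = \<theta> (set_pair k1 k2 z r)" for r
      define S where "S = gap_sign k1 k2 z d"
      define u0 where "u0 = cis (t 0) * a 0 + of_real sg * (cis (t 1) * a 1)"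
      define u1 where "u1 = cis (t 2) * a 2 + of_real sg * (cis (t 3) * a 3)"
      let ?s' = "result (combine (\<lambda>r. 6 + r * B)) s"
      have less: "set_pair k1 k2 z r < 2 ^ d" for r using z k by (simp add: set_pair_def flip_bit_less)
      have fr: "frame {3, 4, 5} {0, 3, 4} s1 s" using inv by (simp add: pin_inv_def)
      have same: "nmem s 0 = nmem s1 0" "nmem s 2 = nmem s1 2" "rmem s 1 = rmem s1 1"
        "rmem s 2 = rmem s1 2"
        "\<And>r. rmem s (6 + r * B) = rmem s1 (6 + r * B)"
        using fr by (simp_all add: frame_def)
      have th: "rmem s (6 + r * B) 0 0 = t r" if "r < 4" for r
        using Q1 that by (simp add: same(5) Q1_def t_def)
      have cells: "rmem s 4 0 0 = sqnorm d f" "rmem s 4 1 0 = S"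
        using inv by (simp_all add: pin_inv_def f_def S_def)
      have G: "rmem s 0 i j = gcov d f i j"
        if "i < 2 * d" "j < 2 * d" "i \<noteq> j" "maj_mode d i \<in> {k1, k2}" "maj_mode d j \<in> {k1, k2}" for i j
        using inv that unfolding pin_inv_def f_def by blast
      have fa: "f (set_pair k1 k2 z r) = a r" for r
        by (auto simp: f_def pinned_def a_def set_pair_def)
      note fa' = fa[of 0, unfolded set_pair_simps] fa[of 1, unfolded set_pair_simps]
        fa[of 2, unfolded set_pair_simps] fa[of 3, unfolded set_pair_simps]
      have supp: "f x = 0" if "x < 2 ^ d" "x \<notin> block d {k1, k2} z" for x
        using that by (auto simp: f_def pinned_def block_def)
      have S: "(\<Prod>i\<in>{k1<..<k2}. zsign z i) = S" unfolding S_def by (rule gap_sign_eq[OF k(2), symmetric])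
      have "z \<in> anchors d {k1, k2}" using z by (simp add: anchors_def)
      note two = gcov_two_qubits[OF k this, where f = f, OF supp, unfolded S fa']
      have pos: "k1 < 2 * d" "k2 < 2 * d" "d + k1 < 2 * d" "d + k2 < 2 * d" "k1 \<noteq> k2" "k1 < d"
        "maj_mode d k1 = k1" "maj_mode d k2 = k2" "maj_mode d (d + k1) = k1" "maj_mode d (d + k2) = k2"
        using k by (auto simp: maj_mode_def)
      have parity: "outcome_parity d (set_pair k1 k2 z r) =
          (if r div 2 = 0 then 1 else - 1) * (if r mod 2 = 0 then 1 else - 1) * outcome_parity d z" for r
        using k by (simp add: set_pair_def outcome_parity_flip_bit)
      \<comment> \<open>Strings 0 and 3 of the block have the parity of \<open>z\<close> and strings
        1 and 2 the opposite one, so definite parity removes one of the two pairs.\<close>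
      have pairs: "a 0 = 0 \<and> a 3 = 0 \<or> a 1 = 0 \<and> a 2 = 0"
      proof (cases "outcome_parity d z = \<sigma>")
        case True
        then have "a r = 0" if "r \<in> {1, 2}" for r
          unfolding a_def using that outcome_parity_cases[of d z] by (intro par less) (auto simp: parity)
        then show ?thesis by simp
      next
        case False
        then have "a r = 0" if "r \<in> {0, 3}" for r
          unfolding a_def using that by (intro par less) (auto simp: parity)
        then show ?thesis by simp
      qed
      have signs: "sg * sg = 1" "S * S = 1"
        by (simp_all add: sg_def S_def gap_sign_def prod.distrib[symmetric] zsign_def)
      note dressed = dressed_pairs[OF pairs signs u0_def u1_def]
      have n0: "nmem s 0 0 = d" "nmem s 0 1 = k1" "nmem s 0 2 = k2" "nmem s 0 3 = of_bool m"
        using same(1) s1(1) input by simp_all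
      have A: "Complex (- (rmem s 0 k1 (d + k2) + rmem s 0 (d + k1) k2) / 4)
          ((rmem s 0 k1 k2 - rmem s 0 (d + k1) (d + k2)) / 4) = - of_real S * (cnj (a 0) * a 3)"
        and C: "Complex ((rmem s 0 (d + k1) k2 - rmem s 0 k1 (d + k2)) / 4)
          ((rmem s 0 k1 k2 + rmem s 0 (d + k1) (d + k2)) / 4) = of_real S * (cnj (a 1) * a 2)"
        using two(3,4) pos by (simp_all add: G)
      have eq: "sg = (if 0 < (of_bool m :: nat) then - 1 else 1)" by (simp add: sg_def)
      have eq': "cnj u0 * u1 = of_real (sg * S) *
          (cis (rmem s (6 + 2 * B) 0 0 - rmem s (6 + 1 * B) 0 0) * (of_real S * (cnj (a 1) * a 2)) -
          cis (rmem s (6 + 3 * B) 0 0 - rmem s (6 + 0 * B) 0 0) * (- of_real S * (cnj (a 0) * a 3)))"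
        unfolding dressed(3)[symmetric] using th[of 0] th[of 1] th[of 2] th[of 3] by simp
      have array: "6 + r * B \<noteq> 4" for r by simp
      note comb = result_combine[where s = s
        and th = "\<lambda>r. 6 + r * B", unfolded n0 cells, OF array A C eq eq']
      have "outputs_basis (result emit ?s') (final_basis \<phi> k1 k2 z m)"
      proof (rule emit_outputs)
        show "rmem ?s' 4 0 0 = (cmod u0)\<^sup>2 + (cmod u1)\<^sup>2"
          by (simp add: comb cells two dressed)
        show "rmem ?s' 4 5 0 = (cmod u0)\<^sup>2"
          using pos by (simp add: comb cells two dressed G)
        have \<phi>: "\<phi> $ set_pair k1 k2 z r = cis (t r) * a r" for r
          unfolding \<phi>_def t_def a_def by (rule phase_dressed_index[OF psi(1) less])
        note \<phi>' = \<phi>[of 0, unfolded set_pair_simps] \<phi>[of 1, unfolded set_pair_simps]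
          \<phi>[of 2, unfolded set_pair_simps] \<phi>[of 3, unfolded set_pair_simps]
        have "k1 \<noteq> k2" using k by simp
        note cond = cond_vec_index[OF z(2,3) this, where \<phi> = \<phi> and m = m, unfolded \<phi>']
        show "cond_vec \<phi> k1 k2 z m $ 0 = of_real (1 / sqrt 2) * u0"
          "cond_vec \<phi> k1 k2 z m $ 1 = of_real (1 / sqrt 2) * u1"
          unfolding cond by (simp_all add: x_ket_index u0_def u1_def sg_def ring_distribs)
        show "nmem ?s' 2 = (\<lambda>_. 0)" "rmem ?s' 1 = (\<lambda>_ _. 0)" "rmem ?s' 2 = (\<lambda>_ _. 0)"
          using comb(1) same(2-4) s1 input by (simp_all add: frame_def)
      qed (simp_all add: comb)
      then show ?thesis
        using run_loop_free[of "Seq (combine (\<lambda>r. 6 + r * B)) emit"] by simp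
    qed
    show ?thesis
      by (rule run_Seq[OF a run_Seq[OF b run_Seq[OF c d order_refl] order_refl]]) auto
  qed
  have "run (basis_program c) s0 (basis_cost c T d) (\<lambda>s. outputs_basis s (final_basis \<phi> k1 k2 z m))"
    unfolding basis_program_def Let_def B_def[symmetric]
    by (rule run_Seq[OF 1 rest]) (auto simp: basis_cost_def B_def)
  then show "\<exists>t s. exec (basis_program c) (basis_input d (covariance d \<psi>) k1 k2 z m) t s \<and>
      t \<le> basis_cost c T d \<and> outputs_basis s (final_basis (phase_dressed d \<theta> \<psi>) k1 k2 z m)"
    by (simp add: run_def s0_def \<phi>_def)
qed


lemma basis_cost_poly: "\<exists>p. \<forall>d. poly p d = basis_cost c (poly q d) d"
proof -
  define mac where "mac e = [:1, 2:] * ([:1, 2:] * [:rcost e + 22:] + [:17:])" for e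
  have mac: "poly (mac e) d = mat_assign_cost (2 * d) e" for e d
    by (simp add: mac_def mat_assign_cost_def algebra_simps)
  define r where "r = [:bcost (BAnd (neq (ncell 3) pos1) (neq (ncell 3) pos2)) + max_cost set_signs +
    max_cost set_norm + 5:] + mac (RCell 0 (ncell 4) (ncell 5)) + mac update_entry"
  have r: "poly r d = pin_body_cost d" for d by (simp add: r_def mac pin_body_cost_def)
  define p where "p = [:4:] * ([:51, 20:] + q) + [:1, 1:] * (r + [:14:]) +
    [:max_cost (combine (\<lambda>r. 6 + r * max 2 (arrays_com c))) + max_cost emit + 16:]"
  have "poly p d = basis_cost c (poly q d) d" for d
    by (simp add: p_def r basis_cost_def algebra_simps)
  then show ?thesis by blast
qed

theorem corollary1:
  fixes \<theta> :: "nat \<Rightarrow> nat \<Rightarrow> real"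
  assumes "efficient_phase \<theta>"
  shows "\<exists>(c :: com) (p :: nat poly).
    \<forall>(d :: nat) (\<psi> :: complex vec) (\<sigma> :: int).
      2 \<le> d \<and> gaussian_state d \<psi> \<and> has_parity d \<sigma> \<psi> \<longrightarrow>
      (let \<phi> = phase_dressed d (\<theta> d) \<psi>; P = copy_test d \<sigma> \<phi> in
        (\<forall>\<epsilon> \<delta> :: real. 0 < \<epsilon> \<and> \<epsilon> < 1 \<and> 0 < \<delta> \<and> \<delta> < 1 \<longrightarrow>
           certifies d P \<phi> (num_copies d P \<epsilon> \<delta>) \<epsilon> \<delta> \<and>
           int (num_copies d P \<epsilon> \<delta>) \<le> \<lceil>real d * (real d - 1) / \<epsilon> * ln (1 / \<delta>)\<rceil>) \<and>
        single_qubit_protocol {..<d} P \<and>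
        computes_final_basis c (poly p d) d (\<theta> d) \<psi>)"
proof -
  obtain c q where exec: "\<And>d x. x < 2 ^ d \<Longrightarrow>
      \<exists>t s. exec c (phase_input d x) t s \<and> t \<le> poly q d \<and> rmem s 0 0 0 = \<theta> d x"
    using assms unfolding efficient_phase_def by blast
  obtain p where p: "\<And>d. poly p d = basis_cost c (poly q d) d" using basis_cost_poly[of c q] by blast
  show ?thesis
  proof (intro exI[of _ "basis_program c"] exI[of _ p] allI impI)
    fix d \<psi> \<sigma> assume "2 \<le> d \<and> gaussian_state d \<psi> \<and> has_parity d \<sigma> \<psi>"
    then have d: "2 \<le> d" and gauss: "gaussian_state d \<psi>" and parity: "has_parity d \<sigma> \<psi>" by auto
    define \<phi> where "\<phi> = phase_dressed d (\<theta> d) \<psi>"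
    note psi = gaussian_state_wick_and_norm[OF gauss]
    have norm: "sqnorm d (($) \<psi>) = 1" using psi(2) by (simp add: ip_self)
    have par: "\<psi> $ x = 0" if "x < 2 ^ d" "outcome_parity d x \<noteq> \<sigma>" for x
      by (rule has_parity_vanishes[OF parity psi(3) that])
    have index: "\<phi> $ x = cis (\<theta> d x) * \<psi> $ x" if "x < 2 ^ d" for x
      unfolding \<phi>_def by (rule phase_dressed_index[OF psi(3) that])
    \<comment> \<open>The dressed state need not be Gaussian. The spectral estimate uses the
      relations of \<open>\<psi>\<close> together with this equality of moduli.\<close>
    have cmod: "cmod (\<phi> $ x) = cmod (\<psi> $ x)" if "x < 2 ^ d" for x
      using index[OF that] by (simp add: norm_mult)
    have par': "\<phi> $ x = 0" if "x < 2 ^ d" "outcome_parity d x \<noteq> \<sigma>" for x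
      using index[OF that(1)] par[OF that] by simp
    have carrier: "\<phi> \<in> carrier_vec (2 ^ d)"
      unfolding \<phi>_def phase_dressed_def
      by (rule mult_mat_vec_carrier[OF _ psi(3)]) (simp add: phase_unitary_def)
    have norm': "sqnorm d (($) \<phi>) = 1" using norm cmod by (simp add: sqnorm_def)
    have \<sigma>: "\<sigma> \<in> {1, - 1}" using parity by (simp add: has_parity_def)
    have "single_qubit_protocol {..<d} (copy_test d \<sigma> \<phi>)"
      by (rule accept_copy_test(1)[OF psi(1) cmod d par' \<sigma>])
    moreover have "computes_final_basis (basis_program c) (poly p d) d (\<theta> d) \<psi>"
      unfolding p by (rule computes_final_basis[OF psi(1,3) norm par exec])
    ultimately show "let \<phi> = phase_dressed d (\<theta> d) \<psi>; P = copy_test d \<sigma> \<phi> in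
        (\<forall>\<epsilon> \<delta> :: real. 0 < \<epsilon> \<and> \<epsilon> < 1 \<and> 0 < \<delta> \<and> \<delta> < 1 \<longrightarrow>
           certifies d P \<phi> (num_copies d P \<epsilon> \<delta>) \<epsilon> \<delta> \<and>
           int (num_copies d P \<epsilon> \<delta>) \<le> \<lceil>real d * (real d - 1) / \<epsilon> * ln (1 / \<delta>)\<rceil>) \<and>
        single_qubit_protocol {..<d} P \<and>
        computes_final_basis (basis_program c) (poly p d) d (\<theta> d) \<psi>"
      unfolding Let_def \<phi>_def[symmetric]
      using copy_test_certifies[OF psi(1) cmod d par' \<sigma> carrier norm'] by blast
  qed
qed

end
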